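(* Let $k$ be a field and let $\Lambda=\begin{pmatrix} A & N\\ M & B\end{pmatrix}$ be a null-square projective $k$-algebra, let $I=M\oplus N$ and $C=A\times B$. For $m\geq 0$ there are identifications (isomorphisms of vector spaces) $$\mathrm{Tor}^{\Lambda\otimes\Lambda^{\mathrm{op}}}_{2m+1}(K_C^1(\Lambda),\Lambda)=H_0\left(B,(M\otimes_AN)^{\otimes_B(m+1)}\right)^{C_{m+1}}$$ and $$\mathrm{Tor}^{\Lambda\otimes\Lambda^{\mathrm{op}}}_{2m}(K_C^1(\Lambda),\Lambda)=H_0\left(B,(M\otimes_AN)^{\otimes_B(m+1)}\right)_{C_{m+1}}.$$
   Context: Given $k$-algebras $A$, $B$, a $B$-$A$-bimodule $M$ and an $A$-$B$-bimodule $N$, the null-square algebra $\begin{pmatrix} A & N\\ M & B\end{pmatrix}$ is the algebra of such matrices with matrix multiplication given by the products of $A$ and $B$, the bimodule structures, and $mn=0$, $nm=0$ for all $m\in M$, $n\in N$. It is null-square projective if $M$ is a projective $B$-$A$-bimodule and $N$ is a projective $A$-$B$-bimodule. Then $\Lambda=C\oplus I$ with $C=A\times B$ a subalgebra and $I$ a two-sided ideal with $I^2=0$. Set $K^1_C(\Lambda)=\ker(\Lambda\otimes_C\Lambda\to\Lambda)$, the kernel of the map given by the product of $\Lambda$; it is a $\Lambda$-bimodule. $\mathrm{Tor}$ is taken over $\Lambda\otimes\Lambda^{\mathrm{op}}$ ($\otimes=\otimes_k$), viewing $\Lambda$-bimodules as modules over it. For a $B$-bimodule $Z$, $H_0(B,Z)=Z/\langle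 bz-zb\mid b\in B,z\in Z\rangle$. The cyclic group $C_m=\langle t\mid t^m=1\rangle$ acts on $H_0(B,(M\otimes_AN)^{\otimes_B m})$ by cyclic permutation: for $x_i\in M$, $y_i\in N$, $$t(x_m\otimes y_m\otimes\cdots\otimes x_2\otimes y_2\otimes x_1\otimes y_1)=x_1\otimes y_1\otimes x_m\otimes y_m\otimes\cdots\otimes x_2\otimes y_2.$$ For a $kG$-module $H$, $H^G=\{x\in H\mid sx=x\ \forall s\in G\}$ and $H_G=H/\langle sx-x\mid s\in G,x\in H\rangle$. *)

theory Defs
  imports "HOL-Algebra.Algebra" "HOL.Hull"
begin

section \<open>Algebras and bimodules over a field\<close>

locale k_algebra = K: field K + V: module K A + A: ring A
  for K :: "('k, 'x) ring_scheme" (structure) and A :: "('k, 'a, 'y) module_scheme" (structure) +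
  assumes smult_mult_left:
      "\<lbrakk>c \<in> carrier K; x \<in> carrier A; y \<in> carrier A\<rbrakk>
        \<Longrightarrow> (c \<odot>\<^bsub>A\<^esub> x) \<otimes>\<^bsub>A\<^esub> y = c \<odot>\<^bsub>A\<^esub> (x \<otimes>\<^bsub>A\<^esub> y)"
    and smult_mult_right:
      "\<lbrakk>c \<in> carrier K; x \<in> carrier A; y \<in> carrier A\<rbrakk>
        \<Longrightarrow> x \<otimes>\<^bsub>A\<^esub> (c \<odot>\<^bsub>A\<^esub> y) = c \<odot>\<^bsub>A\<^esub> (x \<otimes>\<^bsub>A\<^esub> y)"

definition opp_alg :: "('k, 'a) module \<Rightarrow> ('k, 'a) module" where
  "opp_alg A = A\<lparr>monoid.mult := \<lambda>x y. y \<otimes>\<^bsub>A\<^esub> x\<rparr>"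

text \<open>The field as an algebra over itself.\<close>

definition ground :: "('k, 'x) ring_scheme \<Rightarrow> ('k, 'k) module" where
  "ground K = \<lparr>carrier = carrier K, monoid.mult = monoid.mult K, monoid.one = monoid.one K, ring.zero = ring.zero K, ring.add = ring.add K,
     smult = monoid.mult K\<rparr>"

text \<open>
  As in the record \<open>module\<close>, the fields \<open>mult\<close> and \<open>one\<close> inherited from \<open>ring\<close> carry no
  information. A left (right) \<open>R\<close>-module is the same thing as an \<open>R\<close>-\<open>K\<close>-bimodule
  (a \<open>K\<close>-\<open>R\<close>-bimodule).
\<close>

record ('k, 'r, 's, 'v) bimodule = "('k, 'v) module" +
  lmult :: "'r \<Rightarrow> 'v \<Rightarrow> 'v"
  rmult :: "'v \<Rightarrow> 's \<Rightarrow> 'v"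

locale bimodule = R: k_algebra K R + S: k_algebra K S + V: module K V
  for K :: "('k, 'x) ring_scheme" (structure) and R :: "('k, 'r, 'y) module_scheme" (structure)
    and S :: "('k, 's, 'z) module_scheme" (structure)
    and V :: "('k, 'r, 's, 'v, 'w) bimodule_scheme" (structure) +
  assumes lmult_closed:
      "\<lbrakk>r \<in> carrier R; v \<in> carrier V\<rbrakk> \<Longrightarrow> lmult V r v \<in> carrier V"
    and lmult_add_right: "\<lbrakk>r \<in> carrier R; v \<in> carrier V; w \<in> carrier V\<rbrakk>
        \<Longrightarrow> lmult V r (v \<oplus>\<^bsub>V\<^esub> w) = lmult V r v \<oplus>\<^bsub>V\<^esub> lmult V r w"
    and lmult_add_left: "\<lbrakk>r \<in> carrier R; r' \<in> carrier R; v \<in> carrier V\<rbrakk>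
        \<Longrightarrow> lmult V (r \<oplus>\<^bsub>R\<^esub> r') v = lmult V r v \<oplus>\<^bsub>V\<^esub> lmult V r' v"
    and lmult_assoc: "\<lbrakk>r \<in> carrier R; r' \<in> carrier R; v \<in> carrier V\<rbrakk>
        \<Longrightarrow> lmult V (r \<otimes>\<^bsub>R\<^esub> r') v = lmult V r (lmult V r' v)"
    and lmult_one: "v \<in> carrier V \<Longrightarrow> lmult V \<one>\<^bsub>R\<^esub> v = v"
    and lmult_smult_left: "\<lbrakk>c \<in> carrier K; r \<in> carrier R; v \<in> carrier V\<rbrakk>
        \<Longrightarrow> lmult V (c \<odot>\<^bsub>R\<^esub> r) v = c \<odot>\<^bsub>V\<^esub> lmult V r v"
    and lmult_smult_right: "\<lbrakk>c \<in> carrier K; r \<in> carrier R; v \<in> carrier V\<rbrakk>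
        \<Longrightarrow> lmult V r (c \<odot>\<^bsub>V\<^esub> v) = c \<odot>\<^bsub>V\<^esub> lmult V r v"
    and rmult_closed:
      "\<lbrakk>v \<in> carrier V; s \<in> carrier S\<rbrakk> \<Longrightarrow> rmult V v s \<in> carrier V"
    and rmult_add_left: "\<lbrakk>v \<in> carrier V; w \<in> carrier V; s \<in> carrier S\<rbrakk>
        \<Longrightarrow> rmult V (v \<oplus>\<^bsub>V\<^esub> w) s = rmult V v s \<oplus>\<^bsub>V\<^esub> rmult V w s"
    and rmult_add_right: "\<lbrakk>v \<in> carrier V; s \<in> carrier S; s' \<in> carrier S\<rbrakk>
        \<Longrightarrow> rmult V v (s \<oplus>\<^bsub>S\<^esub> s') = rmult V v s \<oplus>\<^bsub>V\<^esub> rmult V v s'"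
    and rmult_assoc: "\<lbrakk>v \<in> carrier V; s \<in> carrier S; s' \<in> carrier S\<rbrakk>
        \<Longrightarrow> rmult V v (s \<otimes>\<^bsub>S\<^esub> s') = rmult V (rmult V v s) s'"
    and rmult_one: "v \<in> carrier V \<Longrightarrow> rmult V v \<one>\<^bsub>S\<^esub> = v"
    and rmult_smult_right: "\<lbrakk>c \<in> carrier K; v \<in> carrier V; s \<in> carrier S\<rbrakk>
        \<Longrightarrow> rmult V v (c \<odot>\<^bsub>S\<^esub> s) = c \<odot>\<^bsub>V\<^esub> rmult V v s"
    and rmult_smult_left: "\<lbrakk>c \<in> carrier K; v \<in> carrier V; s \<in> carrier S\<rbrakk>
        \<Longrightarrow> rmult V (c \<odot>\<^bsub>V\<^esub> v) s = c \<odot>\<^bsub>V\<^esub> rmult V v s"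
    and lmult_rmult: "\<lbrakk>r \<in> carrier R; v \<in> carrier V; s \<in> carrier S\<rbrakk>
        \<Longrightarrow> rmult V (lmult V r v) s = lmult V r (rmult V v s)"

text \<open>An algebra as a bimodule over itself, hence over each of its subalgebras.\<close>

definition regular :: "('k, 'a) module \<Rightarrow> ('k, 'a, 'a, 'a) bimodule" where
  "regular A = module.extend A \<lparr>lmult = monoid.mult A, rmult = monoid.mult A\<rparr>"

text \<open>A vector space as a \<open>K\<close>-\<open>K\<close>-bimodule.\<close>

definition kbimod :: "('k, 'a) module \<Rightarrow> ('k, 'k, 'k, 'a) bimodule" where
  "kbimod V = module.extend V \<lparr>lmult = smult V, rmult = \<lambda>x c. c \<odot>\<^bsub>V\<^esub> x\<rparr>"

definition vs_iso :: "('k, 'x) ring_scheme \<Rightarrow> ('k, 'v, 'y) module_scheme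
    \<Rightarrow> ('k, 'w, 'z) module_scheme \<Rightarrow> bool" where
  "vs_iso K V W \<longleftrightarrow> (\<exists>f. bij_betw f (carrier V) (carrier W)
     \<and> (\<forall>x\<in>carrier V. \<forall>y\<in>carrier V. f (x \<oplus>\<^bsub>V\<^esub> y) = f x \<oplus>\<^bsub>W\<^esub> f y)
     \<and> (\<forall>c\<in>carrier K. \<forall>x\<in>carrier V. f (c \<odot>\<^bsub>V\<^esub> x) = c \<odot>\<^bsub>W\<^esub> f x))"


section \<open>Quotients, free modules, generators and relations\<close>

definition subspan :: "('k, 'x) ring_scheme \<Rightarrow> ('k, 'v, 'y) module_scheme \<Rightarrow> 'v set \<Rightarrow> 'v set" where
  "subspan K V Z = (\<lambda>H. submodule H K V) hull Z"

definition quot_mod :: "('k, 'v, 'y) module_scheme \<Rightarrow> 'v set \<Rightarrow> ('k, 'v set) module" where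
  "quot_mod V H = \<lparr>carrier = a_rcosets\<^bsub>V\<^esub> H, monoid.mult = undefined, monoid.one = undefined,
     ring.zero = H, ring.add = set_add V, smult = (\<lambda>c U. \<Union>u\<in>U. H +>\<^bsub>V\<^esub> (c \<odot>\<^bsub>V\<^esub> u))\<rparr>"

text \<open>
  The free module on \<open>G\<close>: finitely supported functions \<open>G \<rightarrow> E\<close>. It carries the left and the
  right action of \<open>E\<close> and so serves as the free left and as the free right \<open>E\<close>-module.
\<close>

definition free_mod :: "('k, 'e) module \<Rightarrow> 'g set \<Rightarrow> ('k, 'e, 'e, 'g \<Rightarrow> 'e) bimodule" where
  "free_mod E G = \<lparr>
     carrier = {f. (\<forall>g. f g \<in> carrier E) \<and> (\<forall>g. g \<notin> G \<longrightarrow> f g = \<zero>\<^bsub>E\<^esub>) \<and> finite {g. f g \<noteq> \<zero>\<^bsub>E\<^esub>}},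
     monoid.mult = undefined, monoid.one = undefined, ring.zero = (\<lambda>_. \<zero>\<^bsub>E\<^esub>),
     ring.add = (\<lambda>f h g. f g \<oplus>\<^bsub>E\<^esub> h g), smult = (\<lambda>c f g. c \<odot>\<^bsub>E\<^esub> f g),
     lmult = (\<lambda>e f g. e \<otimes>\<^bsub>E\<^esub> f g), rmult = (\<lambda>f e g. f g \<otimes>\<^bsub>E\<^esub> e)\<rparr>"

definition single :: "('k, 'e) module \<Rightarrow> 'g \<Rightarrow> 'e \<Rightarrow> 'g \<Rightarrow> 'e" where
  "single E g e = (\<lambda>h. if h = g then e else \<zero>\<^bsub>E\<^esub>)"

text \<open>The extension \<open>f \<mapsto> \<Sum>\<^sub>g act (\<phi> g) (f g)\<close> of a map \<open>\<phi>\<close> on generators to the free module.\<close>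

definition lin_ext :: "('k, 'e) module \<Rightarrow> ('k, 'v, 'y) module_scheme \<Rightarrow> ('v \<Rightarrow> 'e \<Rightarrow> 'v)
    \<Rightarrow> ('g \<Rightarrow> 'v) \<Rightarrow> ('g \<Rightarrow> 'e) \<Rightarrow> 'v" where
  "lin_ext E V act \<phi> f = finsum V (\<lambda>g. act (\<phi> g) (f g)) {g. f g \<noteq> \<zero>\<^bsub>E\<^esub>}"

definition presented :: "('k, 'x) ring_scheme \<Rightarrow> 'g set \<Rightarrow> ('g \<Rightarrow> 'k) set
    \<Rightarrow> ('k, ('g \<Rightarrow> 'k) set) module" where
  "presented K G Rs = quot_mod (free_mod (ground K) G) (subspan K (free_mod (ground K) G) Rs)"

definition pgen :: "('k, 'x) ring_scheme \<Rightarrow> 'g set \<Rightarrow> ('g \<Rightarrow> 'k) set \<Rightarrow> 'g \<Rightarrow> ('g \<Rightarrow> 'k) set" where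
  "pgen K G Rs g = subspan K (free_mod (ground K) G) Rs
     +>\<^bsub>free_mod (ground K) G\<^esub> single (ground K) g \<one>\<^bsub>K\<^esub>"

text \<open>
  The linear map into \<open>V\<close> out of a presented vector space with \<open>pgen g \<mapsto> \<phi> g\<close>, evaluated on an
  arbitrary representative; it has this meaning whenever \<open>\<phi>\<close> respects the relations.
\<close>

definition plift :: "('k, 'x) ring_scheme \<Rightarrow> ('k, 'v, 'y) module_scheme
    \<Rightarrow> ('g \<Rightarrow> 'v) \<Rightarrow> ('g \<Rightarrow> 'k) set \<Rightarrow> 'v" where
  "plift K V \<phi> U = lin_ext (ground K) V (\<lambda>v c. c \<odot>\<^bsub>V\<^esub> v) \<phi> (SOME f. f \<in> U)"


section \<open>Tensor products\<close>

text \<open>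
  \<open>M \<otimes>\<^sub>S N\<close> for a right \<open>S\<close>-module \<open>M\<close> and a left \<open>S\<close>-module \<open>N\<close>; of \<open>S\<close> only the carrier matters,
  the actions being part of \<open>M\<close> and \<open>N\<close>.
\<close>

definition tensor_rels :: "('k, 'x) ring_scheme \<Rightarrow> ('s, 'w) partial_object_scheme
    \<Rightarrow> ('k, 'r, 's, 'm) bimodule \<Rightarrow> ('k, 's, 't, 'n) bimodule \<Rightarrow> ('m \<times> 'n \<Rightarrow> 'k) set" where
  "tensor_rels K S M N =
    (let F = free_mod (ground K) (carrier M \<times> carrier N);
         \<delta> = (\<lambda>x y. single (ground K) (x, y) \<one>\<^bsub>K\<^esub>)
     in {\<delta> (x \<oplus>\<^bsub>M\<^esub> x') y \<ominus>\<^bsub>F\<^esub> (\<delta> x y \<oplus>\<^bsub>F\<^esub> \<delta> x' y) |x x' y.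
           x \<in> carrier M \<and> x' \<in> carrier M \<and> y \<in> carrier N}
      \<union> {\<delta> x (y \<oplus>\<^bsub>N\<^esub> y') \<ominus>\<^bsub>F\<^esub> (\<delta> x y \<oplus>\<^bsub>F\<^esub> \<delta> x y') |x y y'.
           x \<in> carrier M \<and> y \<in> carrier N \<and> y' \<in> carrier N}
      \<union> {\<delta> (c \<odot>\<^bsub>M\<^esub> x) y \<ominus>\<^bsub>F\<^esub> (c \<odot>\<^bsub>F\<^esub> \<delta> x y) |c x y.
           c \<in> carrier K \<and> x \<in> carrier M \<and> y \<in> carrier N}
      \<union> {\<delta> x (c \<odot>\<^bsub>N\<^esub> y) \<ominus>\<^bsub>F\<^esub> (c \<odot>\<^bsub>F\<^esub> \<delta> x y) |c x y.
           c \<in> carrier K \<and> x \<in> carrier M \<and> y \<in> carrier N}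
      \<union> {\<delta> (rmult M x s) y \<ominus>\<^bsub>F\<^esub> \<delta> x (lmult N s y) |x s y.
           x \<in> carrier M \<and> s \<in> carrier S \<and> y \<in> carrier N})"

definition tens :: "('k, 'x) ring_scheme \<Rightarrow> ('s, 'w) partial_object_scheme
    \<Rightarrow> ('k, 'r, 's, 'm) bimodule \<Rightarrow> ('k, 's, 't, 'n) bimodule
    \<Rightarrow> 'm \<Rightarrow> 'n \<Rightarrow> ('m \<times> 'n \<Rightarrow> 'k) set" where
  "tens K S M N x y = pgen K (carrier M \<times> carrier N) (tensor_rels K S M N) (x, y)"

definition tensor :: "('k, 'x) ring_scheme \<Rightarrow> ('s, 'w) partial_object_scheme
    \<Rightarrow> ('k, 'r, 's, 'm) bimodule \<Rightarrow> ('k, 's, 't, 'n) bimodule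
    \<Rightarrow> ('k, 'r, 't, ('m \<times> 'n \<Rightarrow> 'k) set) bimodule" where
  "tensor K S M N =
    (let T = presented K (carrier M \<times> carrier N) (tensor_rels K S M N)
     in module.extend T
       \<lparr>lmult = (\<lambda>r. plift K T (\<lambda>(x, y). tens K S M N (lmult M r x) y)),
        rmult = (\<lambda>U t. plift K T (\<lambda>(x, y). tens K S M N x (rmult N y t)) U)\<rparr>)"

text \<open>
  The tensor powers of an \<open>S\<close>-bimodule \<open>W\<close> over \<open>S\<close>, constructed at once on tuples so that all
  powers live in one type. The case \<open>n = 0\<close> is a junk value (it is not \<open>S\<close>).
\<close>

definition tpow_rels :: "('k, 'x) ring_scheme \<Rightarrow> ('s, 'w) partial_object_scheme
    \<Rightarrow> ('k, 's, 's, 'v) bimodule \<Rightarrow> nat \<Rightarrow> ('v list \<Rightarrow> 'k) set" where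
  "tpow_rels K S W n =
    (let G = {ws. set ws \<subseteq> carrier W \<and> length ws = n};
         F = free_mod (ground K) G;
         \<delta> = (\<lambda>ws. single (ground K) ws \<one>\<^bsub>K\<^esub>)
     in {\<delta> (us @ [v \<oplus>\<^bsub>W\<^esub> w] @ vs) \<ominus>\<^bsub>F\<^esub> (\<delta> (us @ [v] @ vs) \<oplus>\<^bsub>F\<^esub> \<delta> (us @ [w] @ vs)) |us v w vs.
           us @ [v] @ vs \<in> G \<and> us @ [w] @ vs \<in> G}
      \<union> {\<delta> (us @ [c \<odot>\<^bsub>W\<^esub> v] @ vs) \<ominus>\<^bsub>F\<^esub> (c \<odot>\<^bsub>F\<^esub> \<delta> (us @ [v] @ vs)) |us c v vs.
           c \<in> carrier K \<and> us @ [v] @ vs \<in> G}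
      \<union> {\<delta> (us @ [rmult W v s, w] @ vs) \<ominus>\<^bsub>F\<^esub> \<delta> (us @ [v, lmult W s w] @ vs) |us v s w vs.
           s \<in> carrier S \<and> us @ [v, w] @ vs \<in> G})"

definition tpgen :: "('k, 'x) ring_scheme \<Rightarrow> ('s, 'w) partial_object_scheme
    \<Rightarrow> ('k, 's, 's, 'v) bimodule \<Rightarrow> nat \<Rightarrow> 'v list \<Rightarrow> ('v list \<Rightarrow> 'k) set" where
  "tpgen K S W n = pgen K {ws. set ws \<subseteq> carrier W \<and> length ws = n} (tpow_rels K S W n)"

definition tpow :: "('k, 'x) ring_scheme \<Rightarrow> ('s, 'w) partial_object_scheme
    \<Rightarrow> ('k, 's, 's, 'v) bimodule \<Rightarrow> nat \<Rightarrow> ('k, 's, 's, ('v list \<Rightarrow> 'k) set) bimodule" where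
  "tpow K S W n =
    (let T = presented K {ws. set ws \<subseteq> carrier W \<and> length ws = n} (tpow_rels K S W n)
     in module.extend T
       \<lparr>lmult = (\<lambda>s. plift K T (\<lambda>ws. tpgen K S W n (lmult W s (hd ws) # tl ws))),
        rmult = (\<lambda>U s. plift K T (\<lambda>ws. tpgen K S W n (butlast ws @ [rmult W (last ws) s])) U)\<rparr>)"

definition alg_tensor :: "('k, 'x) ring_scheme \<Rightarrow> ('k, 'a) module \<Rightarrow> ('k, 'b) module
    \<Rightarrow> ('k, ('a \<times> 'b \<Rightarrow> 'k) set) module" where
  "alg_tensor K A B =
    (let T = tensor K K (kbimod A) (kbimod B);
         t = tens K K (kbimod A) (kbimod B)
     in (module.truncate T)
       \<lparr>monoid.mult := (\<lambda>U U'. plift K T (\<lambda>(a, b). plift K T (\<lambda>(a', b').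
                   t (a \<otimes>\<^bsub>A\<^esub> a') (b \<otimes>\<^bsub>B\<^esub> b')) U') U),
        monoid.one := t \<one>\<^bsub>A\<^esub> \<one>\<^bsub>B\<^esub>\<rparr>)"

text \<open>
  The algebra \<open>R \<otimes> S\<^sup>o\<^sup>p\<close>. An \<open>R\<close>-\<open>S\<close>-bimodule is a left module over it via \<open>(r \<otimes> s) v = r v s\<close>, and
  an \<open>S\<close>-\<open>R\<close>-bimodule is a right module over it via \<open>v (r \<otimes> s) = s v r\<close>.
\<close>

definition env :: "('k, 'x) ring_scheme \<Rightarrow> ('k, 'r) module \<Rightarrow> ('k, 's) module
    \<Rightarrow> ('k, ('r \<times> 's \<Rightarrow> 'k) set) module" where
  "env K R S = alg_tensor K R (opp_alg S)"

definition env_left :: "('k, 'x) ring_scheme \<Rightarrow> ('k, 'r, 's, 'v) bimodule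
    \<Rightarrow> ('k, ('r \<times> 's \<Rightarrow> 'k) set, 'k, 'v) bimodule" where
  "env_left K V = module.extend (module.truncate V)
     \<lparr>lmult = (\<lambda>U v. plift K V (\<lambda>(r, s). rmult V (lmult V r v) s) U),
      rmult = (\<lambda>v c. c \<odot>\<^bsub>V\<^esub> v)\<rparr>"

definition env_right :: "('k, 'x) ring_scheme \<Rightarrow> ('k, 's, 'r, 'v) bimodule
    \<Rightarrow> ('k, 'k, ('r \<times> 's \<Rightarrow> 'k) set, 'v) bimodule" where
  "env_right K V = module.extend (module.truncate V)
     \<lparr>lmult = (\<lambda>c v. c \<odot>\<^bsub>V\<^esub> v),
      rmult = (\<lambda>v U. plift K V (\<lambda>(r, s). rmult V (lmult V s v) r) U)\<rparr>"


section \<open>Projective modules and bimodules\<close>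

definition lmod_hom :: "('e, 'w) partial_object_scheme \<Rightarrow> ('k, 'e, 's, 'v) bimodule
    \<Rightarrow> ('k, 'e, 't, 'u) bimodule \<Rightarrow> ('v \<Rightarrow> 'u) set" where
  "lmod_hom E V W = {f \<in> carrier V \<rightarrow> carrier W.
     (\<forall>x\<in>carrier V. \<forall>y\<in>carrier V. f (x \<oplus>\<^bsub>V\<^esub> y) = f x \<oplus>\<^bsub>W\<^esub> f y)
     \<and> (\<forall>e\<in>carrier E. \<forall>x\<in>carrier V. f (lmult V e x) = lmult W e (f x))}"

text \<open>
  Projective left modules as direct summands (retracts) of free modules. Basis sets inside the type
  of the module suffice: a projective module is a retract of the free module on its own carrier.
\<close>

definition projective_lmod :: "('k, 'e) module \<Rightarrow> ('k, 'e, 's, 'v) bimodule \<Rightarrow> bool" where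
  "projective_lmod E P \<longleftrightarrow> (\<exists>G :: 'v set. \<exists>i p.
     i \<in> lmod_hom E P (free_mod E G) \<and> p \<in> lmod_hom E (free_mod E G) P
     \<and> (\<forall>x\<in>carrier P. p (i x) = x))"

definition projective_bimod :: "('k, 'x) ring_scheme \<Rightarrow> ('k, 'r) module \<Rightarrow> ('k, 's) module
    \<Rightarrow> ('k, 'r, 's, 'v) bimodule \<Rightarrow> bool" where
  "projective_bimod K R S V \<longleftrightarrow> projective_lmod (env K R S) (env_left K V)"


section \<open>Tor\<close>

text \<open>
  \<open>Tor\<close> of a right \<open>E\<close>-module \<open>V\<close> and a left \<open>E\<close>-module \<open>Y\<close> is the homology of \<open>P \<otimes>\<^sub>E Y\<close> for the
  following free resolution \<open>P \<rightarrow> V\<close>: \<open>P\<^sub>0\<close> is free on the elements of \<open>V\<close>, and \<open>P\<^sub>n\<^sub>+\<^sub>1\<close> is free on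
  the (formal expressions of) elements in the kernel of the previous map. A basis element
  \<open>Rel [(g\<^sub>1, e\<^sub>1), \<dots>]\<close> stands for, and is mapped to, the element \<open>\<Sum> g\<^sub>i e\<^sub>i\<close>; the datatype
  accommodates all the \<open>P\<^sub>n\<close> in one type.
\<close>

datatype ('e, 'v) rgen = Gen 'v | Rel "(('e, 'v) rgen \<times> 'e) list"

definition rel_val :: "('k, 'e) module \<Rightarrow> (('e, 'v) rgen \<times> 'e) list \<Rightarrow> ('e, 'v) rgen \<Rightarrow> 'e" where
  "rel_val E l = foldr (\<lambda>(g, e) f. single E g e \<oplus>\<^bsub>free_mod E UNIV\<^esub> f) l \<zero>\<^bsub>free_mod E UNIV\<^esub>"

definition res_aug :: "('k, 'e) module \<Rightarrow> ('k, 'l, 'e, 'v) bimodule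
    \<Rightarrow> (('e, 'v) rgen \<Rightarrow> 'e) \<Rightarrow> 'v" where
  "res_aug E V = lin_ext E V (rmult V) (\<lambda>g. case g of Gen x \<Rightarrow> x | Rel l \<Rightarrow> \<zero>\<^bsub>V\<^esub>)"

definition res_diff :: "('k, 'e) module \<Rightarrow> (('e, 'v) rgen \<Rightarrow> 'e) \<Rightarrow> ('e, 'v) rgen \<Rightarrow> 'e" where
  "res_diff E = lin_ext E (free_mod E UNIV) (rmult (free_mod E (UNIV :: ('e, 'v) rgen set)))
     (\<lambda>g. case g of Gen x \<Rightarrow> \<zero>\<^bsub>free_mod E UNIV\<^esub> | Rel l \<Rightarrow> rel_val E l)"

primrec res_gens :: "('k, 'e) module \<Rightarrow> ('k, 'l, 'e, 'v) bimodule \<Rightarrow> nat \<Rightarrow> ('e, 'v) rgen set" where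
  "res_gens E V 0 = Gen ` carrier V"
| "res_gens E V (Suc n) = {Rel l |l. set l \<subseteq> res_gens E V n \<times> carrier E
     \<and> (if n = 0 then res_aug E V (rel_val E l) = \<zero>\<^bsub>V\<^esub>
        else res_diff E (rel_val E l) = \<zero>\<^bsub>free_mod E UNIV\<^esub>)}"

definition res_mod :: "('k, 'e) module \<Rightarrow> ('k, 'l, 'e, 'v) bimodule \<Rightarrow> nat
    \<Rightarrow> ('k, 'e, 'e, ('e, 'v) rgen \<Rightarrow> 'e) bimodule" where
  "res_mod E V n = free_mod E (res_gens E V n)"

definition tor_mod :: "('k, 'x) ring_scheme \<Rightarrow> ('k, 'e) module \<Rightarrow> ('k, 'l, 'e, 'v) bimodule
    \<Rightarrow> ('k, 'e, 't, 'y) bimodule \<Rightarrow> nat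
    \<Rightarrow> ('k, 'e, 't, ((('e, 'v) rgen \<Rightarrow> 'e) \<times> 'y \<Rightarrow> 'k) set) bimodule" where
  "tor_mod K E V Y n = tensor K E (res_mod E V n) Y"

text \<open>The map \<open>P\<^sub>n\<^sub>+\<^sub>1 \<otimes>\<^sub>E Y \<rightarrow> P\<^sub>n \<otimes>\<^sub>E Y\<close>.\<close>

definition tor_diff :: "('k, 'x) ring_scheme \<Rightarrow> ('k, 'e) module \<Rightarrow> ('k, 'l, 'e, 'v) bimodule
    \<Rightarrow> ('k, 'e, 't, 'y) bimodule \<Rightarrow> nat \<Rightarrow> ((('e, 'v) rgen \<Rightarrow> 'e) \<times> 'y \<Rightarrow> 'k) set
    \<Rightarrow> ((('e, 'v) rgen \<Rightarrow> 'e) \<times> 'y \<Rightarrow> 'k) set" where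
  "tor_diff K E V Y n = plift K (tor_mod K E V Y n)
     (\<lambda>(f, y). tens K E (res_mod E V n) Y (res_diff E f) y)"

definition tor_cycles :: "('k, 'x) ring_scheme \<Rightarrow> ('k, 'e) module \<Rightarrow> ('k, 'l, 'e, 'v) bimodule
    \<Rightarrow> ('k, 'e, 't, 'y) bimodule \<Rightarrow> nat \<Rightarrow> ((('e, 'v) rgen \<Rightarrow> 'e) \<times> 'y \<Rightarrow> 'k) set set" where
  "tor_cycles K E V Y n = (case n of 0 \<Rightarrow> carrier (tor_mod K E V Y 0)
     | Suc j \<Rightarrow> {u \<in> carrier (tor_mod K E V Y n). tor_diff K E V Y j u = \<zero>\<^bsub>tor_mod K E V Y j\<^esub>})"

definition Tor :: "('k, 'x) ring_scheme \<Rightarrow> ('k, 'e) module \<Rightarrow> nat \<Rightarrow> ('k, 'l, 'e, 'v) bimodule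
    \<Rightarrow> ('k, 'e, 't, 'y) bimodule
    \<Rightarrow> ('k, ((('e, 'v) rgen \<Rightarrow> 'e) \<times> 'y \<Rightarrow> 'k) set set) module" where
  "Tor K E n V Y = quot_mod ((tor_mod K E V Y n)\<lparr>carrier := tor_cycles K E V Y n\<rparr>)
     (tor_diff K E V Y n ` carrier (tor_mod K E V Y (Suc n)))"


section \<open>Null-square algebras\<close>

text \<open>The quadruple \<open>(a, n, m, b)\<close> is the matrix with rows \<open>a n\<close> and \<open>m b\<close>.\<close>

definition null_square :: "('k, 'a) module \<Rightarrow> ('k, 'b) module \<Rightarrow> ('k, 'b, 'a, 'm) bimodule
    \<Rightarrow> ('k, 'a, 'b, 'n) bimodule \<Rightarrow> ('k, 'a \<times> 'n \<times> 'm \<times> 'b) module" where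
  "null_square A B M N = \<lparr>
     carrier = carrier A \<times> carrier N \<times> carrier M \<times> carrier B,
     monoid.mult = (\<lambda>(a, n, m, b) (a', n', m', b').
       (a \<otimes>\<^bsub>A\<^esub> a', lmult N a n' \<oplus>\<^bsub>N\<^esub> rmult N n b',
        rmult M m a' \<oplus>\<^bsub>M\<^esub> lmult M b m', b \<otimes>\<^bsub>B\<^esub> b')),
     monoid.one = (\<one>\<^bsub>A\<^esub>, \<zero>\<^bsub>N\<^esub>, \<zero>\<^bsub>M\<^esub>, \<one>\<^bsub>B\<^esub>),
     ring.zero = (\<zero>\<^bsub>A\<^esub>, \<zero>\<^bsub>N\<^esub>, \<zero>\<^bsub>M\<^esub>, \<zero>\<^bsub>B\<^esub>),
     ring.add = (\<lambda>(a, n, m, b) (a', n', m', b').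
       (a \<oplus>\<^bsub>A\<^esub> a', n \<oplus>\<^bsub>N\<^esub> n', m \<oplus>\<^bsub>M\<^esub> m', b \<oplus>\<^bsub>B\<^esub> b')),
     smult = (\<lambda>c (a, n, m, b).
       (c \<odot>\<^bsub>A\<^esub> a, c \<odot>\<^bsub>N\<^esub> n, c \<odot>\<^bsub>M\<^esub> m, c \<odot>\<^bsub>B\<^esub> b))\<rparr>"

definition diag_subalg :: "('k, 'a) module \<Rightarrow> ('k, 'b) module \<Rightarrow> ('k, 'b, 'a, 'm) bimodule
    \<Rightarrow> ('k, 'a, 'b, 'n) bimodule \<Rightarrow> ('k, 'a \<times> 'n \<times> 'm \<times> 'b) module" where
  "diag_subalg A B M N = (null_square A B M N)
     \<lparr>carrier := {(a, \<zero>\<^bsub>N\<^esub>, \<zero>\<^bsub>M\<^esub>, b) |a b. a \<in> carrier A \<and> b \<in> carrier B}\<rparr>"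

text \<open>The kernel \<open>K\<^sup>1\<^sub>C(L)\<close> of the product map \<open>L \<otimes>\<^sub>C L \<rightarrow> L\<close>, as an \<open>L\<close>-bimodule.\<close>

definition prod_kernel :: "('k, 'x) ring_scheme \<Rightarrow> ('k, 'a) module \<Rightarrow> ('k, 'a) module
    \<Rightarrow> ('k, 'a, 'a, ('a \<times> 'a \<Rightarrow> 'k) set) bimodule" where
  "prod_kernel K C L =
    (let T = tensor K C (regular L) (regular L)
     in T\<lparr>carrier := {u \<in> carrier T. plift K L (\<lambda>(x, y). x \<otimes>\<^bsub>L\<^esub> y) u = \<zero>\<^bsub>L\<^esub>}\<rparr>)"


section \<open>Zeroth Hochschild homology and the cyclic action\<close>

definition commutator_span :: "('k, 'x) ring_scheme \<Rightarrow> ('b, 'w) partial_object_scheme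
    \<Rightarrow> ('k, 'b, 'b, 'z) bimodule \<Rightarrow> 'z set" where
  "commutator_span K B Z = subspan K Z
     {lmult Z b z \<ominus>\<^bsub>Z\<^esub> rmult Z z b |b z. b \<in> carrier B \<and> z \<in> carrier Z}"

definition H0 :: "('k, 'x) ring_scheme \<Rightarrow> ('b, 'w) partial_object_scheme
    \<Rightarrow> ('k, 'b, 'b, 'z) bimodule \<Rightarrow> ('k, 'z set) module" where
  "H0 K B Z = quot_mod Z (commutator_span K B Z)"

text \<open>
  The generator \<open>t\<close> of the cyclic group acting on \<open>H\<^sub>0(B, W\<^sup>\<otimes>\<^sup>n)\<close>, \<open>n \<ge> 1\<close>, by
  \<open>w\<^sub>n \<otimes> \<cdots> \<otimes> w\<^sub>2 \<otimes> w\<^sub>1 \<mapsto> w\<^sub>1 \<otimes> w\<^sub>n \<otimes> \<cdots> \<otimes> w\<^sub>2\<close>. For \<open>W = M \<otimes>\<^sub>A N\<close> and \<open>w\<^sub>i = x\<^sub>i \<otimes> y\<^sub>i\<close> this moves the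
  pair \<open>x\<^sub>1 \<otimes> y\<^sub>1\<close> to the front. It is well defined only on \<open>H\<^sub>0\<close>, not on \<open>W\<^sup>\<otimes>\<^sup>n\<close>, so it is
  computed as the map induced by \<open>w\<^sub>n \<otimes> \<cdots> \<otimes> w\<^sub>1 \<mapsto> [w\<^sub>1 \<otimes> w\<^sub>n \<otimes> \<cdots> \<otimes> w\<^sub>2]\<close> on a representative.
\<close>

definition cyc_gen :: "('k, 'x) ring_scheme \<Rightarrow> ('b, 'w) partial_object_scheme
    \<Rightarrow> ('k, 'b, 'b, 'v) bimodule \<Rightarrow> nat \<Rightarrow> ('v list \<Rightarrow> 'k) set set \<Rightarrow> ('v list \<Rightarrow> 'k) set set" where
  "cyc_gen K B W n U = plift K (H0 K B (tpow K B W n))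
     (\<lambda>ws. commutator_span K B (tpow K B W n)
        +>\<^bsub>tpow K B W n\<^esub> tpgen K B W n (last ws # butlast ws))
     (SOME z. z \<in> U)"

text \<open>The action of the element \<open>i\<close> of \<open>integer_mod_group n\<close>, that is, of \<open>t\<^sup>i\<close>.\<close>

definition cyc_act :: "('k, 'x) ring_scheme \<Rightarrow> ('b, 'w) partial_object_scheme
    \<Rightarrow> ('k, 'b, 'b, 'v) bimodule \<Rightarrow> nat
    \<Rightarrow> int \<Rightarrow> ('v list \<Rightarrow> 'k) set set \<Rightarrow> ('v list \<Rightarrow> 'k) set set" where
  "cyc_act K B W n i = cyc_gen K B W n ^^ nat i"

definition invariants :: "('g, 'w) monoid_scheme \<Rightarrow> ('g \<Rightarrow> 'v \<Rightarrow> 'v)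
    \<Rightarrow> ('k, 'v) module \<Rightarrow> ('k, 'v) module" where
  "invariants G act V = V\<lparr>carrier := {x \<in> carrier V. \<forall>s\<in>carrier G. act s x = x}\<rparr>"

definition coinvariants :: "('k, 'x) ring_scheme \<Rightarrow> ('g, 'w) monoid_scheme \<Rightarrow> ('g \<Rightarrow> 'v \<Rightarrow> 'v)
    \<Rightarrow> ('k, 'v) module \<Rightarrow> ('k, 'v set) module" where
  "coinvariants K G act V =
     quot_mod V (subspan K V {act s x \<ominus>\<^bsub>V\<^esub> x |s x. s \<in> carrier G \<and> x \<in> carrier V})"

end

theory Submission
  imports Defs
begin

text \<open>
  Let \<open>I = M \<oplus> N\<close>, so that \<open>\<Lambda> = C \<oplus> I\<close> with \<open>I\<^sup>2 = 0\<close>. The bimodule \<open>K\<^sup>1\<^sub>C(\<Lambda>)\<close> is resolved by the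
  \<open>\<Lambda> \<otimes>\<^sub>C I\<^sup>n\<^sup>+\<^sup>1 \<otimes>\<^sub>C \<Lambda>\<close>, where only the two outer faces of the bar differential survive. Projectivity of
  \<open>M\<close> and \<open>N\<close> gives these bimodules the lifting property, so \<open>Tor\<close> is the homology of this complex modulo
  commutators. There \<open>H\<^sub>0(C, I\<^sup>k)\<close> vanishes for odd \<open>k\<close>, because the idempotents of \<open>C\<close> kill cyclic words that do
  not alternate between \<open>M\<close> and \<open>N\<close>; for \<open>k = 2p\<close> it is \<open>H \<oplus> H\<close> with \<open>H = H\<^sub>0(B, (M \<otimes>\<^sub>A N)\<^sup>p)\<close>, one copy for the
  words that start in \<open>M\<close> and one for those that start in \<open>N\<close>. From degree \<open>2p - 1\<close> to \<open>2p - 2\<close> the differential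
  becomes \<open>(x, y) \<mapsto> (x + y, y + t x)\<close> on \<open>H \<oplus> H\<close>, and the neighbouring differentials vanish: the kernel is the
  space of invariants of \<open>t\<close>, the cokernel the space of coinvariants.
\<close>

text \<open>\<open>Tor\<close> is computed from one fixed free resolution, which has to be compared
  with \<open>Q\<close>. HOL cannot quantify over the types of test modules, so the lifting property
  is stated for given targets; six families of instances suffice, for chain maps in both directions
  and for the homotopies from their composites to the identity. Over a field a lift out of a tensor
  power of \<open>I\<close> exists linearly, and it only has to be corrected at the two outer
  letters; this is where projectivity of \<open>M\<close> and \<open>N\<close> enters.

  Origin of \<open>(x + y, y + t x)\<close>: modulo commutators with \<open>I\<close>, the word
  \<open>u j\<close> in \<open>I^(n+1) \<otimes> I\<close> equals \<open>j u\<close> in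
  \<open>I \<otimes> I^(n+1)\<close>. The differential thus becomes
  \<open>u \<mapsto> u + r u\<close> or \<open>u \<mapsto> u - r u\<close>, where \<open>r\<close>
  moves the last letter to the front; the sign is plus into even degrees. On
  \<open>H \<oplus> H\<close> the map \<open>r\<close> is \<open>(x, y) \<mapsto> (y, t x)\<close>:
  one letter exchanges the words starting in \<open>M\<close> with those starting in
  \<open>N\<close>, and two letters make up one factor \<open>M \<otimes> N\<close>.\<close>

abbreviation (input) add_in ("(_ \<oplus>[_] _)" [65, 0, 66] 65) where "x \<oplus>[V] y \<equiv> x \<oplus>\<^bsub>V\<^esub> y"
abbreviation (input) mult_in ("(_ \<otimes>[_] _)" [70, 0, 71] 70) where "x \<otimes>[V] y \<equiv> x \<otimes>\<^bsub>V\<^esub> y"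
abbreviation (input) smult_in ("(_ \<odot>[_] _)" [70, 0, 71] 70) where "c \<odot>[V] x \<equiv> c \<odot>\<^bsub>V\<^esub> x"
abbreviation (input) minus_in ("(_ \<ominus>[_] _)" [65, 0, 66] 65) where "x \<ominus>[V] y \<equiv> x \<ominus>\<^bsub>V\<^esub> y"
abbreviation (input) inv_in ("(\<ominus>[_] _)" [0, 81] 80) where "\<ominus>[V] x \<equiv> \<ominus>\<^bsub>V\<^esub> x"
abbreviation (input) coset_in ("(_ +>[_] _)" [60, 0, 61] 60) where "H +>[V] x \<equiv> H +>\<^bsub>V\<^esub> x"
abbreviation (input) zero_in ("(\<zero>[_])") where "\<zero>[V] \<equiv> \<zero>\<^bsub>V\<^esub>"
abbreviation (input) one_in ("(\<one>[_])") where "\<one>[V] \<equiv> \<one>\<^bsub>V\<^esub>"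

section \<open>Linear maps, free modules and quotients\<close>

definition lin :: "('k, 'x) ring_scheme => ('k, 'v, 'y) module_scheme => ('k, 'w, 'z) module_scheme
  => ('v => 'w) => bool" where
 "lin K V W f \<longleftrightarrow> f \<in> carrier V \<rightarrow> carrier W
   \<and> (\<forall>x\<in>carrier V. \<forall>y\<in>carrier V. f (x \<oplus>[V] y) = f x \<oplus>[W] f y)
   \<and> (\<forall>c\<in>carrier K. \<forall>x\<in>carrier V. f (c \<odot>[V] x) = c \<odot>[W] f x)"

lemma linI:
 assumes "!!x. x \<in> carrier V ==> f x \<in> carrier W"
  and "!!x y. x \<in> carrier V ==> y \<in> carrier V ==> f (x \<oplus>[V] y) = f x \<oplus>[W] f y"
  and "!!c x. c \<in> carrier K ==> x \<in> carrier V ==> f (c \<odot>[V] x) = c \<odot>[W] f x"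
 shows "lin K V W f"
 using assms by (auto simp: lin_def)

lemma lin_closed: "lin K V W f ==> x \<in> carrier V ==> f x \<in> carrier W"
 and lin_add: "lin K V W f ==> x \<in> carrier V ==> y \<in> carrier V ==> f (x \<oplus>[V] y) = f x \<oplus>[W] f y"
 and lin_smult: "lin K V W f ==> c \<in> carrier K ==> x \<in> carrier V ==> f (c \<odot>[V] x) = c \<odot>[W] f x"
 by (auto simp: lin_def)

lemma lin_cong:
 assumes "lin K V W f" and "!!x. x \<in> carrier V ==> f x = g x"
  and "!!x y. x \<in> carrier V ==> y \<in> carrier V ==> x \<oplus>[V] y \<in> carrier V"
  and "!!c x. c \<in> carrier K ==> x \<in> carrier V ==> c \<odot>[V] x \<in> carrier V"
 shows "lin K V W g"
 using assms by (auto simp: lin_def Pi_def)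

lemma lin_comp: "lin K V W f ==> lin K W U g ==> lin K V U (%x. g (f x))"
 by (auto simp: lin_def Pi_def)

lemma lin_ident: "lin K V V (%x. x)"
 by (auto simp: lin_def)

text \<open>Only the field is fixed. Vector spaces enter as premises \<open>module K V\<close>, so
  that one statement can mention several of them at different types.\<close>

locale fld = field K for K :: "('k, 'x) ring_scheme" (structure)
begin

lemma is_cring_K: "cring K" ..

context
 fixes V :: "('k, 'v, 'y) module_scheme"
 assumes V: "module K V"
begin

interpretation V: module K V by (rule V)

lemma v_add [simp, intro]: "x \<in> carrier V ==> y \<in> carrier V ==> x \<oplus>[V] y \<in> carrier V"
 and v_zero [simp, intro]: "\<zero>[V] \<in> carrier V"
 and v_smult [simp, intro]: "c \<in> carrier K ==> x \<in> carrier V ==> c \<odot>[V] x \<in> carrier V"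
 and v_inv [simp, intro]: "x \<in> carrier V ==> \<ominus>[V] x \<in> carrier V"
 and v_minus [simp, intro]: "x \<in> carrier V ==> y \<in> carrier V ==> x \<ominus>[V] y \<in> carrier V"
 and v_l_zero [simp]: "x \<in> carrier V ==> \<zero>[V] \<oplus>[V] x = x"
 and v_r_zero [simp]: "x \<in> carrier V ==> x \<oplus>[V] \<zero>[V] = x"
 and v_smult_l_zero [simp]: "x \<in> carrier V ==> \<zero> \<odot>[V] x = \<zero>[V]"
 and v_smult_r_zero [simp]: "c \<in> carrier K ==> c \<odot>[V] \<zero>[V] = \<zero>[V]"
 and v_smult_one [simp]: "x \<in> carrier V ==> \<one> \<odot>[V] x = x"
 by (simp_all add: a_minus_def)

lemma v_smult_r_distr: "c \<in> carrier K ==> x \<in> carrier V ==> y \<in> carrier V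
  ==> c \<odot>[V] (x \<oplus>[V] y) = c \<odot>[V] x \<oplus>[V] c \<odot>[V] y"
 and v_smult_l_distr: "c \<in> carrier K ==> d \<in> carrier K ==> x \<in> carrier V
  ==> (c \<oplus> d) \<odot>[V] x = c \<odot>[V] x \<oplus>[V] d \<odot>[V] x"
 and v_smult_assoc: "c \<in> carrier K ==> d \<in> carrier K ==> x \<in> carrier V
  ==> (c \<otimes> d) \<odot>[V] x = c \<odot>[V] (d \<odot>[V] x)"
 by (simp_all add: V.smult_r_distr V.smult_l_distr V.smult_assoc1)

lemma v_smult_comm: "c \<in> carrier K ==> d \<in> carrier K ==> x \<in> carrier V
  ==> c \<odot>[V] (d \<odot>[V] x) = d \<odot>[V] (c \<odot>[V] x)"
 by (simp add: V.smult_assoc1 [symmetric] m_comm)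

lemma v_assoc: "x \<in> carrier V ==> y \<in> carrier V ==> z \<in> carrier V
  ==> (x \<oplus>[V] y) \<oplus>[V] z = x \<oplus>[V] (y \<oplus>[V] z)"
 and v_comm: "x \<in> carrier V ==> y \<in> carrier V ==> x \<oplus>[V] y = y \<oplus>[V] x"
 and v_lcomm: "x \<in> carrier V ==> y \<in> carrier V ==> z \<in> carrier V
  ==> x \<oplus>[V] (y \<oplus>[V] z) = y \<oplus>[V] (x \<oplus>[V] z)"
 by (simp_all add: V.a_ac)

lemma v_inv_smult: "x \<in> carrier V ==> \<ominus>[V] x = (\<ominus> \<one>) \<odot>[V] x"
 by (simp add: V.smult_l_minus)

lemma v_smult_inv: "c \<in> carrier K ==> x \<in> carrier V ==> c \<odot>[V] (\<ominus>[V] x) = \<ominus>[V] (c \<odot>[V] x)"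
 and v_inv_inv [simp]: "x \<in> carrier V ==> \<ominus>[V] (\<ominus>[V] x) = x"
 and v_inv_add: "x \<in> carrier V ==> y \<in> carrier V ==> \<ominus>[V] (x \<oplus>[V] y) = \<ominus>[V] x \<oplus>[V] \<ominus>[V] y"
 and v_inv_zero [simp]: "\<ominus>[V] \<zero>[V] = \<zero>[V]"
 and v_l_neg [simp]: "x \<in> carrier V ==> \<ominus>[V] x \<oplus>[V] x = \<zero>[V]"
 and v_r_neg [simp]: "x \<in> carrier V ==> x \<oplus>[V] \<ominus>[V] x = \<zero>[V]"
 and v_minus_self [simp]: "x \<in> carrier V ==> x \<ominus>[V] x = \<zero>[V]"
 and v_minus_zero [simp]: "x \<in> carrier V ==> x \<ominus>[V] \<zero>[V] = x"
 by (simp_all add: V.smult_r_minus V.minus_add V.l_neg V.r_neg a_minus_def)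

lemma v_neg_cancel [simp]:
 "x \<in> carrier V ==> y \<in> carrier V ==> x \<oplus>[V] (\<ominus>[V] x \<oplus>[V] y) = y"
 "x \<in> carrier V ==> y \<in> carrier V ==> \<ominus>[V] x \<oplus>[V] (x \<oplus>[V] y) = y"
 by (simp_all add: V.r_neg2 V.r_neg1)

lemma v_cancel: "x \<in> carrier V ==> y \<in> carrier V ==> z \<in> carrier V
  ==> x \<oplus>[V] y = x \<oplus>[V] z \<longleftrightarrow> y = z"
 by simp

lemma v_minus_eq_zero: "x \<in> carrier V ==> y \<in> carrier V ==> x \<ominus>[V] y = \<zero>[V] \<longleftrightarrow> x = y"
 by (metis V.add.inv_solve_right V.l_zero V.zero_closed a_minus_def)

lemma v_minus_iff: "x \<in> carrier V ==> y \<in> carrier V ==> z \<in> carrier V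
  ==> x \<ominus>[V] y = z \<longleftrightarrow> x = y \<oplus>[V] z"
 by (metis V.a_comm V.add.inv_solve_right a_minus_def)

lemma v_add_eq_zero: "x \<in> carrier V ==> y \<in> carrier V ==> x \<oplus>[V] y = \<zero>[V] \<longleftrightarrow> y = \<ominus>[V] x"
 by (metis V.add.inv_equality V.minus_equality V.a_comm V.r_neg)

lemma v_minus_add_swap:
 "x \<in> carrier V ==> y \<in> carrier V ==> z \<in> carrier V ==> w \<in> carrier V
  ==> (x \<oplus>[V] y) \<ominus>[V] (z \<oplus>[V] w) = (x \<ominus>[V] z) \<oplus>[V] (y \<ominus>[V] w)"
 by (simp add: a_minus_def V.minus_add V.a_ac)

lemma v_add_swap:
 "x \<in> carrier V ==> y \<in> carrier V ==> z \<in> carrier V ==> w \<in> carrier V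
  ==> (x \<oplus>[V] y) \<oplus>[V] (z \<oplus>[V] w) = (x \<oplus>[V] z) \<oplus>[V] (y \<oplus>[V] w)"
 by (simp add: V.a_ac)

lemma v_smult_minus: "c \<in> carrier K ==> x \<in> carrier V ==> y \<in> carrier V
  ==> c \<odot>[V] (x \<ominus>[V] y) = c \<odot>[V] x \<ominus>[V] c \<odot>[V] y"
 by (simp add: a_minus_def V.smult_r_distr V.smult_r_minus)

lemma v_submoduleI:
 assumes "H <= carrier V" "\<zero>[V] \<in> H" "!!a b. a \<in> H ==> b \<in> H ==> a \<oplus>[V] b \<in> H"
  "!!c x. c \<in> carrier K ==> x \<in> H ==> c \<odot>[V] x \<in> H"
 shows "submodule H K V"
proof (rule V.submoduleI)
 fix a assume a: "a \<in> H"
 then have "\<ominus>[V] a = (\<ominus> \<one>) \<odot>[V] a"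
  using assms(1) v_inv_smult by blast
 with a show "\<ominus>[V] a \<in> H" by (simp add: assms(4))
qed (use assms in auto)

lemma v_submoduleD:
 assumes "submodule H K V"
 shows "H <= carrier V" "\<zero>[V] \<in> H" "a \<in> H ==> b \<in> H ==> a \<oplus>[V] b \<in> H"
  "c \<in> carrier K ==> a \<in> H ==> c \<odot>[V] a \<in> H" "a \<in> H ==> \<ominus>[V] a \<in> H"
  "a \<in> H ==> b \<in> H ==> a \<ominus>[V] b \<in> H"
proof -
 note E = V.submoduleE[OF assms]
 from E(2) obtain h where h: "h \<in> H" by blast
 from E(5)[OF h E(3)[OF h]] h E(1) show "\<zero>[V] \<in> H" by (auto simp: V.r_neg subset_iff)
 show "a \<in> H ==> b \<in> H ==> a \<ominus>[V] b \<in> H"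
  by (simp add: a_minus_def E)
qed (use V.submoduleE[OF assms] in auto)

lemma v_submodule_module: "submodule H K V ==> module K (V\<lparr>carrier := H\<rparr>)"
 by (rule submodule.submodule_is_module[OF _ V])

lemma v_submodule_carrier: "submodule (carrier V) K V"
 by (rule V.carrier_is_submodule)

lemma subspan_submodule:
 assumes "Z <= carrier V"
 shows "submodule (subspan K V Z) K V"
proof (rule v_submoduleI)
 show "subspan K V Z <= carrier V"
  unfolding subspan_def using assms v_submodule_carrier by (auto simp: hull_def)
qed (auto simp: subspan_def hull_def dest: v_submoduleD)

lemma subspan_inc: "z \<in> Z ==> z \<in> subspan K V Z"
 by (simp add: subspan_def hull_inc)

lemma subspan_min: "submodule H K V ==> Z <= H ==> subspan K V Z <= H"
 by (simp add: subspan_def hull_minimal)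

end

lemma module_ground [simp]: "module K (ground K)"
 by (rule moduleI)
   (auto intro!: abelian_groupI simp: ground_def is_cring a_assoc m_assoc l_distr r_distr
    is_cring_K intro: a_comm l_neg r_neg bexI[of _ "\<ominus> _"])

lemma lin_zero:
 assumes "lin K V W f" "module K V" "module K W"
 shows "f \<zero>[V] = \<zero>[W]"
proof -
 have "f \<zero>[V] = f (\<zero> \<odot>[V] \<zero>[V])" using assms by simp
 also have "\<dots> = \<zero>[W]" using assms lin_closed[OF assms(1)] by (subst lin_smult[OF assms(1)]) auto
 finally show ?thesis .
qed

lemma lin_inv:
 assumes "lin K V W f" "module K V" "module K W" "x \<in> carrier V"
 shows "f (\<ominus>[V] x) = \<ominus>[W] f x"
 using assms by (simp add: v_inv_smult lin_smult lin_closed)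

lemma lin_minus:
 assumes "lin K V W f" "module K V" "module K W" "x \<in> carrier V" "y \<in> carrier V"
 shows "f (x \<ominus>[V] y) = f x \<ominus>[W] f y"
 using assms by (simp add: a_minus_def lin_add lin_inv)

lemma lin_const_zero: "module K W ==> lin K V W (%x. \<zero>[W])"
 by (rule linI) auto

lemma lin_fun_add:
 assumes "module K W" "lin K V W f" "lin K V W g"
 shows "lin K V W (%x. f x \<oplus>[W] g x)"
 using assms by (intro linI) (simp_all add: lin_closed lin_add lin_smult v_smult_r_distr v_add_swap)

lemma lin_fun_smult:
 assumes "module K W" "lin K V W f" "c \<in> carrier K"
 shows "lin K V W (%x. c \<odot>[W] f x)"
 using assms by (intro linI) (simp_all add: lin_closed lin_add lin_smult v_smult_r_distr v_smult_comm)

lemma lin_fun_minus: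
 assumes "module K W" "lin K V W f" "lin K V W g"
 shows "lin K V W (%x. f x \<ominus>[W] g x)"
 using assms
 by (intro linI) (simp_all add: lin_closed lin_add lin_smult v_smult_minus v_minus_add_swap)

lemma lin_ker:
 assumes "lin K V W f" "module K V" "module K W"
 shows "submodule {x \<in> carrier V. f x = \<zero>[W]} K V"
 using assms by (intro v_submoduleI) (auto simp: lin_zero lin_add lin_smult)

lemma lin_vimage:
 assumes "lin K V W f" "module K V" "module K W" "submodule H K W"
 shows "submodule {x \<in> carrier V. f x \<in> H} K V"
 using assms
 by (intro v_submoduleI) (auto simp: lin_zero lin_add lin_smult v_submoduleD[OF assms(3,4)])

lemma lin_image:
 assumes "lin K V W f" "module K V" "module K W" "submodule H K V"
 shows "submodule (f ` H) K W"
proof (rule v_submoduleI)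
 note D = v_submoduleD[OF assms(2,4)]
 show "f ` H <= carrier W" using D(1) lin_closed[OF assms(1)] by blast
 show "\<zero>[W] \<in> f ` H" using D(2) lin_zero[OF assms(1-3)] by (metis imageI)
 show "a \<oplus>[W] b \<in> f ` H" if "a \<in> f ` H" "b \<in> f ` H" for a b
  using that D lin_add[OF assms(1), symmetric] by (auto simp: subset_iff)
 show "c \<odot>[W] a \<in> f ` H" if "c \<in> carrier K" "a \<in> f ` H" for a c
  using that D lin_smult[OF assms(1), symmetric] by (auto simp: subset_iff)
qed (use assms in auto)

text \<open>The preimage of a subspace under a linear map is a subspace, so membership is tested on
  the generators of the span.\<close>

lemma subspan_lin_in:
 assumes "lin K V W f" "module K V" "module K W" "submodule H K W" "Z <= carrier V"
  and "!!z. z \<in> Z ==> f z \<in> H" and "x \<in> subspan K V Z"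
 shows "f x \<in> H"
 using subspan_min[OF assms(2) lin_vimage[OF assms(1-4)], of Z] assms(5-7) by auto

lemma submodule_zero: "module K V ==> submodule {\<zero>[V]} K V"
 by (rule v_submoduleI) auto

lemma subspan_lin_zero:
 assumes "lin K V W f" "module K V" "module K W" "Z <= carrier V"
  and "!!z. z \<in> Z ==> f z = \<zero>[W]" and "x \<in> subspan K V Z"
 shows "f x = \<zero>[W]"
 using subspan_lin_in[OF assms(1-3) submodule_zero[OF assms(3)] assms(4)] assms(5,6) by auto


end

lemma free_mod_simps [simp]:
 "\<zero>[free_mod E G] = (%_. \<zero>[E])"
 "f \<oplus>[free_mod E G] h = (%g. f g \<oplus>[E] h g)"
 "c \<odot>[free_mod E G] f = (%g. c \<odot>[E] f g)"
 "lmult (free_mod E G) e f = (%g. e \<otimes>[E] f g)"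
 "rmult (free_mod E G) f e = (%g. f g \<otimes>[E] e)"
 by (simp_all add: free_mod_def)

lemma free_mod_carrier: "f \<in> carrier (free_mod E G) \<longleftrightarrow>
  (\<forall>g. f g \<in> carrier E) \<and> (\<forall>g. g \<notin> G \<longrightarrow> f g = \<zero>[E]) \<and> finite {g. f g \<noteq> \<zero>[E]}"
 by (simp add: free_mod_def)

lemma ground_simps [simp]: "carrier (ground K) = carrier K" "\<zero>[ground K] = \<zero>[K]"
 "\<one>[ground K] = \<one>[K]" "x \<oplus>[ground K] y = x \<oplus>[K] y" "c \<odot>[ground K] y = c \<otimes>[K] y"
 "x \<otimes>[ground K] y = x \<otimes>[K] y"
 by (simp_all add: ground_def)

context fld
begin

lemma module_free_mod [simp]:
 assumes E: "module K E"
 shows "module K (free_mod E G)"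
proof -
 have fin: "finite {g. F (f g) (h g) \<noteq> \<zero>[E]}"
  if "finite {g. f g \<noteq> \<zero>[E]}" "finite {g. h g \<noteq> \<zero>[E]}" "F \<zero>[E] \<zero>[E] = \<zero>[E]" for F f h
  by (rule finite_subset[OF _ finite_UnI[OF that(1,2)]]) (use that(3) in auto)
 have fin1: "finite {g. F (f g) \<noteq> \<zero>[E]}"
  if "finite {g. f g \<noteq> \<zero>[E]}" "F \<zero>[E] = \<zero>[E]" for F f
  by (rule finite_subset[OF _ that(1)]) (use that(2) in auto)
 have add: "f \<oplus>[free_mod E G] h \<in> carrier (free_mod E G)"
  if "f \<in> carrier (free_mod E G)" "h \<in> carrier (free_mod E G)" for f h
  using that E by (auto simp: free_mod_carrier intro: fin)
 have smult: "c \<odot>[free_mod E G] f \<in> carrier (free_mod E G)"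
  if "c \<in> carrier K" "f \<in> carrier (free_mod E G)" for c f
  using that E by (auto simp: free_mod_carrier intro: fin1)
 have "abelian_group (free_mod E G)"
 proof (rule abelian_groupI)
  fix f assume f: "f \<in> carrier (free_mod E G)"
  have "(\<ominus> \<one>) \<odot>[free_mod E G] f \<oplus>[free_mod E G] f = \<zero>[free_mod E G]"
   using f E by (simp add: free_mod_carrier v_inv_smult[symmetric])
  with smult[OF _ f, of "\<ominus> \<one>"]
  show "\<exists>h\<in>carrier (free_mod E G). h \<oplus>[free_mod E G] f = \<zero>[free_mod E G]" by auto
 qed (use E add in \<open>auto simp: free_mod_carrier v_assoc intro!: v_comm\<close>)
 then show ?thesis
  using E smult
  by (intro moduleI is_cring_K)
   (auto simp: free_mod_carrier v_smult_l_distr v_smult_r_distr v_smult_assoc)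
qed

lemma single_closed [simp]:
 assumes "module K E" "g \<in> G" "e \<in> carrier E"
 shows "single E g e \<in> carrier (free_mod E G)"
proof -
 have "{h. single E g e h \<noteq> \<zero>[E]} <= {g}" by (auto simp: single_def)
 then have "finite {h. single E g e h \<noteq> \<zero>[E]}" by (rule finite_subset) simp
 with assms show ?thesis by (auto simp: free_mod_carrier single_def)
qed


lemma free_induct [consumes 2, case_names zero single add]:
 assumes f: "f \<in> carrier (free_mod E G)" and E: "module K E"
  and zero: "P \<zero>[free_mod E G]" and single: "!!g e. g \<in> G ==> e \<in> carrier E ==> P (single E g e)"
  and add: "!!f h. f \<in> carrier (free_mod E G) ==> h \<in> carrier (free_mod E G) ==> P f ==> P h
    ==> P (f \<oplus>[free_mod E G] h)"
 shows "P f"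
proof -
 have "finite S ==> {g. f g \<noteq> \<zero>[E]} = S ==> f \<in> carrier (free_mod E G) ==> P f" for S f
 proof (induction S arbitrary: f rule: finite_induct)
  case empty
  then have "f = \<zero>[free_mod E G]" by auto
  with zero show ?case by simp
 next
  case (insert a S)
  let ?h = "f(a := \<zero>[E])"
  have S: "{g. ?h g \<noteq> \<zero>[E]} = S" using insert by auto
  have a: "a \<in> G" using insert.prems by (auto simp: free_mod_carrier)
  have h: "?h \<in> carrier (free_mod E G)"
   unfolding free_mod_carrier S using insert E by (auto simp: free_mod_carrier)
  have fa: "f a \<in> carrier E" using insert by (simp add: free_mod_carrier)
  have "f = single E a (f a) \<oplus>[free_mod E G] ?h"
   using insert E by (auto simp: single_def fun_eq_iff free_mod_carrier)
  with add[OF single_closed[OF E a fa] h single[OF a fa] insert.IH[OF S h]] show ?case by simp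
 qed
 with f show ?thesis by (auto simp: free_mod_carrier)
qed

lemma finsum_supp:
 assumes "module K V" "finite S" "{g. f g \<noteq> z} <= S" "!!g. g \<in> S ==> \<psi> g (f g) \<in> carrier V"
  "!!g. g \<in> S ==> \<psi> g z = \<zero>[V]"
 shows "finsum V (%g. \<psi> g (f g)) {g. f g \<noteq> z} = finsum V (%g. \<psi> g (f g)) S"
proof -
 interpret V: module K V by (rule assms)
 show ?thesis
  by (rule V.add.finprod_mono_neutral_cong_left) (use assms in auto)
qed

text \<open>The coefficient at a generator \<open>g\<close> passes through its own linear map
  \<open>\<psi> g\<close>. In this form the lemma covers scalar multiples as well as left and right
  actions of an algebra.\<close>

lemma free_lin:
 assumes E: "module K E" and V: "module K V" and \<psi>: "!!g. g \<in> G ==> lin K E V (\<psi> g)"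
 defines "F \<equiv> %f. finsum V (%g. \<psi> g (f g)) {g. f g \<noteq> \<zero>[E]}"
 shows "lin K (free_mod E G) V F"
  and "g \<in> G ==> e \<in> carrier E ==> F (single E g e) = \<psi> g e"
proof -
 interpret V: module K V by (rule V)
 let ?s = "%f. {g. f g \<noteq> \<zero>[E]}"
 have z: "\<psi> g \<zero>[E] = \<zero>[V]" if "g \<in> G" for g
  using lin_zero[OF \<psi>[OF that] E V] .
 \<comment> \<open>The sum may be taken over any finite set of generators that contains the support;
   additivity is then computed on the union of two supports.\<close>
 have F: "F f = finsum V (%g. \<psi> g (f g)) S"
  if "finite S" "?s f <= S" "S <= G" "!!g. f g \<in> carrier E" for f S
  unfolding F_def by (rule finsum_supp) (use that V z lin_closed[OF \<psi>] in auto)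
 have cl: "\<psi> g (f g) \<in> carrier V" if "g \<in> G" "f \<in> carrier (free_mod E G)" for f g
  using lin_closed[OF \<psi>[OF that(1)]] that(2) by (auto simp: free_mod_carrier)
 have sG: "?s f <= G" if "f \<in> carrier (free_mod E G)" for f
  using that by (auto simp: free_mod_carrier)
 show "lin K (free_mod E G) V F"
 proof (rule linI)
  fix f h assume fh: "f \<in> carrier (free_mod E G)" "h \<in> carrier (free_mod E G)"
  let ?S = "?s f \<union> ?s h"
  have S: "finite ?S" "?S <= G" using fh by (auto simp: free_mod_carrier)
  have "F (f \<oplus>[free_mod E G] h) = finsum V (%g. \<psi> g (f g \<oplus>[E] h g)) ?S"
   unfolding free_mod_simps by (rule F) (use fh S E in \<open>auto simp: free_mod_carrier\<close>)
  also have "\<dots> = finsum V (%g. \<psi> g (f g) \<oplus>[V] \<psi> g (h g)) ?S"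
  proof (rule V.finsum_cong')
   fix g assume g: "g \<in> ?S"
   with S have "g \<in> G" by blast
   then show "\<psi> g (f g \<oplus>[E] h g) = \<psi> g (f g) \<oplus>[V] \<psi> g (h g)"
    using fh by (intro lin_add[OF \<psi>]) (auto simp: free_mod_carrier)
  qed (use S fh cl in auto)
  also have "\<dots> = finsum V (%g. \<psi> g (f g)) ?S \<oplus>[V] finsum V (%g. \<psi> g (h g)) ?S"
   by (rule V.finsum_addf) (use S fh cl in blast)+
  also have "\<dots> = F f \<oplus>[V] F h"
   using S fh by (subst (1 2) F[of ?S]) (auto simp: free_mod_carrier)
  finally show "F (f \<oplus>[free_mod E G] h) = F f \<oplus>[V] F h" .
 next
  fix c f assume c: "c \<in> carrier K" and f: "f \<in> carrier (free_mod E G)"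
  have S: "finite (?s f)" using f by (auto simp: free_mod_carrier)
  have "F (c \<odot>[free_mod E G] f) = finsum V (%g. \<psi> g (c \<odot>[E] f g)) (?s f)"
   unfolding free_mod_simps
   by (rule F) (use f S E c sG[OF f] in \<open>auto simp: free_mod_carrier\<close>)
  also have "\<dots> = finsum V (%g. c \<odot>[V] \<psi> g (f g)) (?s f)"
  proof (rule V.finsum_cong')
   fix g assume g: "g \<in> ?s f"
   with sG[OF f] have "g \<in> G" by blast
   then show "\<psi> g (c \<odot>[E] f g) = c \<odot>[V] \<psi> g (f g)"
    using f c by (intro lin_smult[OF \<psi>]) (auto simp: free_mod_carrier)
  qed (use sG[OF f] f c cl in auto)
  also have "\<dots> = c \<odot>[V] F f" unfolding F_def
   by (rule V.finsum_smult_ldistr[symmetric]) (use sG[OF f] f c cl S in auto)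
  finally show "F (c \<odot>[free_mod E G] f) = c \<odot>[V] F f" .
 next
  fix f assume "f \<in> carrier (free_mod E G)"
  then show "F f \<in> carrier V" unfolding F_def
   using sG cl by (intro V.finsum_closed) blast
 qed
 show "F (single E g e) = \<psi> g e" if "g \<in> G" "e \<in> carrier E"
 proof -
  have "F (single E g e) = finsum V (%h. \<psi> h (single E g e h)) {g}"
   by (rule F) (use that E in \<open>auto simp: single_def\<close>)
  also have "\<dots> = \<psi> g e"
   using that lin_closed[OF \<psi>[OF that(1)]] by (simp add: single_def)
  finally show ?thesis .
 qed
qed

lemma free_lin_eq:
 assumes "lin K (free_mod E G) V F" "lin K (free_mod E G) V H" "module K E" "module K V"
  "!!g e. g \<in> G ==> e \<in> carrier E ==> F (single E g e) = H (single E g e)"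
  "f \<in> carrier (free_mod E G)"
 shows "F f = H f"
 using assms(6,3)
proof (induction rule: free_induct)
 case zero
 show ?case using lin_zero[OF assms(1)] lin_zero[OF assms(2)] assms(3,4) by simp
next
 case (single g e) then show ?case by (rule assms(5))
next
 case (add f h)
 then show ?case by (simp add: lin_add[OF assms(1)] lin_add[OF assms(2)] del: free_mod_simps)
qed

section \<open>Quotient spaces\<close>

context
 fixes V :: "('k, 'v, 'y) module_scheme" and H
 assumes V: "module K V" and H: "submodule H K V"
begin

interpretation V: module K V by (rule V)

interpretation H: abelian_subgroup H V
 by (rule abelian_subgroupI3)
   (use H in \<open>auto simp: submodule_def additive_subgroup_def V.abelian_group_axioms\<close>)

lemma coset_eq_iff:
 assumes x: "x \<in> carrier V" and y: "y \<in> carrier V"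
 shows "H +>[V] x = H +>[V] y \<longleftrightarrow> x \<ominus>[V] y \<in> H"
proof
 assume "H +>[V] x = H +>[V] y"
 with H.a_rcos_self[OF x] obtain h where h: "h \<in> H" "x = h \<oplus>[V] y"
  by (auto simp: a_r_coset_def')
 then have "x \<ominus>[V] y = h"
  using v_submoduleD(1)[OF V H] V y by (subst v_minus_iff) (auto simp: v_comm)
 with h show "x \<ominus>[V] y \<in> H" by simp
next
 assume *: "x \<ominus>[V] y \<in> H"
 have "x = (x \<ominus>[V] y) \<oplus>[V] y"
  using V x y by (simp add: a_minus_def v_assoc)
 with * have "x \<in> H +>[V] y" by (auto simp: a_r_coset_def')
 then show "H +>[V] x = H +>[V] y"
  using V.a_repr_independence[OF _ y H.a_subgroup] by simp
qed

lemma mem_coset: "y \<in> H +>[V] x ==> x \<in> carrier V ==> y \<in> carrier V \<and> H +>[V] y = H +>[V] x"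
 using V.a_repr_independence[OF _ _ H.a_subgroup, of y x] H.a_elemrcos_carrier[of x y]
 by simp

text \<open>Maps out of a quotient are evaluated at a \<open>SOME\<close>-chosen representative, as
  in \<open>plift\<close> and \<open>cyc_gen\<close>; such a choice stays in the coset.\<close>

lemma coset_some:
 assumes "x \<in> carrier V"
 shows "(SOME y. y \<in> H +>[V] x) \<in> carrier V"
  "H +>[V] (SOME y. y \<in> H +>[V] x) = H +>[V] x"
proof -
 have "(SOME y. y \<in> H +>[V] x) \<in> H +>[V] x"
  using H.a_rcos_self[OF assms] by (rule someI)
 from mem_coset[OF this assms] show "(SOME y. y \<in> H +>[V] x) \<in> carrier V"
  "H +>[V] (SOME y. y \<in> H +>[V] x) = H +>[V] x" by auto
qed

lemma quot_mod_carrier: "carrier (quot_mod V H) = (%x. H +>[V] x) ` carrier V"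
 by (auto simp: quot_mod_def A_RCOSETS_def')

lemma quot_mod_zero: "\<zero>[quot_mod V H] = H +>[V] \<zero>[V]"
 using V.a_coset_add_zero[OF v_submoduleD(1)[OF V H]] by (simp only: quot_mod_def ring.simps)

lemma coset_zero_iff: "x \<in> carrier V ==> H +>[V] x = \<zero>[quot_mod V H] \<longleftrightarrow> x \<in> H"
 using V by (simp add: quot_mod_zero coset_eq_iff)

lemma quot_mod_add: "x \<in> carrier V ==> y \<in> carrier V
  ==> (H +>[V] x) \<oplus>[quot_mod V H] (H +>[V] y) = H +>[V] (x \<oplus>[V] y)"
 by (simp add: quot_mod_def H.a_rcos_sum)

text \<open>The scalar action is defined as a union over all representatives. All members of the
  union are the same coset, and the union is not empty.\<close>

lemma quot_mod_smult:
 assumes "c \<in> carrier K" "x \<in> carrier V"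
 shows "c \<odot>[quot_mod V H] (H +>[V] x) = H +>[V] (c \<odot>[V] x)"
proof -
 have eq: "H +>[V] (c \<odot>[V] u) = H +>[V] (c \<odot>[V] x)" if "u \<in> H +>[V] x" for u
 proof -
  from mem_coset[OF that assms(2)] have u: "u \<in> carrier V" "H +>[V] u = H +>[V] x" by auto
  with assms have "u \<ominus>[V] x \<in> H" by (simp add: coset_eq_iff)
  with u assms V H show ?thesis
   by (simp add: coset_eq_iff v_smult_minus[symmetric] v_submoduleD)
 qed
 have "(\<Union>u\<in>H +>[V] x. H +>[V] (c \<odot>[V] u)) = (\<Union>u\<in>H +>[V] x. H +>[V] (c \<odot>[V] x))"
  by (rule SUP_cong[OF refl eq])
 also have "\<dots> = H +>[V] (c \<odot>[V] x)"
  using H.a_rcos_self[OF assms(2)] by auto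
 finally show ?thesis by (simp only: quot_mod_def module.simps)
qed

lemma coset_lin: "lin K V (quot_mod V H) (%x. H +>[V] x)"
 by (rule linI) (auto simp: quot_mod_carrier quot_mod_add quot_mod_smult)

lemma quot_mod_cases [elim]:
 assumes "U \<in> carrier (quot_mod V H)"
 obtains x where "x \<in> carrier V" "U = H +>[V] x"
 using assms by (auto simp: quot_mod_carrier)

lemma quot_mod_module: "module K (quot_mod V H)"
proof (rule moduleI[OF is_cring_K])
 note S = quot_mod_add quot_mod_smult quot_mod_zero V lin_closed[OF coset_lin]
 show "abelian_group (quot_mod V H)"
 proof (rule abelian_groupI)
  fix U assume "U \<in> carrier (quot_mod V H)"
  then obtain x where x: "x \<in> carrier V" "U = H +>[V] x" ..
  then have "(H +>[V] (\<ominus>[V] x)) \<oplus>[quot_mod V H] U = \<zero>[quot_mod V H]"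
   by (simp add: S)
  then show "\<exists>U'\<in>carrier (quot_mod V H). U' \<oplus>[quot_mod V H] U = \<zero>[quot_mod V H]"
   using x V by (intro bexI[of _ "H +>[V] (\<ominus>[V] x)"]) (simp_all add: S)
  show "\<zero>[quot_mod V H] \<oplus>[quot_mod V H] U = U" using x by (simp add: S)
  fix U' assume "U' \<in> carrier (quot_mod V H)"
  then obtain x' where x': "x' \<in> carrier V" "U' = H +>[V] x'" ..
  show "U \<oplus>[quot_mod V H] U' \<in> carrier (quot_mod V H)" using x x' by (simp add: S)
  show "U \<oplus>[quot_mod V H] U' = U' \<oplus>[quot_mod V H] U"
   using x x' v_comm[OF V, of x x'] by (simp add: S)
  fix U'' assume "U'' \<in> carrier (quot_mod V H)"
  then obtain x'' where x'': "x'' \<in> carrier V" "U'' = H +>[V] x''" ..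
  then show "U \<oplus>[quot_mod V H] U' \<oplus>[quot_mod V H] U'' = U \<oplus>[quot_mod V H] (U' \<oplus>[quot_mod V H] U'')"
   using x x' by (simp add: S v_assoc)
 qed (simp add: S)
 fix a U assume a: "a \<in> carrier K" and "U \<in> carrier (quot_mod V H)"
 then obtain x where x: "x \<in> carrier V" "U = H +>[V] x" by blast
 show "a \<odot>[quot_mod V H] U \<in> carrier (quot_mod V H)" using a x by (simp add: S)
 show "(a \<oplus> b) \<odot>[quot_mod V H] U = a \<odot>[quot_mod V H] U \<oplus>[quot_mod V H] b \<odot>[quot_mod V H] U"
  if "b \<in> carrier K" for b using a x that by (simp add: S v_smult_l_distr)
 show "(a \<otimes> b) \<odot>[quot_mod V H] U = a \<odot>[quot_mod V H] (b \<odot>[quot_mod V H] U)"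
  if "b \<in> carrier K" for b using a x that by (simp add: S v_smult_assoc)
 fix U' assume "U' \<in> carrier (quot_mod V H)"
 then obtain x' where x': "x' \<in> carrier V" "U' = H +>[V] x'" ..
 then show "a \<odot>[quot_mod V H] (U \<oplus>[quot_mod V H] U')
   = a \<odot>[quot_mod V H] U \<oplus>[quot_mod V H] a \<odot>[quot_mod V H] U'"
  using a x by (simp add: S v_smult_r_distr)
next
 fix U assume "U \<in> carrier (quot_mod V H)"
 then obtain x where "x \<in> carrier V" "U = H +>[V] x" ..
 then show "\<one> \<odot>[quot_mod V H] U = U" using V by (simp add: quot_mod_smult)
qed

lemma quot_lift:
 assumes W: "module K W" and f: "lin K V W f" and 0: "!!h. h \<in> H ==> f h = \<zero>[W]"
 shows "lin K (quot_mod V H) W (%U. f (SOME x. x \<in> U))"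
  and "x \<in> carrier V ==> f (SOME y. y \<in> H +>[V] x) = f x"
proof -
 have eq: "f (SOME y. y \<in> H +>[V] x) = f x" if x: "x \<in> carrier V" for x
 proof -
  let ?y = "SOME y. y \<in> H +>[V] x"
  note y = coset_some[OF x]
  with x have "?y \<ominus>[V] x \<in> H" by (simp add: coset_eq_iff)
  then have "f ?y \<ominus>[W] f x = \<zero>[W]" using 0 lin_minus[OF f V W y(1) x] by simp
  with lin_closed[OF f] x y W show ?thesis by (simp add: v_minus_eq_zero)
 qed
 show "x \<in> carrier V ==> f (SOME y. y \<in> H +>[V] x) = f x" by (rule eq)
 show "lin K (quot_mod V H) W (%U. f (SOME x. x \<in> U))"
  using V by (intro linI)
   (auto simp: quot_mod_carrier quot_mod_add quot_mod_smult eq lin_closed[OF f] lin_add[OF f]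
    lin_smult[OF f])
qed

end

text \<open>First isomorphism theorem; equality of two values is reduced to the kernel through the
  difference of representatives.\<close>

lemma vs_iso_quot:
 assumes V: "module K V" and H: "submodule H K V" and W: "module K W" and f: "lin K V W f"
  and surj: "f ` carrier V = carrier W" and ker: "!!x. x \<in> carrier V ==> f x = \<zero>[W] \<longleftrightarrow> x \<in> H"
 shows "vs_iso K (quot_mod V H) W"
proof -
 have 0: "!!h. h \<in> H ==> f h = \<zero>[W]" using ker v_submoduleD(1)[OF V H] by blast
 let ?F = "%U. f (SOME x. x \<in> U)"
 note L = quot_lift[OF V H W f 0]
 have bij: "bij_betw ?F (carrier (quot_mod V H)) (carrier W)"
 proof (rule bij_betwI')
  fix U U' assume "U \<in> carrier (quot_mod V H)" "U' \<in> carrier (quot_mod V H)"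
  then obtain x y where x: "x \<in> carrier V" "U = H +>[V] x" and y: "y \<in> carrier V" "U' = H +>[V] y"
   by (auto simp: quot_mod_carrier[OF V H])
  have "?F U = ?F U' \<longleftrightarrow> f x = f y" using x y L(2) by simp
  also have "\<dots> \<longleftrightarrow> f (x \<ominus>[V] y) = \<zero>[W]"
   using x y lin_closed[OF f] W by (simp add: lin_minus[OF f V W] v_minus_eq_zero)
  also have "\<dots> \<longleftrightarrow> U = U'" using x y V by (simp add: ker coset_eq_iff[OF V H])
  finally show "?F U = ?F U' \<longleftrightarrow> U = U'" .
 next
  fix w assume "w \<in> carrier W"
  with surj obtain x where "x \<in> carrier V" "w = f x" by blast
  then show "\<exists>U\<in>carrier (quot_mod V H). w = ?F U"
   using L(2) by (auto simp: quot_mod_carrier[OF V H])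
 qed (rule lin_closed[OF L(1)])
 show ?thesis
  unfolding vs_iso_def by (rule exI, rule conjI[OF bij L(1)[unfolded lin_def, THEN conjunct2]])
qed

subsection \<open>Generators and relations\<close>

context
 fixes G :: "'g set" and Rs :: "('g => 'k) set"
 assumes Rs: "Rs <= carrier (free_mod (ground K) G)"
begin

abbreviation (input) "pres_free \<equiv> free_mod (ground K) G"
abbreviation (input) "pres_proj \<equiv> %f. subspan K pres_free Rs +>[pres_free] f"

lemma pres_sub: "submodule (subspan K pres_free Rs) K pres_free"
 by (rule subspan_submodule[OF module_free_mod[OF module_ground] Rs])

lemma pres_module: "module K (presented K G Rs)"
 unfolding presented_def by (rule quot_mod_module[OF module_free_mod[OF module_ground] pres_sub])

lemma pres_proj_lin: "lin K pres_free (presented K G Rs) pres_proj"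
 unfolding presented_def by (rule coset_lin[OF module_free_mod[OF module_ground] pres_sub])

lemma pgen_closed: "g \<in> G ==> pgen K G Rs g \<in> carrier (presented K G Rs)"
 unfolding pgen_def
 by (rule lin_closed[OF pres_proj_lin]) (rule single_closed[OF module_ground], simp_all)

lemma pres_rel: "r \<in> Rs ==> pres_proj r = \<zero>[presented K G Rs]"
 unfolding presented_def using Rs
 by (subst coset_zero_iff[OF module_free_mod[OF module_ground] pres_sub])
  (auto intro: subspan_inc[OF module_free_mod[OF module_ground]])

lemma pres_induct [consumes 1, case_names gen zero add smult]:
 assumes U: "U \<in> carrier (presented K G Rs)" and gen: "!!g. g \<in> G ==> P (pgen K G Rs g)"
  and zero: "P \<zero>[presented K G Rs]"
  and add: "!!x y. x \<in> carrier (presented K G Rs) ==> y \<in> carrier (presented K G Rs) ==> P x ==> P y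
   ==> P (x \<oplus>[presented K G Rs] y)"
  and smult: "!!c x. c \<in> carrier K ==> x \<in> carrier (presented K G Rs) ==> P x
   ==> P (c \<odot>[presented K G Rs] x)"
 shows "P U"
proof -
 note L = pres_proj_lin
 from U obtain f where f: "f \<in> carrier pres_free" "U = pres_proj f"
  using quot_mod_carrier[OF _ pres_sub] by (auto simp: presented_def)
 from f(1) module_ground have "P (pres_proj f)"
 proof (induction rule: free_induct)
  case zero
  show ?case
   unfolding lin_zero[OF L module_free_mod[OF module_ground] pres_module] by (rule assms(3))
 next
  case (single g e)
  have "single (ground K) g e = e \<odot>[pres_free] single (ground K) g \<one>"
   using single by (auto simp: single_def)
  then have "pres_proj (single (ground K) g e) = e \<odot>[presented K G Rs] pgen K G Rs g"
   using single unfolding pgen_def by (simp add: lin_smult[OF L] del: free_mod_simps)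
  moreover have "P (e \<odot>[presented K G Rs] pgen K G Rs g)"
   using single by (intro smult gen pgen_closed) simp_all
  ultimately show ?case by (simp only:)
 next
  case (add f h)
  show ?case unfolding lin_add[OF L add(1,2)]
   by (rule assms(4)[OF lin_closed[OF L add(1)] lin_closed[OF L add(2)] add(3,4)])
 qed
 with f show ?thesis by simp
qed


text \<open>The premise \<open>rel\<close> speaks of an arbitrary linear \<open>F\<close> with the
  prescribed values on generators. Relations are checked from these two properties alone, and the
  finite sum behind \<open>lin_ext\<close> does not surface in applications.\<close>

lemma plift:
 assumes V: "module K V" and \<phi>: "!!g. g \<in> G ==> \<phi> g \<in> carrier V"
  and rel: "!!F. lin K pres_free V F ==> (!!g. g \<in> G ==> F (single (ground K) g \<one>) = \<phi> g)
   ==> \<forall>r\<in>Rs. F r = \<zero>[V]"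
 shows "lin K (presented K G Rs) V (plift K V \<phi>)"
  and "g \<in> G ==> plift K V \<phi> (pgen K G Rs g) = \<phi> g"
proof -
 define F where "F = lin_ext (ground K) V (%v c. c \<odot>[V] v) \<phi>"
 have \<psi>: "lin K (ground K) V (%c. c \<odot>[V] \<phi> g)" if "g \<in> G" for g
  using that V \<phi> by (intro linI) (auto simp: v_smult_l_distr v_smult_assoc)
 have F_eq: "F = (%f. finsum V (%g. f g \<odot>[V] \<phi> g) {g. f g \<noteq> \<zero>[ground K]})"
  by (rule ext) (simp only: F_def lin_ext_def)
 note FL = free_lin[OF module_ground V, of G "%g c. c \<odot>[V] \<phi> g", OF \<psi>]
 have Fl: "lin K pres_free V F" unfolding F_eq by (rule FL(1))
 have Fs: "F (single (ground K) g \<one>) = \<phi> g" if "g \<in> G" for g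
  using FL(2)[OF _ that, of \<one>] V \<phi>[OF that] by (simp add: F_eq)
 have 0: "F h = \<zero>[V]" if "h \<in> subspan K pres_free Rs" for h
  by (rule subspan_lin_zero[OF Fl module_free_mod[OF module_ground] V Rs bspec[OF rel[OF Fl Fs]] that])
 have eq: "plift K V \<phi> = (%U. F (SOME f. f \<in> U))"
  by (rule ext) (simp only: plift_def F_def)
 note L = quot_lift[OF module_free_mod[OF module_ground] pres_sub V Fl 0]
 show "lin K (presented K G Rs) V (plift K V \<phi>)"
  unfolding eq presented_def by (rule L(1))
 show "plift K V \<phi> (pgen K G Rs g) = \<phi> g" if g: "g \<in> G"
  unfolding eq pgen_def
  by (rule trans[OF L(2) Fs[OF g]], assumption) (rule single_closed[OF module_ground g], simp)
qed

end

end

lemma module_extend_simps [simp]: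
 "carrier (module.extend V e) = carrier V" "\<zero>[module.extend V e] = \<zero>[V]"
 "x \<oplus>[module.extend V e] y = x \<oplus>[V] y" "c \<odot>[module.extend V e] x = c \<odot>[V] x"
 "x \<otimes>[module.extend V e] y = x \<otimes>[V] y" "\<one>[module.extend V e] = \<one>[V]"
 by (simp_all add: module.defs)

lemma module_truncate_simps [simp]:
 "carrier (module.truncate V) = carrier V" "\<zero>[module.truncate V] = \<zero>[V]"
 "x \<oplus>[module.truncate V] y = x \<oplus>[V] y" "c \<odot>[module.truncate V] x = c \<odot>[V] x"
 "x \<otimes>[module.truncate V] y = x \<otimes>[V] y" "\<one>[module.truncate V] = \<one>[V]"
 by (simp_all add: module.defs)

lemma bimodule_extend_simps [simp]:
 "lmult (module.extend V \<lparr>lmult = l, rmult = r\<rparr>) = l" "rmult (module.extend V \<lparr>lmult = l, rmult = r\<rparr>) = r"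
 by (simp_all add: module.defs)

lemma module_cong:
 assumes V: "module K V" and W: "carrier W = carrier V" "\<zero>[W] = \<zero>[V]" "(\<oplus>\<^bsub>W\<^esub>) = (\<oplus>\<^bsub>V\<^esub>)"
  "(\<odot>\<^bsub>W\<^esub>) = (\<odot>\<^bsub>V\<^esub>)"
 shows "module K W"
proof -
 interpret module K V by (rule V)
 show ?thesis
 proof (rule moduleI)
  show "abelian_group W"
   by (rule abelian_groupI) (auto simp: W M.a_assoc intro: M.a_comm M.l_neg bexI[of _ "\<ominus>[V] _"])
 qed (simp_all add: W is_cring smult_l_distr smult_r_distr smult_assoc1)
qed

lemma module_extend [simp]: "module K V ==> module K (module.extend V e)"
 by (erule module_cong) (auto simp: fun_eq_iff)

lemma module_truncate [simp]: "module K V ==> module K (module.truncate V)"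
 by (erule module_cong) (auto simp: fun_eq_iff)

lemma lin_extend1 [simp]: "lin K (module.extend V e) W f = lin K V W f"
 by (simp add: lin_def)

lemma lin_extend2 [simp]: "lin K V (module.extend W e) f = lin K V W f"
 by (simp add: lin_def)

lemma lin_truncate1 [simp]: "lin K (module.truncate V) W f = lin K V W f"
 by (simp add: lin_def)

lemma lin_truncate2 [simp]: "lin K V (module.truncate W) f = lin K V W f"
 by (simp add: lin_def)

lemma regular_simps [simp]:
 "lmult (regular A) = monoid.mult A" "rmult (regular A) = monoid.mult A"
 "carrier (regular A) = carrier A" "\<zero>[regular A] = \<zero>[A]" "x \<oplus>[regular A] y = x \<oplus>[A] y"
 "c \<odot>[regular A] x = c \<odot>[A] x"
 by (simp_all add: regular_def)

lemma kbimod_simps [simp]: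
 "lmult (kbimod A) = smult A" "rmult (kbimod A) x c = c \<odot>[A] x"
 "carrier (kbimod A) = carrier A" "\<zero>[kbimod A] = \<zero>[A]" "x \<oplus>[kbimod A] y = x \<oplus>[A] y"
 "c \<odot>[kbimod A] x = c \<odot>[A] x"
 by (simp_all add: kbimod_def)

lemma opp_alg_simps [simp]:
 "carrier (opp_alg A) = carrier A" "\<zero>[opp_alg A] = \<zero>[A]" "\<one>[opp_alg A] = \<one>[A]"
 "x \<oplus>[opp_alg A] y = x \<oplus>[A] y" "c \<odot>[opp_alg A] x = c \<odot>[A] x" "x \<otimes>[opp_alg A] y = y \<otimes>[A] x"
 "lin K V (opp_alg A) f = lin K V A f"
 by (simp_all add: opp_alg_def lin_def)

lemma lin_regular1 [simp]: "lin K V (regular A) f = lin K V A f"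
 by (simp add: lin_def)

lemma lin_regular2 [simp]: "lin K (regular A) W h = lin K A W h"
 by (simp add: lin_def)

lemma module_regular [simp]: "module K A ==> module K (regular A)"
 by (simp add: regular_def)


lemma lin_kbimod2 [simp]: "lin K (kbimod A) W h = lin K A W h"
 by (simp add: lin_def)

lemma module_kbimod [simp]: "module K A ==> module K (kbimod A)"
 by (simp add: kbimod_def)

lemma module_opp_alg [simp]: "module K A ==> module K (opp_alg A)"
 by (erule module_cong) (auto simp: fun_eq_iff)

section \<open>Tensor products\<close>

text \<open>Weaker than asking for two bimodules: the factors of the tensor product behind
  \<open>Tor\<close> are records of which only the actions of the middle ring are under
  control.\<close>

definition tensorable :: "('k, 'x) ring_scheme => ('s, 'w) partial_object_scheme
  => ('k, 'r, 's, 'm) bimodule => ('k, 's, 't, 'n) bimodule => bool" where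
 "tensorable K S M N \<longleftrightarrow> module K M \<and> module K N
   \<and> (\<forall>x\<in>carrier M. \<forall>s\<in>carrier S. rmult M x s \<in> carrier M)
   \<and> (\<forall>y\<in>carrier N. \<forall>s\<in>carrier S. lmult N s y \<in> carrier N)"

definition balanced :: "('k, 'x) ring_scheme => ('s, 'w) partial_object_scheme
  => ('k, 'r, 's, 'm) bimodule => ('k, 's, 't, 'n) bimodule => ('k, 'v, 'y) module_scheme
  => ('m => 'n => 'v) => bool" where
 "balanced K S M N V \<phi> \<longleftrightarrow>
   (\<forall>x\<in>carrier M. lin K N V (\<phi> x)) \<and> (\<forall>y\<in>carrier N. lin K M V (%x. \<phi> x y))
   \<and> (\<forall>x\<in>carrier M. \<forall>s\<in>carrier S. \<forall>y\<in>carrier N. \<phi> (rmult M x s) y = \<phi> x (lmult N s y))"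

lemma balancedI:
 assumes "!!x. x \<in> carrier M ==> lin K N V (\<phi> x)" "!!y. y \<in> carrier N ==> lin K M V (%x. \<phi> x y)"
  "!!x s y. x \<in> carrier M ==> s \<in> carrier S ==> y \<in> carrier N ==> \<phi> (rmult M x s) y = \<phi> x (lmult N s y)"
 shows "balanced K S M N V \<phi>"
 using assms by (auto simp: balanced_def)

context fld
begin


context
 fixes S :: "('s, 'w) partial_object_scheme" and M :: "('k, 'r, 's, 'm) bimodule"
  and N :: "('k, 's, 't, 'n) bimodule"
 assumes T: "tensorable K S M N"
begin

lemma M: "module K M" and N: "module K N"
  and Mc: "!!x s. x \<in> carrier M ==> s \<in> carrier S ==> rmult M x s \<in> carrier M"
  and Nc: "!!y s. y \<in> carrier N ==> s \<in> carrier S ==> lmult N s y \<in> carrier N"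
 using T by (auto simp: tensorable_def)

lemma tensor_rels_free: "tensor_rels K S M N <= carrier (free_mod (ground K) (carrier M \<times> carrier N))"
proof -
 let ?F = "free_mod (ground K) (carrier M \<times> carrier N)"
 have F: "module K ?F" by simp
 have s: "!!x y. x \<in> carrier M ==> y \<in> carrier N ==> single (ground K) (x, y) \<one> \<in> carrier ?F" by simp
 show ?thesis
  unfolding tensor_rels_def Let_def
  using M N by (auto intro!: v_minus[OF F] v_add[OF F] v_smult[OF F] s Mc Nc simp del: free_mod_simps)
qed

lemma tensor_module: "module K (tensor K S M N)"
 by (simp add: tensor_def Let_def pres_module[OF tensor_rels_free])

lemma tensor_lift:
 assumes V: "module K V" and \<phi>: "balanced K S M N V \<phi>"
 shows "lin K (tensor K S M N) V (plift K V (%(x, y). \<phi> x y))"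
  and "x \<in> carrier M ==> y \<in> carrier N ==> plift K V (%(x, y). \<phi> x y) (tens K S M N x y) = \<phi> x y"
proof -
 let ?F = "free_mod (ground K) (carrier M \<times> carrier N)"
 let ?d = "%x y. single (ground K) (x, y) \<one>"
 have F: "module K ?F" by simp
 have l1: "!!x. x \<in> carrier M ==> lin K N V (\<phi> x)" and l2: "!!y. y \<in> carrier N ==> lin K M V (%x. \<phi> x y)"
  and b: "!!x s y. x \<in> carrier M ==> s \<in> carrier S ==> y \<in> carrier N ==> \<phi> (rmult M x s) y = \<phi> x (lmult N s y)"
  using \<phi> by (auto simp: balanced_def)
 have c: "\<phi> x y \<in> carrier V" if "x \<in> carrier M" "y \<in> carrier N" for x y
  using lin_closed[OF l1] that by blast
 have s: "!!x y. x \<in> carrier M ==> y \<in> carrier N ==> ?d x y \<in> carrier ?F" by simp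
 have rel: "\<forall>r\<in>tensor_rels K S M N. f r = \<zero>[V]" if f: "lin K ?F V f"
  and fs: "!!g. g \<in> carrier M \<times> carrier N ==> f (single (ground K) g \<one>) = (%(x, y). \<phi> x y) g" for f
 proof
  have fs': "!!x y. x \<in> carrier M ==> y \<in> carrier N ==> f (?d x y) = \<phi> x y" using fs by auto
  note S = lin_minus[OF f F V] lin_add[OF f] lin_smult[OF f] fs' s v_add[OF F] v_smult[OF F] M N V c
   lin_add[OF l1] lin_add[OF l2] lin_smult[OF l1] lin_smult[OF l2] b Mc Nc
  fix r assume r: "r \<in> tensor_rels K S M N"
  show "f r = \<zero>[V]"
   using r unfolding tensor_rels_def Let_def
   by (elim UnE CollectE exE conjE) (simp_all add: S del: free_mod_simps single_closed)
 qed
 have c': "!!g. g \<in> carrier M \<times> carrier N ==> (%(x, y). \<phi> x y) g \<in> carrier V"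
  using c by auto
 note L = plift[OF tensor_rels_free V c' rel]
 show "lin K (tensor K S M N) V (plift K V (%(x, y). \<phi> x y))"
  unfolding tensor_def Let_def lin_extend1 by (rule L(1)) (auto simp: c)
 show "plift K V (%(x, y). \<phi> x y) (tens K S M N x y) = \<phi> x y" if xy: "x \<in> carrier M" "y \<in> carrier N"
  unfolding tens_def by (subst L(2)) (use xy c in auto)
qed

lemma tens_closed [simp]:
 "x \<in> carrier M ==> y \<in> carrier N ==> tens K S M N x y \<in> carrier (tensor K S M N)"
 using pgen_closed[OF tensor_rels_free] by (simp add: tensor_def tens_def Let_def)

lemma tens_balanced: "balanced K S M N (tensor K S M N) (tens K S M N)"
proof -
 let ?F = "free_mod (ground K) (carrier M \<times> carrier N)"
 let ?P = "presented K (carrier M \<times> carrier N) (tensor_rels K S M N)"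
 let ?d = "%x y. single (ground K) (x, y) \<one>"
 let ?p = "%f. subspan K ?F (tensor_rels K S M N) +>[?F] f"
 have F: "module K ?F" by simp
 note P = pres_module[OF tensor_rels_free]
 note L = pres_proj_lin[OF tensor_rels_free]
 have s: "!!x y. x \<in> carrier M ==> y \<in> carrier N ==> ?d x y \<in> carrier ?F" by simp
 have d: "!!x y. ?p (?d x y) = tens K S M N x y" by (simp add: tens_def pgen_def)
 note cl = tens_closed[unfolded tensor_def Let_def module_extend_simps]
 have eq: "?p u = ?p v" if "u \<ominus>[?F] v \<in> tensor_rels K S M N" "u \<in> carrier ?F" "v \<in> carrier ?F" for u v
  using pres_rel[OF tensor_rels_free that(1)] lin_minus[OF L F P that(2,3)]
   lin_closed[OF L that(2)] lin_closed[OF L that(3)] P by (simp add: v_minus_eq_zero del: free_mod_simps)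
 note S = lin_add[OF L] lin_smult[OF L] d s v_add[OF F] v_smult[OF F] M N
 have a1: "tens K S M N (x \<oplus>[M] x') y = tens K S M N x y \<oplus>[?P] tens K S M N x' y"
  if "x \<in> carrier M" "x' \<in> carrier M" "y \<in> carrier N" for x x' y
  using eq[of "?d (x \<oplus>[M] x') y" "?d x y \<oplus>[?F] ?d x' y"] that
  by (simp add: S del: free_mod_simps single_closed) (auto simp: tensor_rels_def Let_def)
 have a2: "tens K S M N x (y \<oplus>[N] y') = tens K S M N x y \<oplus>[?P] tens K S M N x y'"
  if "x \<in> carrier M" "y \<in> carrier N" "y' \<in> carrier N" for x y y'
  using eq[of "?d x (y \<oplus>[N] y')" "?d x y \<oplus>[?F] ?d x y'"] that
  by (simp add: S del: free_mod_simps single_closed) (auto simp: tensor_rels_def Let_def)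
 have a3: "tens K S M N (c \<odot>[M] x) y = c \<odot>[?P] tens K S M N x y"
  if "c \<in> carrier K" "x \<in> carrier M" "y \<in> carrier N" for c x y
  using eq[of "?d (c \<odot>[M] x) y" "c \<odot>[?F] ?d x y"] that
  by (simp add: S del: free_mod_simps single_closed) (auto simp: tensor_rels_def Let_def)
 have a4: "tens K S M N x (c \<odot>[N] y) = c \<odot>[?P] tens K S M N x y"
  if "c \<in> carrier K" "x \<in> carrier M" "y \<in> carrier N" for c x y
  using eq[of "?d x (c \<odot>[N] y)" "c \<odot>[?F] ?d x y"] that
  by (simp add: S del: free_mod_simps single_closed) (auto simp: tensor_rels_def Let_def)
 have a5: "tens K S M N (rmult M x s) y = tens K S M N x (lmult N s y)"
  if "x \<in> carrier M" "s \<in> carrier S" "y \<in> carrier N" for x s y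
  using eq[of "?d (rmult M x s) y" "?d x (lmult N s y)"] that
  by (simp add: S Mc Nc del: free_mod_simps single_closed) (auto simp: tensor_rels_def Let_def)
 show ?thesis
  by (intro balancedI) (auto intro!: linI simp: tensor_def Let_def a1 a2 a3 a4 a5 cl)
qed

lemma tens_lin1: "y \<in> carrier N ==> lin K M (tensor K S M N) (%x. tens K S M N x y)"
 and tens_lin2: "x \<in> carrier M ==> lin K N (tensor K S M N) (tens K S M N x)"
 and tens_balance: "x \<in> carrier M ==> s \<in> carrier S ==> y \<in> carrier N
  ==> tens K S M N (rmult M x s) y = tens K S M N x (lmult N s y)"
 using tens_balanced by (auto simp: balanced_def)

text \<open>Cases for zero and for scalars do not arise: zero is a pure tensor, and a scalar is
  absorbed into the first factor of a pure tensor.\<close>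

lemma tensor_induct [consumes 1, case_names gen add]:
 assumes U: "U \<in> carrier (tensor K S M N)"
  and gen: "!!x y. x \<in> carrier M ==> y \<in> carrier N ==> P (tens K S M N x y)"
  and add: "!!u v. u \<in> carrier (tensor K S M N) ==> v \<in> carrier (tensor K S M N) ==> P u ==> P v
   ==> P (u \<oplus>[tensor K S M N] v)"
 shows "P U"
proof -
 let ?P = "presented K (carrier M \<times> carrier N) (tensor_rels K S M N)"
 have car: "carrier ?P = carrier (tensor K S M N)" "\<zero>[?P] = \<zero>[tensor K S M N]"
  "!!u v. u \<oplus>[?P] v = u \<oplus>[tensor K S M N] v" "!!c v. c \<odot>[?P] v = c \<odot>[tensor K S M N] v"
  by (simp_all add: tensor_def Let_def)
 have T: "module K (tensor K S M N)" by (rule tensor_module)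
 have "U \<in> carrier ?P" using U car by simp
 \<comment> \<open>The claim is strengthened to all scalar multiples, so that the scalar case of
   \<open>pres_induct\<close> is carried by the induction hypothesis.\<close>
 then have "\<forall>c\<in>carrier K. P (c \<odot>[tensor K S M N] U)"
 proof (induction rule: pres_induct[OF tensor_rels_free, consumes 1, case_names gen zero add smult])
  case (gen g)
  then obtain x y where g: "g = (x, y)" "x \<in> carrier M" "y \<in> carrier N" by blast
  then show ?case
   using assms(2) M lin_smult[OF tens_lin1, symmetric] by (auto simp: tens_def[symmetric])
 next
  case zero
  have z: "\<zero>[tensor K S M N] = tens K S M N \<zero>[M] \<zero>[N]"
   using lin_zero[OF tens_lin1 M T] N by simp
  have "P \<zero>[tensor K S M N]" unfolding z using M N by (intro assms(2)) simp_all
  then show ?case using T by (simp add: car)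
 next
  case (add u v)
  then show ?case using T assms(3) by (simp add: car v_smult_r_distr)
 next
  case (smult c u)
  then show ?case using T by (simp add: car v_smult_assoc[symmetric])
 qed
 then have "P (\<one> \<odot>[tensor K S M N] U)" by blast
 then show ?thesis using U T by simp
qed

lemma tensor_lin_eq:
 assumes f: "lin K (tensor K S M N) V f" and h: "lin K (tensor K S M N) V h"
  and gen: "!!x y. x \<in> carrier M ==> y \<in> carrier N ==> f (tens K S M N x y) = h (tens K S M N x y)"
  and U: "U \<in> carrier (tensor K S M N)"
 shows "f U = h U"
 using U by (induction rule: tensor_induct) (simp_all add: gen lin_add[OF f] lin_add[OF h])

end

lemmas tensor_module' [simp] = tensor_module


end

context fld
begin

subsection \<open>Bimodule structures\<close>

lemma alg_module [simp]: "k_algebra K R ==> module K R"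
 by (rule k_algebra.axioms)

lemma alg_ring: "k_algebra K R ==> ring R"
 by (rule k_algebra.axioms)

lemma alg_mult [simp, intro]: "k_algebra K R ==> x \<in> carrier R ==> y \<in> carrier R ==> x \<otimes>[R] y \<in> carrier R"
 and alg_one [simp, intro]: "k_algebra K R ==> \<one>[R] \<in> carrier R"
 and alg_l_one [simp]: "k_algebra K R ==> x \<in> carrier R ==> \<one>[R] \<otimes>[R] x = x"
 and alg_r_one [simp]: "k_algebra K R ==> x \<in> carrier R ==> x \<otimes>[R] \<one>[R] = x"
 and alg_assoc: "k_algebra K R ==> x \<in> carrier R ==> y \<in> carrier R ==> z \<in> carrier R
  ==> (x \<otimes>[R] y) \<otimes>[R] z = x \<otimes>[R] (y \<otimes>[R] z)"
 by (auto dest!: alg_ring dest: ring.is_monoid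
   intro: monoid.m_closed monoid.one_closed monoid.l_one monoid.r_one monoid.m_assoc)

lemma alg_lin1: "k_algebra K R ==> y \<in> carrier R ==> lin K R R (%x. x \<otimes>[R] y)"
 by (intro linI) (simp_all add: ring.ring_simprules[OF alg_ring] k_algebra.smult_mult_left)

lemma alg_lin2: "k_algebra K R ==> x \<in> carrier R ==> lin K R R (%y. x \<otimes>[R] y)"
 by (intro linI) (simp_all add: ring.ring_simprules[OF alg_ring] k_algebra.smult_mult_right)

lemma algI:
 assumes "module K R" "\<one>[R] \<in> carrier R" "!!x. x \<in> carrier R ==> lin K R R (%y. x \<otimes>[R] y)"
  "!!y. y \<in> carrier R ==> lin K R R (%x. x \<otimes>[R] y)"
  "!!x y z. x \<in> carrier R ==> y \<in> carrier R ==> z \<in> carrier R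
   ==> (x \<otimes>[R] y) \<otimes>[R] z = x \<otimes>[R] (y \<otimes>[R] z)"
  "!!x. x \<in> carrier R ==> \<one>[R] \<otimes>[R] x = x" "!!x. x \<in> carrier R ==> x \<otimes>[R] \<one>[R] = x"
 shows "k_algebra K R"
proof (intro k_algebra.intro k_algebra_axioms.intro)
 show "ring R"
  by (intro ringI module.axioms(2)[OF assms(1)] monoidI)
    (use assms lin_closed[OF assms(3)] lin_add[OF assms(3)] lin_add[OF assms(4)] in auto)
qed (use assms lin_smult[OF assms(3)] lin_smult[OF assms(4)] in \<open>auto simp: field_axioms\<close>)

lemma bm_alg: "bimodule K R S V ==> k_algebra K R" "bimodule K R S V ==> k_algebra K S"
 by (auto dest: bimodule.axioms)

lemma bm_module [simp, dest]: "bimodule K R S V ==> module K V"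
 by (rule bimodule.axioms)

context
 fixes R :: "('k, 'r, 'y) module_scheme" and S :: "('k, 's, 'z) module_scheme"
  and V :: "('k, 'r, 's, 'v, 'w) bimodule_scheme"
 assumes V: "bimodule K R S V"
begin

interpretation V: bimodule K R S V by (rule V)

lemma bm_l: "r \<in> carrier R ==> lin K V V (lmult V r)"
 and bm_r: "s \<in> carrier S ==> lin K V V (%v. rmult V v s)"
 and bm_la: "v \<in> carrier V ==> lin K R V (%r. lmult V r v)"
 and bm_ra: "v \<in> carrier V ==> lin K S V (rmult V v)"
 by (auto intro!: linI V.lmult_closed V.rmult_closed V.lmult_add_right V.lmult_add_left
   V.lmult_smult_left V.lmult_smult_right V.rmult_add_right V.rmult_add_left
   V.rmult_smult_left V.rmult_smult_right)

lemma bm_lcl [simp]: "r \<in> carrier R ==> v \<in> carrier V ==> lmult V r v \<in> carrier V"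
 and bm_rcl [simp]: "s \<in> carrier S ==> v \<in> carrier V ==> rmult V v s \<in> carrier V"
 and bm_lassoc: "r \<in> carrier R ==> r' \<in> carrier R ==> v \<in> carrier V
  ==> lmult V (r \<otimes>[R] r') v = lmult V r (lmult V r' v)"
 and bm_rassoc: "s \<in> carrier S ==> s' \<in> carrier S ==> v \<in> carrier V
  ==> rmult V v (s \<otimes>[S] s') = rmult V (rmult V v s) s'"
 and bm_lone: "v \<in> carrier V ==> lmult V \<one>[R] v = v"
 and bm_rone: "v \<in> carrier V ==> rmult V v \<one>[S] = v"
 and bm_lr: "r \<in> carrier R ==> s \<in> carrier S ==> v \<in> carrier V
  ==> rmult V (lmult V r v) s = lmult V r (rmult V v s)"
 by (simp_all add: V.lmult_closed V.rmult_closed V.lmult_assoc V.rmult_assoc V.lmult_one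
   V.rmult_one V.lmult_rmult)

lemmas bm_ladd = lin_add[OF bm_l] and bm_radd = lin_add[OF bm_r]
 and bm_laddl = lin_add[OF bm_la] and bm_raddr = lin_add[OF bm_ra]
 and bm_lsm = lin_smult[OF bm_l] and bm_rsm = lin_smult[OF bm_r]
 and bm_lsml = lin_smult[OF bm_la] and bm_rsmr = lin_smult[OF bm_ra]

lemma bm_lzero: "r \<in> carrier R ==> lmult V r \<zero>[V] = \<zero>[V]"
 and bm_rzero: "s \<in> carrier S ==> rmult V \<zero>[V] s = \<zero>[V]"
 and bm_lzerol: "v \<in> carrier V ==> lmult V \<zero>[R] v = \<zero>[V]"
 and bm_rzeror: "v \<in> carrier V ==> rmult V v \<zero>[S] = \<zero>[V]"
 using V lin_zero[OF bm_l] lin_zero[OF bm_r] lin_zero[OF bm_la] lin_zero[OF bm_ra] bm_alg[OF V] by auto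

end

lemma bmI:
 assumes "k_algebra K R" "k_algebra K S" "module K V"
  and l: "!!r. r \<in> carrier R ==> lin K V V (lmult V r)"
  and r: "!!s. s \<in> carrier S ==> lin K V V (%v. rmult V v s)"
  and la: "!!v. v \<in> carrier V ==> lin K R V (%r. lmult V r v)"
  and ra: "!!v. v \<in> carrier V ==> lin K S V (rmult V v)"
  and "!!r r' v. r \<in> carrier R ==> r' \<in> carrier R ==> v \<in> carrier V
   ==> lmult V (r \<otimes>[R] r') v = lmult V r (lmult V r' v)"
  and "!!s s' v. s \<in> carrier S ==> s' \<in> carrier S ==> v \<in> carrier V
   ==> rmult V v (s \<otimes>[S] s') = rmult V (rmult V v s) s'"
  and "!!v. v \<in> carrier V ==> lmult V \<one>[R] v = v" "!!v. v \<in> carrier V ==> rmult V v \<one>[S] = v"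
  and "!!r s v. r \<in> carrier R ==> s \<in> carrier S ==> v \<in> carrier V
   ==> rmult V (lmult V r v) s = lmult V r (rmult V v s)"
 shows "bimodule K R S V"
 by (intro bimodule.intro bimodule_axioms.intro)
   (use assms lin_closed[OF l] lin_closed[OF r] lin_add[OF l] lin_add[OF r] lin_add[OF la]
    lin_add[OF ra] lin_smult[OF l] lin_smult[OF r] lin_smult[OF la] lin_smult[OF ra] in simp_all)

lemma tens_map:
 assumes T': "tensorable K S M' N'" and f: "lin K M M' f" and g: "lin K N N' g"
  and fs: "!!x s. x \<in> carrier M ==> s \<in> carrier S ==> f (rmult M x s) = rmult M' (f x) s"
  and gs: "!!y s. y \<in> carrier N ==> s \<in> carrier S ==> g (lmult N s y) = lmult N' s (g y)"
 shows "balanced K S M N (tensor K S M' N') (%x y. tens K S M' N' (f x) (g y))"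
 by (rule balancedI)
   (simp_all add: fs gs tens_balance[OF T'] lin_closed[OF f] lin_closed[OF g]
    lin_comp[OF f tens_lin1[OF T']] lin_comp[OF g tens_lin2[OF T']])

context
 fixes S :: "('k, 's, 'z) module_scheme" and R :: "('k, 'r, 'y) module_scheme"
  and T :: "('k, 't, 'y1) module_scheme"
  and M :: "('k, 'r, 's, 'm) bimodule" and N :: "('k, 's, 't, 'n) bimodule"
 assumes M: "bimodule K R S M" and N: "bimodule K S T N"
begin

lemma bm_tensorable: "tensorable K S M N"
 using M N by (auto simp: tensorable_def)

abbreviation (input) "MN \<equiv> tensor K S M N"
abbreviation (input) "mn \<equiv> tens K S M N"

text \<open>In the definition the actions are lifts into the bare presented space, which has the
  same operations as the tensor product. The lifting lemma is applied there and its result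
  transported back.\<close>

lemma tensor_lmult_lin: "r \<in> carrier R ==> lin K MN MN (lmult MN r)"
 and tensor_lmult: "r \<in> carrier R ==> x \<in> carrier M ==> y \<in> carrier N
  ==> lmult MN r (mn x y) = mn (lmult M r x) y"
proof -
 note TT = bm_tensorable
 let ?P = "presented K (carrier M \<times> carrier N) (tensor_rels K S M N)"
 have P: "module K ?P" by (rule pres_module[OF tensor_rels_free[OF TT]])
 assume r: "r \<in> carrier R"
 have "balanced K S M N MN (%x y. mn (lmult M r x) y)"
  by (rule tens_map[OF TT bm_l[OF M r] lin_ident]) (simp_all add: bm_lr[OF M] r)
 then have b: "balanced K S M N ?P (%x y. mn (lmult M r x) y)"
  by (simp add: balanced_def tensor_def Let_def)
 have e: "lmult MN r = plift K ?P (%(x, y). mn (lmult M r x) y)" by (simp add: tensor_def Let_def)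
 show "lin K MN MN (lmult MN r)"
  using tensor_lift(1)[OF TT P b] unfolding e by (simp add: tensor_def Let_def)
 show "lmult MN r (mn x y) = mn (lmult M r x) y" if "x \<in> carrier M" "y \<in> carrier N"
  using tensor_lift(2)[OF TT P b that] unfolding e .
qed

lemma tensor_rmult_lin: "t \<in> carrier T ==> lin K MN MN (%u. rmult MN u t)"
 and tensor_rmult: "t \<in> carrier T ==> x \<in> carrier M ==> y \<in> carrier N
  ==> rmult MN (mn x y) t = mn x (rmult N y t)"
proof -
 note TT = bm_tensorable
 let ?P = "presented K (carrier M \<times> carrier N) (tensor_rels K S M N)"
 have P: "module K ?P" by (rule pres_module[OF tensor_rels_free[OF TT]])
 assume t: "t \<in> carrier T"
 have "balanced K S M N MN (%x y. mn x (rmult N y t))"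
  by (rule tens_map[OF TT lin_ident bm_r[OF N t]]) (simp_all add: bm_lr[OF N] t)
 then have b: "balanced K S M N ?P (%x y. mn x (rmult N y t))"
  by (simp add: balanced_def tensor_def Let_def)
 have e: "(%u. rmult MN u t) = plift K ?P (%(x, y). mn x (rmult N y t))" by (simp add: tensor_def Let_def fun_eq_iff)
 show "lin K MN MN (%u. rmult MN u t)"
  using tensor_lift(1)[OF TT P b] unfolding e by (simp add: tensor_def Let_def)
 show "rmult MN (mn x y) t = mn x (rmult N y t)" if "x \<in> carrier M" "y \<in> carrier N"
  using tensor_lift(2)[OF TT P b that] fun_cong[OF e, of "mn x y"] by simp
qed

lemma tensor_bimodule: "bimodule K R T MN"
proof -
 note TT = bm_tensorable
 note MNm = tensor_module[OF TT]
 note S = tensor_lmult tensor_rmult tens_closed[OF TT] lin_closed[OF tensor_lmult_lin]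
  lin_closed[OF tensor_rmult_lin] lin_add[OF tensor_lmult_lin] lin_add[OF tensor_rmult_lin]
  lin_smult[OF tensor_lmult_lin] lin_smult[OF tensor_rmult_lin] MNm bm_alg[OF M] bm_alg[OF N]
  bm_lcl[OF M] bm_rcl[OF N]
 have c1: "lin K R MN (%r. lmult MN r u)" if "u \<in> carrier MN" for u
  using that
 proof (induction rule: tensor_induct[OF TT, consumes 1, case_names gen add])
  case (gen x y)
  show ?case
   by (rule lin_cong[OF lin_comp[OF bm_la[OF M gen(1)] tens_lin1[OF TT gen(2)]]])
     (simp_all add: S gen)
 next
  case (add u v)
  show ?case by (rule lin_cong[OF lin_fun_add[OF MNm add(3,4)]]) (simp_all add: S add)
 qed
 have c2: "lin K T MN (rmult MN u)" if "u \<in> carrier MN" for u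
  using that
 proof (induction rule: tensor_induct[OF TT, consumes 1, case_names gen add])
  case (gen x y)
  show ?case
   by (rule lin_cong[OF lin_comp[OF bm_ra[OF N gen(2)] tens_lin2[OF TT gen(1)]]])
     (simp_all add: S gen)
 next
  case (add u v)
  show ?case by (rule lin_cong[OF lin_fun_add[OF MNm add(3,4)]]) (simp_all add: S add)
 qed
 show ?thesis
 proof (rule bmI)
  fix r r' u assume r: "r \<in> carrier R" "r' \<in> carrier R" and u: "u \<in> carrier MN"
  show "lmult MN (r \<otimes>[R] r') u = lmult MN r (lmult MN r' u)"
   using u by (induction rule: tensor_induct[OF TT, consumes 1, case_names gen add])
    (simp_all add: S r bm_lassoc[OF M])
 next
  fix r r' u assume r: "r \<in> carrier T" "r' \<in> carrier T" and u: "u \<in> carrier MN"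
  show "rmult MN u (r \<otimes>[T] r') = rmult MN (rmult MN u r) r'"
   using u by (induction rule: tensor_induct[OF TT, consumes 1, case_names gen add])
    (simp_all add: S r bm_rassoc[OF N])
 next
  fix u assume u: "u \<in> carrier MN"
  show "lmult MN \<one>[R] u = u" "rmult MN u \<one>[T] = u"
   using u by (induction rule: tensor_induct[OF TT, consumes 1, case_names gen add])
    (simp_all add: S bm_lone[OF M] bm_rone[OF N])
 next
  fix r t u assume r: "r \<in> carrier R" "t \<in> carrier T" and u: "u \<in> carrier MN"
  show "rmult MN (lmult MN r u) t = lmult MN r (rmult MN u t)"
   using u by (induction rule: tensor_induct[OF TT, consumes 1, case_names gen add])
    (simp_all add: S r)
 qed (simp_all add: S c1 c2 tensor_lmult_lin tensor_rmult_lin)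
qed

end
end

subsection \<open>Tensor powers\<close>

definition powable :: "('k, 'x) ring_scheme => ('s, 'w) partial_object_scheme
  => ('k, 's, 's, 'v) bimodule => bool" where
 "powable K S W \<longleftrightarrow> module K W
   \<and> (\<forall>x\<in>carrier W. \<forall>s\<in>carrier S. rmult W x s \<in> carrier W \<and> lmult W s x \<in> carrier W)"

definition multilin :: "('k, 'x) ring_scheme => ('s, 'w) partial_object_scheme
  => ('k, 's, 's, 'v) bimodule => nat => ('k, 'u, 'y) module_scheme => ('v list => 'u) => bool" where
 "multilin K S W n V \<phi> \<longleftrightarrow>
   (\<forall>ws. set ws <= carrier W \<and> length ws = n \<longrightarrow> \<phi> ws \<in> carrier V)
   \<and> (\<forall>us vs. set us <= carrier W \<and> set vs <= carrier W \<and> length us + length vs + 1 = n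
     \<longrightarrow> lin K W V (%w. \<phi> (us @ w # vs)))
   \<and> (\<forall>us vs v s w. set us <= carrier W \<and> set vs <= carrier W \<and> length us + length vs + 2 = n
     \<and> v \<in> carrier W \<and> s \<in> carrier S \<and> w \<in> carrier W
     \<longrightarrow> \<phi> (us @ rmult W v s # w # vs) = \<phi> (us @ v # lmult W s w # vs))"

lemma multilinI:
 assumes "!!ws. set ws <= carrier W ==> length ws = n ==> \<phi> ws \<in> carrier V"
  and "!!us vs. set us <= carrier W ==> set vs <= carrier W ==> length us + length vs + 1 = n
     ==> lin K W V (%w. \<phi> (us @ w # vs))"
  and "!!us vs v s w. set us <= carrier W ==> set vs <= carrier W ==> length us + length vs + 2 = n
     ==> v \<in> carrier W ==> s \<in> carrier S ==> w \<in> carrier W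
     ==> \<phi> (us @ rmult W v s # w # vs) = \<phi> (us @ v # lmult W s w # vs)"
 shows "multilin K S W n V \<phi>"
 using assms by (simp add: multilin_def)

lemma multilinD:
 assumes "multilin K S W n V \<phi>"
 shows "set ws <= carrier W ==> length ws = n ==> \<phi> ws \<in> carrier V"
  and "set us <= carrier W ==> set vs <= carrier W ==> length us + length vs + 1 = n
     ==> lin K W V (%w. \<phi> (us @ w # vs))"
  and "set us <= carrier W ==> set vs <= carrier W ==> length us + length vs + 2 = n
     ==> v \<in> carrier W ==> s \<in> carrier S ==> w \<in> carrier W
     ==> \<phi> (us @ rmult W v s # w # vs) = \<phi> (us @ v # lmult W s w # vs)"
 using assms by (simp_all add: multilin_def)

lemma multilin_comp: "multilin K S W n V \<phi> ==> lin K V U f ==> multilin K S W n U (%ws. f (\<phi> ws))"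
 by (intro multilinI) (auto intro: lin_closed multilinD lin_comp[OF multilinD(2)] simp: multilinD(3))


context fld
begin

context
 fixes S :: "('s, 'w) partial_object_scheme" and W :: "('k, 's, 's, 'v) bimodule" and n :: nat
 assumes Wp: "powable K S W"
begin

abbreviation (input) "tw \<equiv> {ws. set ws <= carrier W \<and> length ws = n}"

lemma powableD: "module K W" "x \<in> carrier W ==> s \<in> carrier S ==> rmult W x s \<in> carrier W"
  "x \<in> carrier W ==> s \<in> carrier S ==> lmult W s x \<in> carrier W"
 using Wp by (auto simp: powable_def)

text \<open>The side conditions of the relations are spelled out letter by letter, the form in which
  \<open>multilinD\<close> provides them to the simplifier.\<close>

lemma tpow_rels_eq: "tpow_rels K S W n =
  (let F = free_mod (ground K) tw; \<delta> = (%ws. single (ground K) ws \<one>)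
   in {\<delta> (us @ (v \<oplus>[W] w) # vs) \<ominus>[F] (\<delta> (us @ v # vs) \<oplus>[F] \<delta> (us @ w # vs)) |us v w vs.
      set us <= carrier W \<and> v \<in> carrier W \<and> w \<in> carrier W \<and> set vs <= carrier W \<and> length us + length vs + 1 = n}
   \<union> {\<delta> (us @ (c \<odot>[W] v) # vs) \<ominus>[F] (c \<odot>[F] \<delta> (us @ v # vs)) |us c v vs. c \<in> carrier K \<and>
      set us <= carrier W \<and> v \<in> carrier W \<and> set vs <= carrier W \<and> length us + length vs + 1 = n}
   \<union> {\<delta> (us @ rmult W v s # w # vs) \<ominus>[F] \<delta> (us @ v # lmult W s w # vs) |us v s w vs. s \<in> carrier S \<and>
      set us <= carrier W \<and> v \<in> carrier W \<and> w \<in> carrier W \<and> set vs <= carrier W \<and> length us + length vs + 2 = n})"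
 unfolding tpow_rels_def Let_def
 by (intro arg_cong2[where f="(\<union>)"] Collect_cong ex_cong1) auto

lemma tpow_rels_free: "tpow_rels K S W n <= carrier (free_mod (ground K) tw)"
proof -
 let ?F = "free_mod (ground K) tw"
 have F: "module K ?F" by simp
 have s: "single (ground K) ws \<one> \<in> carrier ?F" if "set ws <= carrier W" "length ws = n" for ws
  using that by simp
 show ?thesis
  unfolding tpow_rels_eq Let_def
  using powableD by (auto intro!: v_minus[OF F] v_add[OF F] v_smult[OF F] s simp del: free_mod_simps)
qed

lemma tpow_module: "module K (tpow K S W n)"
 by (simp add: tpow_def Let_def pres_module[OF tpow_rels_free])

lemma tpow_lift:
 assumes V: "module K V" and \<phi>: "multilin K S W n V \<phi>"
 shows "lin K (tpow K S W n) V (plift K V \<phi>)"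
  and "set ws <= carrier W ==> length ws = n ==> plift K V \<phi> (tpgen K S W n ws) = \<phi> ws"
proof -
 let ?F = "free_mod (ground K) tw"
 let ?d = "%ws. single (ground K) ws \<one>"
 have F: "module K ?F" by simp
 have s: "?d ws \<in> carrier ?F" if "set ws <= carrier W" "length ws = n" for ws
  using that by simp
 have rel: "\<forall>r\<in>tpow_rels K S W n. f r = \<zero>[V]" if f: "lin K ?F V f"
  and fs: "!!g. g \<in> tw ==> f (single (ground K) g \<one>) = \<phi> g" for f
 proof
  have fs': "f (?d ws) = \<phi> ws" if "set ws <= carrier W" "length ws = n" for ws using that fs by auto
  note S = lin_minus[OF f F V] lin_add[OF f] lin_smult[OF f] fs' s v_add[OF F] v_smult[OF F] V
   multilinD(1)[OF \<phi>] lin_add[OF multilinD(2)[OF \<phi>]] lin_smult[OF multilinD(2)[OF \<phi>]] multilinD(3)[OF \<phi>] powableD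
  fix r assume r: "r \<in> tpow_rels K S W n"
  show "f r = \<zero>[V]"
   using r unfolding tpow_rels_eq Let_def
   by (elim UnE CollectE exE conjE) (simp_all add: S del: free_mod_simps single_closed)
 qed
 have c: "!!g. g \<in> tw ==> \<phi> g \<in> carrier V" using multilinD(1)[OF \<phi>] by auto
 note L = plift[OF tpow_rels_free V c rel]
 show "lin K (tpow K S W n) V (plift K V \<phi>)"
  unfolding tpow_def Let_def lin_extend1 by (rule L(1)) auto
 show "plift K V \<phi> (tpgen K S W n ws) = \<phi> ws" if "set ws <= carrier W" "length ws = n"
  unfolding tpgen_def by (rule L(2)) (use that in auto)
qed

lemma tpgen_closed:
 "set ws <= carrier W ==> length ws = n ==> tpgen K S W n ws \<in> carrier (tpow K S W n)"
 using pgen_closed[OF tpow_rels_free] by (simp add: tpow_def tpgen_def Let_def)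

lemma tpgen_multilin: "multilin K S W n (tpow K S W n) (tpgen K S W n)"
proof -
 let ?F = "free_mod (ground K) tw"
 let ?P = "presented K tw (tpow_rels K S W n)"
 let ?d = "%ws. single (ground K) ws \<one>"
 let ?p = "%f. subspan K ?F (tpow_rels K S W n) +>[?F] f"
 have F: "module K ?F" by simp
 note P = pres_module[OF tpow_rels_free]
 note L = pres_proj_lin[OF tpow_rels_free]
 have s: "?d ws \<in> carrier ?F" if "set ws <= carrier W" "length ws = n" for ws
  using that by simp
 have d: "!!ws. ?p (?d ws) = tpgen K S W n ws" by (simp add: tpgen_def pgen_def)
 note cl = tpgen_closed[unfolded tpow_def Let_def module_extend_simps]
 have eq: "?p u = ?p v" if "u \<ominus>[?F] v \<in> tpow_rels K S W n" "u \<in> carrier ?F" "v \<in> carrier ?F" for u v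
  using pres_rel[OF tpow_rels_free that(1)] lin_minus[OF L F P that(2,3)]
   lin_closed[OF L that(2)] lin_closed[OF L that(3)] P by (simp add: v_minus_eq_zero del: free_mod_simps)
 note S = lin_add[OF L] lin_smult[OF L] d s v_add[OF F] v_smult[OF F] powableD
 have a1: "tpgen K S W n (us @ (v \<oplus>[W] w) # vs) = tpgen K S W n (us @ v # vs) \<oplus>[?P] tpgen K S W n (us @ w # vs)"
  if "set us <= carrier W" "v \<in> carrier W" "w \<in> carrier W" "set vs <= carrier W" "length us + length vs + 1 = n"
  for us v w vs
  using eq[of "?d (us @ (v \<oplus>[W] w) # vs)" "?d (us @ v # vs) \<oplus>[?F] ?d (us @ w # vs)"] that
  by (simp add: S del: free_mod_simps single_closed) (use that in \<open>unfold tpow_rels_eq Let_def, blast\<close>)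
 have a2: "tpgen K S W n (us @ (c \<odot>[W] v) # vs) = c \<odot>[?P] tpgen K S W n (us @ v # vs)"
  if "c \<in> carrier K" "set us <= carrier W" "v \<in> carrier W" "set vs <= carrier W" "length us + length vs + 1 = n"
  for us c v vs
  using eq[of "?d (us @ (c \<odot>[W] v) # vs)" "c \<odot>[?F] ?d (us @ v # vs)"] that
  by (simp add: S del: free_mod_simps single_closed) (use that in \<open>unfold tpow_rels_eq Let_def, blast\<close>)
 have a3: "tpgen K S W n (us @ rmult W v s # w # vs) = tpgen K S W n (us @ v # lmult W s w # vs)"
  if "set us <= carrier W" "v \<in> carrier W" "s \<in> carrier S" "w \<in> carrier W" "set vs <= carrier W"
   "length us + length vs + 2 = n" for us v s w vs
  using eq[of "?d (us @ rmult W v s # w # vs)" "?d (us @ v # lmult W s w # vs)"] that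
  by (simp add: S del: free_mod_simps single_closed) (use that in \<open>unfold tpow_rels_eq Let_def, blast\<close>)
 show ?thesis
 proof (rule multilinI)
  fix us vs assume uv: "set us <= carrier W" "set vs <= carrier W" "length us + length vs + 1 = n"
  show "lin K W (tpow K S W n) (%w. tpgen K S W n (us @ w # vs))"
   by (rule linI) (use uv a1 a2 cl in \<open>simp_all add: tpow_def Let_def\<close>)
 qed (rule tpgen_closed a3; assumption)+
qed

lemmas tpgen_lin = multilinD(2)[OF tpgen_multilin]
 and tpgen_balance = multilinD(3)[OF tpgen_multilin]

text \<open>\<open>n > 0\<close> supplies a first letter that absorbs scalars and zero, as in a
  tensor product; the zeroth power consists of multiples of the empty word.\<close>

lemma tpow_induct [consumes 2, case_names gen add]:
 assumes U: "U \<in> carrier (tpow K S W n)" and n: "n > 0"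
  and gen: "!!ws. set ws <= carrier W ==> length ws = n ==> P (tpgen K S W n ws)"
  and add: "!!u v. u \<in> carrier (tpow K S W n) ==> v \<in> carrier (tpow K S W n) ==> P u ==> P v
   ==> P (u \<oplus>[tpow K S W n] v)"
 shows "P U"
proof -
 let ?P = "presented K tw (tpow_rels K S W n)"
 let ?T = "tpow K S W n"
 have car: "carrier ?P = carrier ?T" "\<zero>[?P] = \<zero>[?T]"
  "!!u v. u \<oplus>[?P] v = u \<oplus>[?T] v" "!!c v. c \<odot>[?P] v = c \<odot>[?T] v"
  by (simp_all add: tpow_def Let_def)
 note T = tpow_module
 have "U \<in> carrier ?P" using U car by simp
 then have "\<forall>c\<in>carrier K. P (c \<odot>[?T] U)"
 proof (induction rule: pres_induct[OF tpow_rels_free, consumes 1, case_names gen zero add smult])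
  case (gen g)
  with n obtain w ws where g: "g = w # ws" "w \<in> carrier W" "set ws <= carrier W" "length ws + 1 = n"
   by (cases g) auto
  then show ?case
   using assms(3) powableD(1) lin_smult[OF tpgen_lin[of "[]" ws], symmetric]
   by (auto simp: tpgen_def[symmetric])
 next
  case zero
  let ?vs = "replicate (n - 1) \<zero>[W]"
  have vs: "set ?vs <= carrier W" "length [] + length ?vs + 1 = n" using n powableD(1) by auto
  have z: "\<zero>[?T] = tpgen K S W n (\<zero>[W] # ?vs)"
   using lin_zero[OF tpgen_lin[OF _ vs] powableD(1) T] by simp
  have "P \<zero>[?T]" unfolding z using vs powableD(1) by (intro assms(3)) simp_all
  then show ?case using T by (simp add: car)
 next
  case (add u v)
  then show ?case using T assms(4) by (simp add: car v_smult_r_distr)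
 next
  case (smult c u)
  then show ?case using T by (simp add: car v_smult_assoc[symmetric])
 qed
 then have "P (\<one> \<odot>[?T] U)" by blast
 then show ?thesis using U T by simp
qed

lemma tpow_lin_eq:
 assumes f: "lin K (tpow K S W n) V f" and h: "lin K (tpow K S W n) V h" and n: "n > 0"
  and gen: "!!ws. set ws <= carrier W ==> length ws = n ==> f (tpgen K S W n ws) = h (tpgen K S W n ws)"
  and U: "U \<in> carrier (tpow K S W n)"
 shows "f U = h U"
 using U n by (induction rule: tpow_induct) (simp_all add: gen lin_add[OF f] lin_add[OF h])

text \<open>A map that commutes with the right action does not disturb the balancing between the
  first two letters. The left action on a tensor power is of this kind.\<close>

lemma multilin_hd:
 assumes \<phi>: "multilin K S W n V \<phi>" and g: "lin K W W g" and n: "n > 0"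
  and gs: "!!x s. x \<in> carrier W ==> s \<in> carrier S ==> g (rmult W x s) = rmult W (g x) s"
 shows "multilin K S W n V (%ws. \<phi> (g (hd ws) # tl ws))"
proof (rule multilinI)
 fix ws :: "'v list" assume "set ws <= carrier W" "length ws = n"
 with n show "\<phi> (g (hd ws) # tl ws) \<in> carrier V"
  by (cases ws) (auto intro!: multilinD(1)[OF \<phi>] lin_closed[OF g])
next
 fix us vs assume uv: "set us <= carrier W" "set vs <= carrier W" "length us + length vs + 1 = n"
 show "lin K W V (%w. \<phi> (g (hd (us @ w # vs)) # tl (us @ w # vs)))"
 proof (cases us)
  case Nil
  then show ?thesis using uv lin_comp[OF g multilinD(2)[OF \<phi>, of "[]" vs]] by simp
 next
  case (Cons u us')
  then show ?thesis using uv multilinD(2)[OF \<phi>, of "g u # us'" vs] lin_closed[OF g] by simp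
 qed
next
 fix us vs v s w assume uv: "set us <= carrier W" "set vs <= carrier W" "length us + length vs + 2 = n"
  and *: "v \<in> carrier W" "s \<in> carrier S" "w \<in> carrier W"
 show "\<phi> (g (hd (us @ rmult W v s # w # vs)) # tl (us @ rmult W v s # w # vs))
   = \<phi> (g (hd (us @ v # lmult W s w # vs)) # tl (us @ v # lmult W s w # vs))"
 proof (cases us)
  case Nil
  then show ?thesis using uv * multilinD(3)[OF \<phi>, of "[]" vs "g v" s w] lin_closed[OF g] by (simp add: gs)
 next
  case (Cons u us')
  then show ?thesis using uv * multilinD(3)[OF \<phi>, of "g u # us'" vs] lin_closed[OF g] by simp
 qed
qed

lemma multilin_last:
 assumes \<phi>: "multilin K S W n V \<phi>" and g: "lin K W W g" and n: "n > 0"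
  and gs: "!!x s. x \<in> carrier W ==> s \<in> carrier S ==> g (lmult W s x) = lmult W s (g x)"
 shows "multilin K S W n V (%ws. \<phi> (butlast ws @ [g (last ws)]))"
proof (rule multilinI)
 fix ws :: "'v list" assume "set ws <= carrier W" "length ws = n"
 with n show "\<phi> (butlast ws @ [g (last ws)]) \<in> carrier V"
  by (cases ws rule: rev_cases) (auto intro!: multilinD(1)[OF \<phi>] lin_closed[OF g])
next
 fix us vs assume uv: "set us <= carrier W" "set vs <= carrier W" "length us + length vs + 1 = n"
 show "lin K W V (%w. \<phi> (butlast (us @ w # vs) @ [g (last (us @ w # vs))]))"
 proof (cases vs rule: rev_cases)
  case Nil
  then show ?thesis using uv lin_comp[OF g multilinD(2)[OF \<phi>, of us "[]"]] by (simp add: butlast_append)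
 next
  case (snoc vs' v)
  then show ?thesis using uv multilinD(2)[OF \<phi>, of us "vs' @ [g v]"] lin_closed[OF g] by (simp add: butlast_append)
 qed
next
 fix us vs v s w assume uv: "set us <= carrier W" "set vs <= carrier W" "length us + length vs + 2 = n"
  and *: "v \<in> carrier W" "s \<in> carrier S" "w \<in> carrier W"
 show "\<phi> (butlast (us @ rmult W v s # w # vs) @ [g (last (us @ rmult W v s # w # vs))])
   = \<phi> (butlast (us @ v # lmult W s w # vs) @ [g (last (us @ v # lmult W s w # vs))])"
 proof (cases vs rule: rev_cases)
  case Nil
  then show ?thesis using uv * multilinD(3)[OF \<phi>, of us "[]" v s "g w"] lin_closed[OF g] by (simp add: gs butlast_append)
 next
  case (snoc vs' z)
  then show ?thesis using uv * multilinD(3)[OF \<phi>, of us "vs' @ [g z]"] lin_closed[OF g] by (simp add: butlast_append)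
 qed
qed

end

context
 fixes S :: "('k, 's, 'z) module_scheme" and W :: "('k, 's, 's, 'v) bimodule" and n :: nat
 assumes W: "bimodule K S S W" and n: "n > 0"
begin

lemma bm_powable: "powable K S W"
 using W by (auto simp: powable_def)

abbreviation (input) "WT \<equiv> tpow K S W n"
abbreviation (input) "wt \<equiv> tpgen K S W n"

lemma tpow_lmult_lin: "s \<in> carrier S ==> lin K WT WT (lmult WT s)"
 and tpow_lmult: "s \<in> carrier S ==> set (w # ws) <= carrier W ==> length (w # ws) = n
  ==> lmult WT s (wt (w # ws)) = wt (lmult W s w # ws)"
proof -
 let ?P = "presented K {ws. set ws <= carrier W \<and> length ws = n} (tpow_rels K S W n)"
 have P: "module K ?P" by (rule pres_module[OF tpow_rels_free[OF bm_powable]])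
 assume s: "s \<in> carrier S"
 have "multilin K S W n WT (%ws. wt (lmult W s (hd ws) # tl ws))"
  by (rule multilin_hd[OF bm_powable tpgen_multilin[OF bm_powable] bm_l[OF W s] n]) (simp add: bm_lr[OF W] s)
 then have b: "multilin K S W n ?P (%ws. wt (lmult W s (hd ws) # tl ws))"
  by (simp add: multilin_def tpow_def Let_def)
 have e: "lmult WT s = plift K ?P (%ws. wt (lmult W s (hd ws) # tl ws))" by (simp add: tpow_def Let_def)
 show "lin K WT WT (lmult WT s)"
  using tpow_lift(1)[OF bm_powable P b] unfolding e by (simp add: tpow_def Let_def)
 show "lmult WT s (wt (w # ws)) = wt (lmult W s w # ws)" if "set (w # ws) <= carrier W" "length (w # ws) = n"
  using tpow_lift(2)[OF bm_powable P b that] unfolding e by simp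
qed

lemma tpow_rmult_lin: "s \<in> carrier S ==> lin K WT WT (%u. rmult WT u s)"
 and tpow_rmult: "s \<in> carrier S ==> set (ws @ [w]) <= carrier W ==> length (ws @ [w]) = n
  ==> rmult WT (wt (ws @ [w])) s = wt (ws @ [rmult W w s])"
proof -
 let ?P = "presented K {ws. set ws <= carrier W \<and> length ws = n} (tpow_rels K S W n)"
 have P: "module K ?P" by (rule pres_module[OF tpow_rels_free[OF bm_powable]])
 assume s: "s \<in> carrier S"
 have "multilin K S W n WT (%ws. wt (butlast ws @ [rmult W (last ws) s]))"
  by (rule multilin_last[OF bm_powable tpgen_multilin[OF bm_powable] bm_r[OF W s] n]) (simp add: bm_lr[OF W] s)
 then have b: "multilin K S W n ?P (%ws. wt (butlast ws @ [rmult W (last ws) s]))"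
  by (simp add: multilin_def tpow_def Let_def)
 have e: "(%u. rmult WT u s) = plift K ?P (%ws. wt (butlast ws @ [rmult W (last ws) s]))"
  by (simp add: tpow_def Let_def fun_eq_iff)
 show "lin K WT WT (%u. rmult WT u s)"
  using tpow_lift(1)[OF bm_powable P b] unfolding e by (simp add: tpow_def Let_def)
 show "rmult WT (wt (ws @ [w])) s = wt (ws @ [rmult W w s])" if "set (ws @ [w]) <= carrier W" "length (ws @ [w]) = n"
  using tpow_lift(2)[OF bm_powable P b that] fun_cong[OF e, of "wt (ws @ [w])"] by simp
qed

lemma tpow_bimodule: "bimodule K S S WT"
proof -
 note TT = bm_powable
 note Tm = tpow_module[OF TT, of n]
 note S = tpgen_closed[OF TT] lin_closed[OF tpow_lmult_lin] n
  lin_closed[OF tpow_rmult_lin] lin_add[OF tpow_lmult_lin] lin_add[OF tpow_rmult_lin]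
  lin_smult[OF tpow_lmult_lin] lin_smult[OF tpow_rmult_lin] Tm bm_alg[OF W]
  bm_lcl[OF W] bm_rcl[OF W]
 note ind = tpow_induct[OF TT, consumes 2, case_names gen add]
 have ind1: "P u" if u: "u \<in> carrier WT"
  and gen: "!!w ws. w \<in> carrier W ==> set ws <= carrier W ==> Suc (length ws) = n ==> P (wt (w # ws))"
  and add: "!!u v. u \<in> carrier WT ==> v \<in> carrier WT ==> P u ==> P v ==> P (u \<oplus>[WT] v)" for P u
  using u n
 proof (induction rule: ind)
  case (gen ws)
  with n that(2) show ?case by (cases ws) auto
 qed (rule that(3))
 have ind2: "P u" if u: "u \<in> carrier WT"
  and gen: "!!w ws. w \<in> carrier W ==> set ws <= carrier W ==> Suc (length ws) = n ==> P (wt (ws @ [w]))"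
  and add: "!!u v. u \<in> carrier WT ==> v \<in> carrier WT ==> P u ==> P v ==> P (u \<oplus>[WT] v)" for P u
  using u n
 proof (induction rule: ind)
  case (gen ws)
  with n that(2) show ?case by (cases ws rule: rev_cases) auto
 qed (rule that(3))
 have c1: "lin K S WT (%r. lmult WT r u)" if "u \<in> carrier WT" for u
  using that
 proof (rule ind1)
  fix w ws assume 1: "w \<in> carrier W" "set ws <= carrier W" "Suc (length ws) = n"
  have "lin K W WT (%w. wt (w # ws))" using tpgen_lin[OF TT, of "[]" ws n] 1 by simp
  then show "lin K S WT (%r. lmult WT r (wt (w # ws)))"
   by (rule lin_cong[OF lin_comp[OF bm_la[OF W 1(1)]]]) (use 1 in \<open>simp_all add: S tpow_lmult\<close>)
 next
  fix u v assume 2: "u \<in> carrier WT" "v \<in> carrier WT" "lin K S WT (%r. lmult WT r u)" "lin K S WT (%r. lmult WT r v)"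
  show "lin K S WT (%r. lmult WT r (u \<oplus>[WT] v))" by (rule lin_cong[OF lin_fun_add[OF Tm 2(3,4)]]) (simp_all add: S 2)
 qed
 have c2: "lin K S WT (rmult WT u)" if "u \<in> carrier WT" for u
  using that
 proof (rule ind2)
  fix w ws assume 1: "w \<in> carrier W" "set ws <= carrier W" "Suc (length ws) = n"
  have "lin K W WT (%w. wt (ws @ [w]))" using tpgen_lin[OF TT, of ws "[]" n] 1 by simp
  then show "lin K S WT (rmult WT (wt (ws @ [w])))"
   by (rule lin_cong[OF lin_comp[OF bm_ra[OF W 1(1)]]]) (use 1 in \<open>simp_all add: S tpow_rmult\<close>)
 next
  fix u v assume 2: "u \<in> carrier WT" "v \<in> carrier WT" "lin K S WT (rmult WT u)" "lin K S WT (rmult WT v)"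
  show "lin K S WT (rmult WT (u \<oplus>[WT] v))" by (rule lin_cong[OF lin_fun_add[OF Tm 2(3,4)]]) (simp_all add: S 2)
 qed
 show ?thesis
 proof (rule bmI)
  fix r r' u assume r: "r \<in> carrier S" "r' \<in> carrier S" and u: "u \<in> carrier WT"
  show "lmult WT (r \<otimes>[S] r') u = lmult WT r (lmult WT r' u)"
   using u by (rule ind1) (simp_all add: S r tpow_lmult bm_lassoc[OF W])
  show "rmult WT u (r \<otimes>[S] r') = rmult WT (rmult WT u r) r'"
   using u by (rule ind2) (simp_all add: S r tpow_rmult bm_rassoc[OF W])
 next
  fix u assume u: "u \<in> carrier WT"
  show "lmult WT \<one>[S] u = u"
   using u by (rule ind1) (simp_all add: S tpow_lmult bm_lone[OF W])
  show "rmult WT u \<one>[S] = u"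
   using u by (rule ind2) (simp_all add: S tpow_rmult bm_rone[OF W])
 next
  fix r t u assume r: "r \<in> carrier S" "t \<in> carrier S" and u: "u \<in> carrier WT"
  show "rmult WT (lmult WT r u) t = lmult WT r (rmult WT u t)"
   using u
  proof (rule ind2)
   fix w ws assume w: "w \<in> carrier W" "set ws <= carrier W" "Suc (length ws) = n"
   then show "rmult WT (lmult WT r (wt (ws @ [w]))) t = lmult WT r (rmult WT (wt (ws @ [w])) t)"
   \<comment> \<open>On a single letter the two actions meet and commute there; otherwise they touch
     different letters.\<close>
   proof (cases ws)
    case Nil
    then show ?thesis
     using w r tpow_lmult[of r w "[]"] tpow_lmult[of r "rmult W w t" "[]"] tpow_rmult[of t "[]" w]
      tpow_rmult[of t "[]" "lmult W r w"] by (simp add: S bm_lr[OF W])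
   next
    case (Cons v vs)
    then show ?thesis
     using w r tpow_lmult[of r v "vs @ [w]"] tpow_lmult[of r v "vs @ [rmult W w t]"]
      tpow_rmult[of t "v # vs" w] tpow_rmult[of t "lmult W r v # vs" w] by (simp add: S)
   qed
  qed (simp add: S r)
 qed (simp_all add: S c1 c2 tpow_lmult_lin tpow_rmult_lin)
qed

end
end

context fld
begin

subsection \<open>Enveloping algebras\<close>


lemma kbimod_tensorable [simp]: "module K A ==> module K B ==> tensorable K K (kbimod A) (kbimod B)"
 by (simp add: tensorable_def)

lemma balanced_kI:
 assumes "!!x. x \<in> carrier A ==> lin K B V (\<phi> x)" "!!y. y \<in> carrier B ==> lin K A V (%x. \<phi> x y)"
 shows "balanced K K (kbimod A) (kbimod B) V \<phi>"
 by (rule balancedI) (simp_all add: assms lin_smult[OF assms(1)] lin_smult[OF assms(2)])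

context
 fixes R :: "('k, 'r) module" and S :: "('k, 's) module"
 assumes R: "k_algebra K R" and S: "k_algebra K S"
begin

abbreviation (input) "TE \<equiv> tensor K K (kbimod R) (kbimod (opp_alg S))"
abbreviation (input) "et \<equiv> tens K K (kbimod R) (kbimod (opp_alg S))"
abbreviation (input) "EE \<equiv> env K R S"

lemma te: "tensorable K K (kbimod R) (kbimod (opp_alg S))"
 using R S by simp

lemma env_simps: "carrier EE = carrier TE" "\<zero>[EE] = \<zero>[TE]" "x \<oplus>[EE] y = x \<oplus>[TE] y"
  "c \<odot>[EE] x = c \<odot>[TE] x" "\<one>[EE] = et \<one>[R] \<one>[S]"
 by (simp_all add: env_def alg_tensor_def Let_def)

lemma env_module [simp]: "module K EE"
 by (rule module_cong[OF tensor_module[OF te]]) (simp_all add: env_simps fun_eq_iff)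

lemma env_lin: "lin K EE V f = lin K TE V f" "lin K V' EE g = lin K V' TE g"
 by (simp_all add: lin_def env_simps)

lemma et_closed [simp]: "r \<in> carrier R ==> s \<in> carrier S ==> et r s \<in> carrier EE"
 using tens_closed[OF te] by (simp add: env_simps)

lemma et_lin1: "s \<in> carrier S ==> lin K R EE (%r. et r s)"
 and et_lin2: "r \<in> carrier R ==> lin K S EE (et r)"
 using tens_lin1[OF te, of s] tens_lin2[OF te, of r] by (simp_all add: env_lin) (simp add: lin_def)

lemma env_induct [consumes 1, case_names gen add]:
 assumes "U \<in> carrier EE" "!!r s. r \<in> carrier R ==> s \<in> carrier S ==> P (et r s)"
  "!!u v. u \<in> carrier EE ==> v \<in> carrier EE ==> P u ==> P v ==> P (u \<oplus>[EE] v)"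
 shows "P U"
 using assms unfolding env_simps
 by (induction rule: tensor_induct[OF te, consumes 1, case_names gen add]) auto

lemma env_lift:
 assumes V: "module K V" and "!!r. r \<in> carrier R ==> lin K S V (\<phi> r)"
  "!!s. s \<in> carrier S ==> lin K R V (%r. \<phi> r s)"
 shows "lin K EE V (plift K V (%(r, s). \<phi> r s))"
  and "r \<in> carrier R ==> s \<in> carrier S ==> plift K V (%(r, s). \<phi> r s) (et r s) = \<phi> r s"
proof -
 have b: "balanced K K (kbimod R) (kbimod (opp_alg S)) V \<phi>"
  using assms(2,3) by (intro balanced_kI) (simp_all add: lin_def)
 show "lin K EE V (plift K V (%(r, s). \<phi> r s))"
  using tensor_lift(1)[OF te V b] by (simp add: env_lin)
 show "r \<in> carrier R ==> s \<in> carrier S ==> plift K V (%(r, s). \<phi> r s) (et r s) = \<phi> r s"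
  using tensor_lift(2)[OF te V b] by simp
qed

text \<open>The product of the enveloping algebra is a \<open>plift\<close> inside a
  \<open>plift\<close>. The inner one, with a pure left factor, comes first; its linearity in the
  two entries of that factor then permits the outer lift.\<close>

lemma env_inner:
 assumes r: "r \<in> carrier R" and s: "s \<in> carrier S"
 shows "lin K EE EE (plift K TE (%(a', b'). et (r \<otimes>[R] a') (b' \<otimes>[S] s)))"
  and "r' \<in> carrier R ==> s' \<in> carrier S
   ==> plift K TE (%(a', b'). et (r \<otimes>[R] a') (b' \<otimes>[S] s)) (et r' s') = et (r \<otimes>[R] r') (s' \<otimes>[S] s)"
proof -
 have V: "module K TE" using tensor_module[OF te] .
 have 1: "lin K S TE (%b'. et (r \<otimes>[R] a') (b' \<otimes>[S] s))" if "a' \<in> carrier R" for a'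
  using lin_comp[OF alg_lin1[OF S s] et_lin2[unfolded env_lin]] R r that by simp
 have 2: "lin K R TE (%a'. et (r \<otimes>[R] a') (b' \<otimes>[S] s))" if "b' \<in> carrier S" for b'
  using lin_comp[OF alg_lin2[OF R r] et_lin1[unfolded env_lin]] S s that by simp
 show "lin K EE EE (plift K TE (%(a', b'). et (r \<otimes>[R] a') (b' \<otimes>[S] s)))"
  using env_lift(1)[OF V 1 2] by (simp add: env_lin)
 show "plift K TE (%(a', b'). et (r \<otimes>[R] a') (b' \<otimes>[S] s)) (et r' s') = et (r \<otimes>[R] r') (s' \<otimes>[S] s)"
  if "r' \<in> carrier R" "s' \<in> carrier S"
  using env_lift(2)[OF V 1 2 that] .
qed

lemma env_mult_def: "U \<otimes>[EE] U' = plift K TE (%(a, b). plift K TE (%(a', b'). et (a \<otimes>[R] a') (b' \<otimes>[S] b)) U') U"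
 by (simp add: env_def alg_tensor_def Let_def opp_alg_def)

lemma env_outer:
 assumes U': "U' \<in> carrier EE"
 shows "lin K EE EE (%U. U \<otimes>[EE] U')"
  and "r \<in> carrier R ==> s \<in> carrier S
   ==> et r s \<otimes>[EE] U' = plift K TE (%(a', b'). et (r \<otimes>[R] a') (b' \<otimes>[S] s)) U'"
proof -
 have V: "module K TE" using tensor_module[OF te] .
 have EV: "module K EE" by simp
 let ?i = "%r s. plift K TE (%(a', b'). et (r \<otimes>[R] a') (b' \<otimes>[S] s))"
 have "lin K S EE (%s. ?i r s U')" if r: "r \<in> carrier R" for r
  using U'
 proof (induction rule: env_induct)
  case (gen a b)
  show ?case
   by (rule lin_cong[OF lin_comp[OF alg_lin2[OF S gen(2)] et_lin2]])
     (use gen r R S env_inner(2) in auto)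
 next
  case (add u v)
  show ?case
   by (rule lin_cong[OF lin_fun_add[OF EV add(3,4)]])
     (use add r S in \<open>auto simp: lin_add[OF env_inner(1)]\<close>)
 qed
 then have 1: "lin K S TE (%s. ?i r s U')" if r: "r \<in> carrier R" for r
  using that by (simp add: env_lin)
 have "lin K R EE (%r. ?i r s U')" if s: "s \<in> carrier S" for s
  using U'
 proof (induction rule: env_induct)
  case (gen a b)
  show ?case
   by (rule lin_cong[OF lin_comp[OF alg_lin1[OF R gen(1)] et_lin1]])
     (use gen s R S env_inner(2) in auto)
 next
  case (add u v)
  show ?case
   by (rule lin_cong[OF lin_fun_add[OF EV add(3,4)]])
     (use add s R in \<open>auto simp: lin_add[OF env_inner(1)]\<close>)
 qed
 then have 2: "lin K R TE (%r. ?i r s U')" if s: "s \<in> carrier S" for s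
  using that by (simp add: env_lin)
 show "lin K EE EE (%U. U \<otimes>[EE] U')"
  unfolding env_mult_def using env_lift(1)[OF V 1 2] by (simp add: env_lin)
 show "et r s \<otimes>[EE] U' = ?i r s U'" if "r \<in> carrier R" "s \<in> carrier S"
  unfolding env_mult_def using env_lift(2)[OF V 1 2 that] by simp
qed

lemma env_mult: "r \<in> carrier R ==> s \<in> carrier S ==> r' \<in> carrier R ==> s' \<in> carrier S
  ==> et r s \<otimes>[EE] et r' s' = et (r \<otimes>[R] r') (s' \<otimes>[S] s)"
 by (simp add: env_outer(2) env_inner(2))

lemma env_lin_l: "U' \<in> carrier EE ==> lin K EE EE (%U. U \<otimes>[EE] U')"
 by (rule env_outer)

lemma env_lin_r:
 assumes "U \<in> carrier EE"
 shows "lin K EE EE (%U'. U \<otimes>[EE] U')"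
 using assms
proof (induction rule: env_induct)
 case (gen r s)
 show ?case by (rule lin_cong[OF env_inner(1)[OF gen]]) (simp_all add: env_outer(2) gen)
next
 case (add u v)
 show ?case
  by (rule lin_cong[OF lin_fun_add[OF env_module add(3,4)]])
    (simp_all add: lin_add[OF env_lin_l] add)
qed

lemma env_algebra [simp]: "k_algebra K EE"
proof (rule algI)
 note cl = lin_closed[OF env_lin_l] and al = lin_add[OF env_lin_l] and ar = lin_add[OF env_lin_r]
 fix x assume x: "x \<in> carrier EE"
 show "\<one>[EE] \<otimes>[EE] x = x"
  using x by (induction rule: env_induct) (simp_all add: env_simps(5) env_mult R S ar)
 show "x \<otimes>[EE] \<one>[EE] = x"
  using x by (induction rule: env_induct) (simp_all add: env_simps(5) env_mult R S al)
 fix y z assume y: "y \<in> carrier EE" and z: "z \<in> carrier EE"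
 show "x \<otimes>[EE] y \<otimes>[EE] z = x \<otimes>[EE] (y \<otimes>[EE] z)"
  using x
 proof (induction rule: env_induct)
  case x: (gen r s)
  show ?case using y
  proof (induction rule: env_induct)
   case y: (gen r' s')
   show ?case using z x y
    by (induction rule: env_induct) (simp_all add: env_mult R S alg_assoc ar cl)
  qed (use z x in \<open>simp_all add: al ar cl\<close>)
 qed (use y z in \<open>simp_all add: al cl\<close>)
qed (simp_all add: env_lin_l env_lin_r, simp add: env_simps(5) R S tens_closed[OF te])

lemma env_ind_lin:
 assumes "lin K EE V f" "lin K EE V h" "!!r s. r \<in> carrier R ==> s \<in> carrier S ==> f (et r s) = h (et r s)"
  "U \<in> carrier EE"
 shows "f U = h U"
 using assms(4) by (induction rule: env_induct) (simp_all add: assms(3) lin_add[OF assms(1)] lin_add[OF assms(2)])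

context
 fixes V :: "('k, 's, 'r, 'v) bimodule"
 assumes V: "bimodule K S R V"
begin

lemma env_right_lin: "v \<in> carrier V ==> lin K EE V (rmult (env_right K V) v)"
 and env_right_et: "v \<in> carrier V ==> r \<in> carrier R ==> s \<in> carrier S
  ==> rmult (env_right K V) v (et r s) = rmult V (lmult V s v) r"
proof -
 assume v: "v \<in> carrier V"
 have e: "rmult (env_right K V) v = plift K V (%(r, s). rmult V (lmult V s v) r)"
  by (simp add: env_right_def)
 have 1: "lin K S V (%s. rmult V (lmult V s v) r)" if "r \<in> carrier R" for r
  by (rule lin_comp[OF bm_la[OF V v] bm_r[OF V that]])
 have 2: "lin K R V (%r. rmult V (lmult V s v) r)" if "s \<in> carrier S" for s
  by (rule bm_ra[OF V bm_lcl[OF V that v]])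
 note L = env_lift[OF bm_module[OF V] 1 2]
 show "lin K EE V (rmult (env_right K V) v)" unfolding e by (rule L(1))
 show "rmult (env_right K V) v (et r s) = rmult V (lmult V s v) r" if "r \<in> carrier R" "s \<in> carrier S"
  unfolding e using L(2)[of r s] that by simp
qed

lemma env_right_lin2: "U \<in> carrier EE ==> lin K V V (%v. rmult (env_right K V) v U)"
proof (induction rule: env_induct)
 case (gen r s)
 show ?case
  by (rule lin_cong[OF lin_comp[OF bm_l[OF V gen(2)] bm_r[OF V gen(1)]]])
    (use gen bm_module[OF V] in \<open>simp_all add: env_right_et\<close>)
next
 case (add u v)
 show ?case
  by (rule lin_cong[OF lin_fun_add[OF bm_module[OF V] add(3,4)]])
    (use add bm_module[OF V] in \<open>simp_all add: lin_add[OF env_right_lin]\<close>)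
qed

lemma env_right_assoc:
 assumes v: "v \<in> carrier V" and U: "U \<in> carrier EE" and U': "U' \<in> carrier EE"
 shows "rmult (env_right K V) v (U \<otimes>[EE] U') = rmult (env_right K V) (rmult (env_right K V) v U) U'"
proof -
 note cl = lin_closed[OF env_right_lin] lin_closed[OF env_lin_l]
 note S' = lin_add[OF env_right_lin] lin_add[OF env_right_lin2] lin_add[OF env_lin_l] lin_add[OF env_lin_r]
 show ?thesis using U
 proof (induction rule: env_induct)
  case x: (gen r s)
  show ?case using U' v x
   by (induction rule: env_induct)
    (simp_all add: env_mult env_right_et R S bm_lcl[OF V] bm_rcl[OF V] bm_lassoc[OF V]
     bm_rassoc[OF V] bm_lr[OF V] S' cl)
 qed (use v U' in \<open>simp_all add: S' cl\<close>)
qed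

end

context
 fixes V :: "('k, 'r, 's, 'v) bimodule"
 assumes V: "bimodule K R S V"
begin

lemma env_left_lin: "v \<in> carrier V ==> lin K EE V (%U. lmult (env_left K V) U v)"
 and env_left_et: "v \<in> carrier V ==> r \<in> carrier R ==> s \<in> carrier S
  ==> lmult (env_left K V) (et r s) v = rmult V (lmult V r v) s"
proof -
 assume v: "v \<in> carrier V"
 have e: "(%U. lmult (env_left K V) U v) = plift K V (%(r, s). rmult V (lmult V r v) s)"
  by (simp add: env_left_def fun_eq_iff)
 have 1: "lin K R V (%r. rmult V (lmult V r v) s)" if "s \<in> carrier S" for s
  by (rule lin_comp[OF bm_la[OF V v] bm_r[OF V that]])
 have 2: "lin K S V (%s. rmult V (lmult V r v) s)" if "r \<in> carrier R" for r
  by (rule bm_ra[OF V bm_lcl[OF V that v]])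
 note L = env_lift[OF bm_module[OF V] 2 1]
 show "lin K EE V (%U. lmult (env_left K V) U v)" unfolding e by (rule L(1))
 show "lmult (env_left K V) (et r s) v = rmult V (lmult V r v) s" if "r \<in> carrier R" "s \<in> carrier S"
  using L(2)[of r s] that fun_cong[OF e] by simp
qed


end
end

lemma env_left_simps [simp]: "carrier (env_left K V) = carrier V" "\<zero>[env_left K V] = \<zero>[V]"
  "x \<oplus>[env_left K V] y = x \<oplus>[V] y" "c \<odot>[env_left K V] x = c \<odot>[V] x"
  "carrier (env_right K V') = carrier V'" "\<zero>[env_right K V'] = \<zero>[V']"
  "x' \<oplus>[env_right K V'] y' = x' \<oplus>[V'] y'" "c \<odot>[env_right K V'] x' = c \<odot>[V'] x'"
 by (simp_all add: env_left_def env_right_def module.defs)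

lemma env_left_module [simp]: "module K V ==> module K (env_left K V)"
 by (erule module_cong) (auto simp: fun_eq_iff)

lemma env_right_module [simp]: "module K V ==> module K (env_right K V)"
 by (erule module_cong) (auto simp: fun_eq_iff)

subsection \<open>Zeroth Hochschild homology\<close>

context
 fixes B :: "('k, 'b, 'y) module_scheme" and Z :: "('k, 'b, 'b, 'z) bimodule"
 assumes Z: "bimodule K B B Z"
begin

lemma com_sub: "submodule (commutator_span K B Z) K Z"
 unfolding commutator_span_def
 by (rule subspan_submodule) (auto intro!: v_minus[OF bm_module[OF Z]] simp: bm_lcl[OF Z] bm_rcl[OF Z] bm_module[OF Z])

lemma com_in: "b \<in> carrier B ==> z \<in> carrier Z ==> lmult Z b z \<ominus>[Z] rmult Z z b \<in> commutator_span K B Z"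
 unfolding commutator_span_def by (rule subspan_inc[OF bm_module[OF Z]]) auto

lemma com_lin:
 assumes f: "lin K Z V f" and V: "module K V" and H: "submodule H K V"
  and "!!b z. b \<in> carrier B ==> z \<in> carrier Z ==> f (lmult Z b z) \<ominus>[V] f (rmult Z z b) \<in> H"
  and "u \<in> commutator_span K B Z"
 shows "f u \<in> H"
proof (rule subspan_lin_in[OF f bm_module[OF Z] V H _ _ assms(5)[unfolded commutator_span_def]])
 show "{lmult Z b z \<ominus>[Z] rmult Z z b |b z. b \<in> carrier B \<and> z \<in> carrier Z} <= carrier Z"
  by (auto intro!: v_minus[OF bm_module[OF Z]] simp: bm_lcl[OF Z] bm_rcl[OF Z] bm_module[OF Z])
qed (use assms(4) lin_minus[OF f bm_module[OF Z] V] bm_lcl[OF Z] bm_rcl[OF Z] in auto)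

lemma com_lin_zero:
 assumes f: "lin K Z V f" and V: "module K V"
  and "!!b z. b \<in> carrier B ==> z \<in> carrier Z ==> f (lmult Z b z) = f (rmult Z z b)"
  and "u \<in> commutator_span K B Z"
 shows "f u = \<zero>[V]"
 using com_lin[OF f V submodule_zero[OF V] _ assms(4)] assms(3) V lin_closed[OF f] bm_rcl[OF Z] by simp

lemma H0_module: "module K (H0 K B Z)"
 unfolding H0_def by (rule quot_mod_module[OF bm_module[OF Z] com_sub])

abbreviation (input) "hcl \<equiv> %z. commutator_span K B Z +>[Z] z"

lemma hcl_lin: "lin K Z (H0 K B Z) hcl"
 unfolding H0_def by (rule coset_lin[OF bm_module[OF Z] com_sub])

lemma hcl_comm: "b \<in> carrier B ==> z \<in> carrier Z ==> hcl (lmult Z b z) = hcl (rmult Z z b)"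
 using com_in coset_eq_iff[OF bm_module[OF Z] com_sub] bm_lcl[OF Z] bm_rcl[OF Z] by simp

lemma hcl_zero_iff: "z \<in> carrier Z ==> hcl z = \<zero>[H0 K B Z] \<longleftrightarrow> z \<in> commutator_span K B Z"
 unfolding H0_def by (rule coset_zero_iff[OF bm_module[OF Z] com_sub])

lemma H0_cases:
 assumes "U \<in> carrier (H0 K B Z)"
 obtains z where "z \<in> carrier Z" "U = hcl z"
 using assms quot_mod_carrier[OF bm_module[OF Z] com_sub] by (auto simp: H0_def)

lemma H0_lift:
 assumes f: "lin K Z V f" and V: "module K V"
  and "!!b z. b \<in> carrier B ==> z \<in> carrier Z ==> f (lmult Z b z) = f (rmult Z z b)"
 shows "lin K (H0 K B Z) V (%U. f (SOME z. z \<in> U))"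
  and "z \<in> carrier Z ==> f (SOME y. y \<in> hcl z) = f z"
 unfolding H0_def
 using quot_lift[OF bm_module[OF Z] com_sub V f com_lin_zero[OF f V assms(3)]] by auto

end

end

section \<open>Comparison of resolutions\<close>

definition bhom :: "('k, 'x) ring_scheme => ('r, 'a) partial_object_scheme => ('s, 'b) partial_object_scheme
  => ('k, 'r, 's, 'v) bimodule => ('k, 'r, 's, 'w) bimodule => ('v => 'w) => bool" where
 "bhom K R S V W f \<longleftrightarrow> lin K V W f
   \<and> (\<forall>r\<in>carrier R. \<forall>v\<in>carrier V. f (lmult V r v) = lmult W r (f v))
   \<and> (\<forall>s\<in>carrier S. \<forall>v\<in>carrier V. f (rmult V v s) = rmult W (f v) s)"

lemma bhomI:
 assumes "lin K V W f" "!!r v. r \<in> carrier R ==> v \<in> carrier V ==> f (lmult V r v) = lmult W r (f v)"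
  "!!s v. s \<in> carrier S ==> v \<in> carrier V ==> f (rmult V v s) = rmult W (f v) s"
 shows "bhom K R S V W f"
 using assms by (auto simp: bhom_def)

lemma bhomD:
 assumes "bhom K R S V W f"
 shows "lin K V W f" "r \<in> carrier R ==> v \<in> carrier V ==> f (lmult V r v) = lmult W r (f v)"
  "s \<in> carrier S ==> v \<in> carrier V ==> f (rmult V v s) = rmult W (f v) s"
 using assms by (auto simp: bhom_def)

lemma bhom_comp: "bhom K R S V W f ==> bhom K R S W U g ==> bhom K R S V U (%x. g (f x))"
 by (rule bhomI) (auto intro: lin_comp dest: bhomD(1) simp: bhomD(2,3) lin_closed[OF bhomD(1)])

lemma bhom_ident: "bhom K R S V V (%x. x)"
 by (simp add: bhom_def lin_ident)

text \<open>The defining property of projectives, for a single pair of targets since types cannot be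
  quantified. It asks for an inclusion of images rather than for a surjection, because a
  differential maps onto the cycles only.\<close>

definition lifting :: "('k, 'x) ring_scheme => ('r, 'a) partial_object_scheme
  => ('k, 'r, 'r, 'q) bimodule => ('k, 'r, 'r, 'v) bimodule => ('k, 'r, 'r, 'w) bimodule => bool" where
 "lifting K L Q Y Y' \<longleftrightarrow> (\<forall>\<pi> \<phi>. bhom K L L Y Y' \<pi> \<and> bhom K L L Q Y' \<phi> \<and> \<phi> ` carrier Q <= \<pi> ` carrier Y
   \<longrightarrow> (\<exists>\<psi>. bhom K L L Q Y \<psi> \<and> (\<forall>q\<in>carrier Q. \<pi> (\<psi> q) = \<phi> q)))"

lemma liftingE:
 assumes "lifting K L Q Y Y'" "bhom K L L Y Y' \<pi>" "bhom K L L Q Y' \<phi>" "\<phi> ` carrier Q <= \<pi> ` carrier Y"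
 obtains \<psi> where "bhom K L L Q Y \<psi>" "!!q. q \<in> carrier Q ==> \<pi> (\<psi> q) = \<phi> q"
 using assms unfolding lifting_def by blast

context fld
begin

text \<open>A subspace that is maximal among those meeting the kernel of \<open>\<pi>\<close>
  trivially has the full image of \<open>\<pi>\<close> as its image. Zorn's lemma provides
  it.\<close>

lemma linear_complement:
 assumes Y: "module K Y" and Y': "module K Y'" and \<pi>: "lin K Y Y' \<pi>"
 obtains U where "submodule U K Y" "!!y. y \<in> U ==> \<pi> y = \<zero>[Y'] ==> y = \<zero>[Y]"
  "!!y. y \<in> carrier Y ==> \<exists>u\<in>U. \<pi> u = \<pi> y"
proof -
 define \<A> where "\<A> = {U. submodule U K Y \<and> (\<forall>y\<in>U. \<pi> y = \<zero>[Y'] \<longrightarrow> y = \<zero>[Y])}"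
 have "\<exists>U\<in>\<A>. \<forall>Z\<in>\<A>. U <= Z \<longrightarrow> Z = U"
 proof (rule subset_Zorn_nonempty)
  show "\<A> \<noteq> {}" using submodule_zero[OF Y] by (auto simp: \<A>_def)
  fix \<C> assume ne: "\<C> \<noteq> {}" and ch: "subset.chain \<A> \<C>"
  then have CA: "\<C> <= \<A>" by (auto simp: subset.chain_def)
  have "submodule (\<Union>\<C>) K Y"
  proof (rule v_submoduleI[OF Y])
   show "\<Union>\<C> <= carrier Y" using CA v_submoduleD(1)[OF Y] by (auto simp: \<A>_def)
   show "\<zero>[Y] \<in> \<Union>\<C>" using CA ne v_submoduleD(2)[OF Y] by (auto simp: \<A>_def)
   show "c \<odot>[Y] x \<in> \<Union>\<C>" if "c \<in> carrier K" "x \<in> \<Union>\<C>" for c x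
    using that CA v_submoduleD(4)[OF Y] unfolding \<A>_def by blast
   fix a b assume "a \<in> \<Union>\<C>" "b \<in> \<Union>\<C>"
   then obtain Ua Ub where U: "Ua \<in> \<C>" "Ub \<in> \<C>" "a \<in> Ua" "b \<in> Ub" by blast
   then have "Ua <= Ub \<or> Ub <= Ua" using ch by (auto simp: subset.chain_def)
   then show "a \<oplus>[Y] b \<in> \<Union>\<C>"
    using U CA v_submoduleD(3)[OF Y] unfolding \<A>_def by blast
  qed
  then show "\<Union>\<C> \<in> \<A>" using CA by (auto simp: \<A>_def)
 qed
 then obtain U where U: "submodule U K Y" "!!y. y \<in> U ==> \<pi> y = \<zero>[Y'] ==> y = \<zero>[Y]"
  and max: "!!Z. Z \<in> \<A> ==> U <= Z ==> Z = U"
  by (auto simp: \<A>_def)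
 note UD = v_submoduleD[OF Y U(1)]
 have "\<exists>u\<in>U. \<pi> u = \<pi> y" if y: "y \<in> carrier Y" for y
 proof (rule ccontr)
  assume no: "\<not> (\<exists>u\<in>U. \<pi> u = \<pi> y)"
  \<comment> \<open>If \<open>\<pi> y\<close> were missed, \<open>y\<close> could be adjoined to
    \<open>U\<close>: a combination \<open>u + c y\<close> in the kernel with \<open>c\<close>
    nonzero would put \<open>\<pi> y\<close> into the image of \<open>U\<close>.\<close>
  define Z where "Z = {u \<oplus>[Y] c \<odot>[Y] y |u c. u \<in> U \<and> c \<in> carrier K}"
  have ZI: "u \<oplus>[Y] c \<odot>[Y] y \<in> Z" if "u \<in> U" "c \<in> carrier K" for u c
   using that by (auto simp: Z_def)
  have Uc: "!!u. u \<in> U ==> u \<in> carrier Y" using UD(1) by blast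
  have UZ: "U <= Z"
  proof
   fix u assume "u \<in> U"
   with ZI[of u \<zero>] y Y Uc show "u \<in> Z" by simp
  qed
  have yZ: "y \<in> Z" using ZI[OF UD(2), of \<one>] y Y by simp
  have "submodule Z K Y"
  proof (rule v_submoduleI[OF Y])
   show "Z <= carrier Y" using Uc y Y by (auto simp: Z_def)
   show "\<zero>[Y] \<in> Z" using UZ UD(2) by blast
   fix a assume "a \<in> Z"
   then obtain u c where a: "a = u \<oplus>[Y] c \<odot>[Y] y" "u \<in> U" "c \<in> carrier K" by (auto simp: Z_def)
   show "e \<odot>[Y] a \<in> Z" if e: "e \<in> carrier K" for e
    using ZI[OF UD(4)[OF e a(2)], of "e \<otimes> c"] a y e Y Uc
    by (simp add: v_smult_r_distr v_smult_assoc)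
   fix b assume "b \<in> Z"
   then obtain u' c' where b: "b = u' \<oplus>[Y] c' \<odot>[Y] y" "u' \<in> U" "c' \<in> carrier K" by (auto simp: Z_def)
   show "a \<oplus>[Y] b \<in> Z"
    using ZI[OF UD(3)[OF a(2) b(2)], of "c \<oplus> c'"] a b y Y Uc v_add_swap[OF Y]
    by (simp add: v_smult_l_distr)
  qed
  moreover have "z = \<zero>[Y]" if z: "z \<in> Z" "\<pi> z = \<zero>[Y']" for z
  proof -
   from z(1) obtain u c where a: "z = u \<oplus>[Y] c \<odot>[Y] y" "u \<in> U" "c \<in> carrier K" by (auto simp: Z_def)
   have e: "\<pi> u \<oplus>[Y'] c \<odot>[Y'] \<pi> y = \<zero>[Y']"
    using z(2) a y Y Uc by (simp add: lin_add[OF \<pi>] lin_smult[OF \<pi>])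
   show ?thesis
   proof (cases "c = \<zero>")
    case True
    with e a y Y Y' Uc U(2)[OF a(2)] lin_closed[OF \<pi>] show ?thesis by simp
   next
    case False
    then have ci: "inv c \<in> carrier K" "inv c \<otimes> c = \<one>"
     using a(3) field_Units by auto
    have "c \<odot>[Y'] \<pi> y = \<ominus>[Y'] \<pi> u"
     using e a y Y' Uc lin_closed[OF \<pi>] by (simp add: v_add_eq_zero)
    then have "inv c \<odot>[Y'] (c \<odot>[Y'] \<pi> y) = inv c \<odot>[Y'] (\<ominus>[Y'] \<pi> u)" by simp
    then have "\<pi> y = \<pi> (inv c \<odot>[Y] (\<ominus>[Y] u))"
     using ci a y Y Y' Uc lin_closed[OF \<pi>]
     by (simp add: v_smult_assoc[symmetric] lin_smult[OF \<pi>] lin_inv[OF \<pi>])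
    moreover have "inv c \<odot>[Y] (\<ominus>[Y] u) \<in> U" using UD(4)[OF ci(1) UD(5)[OF a(2)]] .
    ultimately show ?thesis using no by metis
   qed
  qed
  ultimately have "Z \<in> \<A>" by (auto simp: \<A>_def)
  from max[OF this UZ] yZ no show False by blast
 qed
 with U that show thesis by blast
qed

text \<open>The lift inverts \<open>\<pi>\<close> on a complement of its kernel. Preimages are
  unique there, and uniqueness gives linearity.\<close>

lemma linear_lift:
 assumes Y: "module K Y" and Y': "module K Y'" and Q: "module K Q" and \<pi>: "lin K Y Y' \<pi>"
  and \<phi>: "lin K Q Y' \<phi>" and im: "\<phi> ` carrier Q <= \<pi> ` carrier Y"
 obtains h where "lin K Q Y h" "!!q. q \<in> carrier Q ==> \<pi> (h q) = \<phi> q"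
proof -
 obtain U where U: "submodule U K Y" "!!y. y \<in> U ==> \<pi> y = \<zero>[Y'] ==> y = \<zero>[Y]"
  and ex: "!!y. y \<in> carrier Y ==> \<exists>u\<in>U. \<pi> u = \<pi> y"
  by (rule linear_complement[OF Y Y' \<pi>]) blast
 note UD = v_submoduleD[OF Y U(1)]
 have uniq: "u = v" if "u \<in> U" "v \<in> U" "\<pi> u = \<pi> v" for u v
 proof -
  have uv: "u \<in> carrier Y" "v \<in> carrier Y" using that UD(1) by auto
  then have "\<pi> (u \<ominus>[Y] v) = \<zero>[Y']"
   using that Y' lin_closed[OF \<pi>] by (simp add: lin_minus[OF \<pi> Y Y'])
  from U(2)[OF UD(6)[OF that(1,2)] this] uv Y show ?thesis by (simp add: v_minus_eq_zero)
 qed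
 define h where "h = (%q. SOME u. u \<in> U \<and> \<pi> u = \<phi> q)"
 have h: "h q \<in> U \<and> \<pi> (h q) = \<phi> q" if "q \<in> carrier Q" for q
 proof -
  from im that obtain y where "y \<in> carrier Y" "\<phi> q = \<pi> y" by auto
  with ex[of y] have "\<exists>u. u \<in> U \<and> \<pi> u = \<phi> q" by auto
  then show ?thesis unfolding h_def by (rule someI_ex)
 qed
 have hc: "h q \<in> carrier Y" if "q \<in> carrier Q" for q using h[OF that] UD(1) by blast
 have "lin K Q Y h"
 proof (rule linI)
  fix p q assume "p \<in> carrier Q" "q \<in> carrier Q"
  then show "h (p \<oplus>[Q] q) = h p \<oplus>[Y] h q"
   using h hc Q UD(3) by (intro uniq) (simp_all add: lin_add[OF \<pi>] lin_add[OF \<phi>])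
 next
  fix c q assume "c \<in> carrier K" "q \<in> carrier Q"
  then show "h (c \<odot>[Q] q) = c \<odot>[Y] h q"
   using h hc Q UD(4) by (intro uniq) (simp_all add: lin_smult[OF \<pi>] lin_smult[OF \<phi>])
 qed (rule hc)
 with h that show thesis by blast
qed

lemma bhom_minus:
 assumes V: "bimodule K R S V" and W: "bimodule K R S W" and f: "bhom K R S V W f" and g: "bhom K R S V W g"
 shows "bhom K R S V W (%x. f x \<ominus>[W] g x)"
 by (rule bhomI[OF lin_fun_minus[OF bm_module[OF W] bhomD(1)[OF f] bhomD(1)[OF g]]])
  (simp_all add: bhomD[OF f] bhomD[OF g] lin_minus[OF bm_l[OF W]] lin_minus[OF bm_r[OF W]]
   bm_module[OF W] lin_closed[OF bhomD(1)[OF f]] lin_closed[OF bhomD(1)[OF g]])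

lemma bhom_com:
 assumes V: "bimodule K R R V" and W: "bimodule K R R W" and f: "bhom K R R V W f"
  and u: "u \<in> commutator_span K R V"
 shows "f u \<in> commutator_span K R W"
 by (rule com_lin[OF V bhomD(1)[OF f] bm_module[OF W] com_sub[OF W] _ u])
   (simp add: bhomD(2,3)[OF f] com_in[OF W] lin_closed[OF bhomD(1)[OF f]])

end

text \<open>A chain complex in HOL needs all its modules in one type. The datatype
  \<open>rgen\<close> achieves this for the free resolution, the lists in \<open>tpow\<close> for
  \<open>Q\<close>.\<close>

locale resolution = fld K for K :: "('k, 'x) ring_scheme" (structure) +
 fixes L :: "('k, 'l) module" and V :: "('k, 'l, 'l, 'v) bimodule" and P :: "nat => ('k, 'l, 'l, 'p) bimodule"
  and d :: "nat => 'p => 'p" and e :: "'p => 'v"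
 assumes bmV: "bimodule K L L V" and bm: "!!n. bimodule K L L (P n)"
  and dh: "!!n. bhom K L L (P (Suc n)) (P n) (d n)" and eh: "bhom K L L (P 0) V e"
  and surj: "e ` carrier (P 0) = carrier V"
  and exact0: "!!p. p \<in> carrier (P 0) ==> e p = \<zero>[V] \<longleftrightarrow> p \<in> d 0 ` carrier (P (Suc 0))"
  and exact: "!!n p. p \<in> carrier (P (Suc n)) ==> d n p = \<zero>[P n] \<longleftrightarrow> p \<in> d (Suc n) ` carrier (P (Suc (Suc n)))"
begin

text \<open>Degree 0 uses the augmentation, so that the two exactness axioms take the single form
  \<open>zc_iff\<close>.\<close>

definition zc :: "nat => 'p => bool" where
 "zc n p \<longleftrightarrow> (case n of 0 => e p = \<zero>[V] | Suc m => d m p = \<zero>[P m])"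

lemma zc_iff: "p \<in> carrier (P n) ==> zc n p \<longleftrightarrow> p \<in> d n ` carrier (P (Suc n))"
 by (cases n) (simp_all add: zc_def exact0 exact)

lemma d_lin: "lin K (P (Suc n)) (P n) (d n)"
 by (rule bhomD(1)[OF dh])

lemma mP [simp]: "module K (P n)"
 by (rule bm_module[OF bm])

lemma d_zc: "p \<in> carrier (P (Suc n)) ==> zc n (d n p)"
 by (simp add: zc_iff lin_closed[OF d_lin])

text \<open>The cycles of the complex \<open>P / [L, P]\<close>.\<close>

definition rcyc :: "nat => 'p set" where
 "rcyc n = {p \<in> carrier (P n). case n of 0 => True | Suc m => d m p \<in> commutator_span K L (P m)}"

text \<open>Each degree of the homotopy is a lift, through the differential, of the error left by
  the previous degree; that error is a cycle and hence a boundary.\<close>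

lemma null_homotopic:
 assumes lift: "!!n. lifting K L (P n) (P (Suc n)) (P n)"
  and fh: "!!n. bhom K L L (P n) (P n) (f n)"
  and f0: "!!p. p \<in> carrier (P 0) ==> e (f 0 p) = e p"
  and fd: "!!n p. p \<in> carrier (P (Suc n)) ==> d n (f (Suc n) p) = f n (d n p)"
 obtains h where "!!n. bhom K L L (P n) (P (Suc n)) (h n)"
  "!!p. p \<in> carrier (P 0) ==> d 0 (h 0 p) = f 0 p \<ominus>[P 0] p"
  "!!n p. p \<in> carrier (P (Suc n)) ==> d (Suc n) (h (Suc n) p) = (f (Suc n) p \<ominus>[P (Suc n)] p) \<ominus>[P (Suc n)] h n (d n p)"
proof -
 \<comment> \<open>\<open>A\<close> records of the homotopy in degree \<open>n\<close> what the next
   step uses: \<open>d n (h p)\<close> is \<open>f n p - p\<close> for cycles \<open>p\<close>, and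
   for all \<open>p\<close> in degree 0. \<open>B\<close> is the homotopy identity joining
   consecutive degrees.\<close>
 define A where "A = (%n h. bhom K L L (P n) (P (Suc n)) h
   \<and> (\<forall>p\<in>carrier (P n). zc n p \<or> n = 0 \<longrightarrow> d n (h p) = f n p \<ominus>[P n] p))"
 define B where "B = (%n h h'. \<forall>p\<in>carrier (P (Suc n)). d (Suc n) (h' p)
   = (f (Suc n) p \<ominus>[P (Suc n)] p) \<ominus>[P (Suc n)] h (d n p))"
 have "\<exists>h. \<forall>n. A n (h n) \<and> B n (h n) (h (Suc n))"
 proof (rule dependent_nat_choice)
  let ?\<phi> = "%p. f 0 p \<ominus>[P 0] p"
  have \<phi>: "bhom K L L (P 0) (P 0) ?\<phi>" by (rule bhom_minus[OF bm bm fh bhom_ident])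
  have im: "?\<phi> ` carrier (P 0) <= d 0 ` carrier (P (Suc 0))"
  proof
   fix q assume "q \<in> ?\<phi> ` carrier (P 0)"
   then obtain p where p: "p \<in> carrier (P 0)" "q = ?\<phi> p" by blast
   then have "e q = \<zero>[V]"
    using f0[OF p(1)] lin_closed[OF bhomD(1)[OF fh]] lin_closed[OF bhomD(1)[OF eh]] bm_module[OF bmV]
    by (simp add: lin_minus[OF bhomD(1)[OF eh]])
   with p lin_closed[OF bhomD(1)[OF \<phi>]] exact0 show "q \<in> d 0 ` carrier (P (Suc 0))" by simp
  qed
  obtain h where
   "bhom K L L (P 0) (P (Suc 0)) h" "!!p. p \<in> carrier (P 0) ==> d 0 (h p) = ?\<phi> p"
   by (rule liftingE[OF lift dh \<phi> im]) blast
  then have "A 0 h" by (simp add: A_def)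
  then show "\<exists>h. A 0 h" by blast
 next
  fix h n assume h: "A n h"
  then have hh: "bhom K L L (P n) (P (Suc n)) h" by (simp add: A_def)
  let ?\<phi> = "%p. (f (Suc n) p \<ominus>[P (Suc n)] p) \<ominus>[P (Suc n)] h (d n p)"
  have \<phi>: "bhom K L L (P (Suc n)) (P (Suc n)) ?\<phi>"
   by (intro bhom_minus[OF bm bm] fh bhom_ident bhom_comp[OF dh hh])
  note cl = lin_closed[OF bhomD(1)[OF fh]] lin_closed[OF bhomD(1)[OF hh]] lin_closed[OF d_lin]
  have im: "?\<phi> ` carrier (P (Suc n)) <= d (Suc n) ` carrier (P (Suc (Suc n)))"
  proof
   fix q assume "q \<in> ?\<phi> ` carrier (P (Suc n))"
   then obtain p where p: "p \<in> carrier (P (Suc n))" "q = ?\<phi> p" by blast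
   have "d n (h (d n p)) = f n (d n p) \<ominus>[P n] d n p"
    using h d_zc[OF p(1)] lin_closed[OF d_lin p(1)] by (simp add: A_def)
   then have "d n q = \<zero>[P n]"
    using p cl by (simp add: lin_minus[OF d_lin] fd)
   with p lin_closed[OF bhomD(1)[OF \<phi>]] exact show "q \<in> d (Suc n) ` carrier (P (Suc (Suc n)))" by simp
  qed
  obtain h' where
   h': "bhom K L L (P (Suc n)) (P (Suc (Suc n))) h'" "!!p. p \<in> carrier (P (Suc n)) ==> d (Suc n) (h' p) = ?\<phi> p"
   by (rule liftingE[OF lift dh \<phi> im]) blast
  have "d (Suc n) (h' p) = f (Suc n) p \<ominus>[P (Suc n)] p" if "p \<in> carrier (P (Suc n))" "zc (Suc n) p" for p
   using h'(2) that cl lin_zero[OF bhomD(1)[OF hh]] by (simp add: zc_def)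
  with h' have "A (Suc n) h' \<and> B n h h'" by (simp add: A_def B_def)
  then show "\<exists>h'. A (Suc n) h' \<and> B n h h'" by blast
 qed
 then obtain h where "!!n. A n (h n)" "!!n. B n (h n) (h (Suc n))" by auto
 then show thesis by (intro that[of h]) (auto simp: A_def B_def)
qed

text \<open>The homotopy is a bimodule map and carries commutators to commutators. For a cycle
  \<open>p\<close> of the commutator quotient this turns the term \<open>h (d p)\<close> into a
  commutator.\<close>

lemma endo_homology:
 assumes lift: "!!n. lifting K L (P n) (P (Suc n)) (P n)"
  and fh: "!!n. bhom K L L (P n) (P n) (f n)"
  and f0: "!!p. p \<in> carrier (P 0) ==> e (f 0 p) = e p"
  and fd: "!!n p. p \<in> carrier (P (Suc n)) ==> d n (f (Suc n) p) = f n (d n p)"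
  and p: "p \<in> rcyc n"
 obtains c q where "c \<in> commutator_span K L (P n)" "q \<in> carrier (P (Suc n))"
  "f n p = p \<oplus>[P n] (c \<oplus>[P n] d n q)"
proof -
 obtain h where hh: "!!n. bhom K L L (P n) (P (Suc n)) (h n)"
  and h0: "!!p. p \<in> carrier (P 0) ==> d 0 (h 0 p) = f 0 p \<ominus>[P 0] p"
  and h1: "!!n p. p \<in> carrier (P (Suc n)) ==> d (Suc n) (h (Suc n) p)
    = (f (Suc n) p \<ominus>[P (Suc n)] p) \<ominus>[P (Suc n)] h n (d n p)"
  by (rule null_homotopic[OF lift fh f0 fd]) blast+
 have pc: "p \<in> carrier (P n)" using p by (simp add: rcyc_def)
 note cl = lin_closed[OF bhomD(1)[OF fh]] lin_closed[OF bhomD(1)[OF hh]] lin_closed[OF d_lin]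
 show thesis
 proof (cases n)
  case 0
  have "f 0 p = p \<oplus>[P 0] d 0 (h 0 p)"
   using h0 pc cl 0 v_minus_iff[OF mP, of "f 0 p" 0 p "d 0 (h 0 p)"] by simp
  with pc cl 0 v_submoduleD(2)[OF mP com_sub[OF bm]] show thesis
   by (intro that[of "\<zero>[P n]" "h n p"]) auto
 next
  case (Suc m)
  let ?c = "h m (d m p)"
  have c: "?c \<in> commutator_span K L (P n)"
   using p bhom_com[OF bm bm hh] Suc by (simp add: rcyc_def)
  have "f n p \<ominus>[P n] p = ?c \<oplus>[P n] d n (h n p)"
   using h1 pc cl Suc v_minus_iff[OF mP, of "f n p \<ominus>[P n] p" n ?c "d n (h n p)"] by simp
  then have "f n p = p \<oplus>[P n] (?c \<oplus>[P n] d n (h n p))"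
   using pc cl Suc v_minus_iff[OF mP, of "f n p" n p "?c \<oplus>[P n] d n (h n p)"] by simp
  with c pc cl show thesis by (intro that[of ?c "h n p"]) auto
 qed
qed

end

text \<open>The comparison theorem. For the next lift to exist, the map in each degree must send
  cycles to cycles, and this is what \<open>A\<close> carries along.\<close>

lemma chain_map_exists:
 assumes "resolution K L V P d e" "resolution K L V Q d' e'"
  and lift0: "lifting K L (P 0) (Q 0) V" and lift: "!!n. lifting K L (P (Suc n)) (Q (Suc n)) (Q n)"
 obtains f where "!!n. bhom K L L (P n) (Q n) (f n)" "!!p. p \<in> carrier (P 0) ==> e' (f 0 p) = e p"
  "!!n p. p \<in> carrier (P (Suc n)) ==> d' n (f (Suc n) p) = f n (d n p)"
proof -
 interpret P: resolution K L V P d e by fact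
 interpret Q: resolution K L V Q d' e' by fact
 define A where "A = (%n f. bhom K L L (P n) (Q n) f \<and> (\<forall>p\<in>carrier (P n). P.zc n p \<longrightarrow> Q.zc n (f p))
   \<and> (n = 0 \<longrightarrow> (\<forall>p\<in>carrier (P n). e' (f p) = e p)))"
 define B where "B = (%n f f'. \<forall>p\<in>carrier (P (Suc n)). d' n (f' p) = f (d n p))"
 have "\<exists>f. \<forall>n. A n (f n) \<and> B n (f n) (f (Suc n))"
 proof (rule dependent_nat_choice)
  have im: "e ` carrier (P 0) <= e' ` carrier (Q 0)" using P.surj Q.surj by simp
  obtain f where
   "bhom K L L (P 0) (Q 0) f" "!!p. p \<in> carrier (P 0) ==> e' (f p) = e p"
   by (rule liftingE[OF lift0 Q.eh P.eh im]) blast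
  then have "A 0 f" by (simp add: A_def P.zc_def Q.zc_def)
  then show "\<exists>f. A 0 f" by blast
 next
  fix f n assume f: "A n f"
  then have fh: "bhom K L L (P n) (Q n) f" by (simp add: A_def)
  let ?\<phi> = "%p. f (d n p)"
  have \<phi>: "bhom K L L (P (Suc n)) (Q n) ?\<phi>" by (rule bhom_comp[OF P.dh fh])
  have im: "?\<phi> ` carrier (P (Suc n)) <= d' n ` carrier (Q (Suc n))"
  proof
   fix q assume "q \<in> ?\<phi> ` carrier (P (Suc n))"
   then obtain p where p: "p \<in> carrier (P (Suc n))" "q = ?\<phi> p" by blast
   then have "Q.zc n q" using f P.d_zc lin_closed[OF P.d_lin] by (simp add: A_def)
   with p lin_closed[OF bhomD(1)[OF \<phi>]] Q.zc_iff show "q \<in> d' n ` carrier (Q (Suc n))" by blast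
  qed
  obtain f' where
   f': "bhom K L L (P (Suc n)) (Q (Suc n)) f'" "!!p. p \<in> carrier (P (Suc n)) ==> d' n (f' p) = ?\<phi> p"
   by (rule liftingE[OF lift Q.dh \<phi> im]) blast
  have "Q.zc (Suc n) (f' p)" if "p \<in> carrier (P (Suc n))" "P.zc (Suc n) p" for p
   using that f'(2) P.lin_zero[OF bhomD(1)[OF fh]] by (simp add: P.zc_def Q.zc_def)
  with f' have "A (Suc n) f' \<and> B n f f'" by (simp add: A_def B_def)
  then show "\<exists>f'. A (Suc n) f' \<and> B n f f'" by blast
 qed
 then obtain f where "!!n. A n (f n)" "!!n. B n (f n) (f (Suc n))" by auto
 then show thesis by (intro that[of f]) (auto simp: A_def B_def)
qed

text \<open>If \<open>\<theta>\<close> computes the homology of \<open>Q / [L, Q]\<close> in degree \<open>n\<close>, its pullback computes that of \<open>P / [L, P]\<close>.\<close>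

theorem homology_transport:
 assumes P: "resolution K L V P d e" and Q: "resolution K L V Q d' e'"
  and PQ0: "lifting K L (P 0) (Q 0) V" and PQ: "!!n. lifting K L (P (Suc n)) (Q (Suc n)) (Q n)"
  and QP0: "lifting K L (Q 0) (P 0) V" and QP: "!!n. lifting K L (Q (Suc n)) (P (Suc n)) (P n)"
  and PP: "!!n. lifting K L (P n) (P (Suc n)) (P n)" and QQ: "!!n. lifting K L (Q n) (Q (Suc n)) (Q n)"
  and \<theta>: "lin K (Q n) H \<theta>" and H: "module K H"
  and im: "\<theta> ` resolution.rcyc K L Q d' n = Z"
  and ker: "!!q. q \<in> resolution.rcyc K L Q d' n ==> \<theta> q = \<zero>[H] \<longleftrightarrow>
   (\<exists>c\<in>commutator_span K L (Q n). \<exists>q'\<in>carrier (Q (Suc n)). q = c \<oplus>[Q n] d' n q')"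
 obtains \<Theta> where "lin K (P n) H \<Theta>" "\<Theta> ` resolution.rcyc K L P d n = Z"
  "!!p. p \<in> resolution.rcyc K L P d n ==> \<Theta> p = \<zero>[H] \<longleftrightarrow>
   (\<exists>c\<in>commutator_span K L (P n). \<exists>p'\<in>carrier (P (Suc n)). p = c \<oplus>[P n] d n p')"
proof -
 interpret P: resolution K L V P d e by fact
 interpret Q: resolution K L V Q d' e' by fact
 obtain f where f: "!!n. bhom K L L (P n) (Q n) (f n)" and f0: "!!p. p \<in> carrier (P 0) ==> e' (f 0 p) = e p"
  and fd: "!!n p. p \<in> carrier (P (Suc n)) ==> d' n (f (Suc n) p) = f n (d n p)"
  by (rule chain_map_exists[OF P Q PQ0 PQ]) blast+
 obtain g where g: "!!n. bhom K L L (Q n) (P n) (g n)" and g0: "!!p. p \<in> carrier (Q 0) ==> e (g 0 p) = e' p"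
  and gd: "!!n p. p \<in> carrier (Q (Suc n)) ==> d n (g (Suc n) p) = g n (d' n p)"
  by (rule chain_map_exists[OF Q P QP0 QP]) blast+
 note fc = lin_closed[OF bhomD(1)[OF f]] and gc = lin_closed[OF bhomD(1)[OF g]]
  and dc = lin_closed[OF P.d_lin] and dc' = lin_closed[OF Q.d_lin]
 have fz: "f n p \<in> Q.rcyc n" if "p \<in> P.rcyc n" for p
  using that fc P.bhom_com[OF P.bm Q.bm f] by (cases n) (simp_all add: P.rcyc_def Q.rcyc_def fd)
 have gz: "g n p \<in> P.rcyc n" if "p \<in> Q.rcyc n" for p
  using that gc P.bhom_com[OF Q.bm P.bm g] by (cases n) (simp_all add: P.rcyc_def Q.rcyc_def gd)
 have Pb: "f n c \<oplus>[Q n] d' n (f (Suc n) p) = f n (c \<oplus>[P n] d n p)"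
  if "c \<in> carrier (P n)" "p \<in> carrier (P (Suc n))" for c p
  using that dc fd by (simp add: lin_add[OF bhomD(1)[OF f]])
 have Qb: "g n c \<oplus>[P n] d n (g (Suc n) p) = g n (c \<oplus>[Q n] d' n p)"
  if "c \<in> carrier (Q n)" "p \<in> carrier (Q (Suc n))" for c p
  using that dc' gd by (simp add: lin_add[OF bhomD(1)[OF g]])
 have comP: "!!c n. c \<in> commutator_span K L (P n) ==> c \<in> carrier (P n)"
  using P.v_submoduleD(1)[OF P.mP P.com_sub[OF P.bm]] by blast
 have comQ: "!!c n. c \<in> commutator_span K L (Q n) ==> c \<in> carrier (Q n)"
  using P.v_submoduleD(1)[OF Q.mP P.com_sub[OF Q.bm]] by blast
 have cQ: "\<theta> (c \<oplus>[Q n] d' n q) = \<zero>[H]" if "c \<in> commutator_span K L (Q n)" "q \<in> carrier (Q (Suc n))"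
  "c \<oplus>[Q n] d' n q \<in> Q.rcyc n" for c q
  by (rule iffD2[OF ker[OF that(3)]]) (rule bexI[OF _ that(1)], rule bexI[OF _ that(2)], rule refl)
 note D = P.v_submoduleD[OF P.mP P.com_sub[OF P.bm]] and D' = P.v_submoduleD[OF Q.mP P.com_sub[OF Q.bm]]
 show thesis
 proof (rule that[of "%p. \<theta> (f n p)"])
  show "lin K (P n) H (%p. \<theta> (f n p))" by (rule lin_comp[OF bhomD(1)[OF f] \<theta>])
  show "(%p. \<theta> (f n p)) ` P.rcyc n = Z"
  proof
   show "(%p. \<theta> (f n p)) ` P.rcyc n <= Z" using fz im by auto
   show "Z <= (%p. \<theta> (f n p)) ` P.rcyc n"
   proof
    fix z assume "z \<in> Z"
    then obtain q where q: "q \<in> Q.rcyc n" "z = \<theta> q" using im by blast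
    have qc: "q \<in> carrier (Q n)" using q(1) by (simp add: Q.rcyc_def)
    \<comment> \<open>\<open>f n (g n q)\<close> differs from \<open>q\<close> by a boundary of the
      commutator quotient. The correction is itself a cycle, so \<open>\<theta>\<close> sends it to
      zero by \<open>ker\<close>.\<close>
    obtain c q' where c: "c \<in> commutator_span K L (Q n)" "q' \<in> carrier (Q (Suc n))"
     "f n (g n q) = q \<oplus>[Q n] (c \<oplus>[Q n] d' n q')"
     by (rule Q.endo_homology[OF QQ bhom_comp[OF g f] _ _ q(1)]) (simp_all add: f0 g0 fd gd gc)
    have cc: "c \<oplus>[Q n] d' n q' \<in> Q.rcyc n"
    proof -
     have cn: "c \<in> carrier (Q n)" using c comQ by blast
     show ?thesis
     proof (cases n)
      case (Suc m)
      have "d' m (c \<oplus>[Q n] d' n q') = d' m c"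
       using Q.d_zc[OF c(2)] c(2) cn Suc dc' lin_add[OF Q.d_lin, of c m "d' n q'"] by (simp add: Q.zc_def)
      then show ?thesis using P.bhom_com[OF Q.bm Q.bm Q.dh, of c] c(1,2) cn Suc dc' by (simp add: Q.rcyc_def)
     qed (use cn c dc' in \<open>auto simp: Q.rcyc_def\<close>)
    qed
    have "\<theta> (f n (g n q)) = \<theta> q \<oplus>[H] \<theta> (c \<oplus>[Q n] d' n q')"
     unfolding c(3) using cc qc by (intro lin_add[OF \<theta>]) (auto simp: Q.rcyc_def)
    also have "\<dots> = z" using cQ[OF c(1,2) cc] q qc H lin_closed[OF \<theta>] by simp
    finally show "z \<in> (%p. \<theta> (f n p)) ` P.rcyc n" using gz[OF q(1)] by (intro image_eqI[of _ _ "g n q"]) simp_all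
   qed
  qed
  fix p assume p: "p \<in> P.rcyc n"
  have pc: "p \<in> carrier (P n)" using p by (simp add: P.rcyc_def)
  show "\<theta> (f n p) = \<zero>[H] \<longleftrightarrow>
   (\<exists>c\<in>commutator_span K L (P n). \<exists>p'\<in>carrier (P (Suc n)). p = c \<oplus>[P n] d n p')" (is "_ \<longleftrightarrow> ?R")
  proof
   assume ?R
   then obtain c p' where c: "c \<in> commutator_span K L (P n)" "p' \<in> carrier (P (Suc n))" "p = c \<oplus>[P n] d n p'"
    by blast
   then have "f n p = f n c \<oplus>[Q n] d' n (f (Suc n) p')" using Pb comP by simp
   then show "\<theta> (f n p) = \<zero>[H]"
    by (intro iffD2[OF ker[OF fz[OF p]]] bexI[of _ "f n c"] bexI[of _ "f (Suc n) p'"] fc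
      P.bhom_com[OF P.bm Q.bm f]) (use c in simp_all)
  next
   assume "\<theta> (f n p) = \<zero>[H]"
   from iffD1[OF ker[OF fz[OF p]] this] obtain c q' where
    c: "c \<in> commutator_span K L (Q n)" "q' \<in> carrier (Q (Suc n))" "f n p = c \<oplus>[Q n] d' n q'"
    by (elim bexE)
   \<comment> \<open>\<open>g\<close> carries the boundary \<open>f n p\<close> to a boundary, and
     \<open>g n (f n p)\<close> differs from \<open>p\<close> by another one; subtracting exhibits
     \<open>p\<close> as a boundary.\<close>
   obtain c' p' where c': "c' \<in> commutator_span K L (P n)" "p' \<in> carrier (P (Suc n))"
    "g n (f n p) = p \<oplus>[P n] (c' \<oplus>[P n] d n p')"
    by (rule P.endo_homology[OF PP bhom_comp[OF f g] _ _ p]) (simp_all add: f0 g0 fd gd fc)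
   let ?c = "g n c" and ?p = "g (Suc n) q'"
   have gcom: "?c \<in> commutator_span K L (P n)" using P.bhom_com[OF Q.bm P.bm g] c by blast
   have car: "?c \<in> carrier (P n)" "d n ?p \<in> carrier (P n)" "?p \<in> carrier (P (Suc n))" "c' \<in> carrier (P n)" "d n p' \<in> carrier (P n)"
    using gcom comP c c' gc dc by auto
   have "p \<oplus>[P n] (c' \<oplus>[P n] d n p') = ?c \<oplus>[P n] d n ?p"
    using c'(3) c Qb comQ by simp
   then have "p = (?c \<oplus>[P n] d n ?p) \<ominus>[P n] (c' \<oplus>[P n] d n p')"
    using pc car P.v_minus_iff[OF P.mP, of "?c \<oplus>[P n] d n ?p" n "c' \<oplus>[P n] d n p'" p]
     P.v_comm[OF P.mP, of p n "c' \<oplus>[P n] d n p'"] by simp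
   also have "\<dots> = (?c \<ominus>[P n] c') \<oplus>[P n] d n (?p \<ominus>[P (Suc n)] p')"
    using car c'(2) by (simp add: P.v_minus_add_swap P.lin_minus[OF P.d_lin])
   finally show ?R
    by (rule bexI[OF bexI[where x="?p \<ominus>[P (Suc n)] p'"] D(6)[OF gcom c'(1)]])
     (use car c'(2) in simp)
  qed
 qed
qed

section \<open>The free resolution\<close>

context fld
begin

context
 fixes E :: "('k, 'e) module"
 assumes E: "k_algebra K E"
begin

lemma fr_lin: "e \<in> carrier E ==> lin K (free_mod E G) (free_mod E G) (%f. rmult (free_mod E G) f e)"
proof (rule linI)
 fix f assume e: "e \<in> carrier E" and f: "f \<in> carrier (free_mod E G)"
 have z: "\<zero>[E] \<otimes>[E] e = \<zero>[E]" using lin_zero[OF alg_lin1[OF E e]] E by simp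
 have "finite {g. f g \<otimes>[E] e \<noteq> \<zero>[E]}"
  by (rule finite_subset[of _ "{g. f g \<noteq> \<zero>[E]}"]) (use f z in \<open>auto simp: free_mod_carrier\<close>)
 with f e z show "rmult (free_mod E G) f e \<in> carrier (free_mod E G)"
  using E by (auto simp: free_mod_carrier)
qed (use E in \<open>auto simp: free_mod_carrier lin_add[OF alg_lin1[OF E]] lin_smult[OF alg_lin1[OF E]]\<close>)

lemma fr_lin2: "f \<in> carrier (free_mod E G) ==> lin K E (free_mod E G) (rmult (free_mod E G) f)"
proof (rule linI)
 fix e assume "f \<in> carrier (free_mod E G)" "e \<in> carrier E"
 then show "rmult (free_mod E G) f e \<in> carrier (free_mod E G)" by (rule lin_closed[OF fr_lin, rotated])
qed (auto simp: free_mod_carrier lin_add[OF alg_lin2[OF E]] lin_smult[OF alg_lin2[OF E]])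

lemma fr_closed: "f \<in> carrier (free_mod E G) ==> e \<in> carrier E ==> rmult (free_mod E G) f e \<in> carrier (free_mod E G)"
 by (rule lin_closed[OF fr_lin])

lemma fr_assoc: "f \<in> carrier (free_mod E G) ==> e \<in> carrier E ==> e' \<in> carrier E
  ==> rmult (free_mod E G) (rmult (free_mod E G) f e) e' = rmult (free_mod E G) f (e \<otimes>[E] e')"
 by (simp add: free_mod_carrier alg_assoc[OF E])

lemma fr_one: "f \<in> carrier (free_mod E G) ==> rmult (free_mod E G) f \<one>[E] = f"
 using E by (simp add: free_mod_carrier)

lemma fr_single: "g \<in> G ==> e \<in> carrier E ==> e' \<in> carrier E
  ==> rmult (free_mod E G) (single E g e) e' = single E g (e \<otimes>[E] e')"
 using lin_zero[OF alg_lin1[OF E]] E by (auto simp: single_def)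

text \<open>Universal property of a free right module. The map is built linearly by
  \<open>free_lin\<close>, and compatibility with the action is then checked on the elements
  \<open>single E g e\<close>.\<close>

lemma fr_ext:
 assumes Z: "module K Z" and l1: "!!v. v \<in> carrier Z ==> lin K E Z (act v)"
  and l2: "!!e. e \<in> carrier E ==> lin K Z Z (%v. act v e)"
  and as: "!!v e e'. v \<in> carrier Z ==> e \<in> carrier E ==> e' \<in> carrier E
   ==> act v (e \<otimes>[E] e') = act (act v e) e'"
  and z: "!!g. g \<in> G ==> z g \<in> carrier Z"
 shows "lin K (free_mod E G) Z (lin_ext E Z act z)"
  and "g \<in> G ==> e \<in> carrier E ==> lin_ext E Z act z (single E g e) = act (z g) e"
  and "f \<in> carrier (free_mod E G) ==> e \<in> carrier E
   ==> lin_ext E Z act z (rmult (free_mod E G) f e) = act (lin_ext E Z act z f) e"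
proof -
 have eq: "lin_ext E Z act z = (%f. finsum Z (%g. act (z g) (f g)) {g. f g \<noteq> \<zero>[E]})"
  by (rule ext) (simp add: lin_ext_def)
 note L = free_lin[OF alg_module[OF E] Z, of G "%g. act (z g)"]
 have Fl: "lin K (free_mod E G) Z (lin_ext E Z act z)" unfolding eq by (rule L(1)) (rule l1[OF z])
 have Fs: "lin_ext E Z act z (single E g e) = act (z g) e" if "g \<in> G" "e \<in> carrier E" for g e
  unfolding eq by (rule L(2)) (use l1 z that in auto)
 show "lin K (free_mod E G) Z (lin_ext E Z act z)" by (rule Fl)
 show "g \<in> G ==> e \<in> carrier E ==> lin_ext E Z act z (single E g e) = act (z g) e" by (rule Fs)
 show "lin_ext E Z act z (rmult (free_mod E G) f e) = act (lin_ext E Z act z f) e"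
  if f: "f \<in> carrier (free_mod E G)" and e: "e \<in> carrier E"
 proof (rule free_lin_eq[OF lin_comp[OF fr_lin[OF e] Fl] lin_comp[OF Fl l2[OF e]] _ Z _ f])
  fix g e' assume g: "g \<in> G" "e' \<in> carrier E"
  then show "lin_ext E Z act z (rmult (free_mod E G) (single E g e') e) = act (lin_ext E Z act z (single E g e')) e"
   unfolding fr_single[OF g e] using E e by (simp add: Fs as z)
 qed (use E in simp)
qed

lemma rel_val_Nil: "rel_val E [] = (%_. \<zero>[E])"
 and rel_val_Cons: "rel_val E ((g, e) # l) = single E g e \<oplus>[free_mod E UNIV] rel_val E l"
 by (simp_all add: rel_val_def)

lemma rel_val_closed: "set l <= G \<times> carrier E ==> rel_val E l \<in> carrier (free_mod E G)"
proof (induction l)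
 case Nil
 then show ?case using v_zero[OF module_free_mod[OF alg_module[OF E]], of G] by (simp add: rel_val_Nil)
next
 case (Cons p l)
 then obtain g e where p: "p = (g, e)" "g \<in> G" "e \<in> carrier E" "rel_val E l \<in> carrier (free_mod E G)" by auto
 then show ?case
  using v_add[OF module_free_mod[OF alg_module[OF E]] single_closed[OF alg_module[OF E] p(2,3)] p(4)]
  by (simp add: rel_val_Cons)
qed

text \<open>A kernel element is thus the value of some formal expression \<open>l\<close> and is hit
  by the basis element \<open>Rel l\<close>; exactness of the free resolution rests on this.\<close>

lemma rel_val_ex:
 assumes "f \<in> carrier (free_mod E G)"
 shows "\<exists>l. set l <= G \<times> carrier E \<and> f = rel_val E l"
 using assms alg_module[OF E]
proof (induction rule: free_induct)
 case zero
 show ?case by (rule exI[of _ "[]"]) (simp add: rel_val_Nil)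
next
 case (single g e)
 then show ?case using E
  by (intro exI[of _ "[(g, e)]"]) (auto simp: rel_val_Cons rel_val_Nil single_def)
next
 case (add f h)
 then obtain l l' where l: "set l <= G \<times> carrier E" "f = rel_val E l"
  and l': "set l' <= G \<times> carrier E" "h = rel_val E l'" by blast
 have "rel_val E (l @ l') = rel_val E l \<oplus>[free_mod E G] rel_val E l'"
  using l(1)
 proof (induction l)
  case Nil
  show ?case using rel_val_closed[OF l'(1)] E by (simp add: rel_val_Nil free_mod_carrier)
 next
  case (Cons p l)
  then show ?case
   using rel_val_closed[OF l'(1)] rel_val_closed[of l G] E
   by (cases p) (auto simp: rel_val_Cons free_mod_carrier single_def v_assoc)
 qed
 with l l' show ?case by (intro exI[of _ "l @ l'"]) auto
qed

end

context
 fixes L :: "('k, 'l) module" and V :: "('k, 'l, 'l, 'v) bimodule"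
 assumes L: "k_algebra K L" and V: "bimodule K L L V"
begin

abbreviation (input) "LE \<equiv> env K L L"
abbreviation (input) "el \<equiv> tens K K (kbimod L) (kbimod (opp_alg L))"
abbreviation (input) "ER \<equiv> env_right K V"
abbreviation (input) "PE \<equiv> res_mod LE ER"

text \<open>A right module over the enveloping algebra turned back into a bimodule:
  \<open>1 \<otimes> a\<close> acts from the left and \<open>a \<otimes> 1\<close> from the
  right.\<close>

definition resb :: "nat => ('k, 'l, 'l, (('l \<times> 'l => 'k) set, 'v) rgen => ('l \<times> 'l => 'k) set) bimodule" where
 "resb n = module.extend (module.truncate (PE n))
   \<lparr>lmult = (%a f. rmult (PE n) f (el \<one>[L] a)), rmult = (%f a. rmult (PE n) f (el a \<one>[L]))\<rparr>"

lemma LEa: "k_algebra K LE"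
 by (rule env_algebra[OF L L])

lemma LEm: "module K LE"
 by (rule alg_module[OF LEa])

lemma el_closed: "a \<in> carrier L ==> b \<in> carrier L ==> el a b \<in> carrier LE"
 by (rule et_closed[OF L L])

lemma el_one: "\<one>[LE] = el \<one>[L] \<one>[L]"
 by (rule env_simps(5)[OF L L])

lemma resb_simps: "carrier (resb n) = carrier (PE n)" "\<zero>[resb n] = \<zero>[PE n]" "f \<oplus>[resb n] h = f \<oplus>[PE n] h"
 "c \<odot>[resb n] f = c \<odot>[PE n] f" "lmult (resb n) a f = rmult (PE n) f (el \<one>[L] a)"
 "rmult (resb n) f a = rmult (PE n) f (el a \<one>[L])"
 by (simp_all add: resb_def)

lemma lin_resb: "lin K (resb n) W f = lin K (PE n) W f" "lin K W' (resb n) g = lin K W' (PE n) g"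
 by (simp_all add: resb_simps lin_def)

lemma PE_module: "module K (PE n)"
 unfolding res_mod_def by (rule module_free_mod[OF LEm])

lemma resb_bimodule: "bimodule K L L (resb n)"
proof (rule bmI)
 note c = fr_closed[OF LEa] and one = alg_one[OF L]
 show "module K (resb n)" by (rule module_cong[OF PE_module[of n]]) (simp_all add: resb_simps fun_eq_iff)
 show "lin K (resb n) (resb n) (lmult (resb n) a)" if "a \<in> carrier L" for a
  unfolding lin_resb using fr_lin[OF LEa el_closed[OF one that]] by (simp add: resb_def res_mod_def)
 show "lin K (resb n) (resb n) (%f. rmult (resb n) f a)" if "a \<in> carrier L" for a
  unfolding lin_resb using fr_lin[OF LEa el_closed[OF that one]] by (simp add: resb_simps res_mod_def)
 fix f assume "f \<in> carrier (resb n)"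
 then have f: "f \<in> carrier (free_mod LE (res_gens LE ER n))" by (simp add: resb_simps res_mod_def)
 show "lin K L (resb n) (%a. lmult (resb n) a f)"
  unfolding lin_resb resb_simps unfolding res_mod_def by (rule lin_comp[OF et_lin2[OF L L one] fr_lin2[OF LEa f]])
 show "lin K L (resb n) (rmult (resb n) f)"
  using lin_comp[OF et_lin1[OF L L one] fr_lin2[OF LEa f]]
  unfolding lin_resb unfolding resb_simps[abs_def] res_mod_def .
 show "lmult (resb n) \<one>[L] f = f" "rmult (resb n) f \<one>[L] = f"
  unfolding resb_simps res_mod_def el_one[symmetric] by (rule fr_one[OF LEa f])+
 fix a b assume a: "a \<in> carrier L" and b: "b \<in> carrier L"
 show "lmult (resb n) (a \<otimes>[L] b) f = lmult (resb n) a (lmult (resb n) b f)"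
  unfolding resb_simps res_mod_def fr_assoc[OF LEa f el_closed[OF one b] el_closed[OF one a]]
  using L a b by (simp add: env_mult[OF L L])
 show "rmult (resb n) f (a \<otimes>[L] b) = rmult (resb n) (rmult (resb n) f a) b"
  unfolding resb_simps res_mod_def fr_assoc[OF LEa f el_closed[OF a one] el_closed[OF b one]]
  using L a b by (simp add: env_mult[OF L L])
 show "rmult (resb n) (lmult (resb n) a f) b = lmult (resb n) a (rmult (resb n) f b)"
  unfolding resb_simps res_mod_def fr_assoc[OF LEa f el_closed[OF b one] el_closed[OF one a]]
   fr_assoc[OF LEa f el_closed[OF one a] el_closed[OF b one]]
  using L a b by (simp add: env_mult[OF L L])
qed (rule L)+

text \<open>The enveloping algebra is spanned by the \<open>r \<otimes> s\<close>, and
  \<open>r \<otimes> s\<close> acts as left multiplication by \<open>s\<close> followed by right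
  multiplication by \<open>r\<close>. Bimodule maps therefore respect the whole action.\<close>

lemma bhom_resb_act:
 assumes Y: "bimodule K L L Y" and f: "bhom K L L (resb n) Y f" and p: "p \<in> carrier (PE n)" and e: "e \<in> carrier LE"
 shows "f (rmult (PE n) p e) = rmult (env_right K Y) (f p) e"
proof (rule env_ind_lin[OF L L _ _ _ e])
 have p': "p \<in> carrier (free_mod LE (res_gens LE ER n))" using p by (simp add: res_mod_def)
 have fp: "f p \<in> carrier Y" using lin_closed[OF bhomD(1)[OF f]] p by (simp add: resb_simps)
 show "lin K LE Y (%e. f (rmult (PE n) p e))"
  using lin_comp[OF fr_lin2[OF LEa p'] bhomD(1)[OF f, unfolded lin_resb, unfolded res_mod_def]]
  by (simp only: res_mod_def)
 show "lin K LE Y (rmult (env_right K Y) (f p))" by (rule env_right_lin[OF L L Y fp])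
 fix r s assume rs: "r \<in> carrier L" "s \<in> carrier L"
 have "rmult (PE n) p (el r s) = rmult (resb n) (lmult (resb n) s p) r"
  unfolding resb_simps unfolding res_mod_def
  by (subst fr_assoc[OF LEa p']) (use rs L in \<open>simp_all add: el_closed env_mult[OF L L]\<close>)
 then have "f (rmult (PE n) p (el r s)) = rmult Y (lmult Y s (f p)) r"
  using rs p bm_lcl[OF resb_bimodule] by (simp add: bhomD(2,3)[OF f] resb_simps(1))
 then show "f (rmult (PE n) p (el r s)) = rmult (env_right K Y) (f p) (el r s)"
  by (simp add: env_right_et[OF L L Y fp rs])
qed

lemma bhom_act:
 assumes Y: "bimodule K L L Y" and Z: "bimodule K L L Z" and f: "bhom K L L Y Z f" and y: "y \<in> carrier Y"
  and e: "e \<in> carrier LE"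
 shows "f (rmult (env_right K Y) y e) = rmult (env_right K Z) (f y) e"
proof (rule env_ind_lin[OF L L _ _ _ e])
 have fy: "f y \<in> carrier Z" using lin_closed[OF bhomD(1)[OF f]] y by simp
 show "lin K LE Z (%e. f (rmult (env_right K Y) y e))"
  by (rule lin_comp[OF env_right_lin[OF L L Y y] bhomD(1)[OF f]])
 show "lin K LE Z (rmult (env_right K Z) (f y))" by (rule env_right_lin[OF L L Z fy])
 fix r s assume "r \<in> carrier L" "s \<in> carrier L"
 with y fy show "f (rmult (env_right K Y) y (el r s)) = rmult (env_right K Z) (f y) (el r s)"
  by (simp add: env_right_et[OF L L Y] env_right_et[OF L L Z] bhomD(2,3)[OF f] bm_lcl[OF Y])
qed

lemma resb_ext:
 assumes Y: "bimodule K L L Y" and z: "!!g. g \<in> res_gens LE ER n ==> z g \<in> carrier Y"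
 obtains \<psi> where "bhom K L L (resb n) Y \<psi>"
  "!!g e. g \<in> res_gens LE ER n ==> e \<in> carrier LE ==> \<psi> (single LE g e) = rmult (env_right K Y) (z g) e"
proof -
 let ?\<psi> = "lin_ext LE Y (rmult (env_right K Y)) z"
 note F = fr_ext[OF LEa bm_module[OF Y] env_right_lin[OF L L Y] env_right_lin2[OF L L Y] env_right_assoc[OF L L Y],
   where z=z and G="res_gens LE ER n"]
 have l: "lin K (free_mod LE (res_gens LE ER n)) Y ?\<psi>" by (rule F(1)) (auto simp: z)
 have a: "?\<psi> (rmult (free_mod LE (res_gens LE ER n)) f e) = rmult (env_right K Y) (?\<psi> f) e"
  if "f \<in> carrier (free_mod LE (res_gens LE ER n))" "e \<in> carrier LE" for f e
  by (rule F(3)) (use that z in auto)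
 have "bhom K L L (resb n) Y ?\<psi>"
 proof (rule bhomI)
  show "lin K (resb n) Y ?\<psi>" using l by (simp add: lin_resb res_mod_def)
  fix r f assume r: "r \<in> carrier L" and "f \<in> carrier (resb n)"
  then have f: "f \<in> carrier (free_mod LE (res_gens LE ER n))" by (simp add: resb_simps res_mod_def)
  then have fc: "?\<psi> f \<in> carrier Y" by (rule lin_closed[OF l])
  note one = alg_one[OF L]
  show "?\<psi> (lmult (resb n) r f) = lmult Y r (?\<psi> f)"
   unfolding resb_simps res_mod_def a[OF f el_closed[OF one r]]
   using env_right_et[OF L L Y fc one r] r fc by (simp add: bm_rone[OF Y] bm_lcl[OF Y])
  show "?\<psi> (rmult (resb n) f r) = rmult Y (?\<psi> f) r"
   unfolding resb_simps res_mod_def a[OF f el_closed[OF r one]]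
   using env_right_et[OF L L Y fc r one] r fc by (simp add: bm_lone[OF Y])
 qed
 moreover have "?\<psi> (single LE g e) = rmult (env_right K Y) (z g) e" if "g \<in> res_gens LE ER n" "e \<in> carrier LE" for g e
  by (rule F(2)) (use that z in auto)
 ultimately show thesis using that by blast
qed

text \<open>Preimages are chosen for the images of the basis elements and extended by
  freeness.\<close>

lemma resb_lifting:
 assumes Y: "bimodule K L L Y" and Y': "bimodule K L L Y'"
 shows "lifting K L (resb n) Y Y'"
 unfolding lifting_def
proof (intro allI impI, elim conjE)
 fix \<pi> \<phi> assume \<pi>: "bhom K L L Y Y' \<pi>" and \<phi>: "bhom K L L (resb n) Y' \<phi>"
  and im: "\<phi> ` carrier (resb n) <= \<pi> ` carrier Y"
 let ?G = "res_gens LE ER n"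
 have s: "single LE g e \<in> carrier (PE n)" if "g \<in> ?G" "e \<in> carrier LE" for g e
  unfolding res_mod_def by (rule single_closed[OF LEm that])
 have "\<forall>g\<in>?G. \<exists>y. y \<in> carrier Y \<and> \<pi> y = \<phi> (single LE g \<one>[LE])"
 proof
  fix g assume "g \<in> ?G"
  then have "\<phi> (single LE g \<one>[LE]) \<in> \<pi> ` carrier Y"
   using im s alg_one[OF LEa] by (auto simp: resb_simps)
  then show "\<exists>y. y \<in> carrier Y \<and> \<pi> y = \<phi> (single LE g \<one>[LE])" by auto
 qed
 from bchoice[OF this] obtain z where z: "!!g. g \<in> ?G ==> z g \<in> carrier Y" "!!g. g \<in> ?G ==> \<pi> (z g) = \<phi> (single LE g \<one>[LE])"
  by auto
 obtain \<psi> where \<psi>: "bhom K L L (resb n) Y \<psi>"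
  and v: "!!g e. g \<in> ?G ==> e \<in> carrier LE ==> \<psi> (single LE g e) = rmult (env_right K Y) (z g) e"
  by (rule resb_ext[where n=n and z=z, OF Y]) (use z in auto)
 have "\<pi> (\<psi> q) = \<phi> q" if q: "q \<in> carrier (resb n)" for q
 proof (rule free_lin_eq[where F="%q. \<pi> (\<psi> q)" and H=\<phi> and f=q, OF _ _ LEm bm_module[OF Y']])
  show "q \<in> carrier (free_mod LE ?G)" using q by (simp add: resb_simps res_mod_def)
  show "lin K (free_mod LE ?G) Y' (%q. \<pi> (\<psi> q))" "lin K (free_mod LE ?G) Y' \<phi>"
   using lin_comp[OF bhomD(1)[OF \<psi>] bhomD(1)[OF \<pi>]] bhomD(1)[OF \<phi>] by (simp_all add: lin_resb res_mod_def)
  fix g e assume g: "g \<in> ?G" and e: "e \<in> carrier LE"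
  have "\<pi> (\<psi> (single LE g e)) = rmult (env_right K Y') (\<phi> (single LE g \<one>[LE])) e"
   using g e z by (simp add: v bhom_act[OF Y Y' \<pi>])
  also have "\<dots> = \<phi> (rmult (PE n) (single LE g \<one>[LE]) e)"
   by (rule bhom_resb_act[OF Y' \<phi> s[OF g alg_one[OF LEa]] e, symmetric])
  also have "rmult (PE n) (single LE g \<one>[LE]) e = single LE g e"
   unfolding res_mod_def fr_single[OF LEa g alg_one[OF LEa] e] using LEa e by simp
  finally show "\<pi> (\<psi> (single LE g e)) = \<phi> (single LE g e)" .
 qed
 with \<psi> show "\<exists>\<psi>. bhom K L L (resb n) Y \<psi> \<and> (\<forall>q\<in>carrier (resb n). \<pi> (\<psi> q) = \<phi> q)" by blast
qed


text \<open>\<open>res_diff\<close> is defined once for all degrees, with values in the free module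
  on all formal generators. That it maps \<open>PE (Suc n)\<close> into \<open>PE n\<close> comes
  from the condition on labels in \<open>res_gens\<close>.\<close>

lemma res_diff_facts:
 shows "lin K (PE (Suc n)) (PE n) (res_diff LE)"
  and "Rel l \<in> res_gens LE ER (Suc n) ==> e \<in> carrier LE
   ==> res_diff LE (single LE (Rel l) e) = rmult (PE n) (rel_val LE l) e"
  and "f \<in> carrier (PE (Suc n)) ==> e \<in> carrier LE
   ==> res_diff LE (rmult (PE (Suc n)) f e) = rmult (PE n) (res_diff LE f) e"
proof -
 let ?G = "%n. res_gens LE ER n" and ?U = "free_mod LE (UNIV :: ((('l \<times> 'l => 'k) set, 'v) rgen) set)"
 have U: "module K ?U" by (rule module_free_mod[OF LEm])
 let ?z = "%g. case g of Gen x => \<zero>[?U] | Rel l => rel_val LE l"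
 have rv: "rel_val LE l \<in> carrier (free_mod LE (?G n))" if "Rel l \<in> ?G (Suc n)" for l
  using that by (intro rel_val_closed[OF LEa]) auto
 have z: "?z g \<in> carrier ?U" if "g \<in> ?G (Suc n)" for g
  using that rv by (auto simp: free_mod_carrier)
 note F = fr_ext[OF LEa U fr_lin2[OF LEa] fr_lin[OF LEa] fr_assoc[OF LEa, symmetric], where z="?z" and G="?G (Suc n)"]
 have D: "res_diff LE = lin_ext LE ?U (rmult ?U) ?z" by (rule ext) (simp add: res_diff_def)
 have l: "lin K (free_mod LE (?G (Suc n))) ?U (res_diff LE)" unfolding D by (rule F(1)) (auto simp: z)
 have s: "res_diff LE (single LE g e) = rmult ?U (?z g) e" if "g \<in> ?G (Suc n)" "e \<in> carrier LE" for g e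
  unfolding D by (rule F(2)) (use that z in auto)
 have c: "res_diff LE f \<in> carrier (free_mod LE (?G n))" if "f \<in> carrier (free_mod LE (?G (Suc n)))" for f
  using that LEm
 proof (induction rule: free_induct)
  case zero
  have "res_diff LE \<zero>[free_mod LE (?G (Suc n))] = \<zero>[free_mod LE (?G n)]"
   using lin_zero[OF l module_free_mod[OF LEm] U] by simp
  then show ?case using v_zero[OF module_free_mod[OF LEm], of "?G n"] by simp
 next
  case (single g e)
  then obtain l where l: "g = Rel l" by auto
  have "rmult ?U (rel_val LE l) e = rmult (free_mod LE (?G n)) (rel_val LE l) e" by simp
  with fr_closed[OF LEa rv single(2)] single l s show ?case by simp
 next
  case (add f h)
  have "res_diff LE (f \<oplus>[free_mod LE (?G (Suc n))] h) = res_diff LE f \<oplus>[free_mod LE (?G n)] res_diff LE h"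
   using lin_add[OF l add(1,2)] by simp
  with v_add[OF module_free_mod[OF LEm] add(3,4)] show ?case by simp
 qed
 show "lin K (PE (Suc n)) (PE n) (res_diff LE)"
  using l c by (auto simp: lin_def res_mod_def)
 show "res_diff LE (single LE (Rel l) e) = rmult (PE n) (rel_val LE l) e" if "Rel l \<in> ?G (Suc n)" "e \<in> carrier LE"
  using s[OF that] by (simp add: res_mod_def)
 show "res_diff LE (rmult (PE (Suc n)) f e) = rmult (PE n) (res_diff LE f) e"
  if f: "f \<in> carrier (PE (Suc n))" and e: "e \<in> carrier LE"
 proof -
  have "res_diff LE (rmult (free_mod LE (?G (Suc n))) f e) = rmult ?U (res_diff LE f) e"
   unfolding D by (rule F(3)) (use f e z in \<open>auto simp: res_mod_def\<close>)
  then show ?thesis by (simp add: res_mod_def)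
 qed
qed

lemma res_aug_facts:
 shows "lin K (PE 0) V (res_aug LE ER)"
  and "x \<in> carrier V ==> e \<in> carrier LE ==> res_aug LE ER (single LE (Gen x) e) = rmult ER x e"
  and "f \<in> carrier (PE 0) ==> e \<in> carrier LE
   ==> res_aug LE ER (rmult (PE 0) f e) = rmult ER (res_aug LE ER f) e"
proof -
 have U: "module K ER" using bm_module[OF V] by simp
 let ?z = "%g. case g of Gen x => x | Rel l => \<zero>[ER]"
 have z: "?z g \<in> carrier ER" if "g \<in> res_gens LE ER 0" for g
  using that by auto
 have ER_lin: "lin K W ER f = lin K W V f" "lin K ER W' h = lin K V W' h" for W f W' h
  by (simp_all add: lin_def)
 have D: "res_aug LE ER = lin_ext LE ER (rmult ER) ?z" by (rule ext) (simp add: res_aug_def)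
 have l1: "lin K LE ER (rmult ER v)" if "v \<in> carrier ER" for v
  using env_right_lin[OF L L V, of v] that by (simp add: ER_lin)
 have l2: "lin K ER ER (%v. rmult ER v e)" if "e \<in> carrier LE" for e
  using env_right_lin2[OF L L V, of e] that by (simp add: ER_lin)
 have as: "rmult ER v (e \<otimes>[LE] e') = rmult ER (rmult ER v e) e'"
  if "v \<in> carrier ER" "e \<in> carrier LE" "e' \<in> carrier LE" for v e e'
  using env_right_assoc[OF L L V, of v e e'] that by simp
 note F = fr_ext[OF LEa U l1 l2 as, where z="?z" and G="res_gens LE ER 0"]
 have l: "lin K (free_mod LE (res_gens LE ER 0)) ER (res_aug LE ER)" unfolding D by (rule F(1)) (use z in auto)
 then show "lin K (PE 0) V (res_aug LE ER)" by (simp add: res_mod_def ER_lin)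
 show "res_aug LE ER (single LE (Gen x) e) = rmult ER x e" if "x \<in> carrier V" "e \<in> carrier LE"
  unfolding D by (subst F(2)) (use that z in auto)
 show "res_aug LE ER (rmult (PE 0) f e) = rmult ER (res_aug LE ER f) e" if "f \<in> carrier (PE 0)" "e \<in> carrier LE"
  unfolding D res_mod_def by (rule F(3)) (use that z in \<open>auto simp: res_mod_def\<close>)
qed

lemma resb_diff: "bhom K L L (resb (Suc n)) (resb n) (res_diff LE)"
 by (rule bhomI) (simp_all add: lin_resb res_diff_facts resb_simps el_closed alg_one[OF L])

lemma resb_aug: "bhom K L L (resb 0) V (res_aug LE ER)"
proof (rule bhomI)
 note one = alg_one[OF L]
 fix a f assume a: "a \<in> carrier L" and "f \<in> carrier (resb 0)"
 then have f: "f \<in> carrier (PE 0)" by (simp add: resb_simps)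
 then have v: "res_aug LE ER f \<in> carrier V" by (rule lin_closed[OF res_aug_facts(1)])
 show "res_aug LE ER (lmult (resb 0) a f) = lmult V a (res_aug LE ER f)"
  using a v env_right_et[OF L L V v one a]
  by (simp add: resb_simps res_aug_facts(3)[OF f el_closed[OF one a]] bm_rone[OF V] bm_lcl[OF V])
 show "res_aug LE ER (rmult (resb 0) f a) = rmult V (res_aug LE ER f) a"
  using a v env_right_et[OF L L V v a one]
  by (simp add: resb_simps res_aug_facts(3)[OF f el_closed[OF a one]] bm_lone[OF V])
qed (simp add: lin_resb res_aug_facts)

lemma resb_zero: "\<zero>[resb n] = (%_. \<zero>[LE])"
 by (simp add: resb_simps res_mod_def)

lemma ER_one: "x \<in> carrier V ==> rmult ER x \<one>[LE] = x"
 unfolding el_one using L by (simp add: env_right_et[OF L L V] bm_lone[OF V] bm_rone[OF V])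

text \<open>The witness is the basis element whose label spells out \<open>p\<close> itself.\<close>

lemma res_boundary:
 assumes p: "p \<in> carrier (PE n)" and pz: "if n = 0 then res_aug LE ER p = \<zero>[V] else res_diff LE p = (%_. \<zero>[LE])"
 shows "p \<in> res_diff LE ` carrier (PE (Suc n))"
proof -
 from rel_val_ex[OF LEa p[unfolded res_mod_def]] obtain l where
  l: "set l <= res_gens LE ER n \<times> carrier LE" "p = rel_val LE l" by blast
 have g: "Rel l \<in> res_gens LE ER (Suc n)" using l(1) pz[unfolded l(2)] by (cases n) simp_all
 have "res_diff LE (single LE (Rel l) \<one>[LE]) = p"
  unfolding res_diff_facts(2)[OF g alg_one[OF LEa]] unfolding l(2)[symmetric]
  using fr_one[OF LEa] p by (simp add: res_mod_def)
 moreover have "single LE (Rel l) \<one>[LE] \<in> carrier (PE (Suc n))"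
  unfolding res_mod_def by (rule single_closed[OF LEm g alg_one[OF LEa]])
 ultimately show ?thesis by (metis imageI)
qed

text \<open>By the condition in \<open>res_gens\<close> the value of every label is a cycle, so the
  composite vanishes on the basis.\<close>

lemma res_cycle:
 assumes "q \<in> carrier (PE (Suc n))"
 shows "if n = 0 then res_aug LE ER (res_diff LE q) = \<zero>[V] else res_diff LE (res_diff LE q) = (%_. \<zero>[LE])"
proof (cases n)
 case 0
 have "res_aug LE ER (res_diff LE q) = \<zero>[V]"
 proof (rule free_lin_eq[where F="%q. res_aug LE ER (res_diff LE q)" and H="%q. \<zero>[V]" and f=q, OF _ _ LEm bm_module[OF V]])
  show "q \<in> carrier (free_mod LE (res_gens LE ER (Suc 0)))" using assms 0 by (simp add: res_mod_def)
  show "lin K (free_mod LE (res_gens LE ER (Suc 0))) V (%q. res_aug LE ER (res_diff LE q))"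
   using lin_comp[OF res_diff_facts(1) res_aug_facts(1)] by (simp add: res_mod_def)
  show "lin K (free_mod LE (res_gens LE ER (Suc 0))) V (%q. \<zero>[V])" using bm_module[OF V] by (rule lin_const_zero)
  fix g e assume g: "g \<in> res_gens LE ER (Suc 0)" and e: "e \<in> carrier LE"
  then obtain l where l: "g = Rel l" "set l <= res_gens LE ER 0 \<times> carrier LE" "res_aug LE ER (rel_val LE l) = \<zero>[V]" by auto
  have "rel_val LE l \<in> carrier (PE 0)" unfolding res_mod_def by (rule rel_val_closed[OF LEa l(2)])
  then show "res_aug LE ER (res_diff LE (single LE g e)) = \<zero>[V]"
   using g e l lin_zero[OF env_right_lin2[OF L L V e] bm_module[OF V] bm_module[OF V]]
   by (simp add: res_diff_facts(2) res_aug_facts(3) del: res_gens.simps)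
 qed
 then show ?thesis using 0 by simp
next
 case (Suc m)
 have "res_diff LE (res_diff LE q) = \<zero>[PE m]"
 proof (rule free_lin_eq[where F="%q. res_diff LE (res_diff LE q)" and H="%q. \<zero>[PE m]" and f=q, OF _ _ LEm PE_module])
  show "q \<in> carrier (free_mod LE (res_gens LE ER (Suc n)))" using assms by (simp add: res_mod_def)
  show "lin K (free_mod LE (res_gens LE ER (Suc n))) (PE m) (%q. res_diff LE (res_diff LE q))"
   using lin_comp[OF res_diff_facts(1) res_diff_facts(1)] Suc by (simp add: res_mod_def)
  show "lin K (free_mod LE (res_gens LE ER (Suc n))) (PE m) (%q. \<zero>[PE m])" using PE_module by (rule lin_const_zero)
  fix g e assume g: "g \<in> res_gens LE ER (Suc n)" and e: "e \<in> carrier LE"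
  then obtain l where l: "g = Rel l" "set l <= res_gens LE ER n \<times> carrier LE" "res_diff LE (rel_val LE l) = (%_. \<zero>[LE])"
   using Suc by auto
  have "rel_val LE l \<in> carrier (PE n)" unfolding res_mod_def by (rule rel_val_closed[OF LEa l(2)])
  then show "res_diff LE (res_diff LE (single LE g e)) = \<zero>[PE m]"
   using g e l Suc lin_zero[OF alg_lin1[OF LEa e] LEm LEm]
   by (simp add: res_diff_facts(2) res_diff_facts(3) del: res_gens.simps) (simp add: res_mod_def)
 qed
 then show ?thesis using Suc by (simp add: res_mod_def)
qed

theorem resb_resolution: "resolution K L V resb (%n. res_diff LE) (res_aug LE ER)"
proof (intro resolution.intro resolution_axioms.intro fld_axioms)
 show "bimodule K L L V" by (rule V)
 show "bimodule K L L (resb n)" for n by (rule resb_bimodule)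
 show "bhom K L L (resb (Suc n)) (resb n) (res_diff LE)" for n by (rule resb_diff)
 show "bhom K L L (resb 0) V (res_aug LE ER)" by (rule resb_aug)
 show "res_aug LE ER ` carrier (resb 0) = carrier V"
 proof
  show "res_aug LE ER ` carrier (resb 0) <= carrier V"
   using lin_closed[OF res_aug_facts(1)] by (auto simp: resb_simps)
  show "carrier V <= res_aug LE ER ` carrier (resb 0)"
  proof
   fix x assume x: "x \<in> carrier V"
   have "single LE (Gen x) \<one>[LE] \<in> carrier (resb 0)"
    unfolding resb_simps res_mod_def using x by (intro single_closed[OF LEm] alg_one[OF LEa]) simp
   moreover have "res_aug LE ER (single LE (Gen x) \<one>[LE]) = x"
    unfolding res_aug_facts(2)[OF x alg_one[OF LEa]] by (rule ER_one[OF x])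
   ultimately show "x \<in> res_aug LE ER ` carrier (resb 0)" by (metis imageI)
  qed
 qed
 show "res_aug LE ER p = \<zero>[V] \<longleftrightarrow> p \<in> res_diff LE ` carrier (resb (Suc 0))" if "p \<in> carrier (resb 0)" for p
  using res_boundary[of p 0] res_cycle[of _ 0] that by (auto simp: resb_simps)
 show "res_diff LE p = \<zero>[resb n] \<longleftrightarrow> p \<in> res_diff LE ` carrier (resb (Suc (Suc n)))" if "p \<in> carrier (resb (Suc n))" for n p
  using res_boundary[of p "Suc n"] res_cycle[of _ "Suc n"] that by (auto simp: resb_simps(1) resb_zero)
qed

end
end

section \<open>Tor with coefficients in the algebra\<close>

context fld
begin

lemma regular_bimodule:
 assumes L: "k_algebra K L"
 shows "bimodule K L L (regular L)"
 using L by (intro bmI) (simp_all add: alg_assoc alg_lin1 alg_lin2)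

context
 fixes L :: "('k, 'l) module" and V :: "('k, 'l, 'l, 'v) bimodule"
 assumes L: "k_algebra K L" and V: "bimodule K L L V"
begin

abbreviation (input) "Le \<equiv> env K L L"
abbreviation (input) "ell \<equiv> tens K K (kbimod L) (kbimod (opp_alg L))"
abbreviation (input) "Rv \<equiv> env_right K V"
abbreviation (input) "Pr \<equiv> res_mod Le Rv"
abbreviation (input) "RY \<equiv> env_left K (regular L)"
abbreviation (input) "RB \<equiv> resb L V"
abbreviation (input) "TM \<equiv> %n. tensor K Le (Pr n) RY"
abbreviation (input) "tm \<equiv> %n. tens K Le (Pr n) RY"

lemma RYm: "module K RY"
 using L by simp

lemma lin_RY: "lin K W RY f = lin K W L f" "lin K RY W' h = lin K L W' h"
 by (simp_all add: lin_def)

lemma RY_act: "y \<in> carrier L ==> r \<in> carrier L ==> s \<in> carrier L ==> lmult RY (ell r s) y = r \<otimes>[L] y \<otimes>[L] s"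
 using env_left_et[OF L L regular_bimodule[OF L], of y r s] by simp

lemma RY_lin: "y \<in> carrier L ==> lin K Le L (%e. lmult RY e y)"
 using env_left_lin[OF L L regular_bimodule[OF L], of y] by simp

lemma RY_closed: "y \<in> carrier L ==> e \<in> carrier Le ==> lmult RY e y \<in> carrier L"
 by (rule lin_closed[OF RY_lin])

lemma PE_act: "f \<in> carrier (Pr n) ==> e \<in> carrier Le ==> rmult (Pr n) f e \<in> carrier (Pr n)"
 unfolding res_mod_def by (rule fr_closed[OF LEa[OF L V]])

lemma TM_tensorable: "tensorable K Le (Pr n) RY"
 using L RYm PE_act RY_closed PE_module[OF L V] by (simp add: tensorable_def)

lemma TM_module: "module K (TM n)"
 by (rule tensor_module[OF TM_tensorable])


text \<open>The map \<open>p \<mapsto> p \<otimes> 1\<close>. It is onto, since \<open>y\<close> in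
  \<open>L\<close> is \<open>y \<otimes> 1\<close> applied to the unit, so that
  \<open>f \<otimes> y\<close> is \<open>f (y \<otimes> 1) \<otimes> 1\<close>.\<close>

definition pt :: "nat => ((('l \<times> 'l => 'k) set, 'v) rgen => ('l \<times> 'l => 'k) set)
  => (((('l \<times> 'l => 'k) set, 'v) rgen => ('l \<times> 'l => 'k) set) \<times> 'l => 'k) set" where
 "pt n f = tm n f \<one>[L]"

lemma pt_lin: "lin K (Pr n) (TM n) (pt n)"
 unfolding pt_def[abs_def] using tens_lin1[OF TM_tensorable] L by simp

lemma tm_pt: "f \<in> carrier (Pr n) ==> y \<in> carrier L ==> tm n f y = pt n (rmult (Pr n) f (ell y \<one>[L]))"
 unfolding pt_def using L
 by (subst tens_balance[OF TM_tensorable]) (simp_all add: el_closed[OF L V] RY_act)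

lemma pt_ex: "u \<in> carrier (TM n) ==> \<exists>p\<in>carrier (Pr n). u = pt n p"
proof (induction rule: tensor_induct[OF TM_tensorable, consumes 1, case_names gen add])
 case (gen f y)
 then show ?case using tm_pt[of f n y] PE_act[of f n "ell y \<one>[L]"] L by (auto simp: el_closed[OF L V])
next
 case (add u v)
 then obtain p q where "p \<in> carrier (Pr n)" "u = pt n p" "q \<in> carrier (Pr n)" "v = pt n q" by blast
 then show ?case
  using lin_add[OF pt_lin, of p n q] v_add[OF PE_module[OF L V], of p n q]
  by (intro bexI[of _ "p \<oplus>[Pr n] q"]) simp_all
qed

text \<open>Both sides are \<open>f \<otimes> a\<close>, because \<open>1 \<otimes> a\<close> and
  \<open>a \<otimes> 1\<close> send the unit of \<open>L\<close> to the same element.\<close>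

lemma pt_comm: "f \<in> carrier (Pr n) ==> a \<in> carrier L ==> pt n (lmult (RB n) a f) = pt n (rmult (RB n) f a)"
proof -
 assume f: "f \<in> carrier (Pr n)" and a: "a \<in> carrier L"
 have "pt n (rmult (Pr n) f (ell \<one>[L] a)) = tm n f a"
  unfolding pt_def using L a f
  by (subst tens_balance[OF TM_tensorable]) (simp_all add: el_closed[OF L V] RY_act)
 then show ?thesis using f a by (simp add: resb_simps[OF L V] tm_pt)
qed

text \<open>\<open>P\<^sub>n \<otimes> L\<close> is \<open>P\<^sub>n / [L, P\<^sub>n]\<close>, by \<open>f \<otimes> y \<mapsto> [f y]\<close>.\<close>

lemma pt_quot:
 shows "lin K (TM n) (H0 K L (RB n)) (plift K (H0 K L (RB n))
   (%(f, y). commutator_span K L (RB n) +>[RB n] rmult (Pr n) f (ell y \<one>[L])))"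
  and "p \<in> carrier (Pr n) ==> plift K (H0 K L (RB n))
   (%(f, y). commutator_span K L (RB n) +>[RB n] rmult (Pr n) f (ell y \<one>[L])) (pt n p)
   = commutator_span K L (RB n) +>[RB n] p"
proof -
 note B = resb_bimodule[OF L V, of n]
 let ?h = "%p. commutator_span K L (RB n) +>[RB n] p"
 let ?\<phi> = "%f y. ?h (rmult (Pr n) f (ell y \<one>[L]))"
 note one = alg_one[OF L]
 have hl: "lin K (Pr n) (H0 K L (RB n)) ?h" using hcl_lin[OF B] by (simp add: lin_resb[OF L V])
 have as: "rmult (Pr n) (rmult (Pr n) f e) e' = rmult (Pr n) f (e \<otimes>[Le] e')"
  if "f \<in> carrier (Pr n)" "e \<in> carrier Le" "e' \<in> carrier Le" for f e e'
  using fr_assoc[OF LEa[OF L V]] that by (simp add: res_mod_def)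
 have l1: "lin K (Pr n) (Pr n) (%f. rmult (Pr n) f e)" if "e \<in> carrier Le" for e
  unfolding res_mod_def by (rule fr_lin[OF LEa[OF L V] that])
 have l2: "lin K Le (Pr n) (rmult (Pr n) f)" if "f \<in> carrier (Pr n)" for f
  using fr_lin2[OF LEa[OF L V]] that unfolding res_mod_def .
 have b: "balanced K Le (Pr n) RY (H0 K L (RB n)) ?\<phi>"
 proof (rule balancedI)
  fix f assume f: "f \<in> carrier (Pr n)"
  show "lin K RY (H0 K L (RB n)) (?\<phi> f)"
   unfolding lin_RY by (rule lin_comp[OF lin_comp[OF et_lin1[OF L L one] l2[OF f]] hl])
 next
  fix y assume y: "y \<in> carrier RY"
  then show "lin K (Pr n) (H0 K L (RB n)) (%f. ?\<phi> f y)"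
   by (intro lin_comp[OF l1 hl] el_closed[OF L V] one) simp
 next
  fix f e y assume f: "f \<in> carrier (Pr n)" and e: "e \<in> carrier Le" and "y \<in> carrier RY"
  then have y: "y \<in> carrier L" by simp
  \<comment> \<open>By linearity \<open>e\<close> may be taken as \<open>r \<otimes> s\<close>. The
    two sides then differ in whether \<open>s\<close> acts from the left or from the right, which a
    commutator repairs.\<close>
  show "?\<phi> (rmult (Pr n) f e) y = ?\<phi> f (lmult RY e y)"
  proof (rule env_ind_lin[OF L L _ _ _ e])
   show "lin K Le (H0 K L (RB n)) (%e. ?\<phi> (rmult (Pr n) f e) y)"
    by (rule lin_comp[OF lin_comp[OF l2[OF f] l1[OF el_closed[OF L V y one]]] hl])
   show "lin K Le (H0 K L (RB n)) (%e. ?\<phi> f (lmult RY e y))"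
    by (rule lin_comp[OF lin_comp[OF lin_comp[OF RY_lin[OF y] et_lin1[OF L L one]] l2[OF f]] hl])
   fix r s assume rs: "r \<in> carrier L" "s \<in> carrier L"
   let ?q = "rmult (Pr n) f (ell (r \<otimes>[L] y) \<one>[L])"
   have q: "?q \<in> carrier (RB n)" using f rs y L by (simp add: resb_simps[OF L V] PE_act el_closed[OF L V])
   have "?\<phi> (rmult (Pr n) f (ell r s)) y = ?h (lmult (RB n) s ?q)"
    using f rs y L by (simp add: resb_simps[OF L V] as el_closed[OF L V] env_mult[OF L L])
   also have "\<dots> = ?h (rmult (RB n) ?q s)" by (rule hcl_comm[OF B rs(2) q])
   also have "\<dots> = ?\<phi> f (lmult RY (ell r s) y)"
    using f rs y L by (simp add: resb_simps[OF L V] as el_closed[OF L V] env_mult[OF L L] RY_act)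
   finally show "?\<phi> (rmult (Pr n) f (ell r s)) y = ?\<phi> f (lmult RY (ell r s) y)" .
  qed
 qed
 note T = tensor_lift[OF TM_tensorable H0_module[OF B] b]
 show "lin K (TM n) (H0 K L (RB n)) (plift K (H0 K L (RB n)) (%(f, y). ?\<phi> f y))" by (rule T(1))
 assume p: "p \<in> carrier (Pr n)"
 have "rmult (Pr n) p (ell \<one>[L] \<one>[L]) = p"
  using fr_one[OF LEa[OF L V]] p unfolding el_one[OF L V] res_mod_def by blast
 then show "plift K (H0 K L (RB n)) (%(f, y). ?\<phi> f y) (pt n p) = ?h p"
  unfolding pt_def using T(2)[OF p, of "\<one>[L]"] L by simp
qed

text \<open>\<open>pt\<close> kills commutators, and \<open>pt_quot\<close> followed after
  \<open>pt\<close> returns the class modulo commutators.\<close>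

lemma pt_zero_iff:
 assumes p: "p \<in> carrier (Pr n)"
 shows "pt n p = \<zero>[TM n] \<longleftrightarrow> p \<in> commutator_span K L (RB n)"
proof
 note B = resb_bimodule[OF L V, of n]
 assume "pt n p = \<zero>[TM n]"
 then have "commutator_span K L (RB n) +>[RB n] p = \<zero>[H0 K L (RB n)]"
  using pt_quot(2)[OF p] lin_zero[OF pt_quot(1) TM_module H0_module[OF B]] by simp
 then show "p \<in> commutator_span K L (RB n)"
  using hcl_zero_iff[OF B] p by (simp add: resb_simps[OF L V])
next
 note B = resb_bimodule[OF L V, of n]
 have l: "lin K (RB n) (TM n) (pt n)" using pt_lin by (simp add: lin_resb[OF L V])
 assume "p \<in> commutator_span K L (RB n)"
 then show "pt n p = \<zero>[TM n]"
  by (rule com_lin_zero[OF B l TM_module, rotated]) (simp add: pt_comm resb_simps(1)[OF L V])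
qed

lemma tor_diff_lin: "lin K (TM (Suc n)) (TM n) (tor_diff K Le Rv RY n)"
 and tor_diff_pt: "p \<in> carrier (Pr (Suc n)) ==> tor_diff K Le Rv RY n (pt (Suc n) p) = pt n (res_diff Le p)"
proof -
 have e: "tor_diff K Le Rv RY n = plift K (TM n) (%(f, y). tm n (res_diff Le f) y)"
  by (simp add: tor_diff_def tor_mod_def)
 have b: "balanced K Le (Pr (Suc n)) RY (TM n) (%f y. tm n (res_diff Le f) y)"
  by (rule tens_map[OF TM_tensorable res_diff_facts(1)[OF L V] lin_ident])
    (simp_all add: res_diff_facts(3)[OF L V])
 note T = tensor_lift[OF TM_tensorable TM_module b]
 show "lin K (TM (Suc n)) (TM n) (tor_diff K Le Rv RY n)" unfolding e by (rule T(1))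
 show "tor_diff K Le Rv RY n (pt (Suc n) p) = pt n (res_diff Le p)" if "p \<in> carrier (Pr (Suc n))"
  unfolding e pt_def using T(2)[OF that, of "\<one>[L]"] L by simp
qed

abbreviation (input) "rcy \<equiv> resolution.rcyc K L RB (%n. res_diff Le)"

text \<open>The cycle condition is pulled back along \<open>pt\<close>; the kernel of
  \<open>pt\<close> is the commutator span, which is the condition in \<open>rcyc\<close>.\<close>

lemma tor_cycles_eq: "tor_cycles K Le Rv RY n = pt n ` rcy n"
proof -
 interpret R: resolution K L V RB "%n. res_diff Le" "res_aug Le Rv"
  by (rule resb_resolution[OF L V])
 have iff: "pt n p \<in> tor_cycles K Le Rv RY n \<longleftrightarrow> p \<in> rcy n" if p: "p \<in> carrier (Pr n)" for p
 proof (cases n)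
  case 0
  then show ?thesis using p lin_closed[OF pt_lin p]
   by (simp add: tor_cycles_def R.rcyc_def resb_simps[OF L V] tor_mod_def)
 next
  case (Suc m)
  then show ?thesis using p lin_closed[OF pt_lin p] lin_closed[OF res_diff_facts(1)[OF L V]]
   by (simp add: tor_cycles_def R.rcyc_def resb_simps(1)[OF L V] tor_mod_def tor_diff_pt pt_zero_iff)
 qed
 have sub: "tor_cycles K Le Rv RY n <= carrier (TM n)"
  by (cases n) (auto simp: tor_cycles_def tor_mod_def)
 have rc: "p \<in> carrier (Pr n)" if "p \<in> rcy n" for p
  using that by (simp add: R.rcyc_def resb_simps(1)[OF L V])
 show ?thesis
 proof (intro equalityI subsetI)
  fix u assume u: "u \<in> tor_cycles K Le Rv RY n"
  from pt_ex[OF subsetD[OF sub u]] obtain p where "p \<in> carrier (Pr n)" "u = pt n p" by (elim bexE)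
  with u iff[of p] show "u \<in> pt n ` rcy n" by simp
 next
  fix u assume "u \<in> pt n ` rcy n"
  then obtain p where "p \<in> rcy n" "u = pt n p" by (elim imageE)
  with iff[of p] rc show "u \<in> tor_cycles K Le Rv RY n" by simp
 qed
qed

text \<open>\<open>pt\<close> matches cycles with \<open>rcyc\<close> and boundaries with values of
  the differential up to commutators, so a description of the homology of \<open>P / [L, P]\<close>
  becomes one of \<open>Tor\<close>.\<close>

theorem Tor_iso:
 assumes H: "module K H" and \<Theta>: "lin K (RB n) H \<Theta>" and im: "\<Theta> ` rcy n = Z"
  and ker: "!!p. p \<in> rcy n ==> \<Theta> p = \<zero>[H] \<longleftrightarrow>
   (\<exists>c\<in>commutator_span K L (RB n). \<exists>p'\<in>carrier (RB (Suc n)). p = c \<oplus>[RB n] res_diff Le p')"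
 shows "vs_iso K (Tor K Le n Rv RY) (H\<lparr>carrier := Z\<rparr>)"
proof -
 interpret R: resolution K L V RB "%n. res_diff Le" "res_aug Le Rv"
  by (rule resb_resolution[OF L V])
 note B = resb_bimodule[OF L V]
 let ?cyc = "tor_cycles K Le Rv RY n" and ?d = "tor_diff K Le Rv RY"
 let ?com = "%n. commutator_span K L (RB n)"
 have rc: "rcy n <= carrier (RB n)" by (auto simp: R.rcyc_def)
 have com_rc: "c \<oplus>[RB n] res_diff Le q \<in> rcy n" if c: "c \<in> ?com n" and q: "q \<in> carrier (RB (Suc n))" for c q
 proof -
  have cn: "c \<in> carrier (RB n)" using c v_submoduleD(1)[OF R.mP com_sub[OF B]] by blast
  note dc = lin_closed[OF R.d_lin]
  show ?thesis
  proof (cases n)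
   case (Suc m)
   have "res_diff Le (c \<oplus>[RB n] res_diff Le q) = res_diff Le c"
    using R.d_zc[OF q] q cn Suc dc lin_add[OF R.d_lin, of c m "res_diff Le q"] by (simp add: R.zc_def)
   then show ?thesis using bhom_com[OF B B resb_diff[OF L V], of c] c q cn Suc dc by (simp add: R.rcyc_def)
  qed (use cn q dc in \<open>auto simp: R.rcyc_def\<close>)
 qed
 \<comment> \<open>A commutator \<open>c\<close> equals \<open>c\<close> plus the differential of
   zero, so \<open>ker\<close> applies and \<open>\<Theta>\<close> factors through the commutator
   quotient.\<close>
 have ker_com: "\<Theta> c = \<zero>[H]" if c: "c \<in> ?com n" for c
 proof -
  have z: "\<zero>[RB (Suc n)] \<in> carrier (RB (Suc n))" by (rule v_zero[OF R.mP])
  have e: "c = c \<oplus>[RB n] res_diff Le \<zero>[RB (Suc n)]"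
   using subsetD[OF v_submoduleD(1)[OF R.mP com_sub[OF B]] c] lin_zero[OF R.d_lin R.mP R.mP, of n]
   by (simp add: v_r_zero[OF R.mP])
  show ?thesis using ker[of c] com_rc[OF c z] e c z by auto
 qed
 have \<Theta>com: "\<Theta> (lmult (RB n) b z) = \<Theta> (rmult (RB n) z b)" if "b \<in> carrier L" "z \<in> carrier (RB n)" for b z
  using ker_com[OF com_in[OF B that]] that H lin_closed[OF \<Theta>] bm_lcl[OF B] bm_rcl[OF B]
  by (simp add: lin_minus[OF \<Theta> R.mP H] v_minus_eq_zero)
 have HL: "lin K (H0 K L (RB n)) H (%U. \<Theta> (SOME z. z \<in> U))"
  by (rule H0_lift(1)[where B=L and Z="RB n", OF B \<Theta> H]) (rule \<Theta>com)
 have Hv: "\<Theta> (SOME y. y \<in> ?com n +>[RB n] z) = \<Theta> z" if "z \<in> carrier (RB n)" for z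
  by (rule H0_lift(2)[where B=L and Z="RB n", OF B \<Theta> H _ that]) (rule \<Theta>com)
 define F where "F = (%u. (%U. \<Theta> (SOME z. z \<in> U)) (plift K (H0 K L (RB n))
   (%(f, y). ?com n +>[RB n] rmult (Pr n) f (ell y \<one>[L])) u))"
 have Fl: "lin K (TM n) H F"
  unfolding F_def by (rule lin_comp[OF pt_quot(1) HL])
 have Fp: "F (pt n p) = \<Theta> p" if "p \<in> carrier (RB n)" for p
  unfolding F_def using that Hv[OF that] pt_quot(2)[of p n] by (simp add: resb_simps[OF L V])
 have cs: "submodule ?cyc K (TM n)"
 proof (cases n)
  case 0
  then show ?thesis using v_submodule_carrier[OF TM_module] by (simp add: tor_cycles_def tor_mod_def)
 next
  case (Suc m)
  then show ?thesis using lin_ker[OF tor_diff_lin TM_module TM_module] by (simp add: tor_cycles_def tor_mod_def)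
 qed
 note csD = v_submoduleD[OF TM_module cs]
 let ?T = "(TM n)\<lparr>carrier := ?cyc\<rparr>"
 have Tm: "module K ?T" by (rule v_submodule_module[OF TM_module cs])
 have Zs: "submodule Z K H"
 proof -
  have "F ` ?cyc = Z" unfolding tor_cycles_eq image_image im[symmetric] by (rule image_cong) (use rc Fp in auto)
  then show ?thesis using lin_image[OF Fl TM_module H cs] by simp
 qed
 let ?Bd = "?d n ` carrier (TM (Suc n))"
 have Bd: "?Bd = {pt n (res_diff Le q) |q. q \<in> carrier (RB (Suc n))}"
 proof (intro equalityI subsetI)
  fix u assume "u \<in> ?Bd"
  then obtain w where w: "w \<in> carrier (TM (Suc n))" "u = ?d n w" by blast
  from pt_ex[OF w(1)] obtain q where "q \<in> carrier (Pr (Suc n))" "w = pt (Suc n) q" by blast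
  then show "u \<in> {pt n (res_diff Le q) |q. q \<in> carrier (RB (Suc n))}"
   using w(2) tor_diff_pt[of q n] by (auto simp: resb_simps(1)[OF L V])
 next
  fix u assume "u \<in> {pt n (res_diff Le q) |q. q \<in> carrier (RB (Suc n))}"
  then obtain q where q: "q \<in> carrier (Pr (Suc n))" "u = pt n (res_diff Le q)"
   by (auto simp: resb_simps(1)[OF L V])
  then show "u \<in> ?Bd"
   by (intro image_eqI[of _ _ "pt (Suc n) q"] lin_closed[OF pt_lin]) (simp_all add: tor_diff_pt)
 qed
 have zc: "\<zero>[RB n] \<in> ?com n" by (rule v_submoduleD(2)[OF R.mP com_sub[OF B]])
 have Bcyc: "?Bd <= ?cyc"
 proof
  fix u assume "u \<in> ?Bd"
  then obtain q where q: "q \<in> carrier (RB (Suc n))" "u = pt n (res_diff Le q)" by (auto simp: Bd)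
  from com_rc[OF zc q(1)] lin_closed[OF R.d_lin q(1)] have "res_diff Le q \<in> rcy n" by simp
  with q show "u \<in> ?cyc" by (auto simp: tor_cycles_eq)
 qed
 have Bs: "submodule ?Bd K ?T"
 proof -
  note D = v_submoduleD[OF TM_module lin_image[OF tor_diff_lin TM_module TM_module v_submodule_carrier[OF TM_module]]]
  show ?thesis
   by (rule v_submoduleI[OF Tm]) (use D(2-4) Bcyc in auto)
 qed
 have "vs_iso K (quot_mod ?T ?Bd) (H\<lparr>carrier := Z\<rparr>)"
 proof (rule vs_iso_quot[OF Tm Bs v_submodule_module[OF H Zs], where f=F])
  have FZ: "F ` ?cyc = Z" unfolding tor_cycles_eq image_image im[symmetric] by (rule image_cong) (use rc Fp in auto)
  then show "F ` carrier ?T = carrier (H\<lparr>carrier := Z\<rparr>)" by simp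
  show "lin K ?T (H\<lparr>carrier := Z\<rparr>) F"
   using FZ csD(1) by (intro linI) (auto simp: lin_add[OF Fl] lin_smult[OF Fl] subset_iff)
  fix u assume "u \<in> carrier ?T"
  then obtain p where p: "p \<in> rcy n" "u = pt n p" by (auto simp: tor_cycles_eq)
  then have pc: "p \<in> carrier (RB n)" using rc by blast
  have "F u = \<zero>[H] \<longleftrightarrow> (\<exists>c\<in>?com n. \<exists>q\<in>carrier (RB (Suc n)). p = c \<oplus>[RB n] res_diff Le q)"
   using ker[OF p(1)] Fp[OF pc] p(2) by simp
  also have "\<dots> \<longleftrightarrow> (\<exists>q\<in>carrier (RB (Suc n)). pt n p = pt n (res_diff Le q))"
  proof -
   have "pt n p = pt n (res_diff Le q) \<longleftrightarrow> (\<exists>c\<in>?com n. p = c \<oplus>[RB n] res_diff Le q)" if q: "q \<in> carrier (RB (Suc n))" for q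
   proof -
    note dq = lin_closed[OF R.d_lin q]
    have pl: "lin K (RB n) (TM n) (pt n)" using pt_lin by (simp add: lin_resb[OF L V])
    have "pt n p = pt n (res_diff Le q) \<longleftrightarrow> pt n (p \<ominus>[RB n] res_diff Le q) = \<zero>[TM n]"
     using pc dq lin_closed[OF pl] TM_module by (simp add: lin_minus[OF pl R.mP TM_module] v_minus_eq_zero)
    also have "\<dots> \<longleftrightarrow> p \<ominus>[RB n] res_diff Le q \<in> ?com n"
     by (rule pt_zero_iff) (use v_minus[OF R.mP pc dq] in \<open>simp add: resb_simps(1)[OF L V]\<close>)
    also have "\<dots> \<longleftrightarrow> (\<exists>c\<in>?com n. p = c \<oplus>[RB n] res_diff Le q)"
    proof
     assume in_com: "p \<ominus>[RB n] res_diff Le q \<in> ?com n"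
     have "p = (p \<ominus>[RB n] res_diff Le q) \<oplus>[RB n] res_diff Le q"
      using v_minus_iff[OF R.mP pc dq v_minus[OF R.mP pc dq]] v_comm[OF R.mP dq v_minus[OF R.mP pc dq]] by simp
     then show "\<exists>c\<in>?com n. p = c \<oplus>[RB n] res_diff Le q" by (rule bexI[OF _ in_com])
    next
     assume "\<exists>c\<in>?com n. p = c \<oplus>[RB n] res_diff Le q"
     then obtain c where c: "c \<in> ?com n" "p = c \<oplus>[RB n] res_diff Le q" by (elim bexE)
     have cc: "c \<in> carrier (RB n)" using subsetD[OF v_submoduleD(1)[OF R.mP com_sub[OF B]] c(1)] .
     show "p \<ominus>[RB n] res_diff Le q \<in> ?com n"
      using c(1) iffD2[OF v_minus_iff[OF R.mP pc dq cc]] v_comm[OF R.mP dq cc] c(2) by simp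
    qed
    finally show ?thesis .
   qed
   then show ?thesis by blast
  qed
  also have "\<dots> \<longleftrightarrow> u \<in> ?Bd" using p(2) by (auto simp: Bd)
  finally show "F u = \<zero>[H\<lparr>carrier := Z\<rparr>] \<longleftrightarrow> u \<in> ?Bd" by simp
 qed
 then show ?thesis by (simp add: Tor_def tor_mod_def)
qed

end
end

section \<open>Square-zero extensions\<close>

definition dsum :: "('k, 'v, 'y) module_scheme => ('k, 'w, 'z) module_scheme => ('k, 'v \<times> 'w) module" where
 "dsum V W = \<lparr>carrier = carrier V \<times> carrier W, monoid.mult = undefined, monoid.one = undefined,
   ring.zero = (\<zero>[V], \<zero>[W]), ring.add = (%p q. (fst p \<oplus>[V] fst q, snd p \<oplus>[W] snd q)),
   smult = (%c p. (c \<odot>[V] fst p, c \<odot>[W] snd p))\<rparr>"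

lemma dsum_simps [simp]: "carrier (dsum V W) = carrier V \<times> carrier W" "\<zero>[dsum V W] = (\<zero>[V], \<zero>[W])"
  "p \<oplus>[dsum V W] q = (fst p \<oplus>[V] fst q, snd p \<oplus>[W] snd q)"
  "c \<odot>[dsum V W] p = (c \<odot>[V] fst p, c \<odot>[W] snd p)"
 by (simp_all add: dsum_def)


context fld
begin

lemma dsum_module [simp]:
 assumes V: "module K V" and W: "module K W"
 shows "module K (dsum V W)"
proof (rule moduleI[OF is_cring_K])
 show "abelian_group (dsum V W)"
 proof (rule abelian_groupI)
  fix p assume "p \<in> carrier (dsum V W)"
  with V W show "\<exists>q\<in>carrier (dsum V W). q \<oplus>[dsum V W] p = \<zero>[dsum V W]"
   by (intro bexI[of _ "(\<ominus>[V] fst p, \<ominus>[W] snd p)"]) auto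
 qed (use V W in \<open>auto simp: v_assoc intro: v_comm\<close>)
qed (use V W in \<open>auto simp: v_smult_l_distr v_smult_r_distr v_smult_assoc\<close>)

lemma sub_bimodule:
 assumes V: "bimodule K R S V" and H: "submodule H K V"
  and l: "!!r v. r \<in> carrier R ==> v \<in> H ==> lmult V r v \<in> H"
  and r: "!!s v. s \<in> carrier S ==> v \<in> H ==> rmult V v s \<in> H"
 shows "bimodule K R S (V\<lparr>carrier := H\<rparr>)"
proof -
 have Hc: "v \<in> carrier V" if "v \<in> H" for v using that v_submoduleD(1)[OF bm_module[OF V] H] by blast
 show ?thesis
  by (rule bmI) (auto intro!: linI v_submodule_module[OF bm_module[OF V] H] bm_alg[OF V] l r
   simp: Hc bm_ladd[OF V] bm_radd[OF V] bm_laddl[OF V] bm_raddr[OF V] bm_lsm[OF V] bm_rsm[OF V]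
    bm_lsml[OF V] bm_rsmr[OF V] bm_lassoc[OF V] bm_rassoc[OF V] bm_lone[OF V] bm_rone[OF V] bm_lr[OF V])
qed

end

text \<open>\<open>C\<close> is the record \<open>L\<close> with a smaller carrier, so the two share
  all operations. The splitting is encoded by the projections \<open>pc\<close> and
  \<open>pi\<close>.\<close>

locale square_zero = fld K for K :: "('k, 'x) ring_scheme" (structure) +
 fixes L :: "('k, 'l) module" and C :: "('k, 'l) module" and I :: "'l set" and pc pi :: "'l => 'l"
 assumes L: "k_algebra K L" and Ceq: "C = L\<lparr>carrier := carrier C\<rparr>"
  and Csub: "submodule (carrier C) K L" and C_one: "\<one>[L] \<in> carrier C"
  and C_mult: "c \<in> carrier C ==> c' \<in> carrier C ==> c \<otimes>[L] c' \<in> carrier C"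
  and Isub: "submodule I K L" and CI: "c \<in> carrier C ==> i \<in> I ==> c \<otimes>[L] i \<in> I"
  and IC: "c \<in> carrier C ==> i \<in> I ==> i \<otimes>[L] c \<in> I"
  and II: "i \<in> I ==> j \<in> I ==> i \<otimes>[L] j = \<zero>[L]"
  and pc_lin: "lin K L C pc" and pi_lin: "lin K L (L\<lparr>carrier := I\<rparr>) pi"
  and decomp: "x \<in> carrier L ==> x = pc x \<oplus>[L] pi x"
  and pc_add: "c \<in> carrier C ==> i \<in> I ==> pc (c \<oplus>[L] i) = c"
  and pi_add: "c \<in> carrier C ==> i \<in> I ==> pi (c \<oplus>[L] i) = i"
begin

lemma Lm [simp]: "module K L"
 using L by simp

lemma CL: "c \<in> carrier C ==> c \<in> carrier L"
 using v_submoduleD(1)[OF Lm Csub] by blast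

lemma IL: "i \<in> I ==> i \<in> carrier L"
 using v_submoduleD(1)[OF Lm Isub] by blast

lemma C_simps: "\<zero>[C] = \<zero>[L]" "\<one>[C] = \<one>[L]" "x \<oplus>[C] y = x \<oplus>[L] y" "x \<otimes>[C] y = x \<otimes>[L] y" "a \<odot>[C] x = a \<odot>[L] x"
 by (subst Ceq, simp)+

lemma Cm [simp]: "module K C"
 by (subst Ceq) (rule v_submodule_module[OF Lm Csub])

lemma C_alg: "k_algebra K C"
proof (rule algI)
 show "lin K C C ((\<otimes>\<^bsub>C\<^esub>) x)" if "x \<in> carrier C" for x
  using that C_mult by (intro linI) (simp_all add: C_simps CL lin_add[OF alg_lin2[OF L]] lin_smult[OF alg_lin2[OF L]])
 show "lin K C C (%x. x \<otimes>[C] y)" if "y \<in> carrier C" for y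
  using that C_mult by (intro linI) (simp_all add: C_simps CL lin_add[OF alg_lin1[OF L]] lin_smult[OF alg_lin1[OF L]])
qed (use L in \<open>simp_all add: C_simps C_one CL alg_assoc\<close>)

definition Im :: "('k, 'l, 'l, 'l) bimodule" where
 "Im = (regular L)\<lparr>carrier := I\<rparr>"

lemma Im_simps [simp]: "carrier Im = I" "\<zero>[Im] = \<zero>[L]" "x \<oplus>[Im] y = x \<oplus>[L] y" "a \<odot>[Im] x = a \<odot>[L] x"
  "lmult Im x y = x \<otimes>[L] y" "rmult Im x y = x \<otimes>[L] y"
 by (simp_all add: Im_def regular_def module.defs)

lemma lin_to_L: "lin K U Im f ==> lin K U L f" "lin K U C g ==> lin K U L g"
 by (auto simp: lin_def C_simps intro: IL CL dest: funcset_mem)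

lemma reg_CC: "bimodule K L C (regular L)" "bimodule K C L (regular L)" "bimodule K C C (regular L)"
 by (rule bmI; auto intro!: linI L C_alg simp: CL C_simps L alg_assoc lin_add[OF alg_lin1[OF L]] lin_add[OF alg_lin2[OF L]]
   lin_smult[OF alg_lin1[OF L]] lin_smult[OF alg_lin2[OF L]])+

lemma Im_bimodule: "bimodule K C C Im"
 unfolding Im_def
proof (rule sub_bimodule[OF reg_CC(3)])
 show "submodule I K (regular L)"
  using v_submoduleD[OF Lm Isub] by (intro v_submoduleI) auto
qed (auto intro: CI IC)

lemma pc_lin': "lin K L C pc" and pi_lin': "lin K L Im pi"
 using pc_lin pi_lin by (simp_all add: lin_def)

lemma pc_C: "c \<in> carrier C ==> pc c = c" and pi_C: "c \<in> carrier C ==> pi c = \<zero>[L]"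
 using pc_add[of c "\<zero>[L]"] pi_add[of c "\<zero>[L]"] v_submoduleD(2)[OF Lm Isub] by (simp_all add: CL)

lemma pc_I: "i \<in> I ==> pc i = \<zero>[L]" and pi_I: "i \<in> I ==> pi i = i"
 using pc_add[of "\<zero>[L]" i] pi_add[of "\<zero>[L]" i] v_submoduleD(2)[OF Lm Csub] by (simp_all add: IL)

lemma pc_closed [simp]: "x \<in> carrier L ==> pc x \<in> carrier C"
 and pi_closed [simp]: "x \<in> carrier L ==> pi x \<in> I"
 using lin_closed[OF pc_lin'] lin_closed[OF pi_lin'] by simp_all

lemma prod_decomp:
 assumes x: "x \<in> carrier L" and y: "y \<in> carrier L"
 shows "x \<otimes>[L] y = pc x \<otimes>[L] pc y \<oplus>[L] (pc x \<otimes>[L] pi y \<oplus>[L] pi x \<otimes>[L] pc y)"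
proof -
 have cl: "pc x \<in> carrier L" "pi x \<in> carrier L" "pc y \<in> carrier L" "pi y \<in> carrier L"
  using x y CL IL by auto
 have "x \<otimes>[L] y = (pc x \<oplus>[L] pi x) \<otimes>[L] (pc y \<oplus>[L] pi y)"
  using decomp[OF x] decomp[OF y] by simp
 also have "\<dots> = (pc x \<otimes>[L] pc y \<oplus>[L] pi x \<otimes>[L] pc y) \<oplus>[L] (pc x \<otimes>[L] pi y \<oplus>[L] pi x \<otimes>[L] pi y)"
  using cl L by (simp add: lin_add[OF alg_lin1[OF L]] lin_add[OF alg_lin2[OF L]])
 also have "pi x \<otimes>[L] pi y = \<zero>[L]" using x y by (simp add: II)
 finally show ?thesis using cl L by (simp add: v_assoc v_comm v_lcomm)
qed

text \<open>Products inside \<open>I\<close> vanish, which makes \<open>pc\<close> multiplicative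
  and \<open>pi\<close> a derivation along \<open>pc\<close>.\<close>

lemma pc_mult: "x \<in> carrier L ==> y \<in> carrier L ==> pc (x \<otimes>[L] y) = pc x \<otimes>[L] pc y"
 and pi_mult: "x \<in> carrier L ==> y \<in> carrier L ==> pi (x \<otimes>[L] y) = pc x \<otimes>[L] pi y \<oplus>[L] pi x \<otimes>[L] pc y"
 using prod_decomp[of x y] pc_add pi_add C_mult[of "pc x" "pc y"]
  v_submoduleD(3)[OF Lm Isub CI[of "pc x" "pi y"] IC[of "pc y" "pi x"]] by auto

text \<open>The powers that make up \<open>Q\<close> are written with explicit \<open>Suc\<close>,
  so that positivity of the exponent is visible to the simplifier; the zeroth power is not
  \<open>C\<close>.\<close>

abbreviation "T \<equiv> tpow K C Im"
abbreviation "tg \<equiv> tpgen K C Im"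
abbreviation "Tb n \<equiv> T (Suc (Suc n))"
abbreviation "Tc n \<equiv> T (Suc (Suc (Suc n)))"

lemma Im_powable: "powable K C Im"
 using bm_powable[OF Im_bimodule, of 1] by simp

lemma T_module [simp]: "module K (T n)"
 by (rule tpow_module[OF Im_powable])

lemma T_bimodule: "bimodule K C C (T (Suc n))"
 by (rule tpow_bimodule[OF Im_bimodule]) simp

lemma tg_closed: "set ws <= I ==> tg (length ws) ws \<in> carrier (T (length ws))"
 using tpgen_closed[OF Im_powable, of ws] by simp

lemma T_lin_eq:
 assumes "lin K (T (Suc n)) V f" "lin K (T (Suc n)) V h"
  and "!!w ws. w \<in> I ==> set ws <= I ==> length ws = n ==> f (tg (Suc n) (w # ws)) = h (tg (Suc n) (w # ws))"
  and "u \<in> carrier (T (Suc n))"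
 shows "f u = h u"
proof (rule tpow_lin_eq[OF Im_powable assms(1,2) _ _ assms(4)])
 fix ws assume "set ws <= carrier Im" "length ws = Suc n"
 then show "f (tg (Suc n) ws) = h (tg (Suc n) ws)" using assms(3) by (cases ws) auto
qed simp

lemma T_lin_eq':
 assumes "lin K (T (Suc n)) V f" "lin K (T (Suc n)) V h"
  and "!!w ws. w \<in> I ==> set ws <= I ==> length ws = n ==> f (tg (Suc n) (ws @ [w])) = h (tg (Suc n) (ws @ [w]))"
  and "u \<in> carrier (T (Suc n))"
 shows "f u = h u"
proof (rule tpow_lin_eq[OF Im_powable assms(1,2) _ _ assms(4)])
 fix ws assume "set ws <= carrier Im" "length ws = Suc n"
 then show "f (tg (Suc n) ws) = h (tg (Suc n) ws)" using assms(3) by (cases ws rule: rev_cases) auto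
qed simp

lemma T_l: "c \<in> carrier C ==> w \<in> I ==> set ws <= I ==> length ws = n
  ==> lmult (T (Suc n)) c (tg (Suc n) (w # ws)) = tg (Suc n) ((c \<otimes>[L] w) # ws)"
 using tpow_lmult[OF Im_bimodule, of "Suc n" c w ws] by simp

lemma T_r: "c \<in> carrier C ==> w \<in> I ==> set ws <= I ==> length ws = n
  ==> rmult (T (Suc n)) (tg (Suc n) (ws @ [w])) c = tg (Suc n) (ws @ [w \<otimes>[L] c])"
 using tpow_rmult[OF Im_bimodule, of "Suc n" c ws w] by simp

lemmas T_balance = tpgen_balance[OF Im_powable, simplified]
lemmas T_lin = tpgen_lin[OF Im_powable, simplified]

lemma multilin_Cons:
 assumes \<phi>: "multilin K C Im (Suc n) V \<phi>" and j: "j \<in> I"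
 shows "multilin K C Im n V (%ws. \<phi> (j # ws))"
proof (rule multilinI)
 show "\<phi> (j # ws) \<in> carrier V" if "set ws <= carrier Im" "length ws = n" for ws
  using multilinD(1)[OF \<phi>, of "j # ws"] that j by simp
 show "lin K Im V (%w. \<phi> (j # us @ w # vs))"
  if "set us <= carrier Im" "set vs <= carrier Im" "length us + length vs + 1 = n" for us vs
  using multilinD(2)[OF \<phi>, of "j # us" vs] that j by simp
 show "\<phi> (j # us @ rmult Im v s # w # vs) = \<phi> (j # us @ v # lmult Im s w # vs)"
  if "set us <= carrier Im" "set vs <= carrier Im" "length us + length vs + 2 = n"
   "v \<in> carrier Im" "s \<in> carrier C" "w \<in> carrier Im" for us vs v s w
  using multilinD(3)[OF \<phi>, of "j # us" vs v s w] that j by simp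
qed

lemma multilin_snoc:
 assumes \<phi>: "multilin K C Im (Suc n) V \<phi>" and j: "j \<in> I"
 shows "multilin K C Im n V (%ws. \<phi> (ws @ [j]))"
proof (rule multilinI)
 show "\<phi> (ws @ [j]) \<in> carrier V" if "set ws <= carrier Im" "length ws = n" for ws
  using multilinD(1)[OF \<phi>, of "ws @ [j]"] that j by simp
 show "lin K Im V (%w. \<phi> ((us @ w # vs) @ [j]))"
  if "set us <= carrier Im" "set vs <= carrier Im" "length us + length vs + 1 = n" for us vs
  using multilinD(2)[OF \<phi>, of us "vs @ [j]"] that j by simp
 show "\<phi> ((us @ rmult Im v s # w # vs) @ [j]) = \<phi> ((us @ v # lmult Im s w # vs) @ [j])"
  if "set us <= carrier Im" "set vs <= carrier Im" "length us + length vs + 2 = n"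
   "v \<in> carrier Im" "s \<in> carrier C" "w \<in> carrier Im" for us vs v s w
  using multilinD(3)[OF \<phi>, of us "vs @ [j]" v s w] that j by simp
qed

text \<open>Concatenation \<open>I \<otimes>\<^sub>C I\<^sup>n \<rightarrow> I\<^sup>n\<^sup>+\<^sup>1\<close> and \<open>I\<^sup>n \<otimes>\<^sub>C I \<rightarrow> I\<^sup>n\<^sup>+\<^sup>1\<close>.\<close>

definition cl :: "nat => 'l => ('l list => 'k) set => ('l list => 'k) set" where
 "cl n j = plift K (T (Suc n)) (%ws. tg (Suc n) (j # ws))"

definition cr :: "nat => ('l list => 'k) set => 'l => ('l list => 'k) set" where
 "cr n u j = plift K (T (Suc n)) (%ws. tg (Suc n) (ws @ [j])) u"

lemma cl_lin: "j \<in> I ==> lin K (T n) (T (Suc n)) (cl n j)"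
 and cl_tg: "j \<in> I ==> set ws <= I ==> length ws = n ==> cl n j (tg n ws) = tg (Suc n) (j # ws)"
proof -
 assume j: "j \<in> I"
 note t = tpow_lift[OF Im_powable T_module multilin_Cons[OF tpgen_multilin[OF Im_powable] j]]
 show "lin K (T n) (T (Suc n)) (cl n j)" unfolding cl_def by (rule t(1))
 show "cl n j (tg n ws) = tg (Suc n) (j # ws)" if "set ws <= I" "length ws = n"
  using t(2)[of ws] that by (simp add: cl_def)
qed

lemma cr_lin: "j \<in> I ==> lin K (T n) (T (Suc n)) (%u. cr n u j)"
 and cr_tg: "j \<in> I ==> set ws <= I ==> length ws = n ==> cr n (tg n ws) j = tg (Suc n) (ws @ [j])"
proof -
 assume j: "j \<in> I"
 have e: "(%u. cr n u j) = plift K (T (Suc n)) (%ws. tg (Suc n) (ws @ [j]))" by (simp add: cr_def fun_eq_iff)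
 note t = tpow_lift[OF Im_powable T_module multilin_snoc[OF tpgen_multilin[OF Im_powable] j]]
 show "lin K (T n) (T (Suc n)) (%u. cr n u j)" unfolding e by (rule t(1))
 show "cr n (tg n ws) j = tg (Suc n) (ws @ [j])" if "set ws <= I" "length ws = n"
  using t(2)[of ws] that by (simp add: cr_def)
qed

lemma T_ind [consumes 1, case_names gen add]:
 assumes "u \<in> carrier (T (Suc n))" and "!!ws. set ws <= I ==> length ws = Suc n ==> P (tg (Suc n) ws)"
  and "!!u v. u \<in> carrier (T (Suc n)) ==> v \<in> carrier (T (Suc n)) ==> P u ==> P v ==> P (u \<oplus>[T (Suc n)] v)"
 shows "P u"
 by (rule tpow_induct[OF Im_powable assms(1)]) (use assms(2,3) in auto)

lemma cl_lin2: "u \<in> carrier (T (Suc n)) ==> lin K Im (Tb n) (%j. cl (Suc n) j u)"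
proof (induction rule: T_ind)
 case (gen ws)
 show ?case
  by (rule lin_cong[OF T_lin[of "[]" ws]])
    (use gen v_submoduleD(3,4)[OF Lm Isub] in \<open>auto simp: cl_tg\<close>)
next
 case (add u v)
 show ?case
  by (rule lin_cong[OF lin_fun_add[OF T_module add(3,4)]])
    (use add v_submoduleD(3,4)[OF Lm Isub] in \<open>auto simp: lin_add[OF cl_lin]\<close>)
qed

lemma cr_lin2: "u \<in> carrier (T (Suc n)) ==> lin K Im (Tb n) (cr (Suc n) u)"
proof (induction rule: T_ind)
 case (gen ws)
 show ?case
  by (rule lin_cong[OF T_lin[of ws "[]"]])
    (use gen v_submoduleD(3,4)[OF Lm Isub] in \<open>auto simp: cr_tg\<close>)
next
 case (add u v)
 show ?case
  by (rule lin_cong[OF lin_fun_add[OF T_module add(3,4)]])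
    (use add v_submoduleD(3,4)[OF Lm Isub] in \<open>auto simp: lin_add[OF cr_lin]\<close>)
qed

lemma cl_closed [simp]: "j \<in> I ==> u \<in> carrier (T n) ==> cl n j u \<in> carrier (T (Suc n))"
 and cr_closed [simp]: "j \<in> I ==> u \<in> carrier (T n) ==> cr n u j \<in> carrier (T (Suc n))"
 using lin_closed[OF cl_lin] lin_closed[OF cr_lin] by auto

context
 fixes n and c :: 'l and j :: 'l and u
 assumes c: "c \<in> carrier C" and j: "j \<in> I" and u: "u \<in> carrier (T (Suc n))"
begin

lemma cl_cmult: "cl (Suc n) (c \<otimes>[L] j) u = lmult (Tb n) c (cl (Suc n) j u)"
 by (rule T_lin_eq[OF cl_lin lin_comp[OF cl_lin bm_l[OF T_bimodule]] _ u])
   (use c j in \<open>auto simp: cl_tg CI T_l\<close>)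

lemma cl_balance: "cl (Suc n) (j \<otimes>[L] c) u = cl (Suc n) j (lmult (T (Suc n)) c u)"
 by (rule T_lin_eq[OF cl_lin lin_comp[OF bm_l[OF T_bimodule] cl_lin] _ u])
   (use c j T_balance[of "[]" _ "Suc (Suc n)" j c] in \<open>auto simp: cl_tg CI IC T_l\<close>)

lemma cl_rmult: "rmult (Tb n) (cl (Suc n) j u) c = cl (Suc n) j (rmult (T (Suc n)) u c)"
proof (rule T_lin_eq'[OF lin_comp[OF cl_lin bm_r[OF T_bimodule]] lin_comp[OF bm_r[OF T_bimodule] cl_lin] _ u])
 fix w ws assume w: "w \<in> I" "set ws <= I" "length ws = n"
 with c j T_r[of c w "j # ws" "Suc n"]
 show "rmult (Tb n) (cl (Suc n) j (tg (Suc n) (ws @ [w]))) c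
   = cl (Suc n) j (rmult (T (Suc n)) (tg (Suc n) (ws @ [w])) c)"
  by (simp add: cl_tg IC T_r)
qed (use c j in auto)

lemma cr_cmult: "cr (Suc n) u (j \<otimes>[L] c) = rmult (Tb n) (cr (Suc n) u j) c"
 by (rule T_lin_eq'[OF cr_lin lin_comp[OF cr_lin bm_r[OF T_bimodule]] _ u])
   (use c j in \<open>auto simp: cr_tg IC T_r simp del: append_assoc\<close>)

lemma cr_balance: "cr (Suc n) u (c \<otimes>[L] j) = cr (Suc n) (rmult (T (Suc n)) u c) j"
proof (rule T_lin_eq'[OF cr_lin lin_comp[OF bm_r[OF T_bimodule] cr_lin] _ u])
 fix w ws assume w: "w \<in> I" "set ws <= I" "length ws = n"
 with c j T_balance[of ws "[]" "Suc (Suc n)" w c j]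
 show "cr (Suc n) (tg (Suc n) (ws @ [w])) (c \<otimes>[L] j)
   = cr (Suc n) (rmult (T (Suc n)) (tg (Suc n) (ws @ [w])) c) j"
  by (simp add: cr_tg IC CI T_r)
qed (use c j CI in auto)

lemma cr_lmult: "lmult (Tb n) c (cr (Suc n) u j) = cr (Suc n) (lmult (T (Suc n)) c u) j"
 by (rule T_lin_eq[OF lin_comp[OF cr_lin bm_l[OF T_bimodule]] lin_comp[OF bm_l[OF T_bimodule] cr_lin] _ u])
   (use c j in \<open>auto simp: cr_tg CI T_l\<close>)

end

lemma cl_cr: "j \<in> I ==> j' \<in> I ==> u \<in> carrier (T (Suc n))
  ==> cl (Suc (Suc n)) j (cr (Suc n) u j') = cr (Suc (Suc n)) (cl (Suc n) j u) j'"
 by (rule T_lin_eq[OF lin_comp[OF cr_lin cl_lin] lin_comp[OF cl_lin cr_lin]]) (auto simp: cl_tg cr_tg)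

end

section \<open>The relative bar resolution\<close>

context square_zero
begin

text \<open>\<open>Q n\<close> models \<open>L \<otimes>\<^sub>C I\<^sup>n\<^sup>+\<^sup>1 \<otimes>\<^sub>C L\<close>: since \<open>L = C \<oplus> I\<close>, it is \<open>I\<^sup>n\<^sup>+\<^sup>1 \<oplus> (I \<otimes> I\<^sup>n\<^sup>+\<^sup>1) \<oplus> (I\<^sup>n\<^sup>+\<^sup>1 \<otimes> I) \<oplus> (I \<otimes> I\<^sup>n\<^sup>+\<^sup>1 \<otimes> I)\<close>.\<close>

definition Q :: "nat => ('k, 'l, 'l, ('l list => 'k) set \<times> ('l list => 'k) set
  \<times> ('l list => 'k) set \<times> ('l list => 'k) set) bimodule" where
 "Q n = module.extend (dsum (T (Suc n)) (dsum (Tb n) (dsum (Tb n) (Tc n))))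
  \<lparr>lmult = (%x (u, v, w, z). (lmult (T (Suc n)) (pc x) u,
    lmult (Tb n) (pc x) v \<oplus>[Tb n] cl (Suc n) (pi x) u,
    lmult (Tb n) (pc x) w,
    lmult (Tc n) (pc x) z \<oplus>[Tc n] cl (Suc (Suc n)) (pi x) w)),
   rmult = (%(u, v, w, z) x. (rmult (T (Suc n)) u (pc x),
    rmult (Tb n) v (pc x),
    rmult (Tb n) w (pc x) \<oplus>[Tb n] cr (Suc n) u (pi x),
    rmult (Tc n) z (pc x) \<oplus>[Tc n] cr (Suc (Suc n)) v (pi x)))\<rparr>"

lemma L_null: "x \<in> carrier L ==> \<zero>[L] \<otimes>[L] x = \<zero>[L]" "x \<in> carrier L ==> x \<otimes>[L] \<zero>[L] = \<zero>[L]"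
 using lin_zero[OF alg_lin1[OF L]] lin_zero[OF alg_lin2[OF L]] by simp_all

lemma Q_simps: "carrier (Q n) = carrier (T (Suc n)) \<times> carrier (Tb n) \<times> carrier (Tb n)
   \<times> carrier (Tc n)"
  "\<zero>[Q n] = (\<zero>[T (Suc n)], \<zero>[Tb n], \<zero>[Tb n], \<zero>[Tc n])"
  "(u, v, w, z) \<oplus>[Q n] (u', v', w', z') = (u \<oplus>[T (Suc n)] u', v \<oplus>[Tb n] v', w \<oplus>[Tb n] w',
   z \<oplus>[Tc n] z')"
  "a \<odot>[Q n] (u, v, w, z) = (a \<odot>[T (Suc n)] u, a \<odot>[Tb n] v, a \<odot>[Tb n] w,
   a \<odot>[Tc n] z)"
  "lmult (Q n) x (u, v, w, z) = (lmult (T (Suc n)) (pc x) u,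
    lmult (Tb n) (pc x) v \<oplus>[Tb n] cl (Suc n) (pi x) u,
    lmult (Tb n) (pc x) w,
    lmult (Tc n) (pc x) z \<oplus>[Tc n] cl (Suc (Suc n)) (pi x) w)"
  "rmult (Q n) (u, v, w, z) x = (rmult (T (Suc n)) u (pc x),
    rmult (Tb n) v (pc x),
    rmult (Tb n) w (pc x) \<oplus>[Tb n] cr (Suc n) u (pi x),
    rmult (Tc n) z (pc x) \<oplus>[Tc n] cr (Suc (Suc n)) v (pi x))"
 by (simp_all add: Q_def)

lemma Q_module [simp]: "module K (Q n)"
 by (simp add: Q_def)

lemma pc_ops: "x \<in> carrier L ==> y \<in> carrier L ==> pc (x \<oplus>[L] y) = pc x \<oplus>[C] pc y"
  "a \<in> carrier K ==> x \<in> carrier L ==> pc (a \<odot>[L] x) = a \<odot>[C] pc x"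
  "x \<in> carrier L ==> y \<in> carrier L ==> pi (x \<oplus>[L] y) = pi x \<oplus>[Im] pi y"
  "a \<in> carrier K ==> x \<in> carrier L ==> pi (a \<odot>[L] x) = a \<odot>[Im] pi x"
 using lin_add[OF pc_lin'] lin_smult[OF pc_lin'] lin_add[OF pi_lin'] lin_smult[OF pi_lin'] by auto

lemmas T_rules = bm_lcl[OF T_bimodule] bm_rcl[OF T_bimodule] bm_ladd[OF T_bimodule] bm_radd[OF T_bimodule]
 bm_lsm[OF T_bimodule] bm_rsm[OF T_bimodule] lin_add[OF cl_lin] lin_add[OF cr_lin] lin_smult[OF cl_lin]
 lin_smult[OF cr_lin]

lemmas T_rules2 = bm_laddl[OF T_bimodule] bm_raddr[OF T_bimodule] bm_lsml[OF T_bimodule] bm_rsmr[OF T_bimodule]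
 lin_add[OF cl_lin2] lin_add[OF cr_lin2] lin_smult[OF cl_lin2] lin_smult[OF cr_lin2]

text \<open>From the left \<open>I\<close> takes the first summand to the second and the third to
  the fourth; from the right it takes the first to the third and the second to the fourth; all else
  it kills. Associativity is then the derivation rule for \<open>pi\<close> together with the
  balancing of \<open>cl\<close> and \<open>cr\<close>.\<close>

lemma Q_bimodule: "bimodule K L L (Q n)"
proof (rule bmI)
 show "k_algebra K L" "k_algebra K L" by (rule L)+
 show "lin K (Q n) (Q n) (lmult (Q n) x)" if "x \<in> carrier L" for x
  using that
  by (intro linI) (auto simp: Q_simps T_rules v_add_swap v_smult_r_distr)
 show "lin K (Q n) (Q n) (%q. rmult (Q n) q x)" if "x \<in> carrier L" for x
  using that
  by (intro linI) (auto simp: Q_simps T_rules v_add_swap v_smult_r_distr)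
 fix q assume q: "q \<in> carrier (Q n)"
 then obtain u v w z where q: "q = (u, v, w, z)" "u \<in> carrier (T (Suc n))" "v \<in> carrier (Tb n)"
  "w \<in> carrier (Tb n)" "z \<in> carrier (Tc n)" by (auto simp: Q_simps)
 show "lin K L (Q n) (%x. lmult (Q n) x q)" "lin K L (Q n) (rmult (Q n) q)"
  by (rule linI; use q in \<open>simp add: Q_simps T_rules pc_ops T_rules2 v_add_swap v_smult_r_distr del: Im_simps(3,4)\<close>)+
 have 1: "pc \<one>[L] = \<one>[C]" "pi \<one>[L] = \<zero>[Im]" using C_one by (simp_all add: pc_C pi_C C_simps)
 have 0: "cl k \<zero>[Im] a = \<zero>[T (Suc k)]" "cr k a \<zero>[Im] = \<zero>[T (Suc k)]" if "a \<in> carrier (T k)" "k > 0" for k a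
  using that lin_zero[OF cl_lin2, of a "k - 1"] lin_zero[OF cr_lin2, of a "k - 1"] bm_module[OF Im_bimodule] by auto
 show "lmult (Q n) \<one>[L] q = q" "rmult (Q n) q \<one>[L] = q"
  using q by (simp_all add: Q_simps 1 0 bm_lone[OF T_bimodule] bm_rone[OF T_bimodule] del: Im_simps(2))
 fix x y assume x: "x \<in> carrier L" and y: "y \<in> carrier L"
 have CIc: "pc x \<otimes>[L] pi y \<in> I" "pi x \<otimes>[L] pc y \<in> I" using x y by (simp_all add: CI IC)
 have pm: "pc (x \<otimes>[L] y) = pc x \<otimes>[C] pc y"
  "pi (x \<otimes>[L] y) = (pc x \<otimes>[L] pi y) \<oplus>[Im] (pi x \<otimes>[L] pc y)"
  using x y by (simp_all add: pc_mult pi_mult C_simps)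
 show "lmult (Q n) (x \<otimes>[L] y) q = lmult (Q n) x (lmult (Q n) y q)"
  using q x y CIc
  by (simp add: Q_simps pm T_rules T_rules2 bm_lassoc[OF T_bimodule] cl_cmult cl_balance v_assoc del: Im_simps(3))
 show "rmult (Q n) q (x \<otimes>[L] y) = rmult (Q n) (rmult (Q n) q x) y"
  using q x y CIc
  by (simp add: Q_simps pm T_rules T_rules2 bm_rassoc[OF T_bimodule] cr_cmult cr_balance v_assoc v_comm v_lcomm del: Im_simps(3))
 show "rmult (Q n) (lmult (Q n) x q) y = lmult (Q n) x (rmult (Q n) q y)"
  using q x y
  by (simp add: Q_simps T_rules bm_lr[OF T_bimodule] cl_rmult cr_lmult cl_cr v_assoc v_comm v_lcomm)
qed simp

definition sg :: "nat => nat => ('l list => 'k) set => ('l list => 'k) set" where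
 "sg n k u = (if even n then u else \<ominus>[T k] u)"

lemma sg_lin: "lin K (T k) (T k) (sg n k)"
proof -
 have "lin K (T k) (T k) (%u. (\<ominus> \<one>) \<odot>[T k] u)" by (rule lin_fun_smult[OF T_module lin_ident]) simp
 then have "lin K (T k) (T k) (%u. \<ominus>[T k] u)"
  by (rule lin_cong) (simp_all add: v_inv_smult[OF T_module])
 then show ?thesis by (cases "even n") (simp_all add: sg_def[abs_def] lin_ident)
qed

lemma sg_closed [simp]: "u \<in> carrier (T k) ==> sg n k u \<in> carrier (T k)"
 by (rule lin_closed[OF sg_lin])

lemma sg_Suc: "u \<in> carrier (T k) ==> sg (Suc n) k u = \<ominus>[T k] sg n k u"
 by (simp add: sg_def)

lemma sg_comm:
 assumes f: "lin K (T k) (T k') f" and u: "u \<in> carrier (T k)"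
 shows "f (sg n k u) = sg n k' (f u)"
 using u by (simp add: sg_def lin_inv[OF f T_module T_module])

text \<open>The differential of the normalized bar resolution: \<open>I\<^sup>2 = 0\<close> leaves only its two outer faces.\<close>

definition dQ :: "nat => ('l list => 'k) set \<times> ('l list => 'k) set \<times> ('l list => 'k) set \<times> ('l list => 'k) set
  => ('l list => 'k) set \<times> ('l list => 'k) set \<times> ('l list => 'k) set \<times> ('l list => 'k) set" where
 "dQ n = (%(u, v, w, z). (\<zero>[T (Suc n)], u, sg n (Suc (Suc n)) u,
   w \<oplus>[Tc n] sg n (Suc (Suc (Suc n))) v))"

lemma dQ_hom: "bhom K L L (Q (Suc n)) (Q n) (dQ n)"
proof (rule bhomI)
 note S = Q_simps T_rules lin_add[OF sg_lin] lin_smult[OF sg_lin] dQ_def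
 show "lin K (Q (Suc n)) (Q n) (dQ n)"
  by (rule linI) (auto simp: S v_add_swap v_smult_r_distr)
 fix x q assume x: "x \<in> carrier L" and "q \<in> carrier (Q (Suc n))"
 then obtain u v w z where q: "q = (u, v, w, z)" "u \<in> carrier (Tb n)" "v \<in> carrier (Tc n)"
  "w \<in> carrier (Tc n)" "z \<in> carrier (Tc (Suc n))" by (auto simp: Q_simps)
 note z = lin_zero[OF cl_lin T_module T_module] lin_zero[OF cr_lin T_module T_module]
  bm_lzero[OF T_bimodule] bm_rzero[OF T_bimodule]
 show "dQ n (lmult (Q (Suc n)) x q) = lmult (Q n) x (dQ n q)"
  using q x
  by (simp add: S z sg_comm[OF cl_lin] sg_comm[OF bm_l[OF T_bimodule]] v_assoc)
 show "dQ n (rmult (Q (Suc n)) q x) = rmult (Q n) (dQ n q) x"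
  using q x
  by (simp add: S z sg_comm[OF cr_lin] sg_comm[OF bm_r[OF T_bimodule]] v_assoc v_comm v_lcomm)
qed

text \<open>In a cycle \<open>u\<close> vanishes and \<open>w\<close> is \<open>v\<close> up to a
  sign. Such an element \<open>(0, v, w, z)\<close> is the image of
  \<open>(v, 0, z, 0)\<close>.\<close>

lemma dQ_exact:
 assumes q: "q \<in> carrier (Q (Suc n))"
 shows "dQ n q = \<zero>[Q n] \<longleftrightarrow> q \<in> dQ (Suc n) ` carrier (Q (Suc (Suc n)))"
proof
 obtain u v w z where q: "q = (u, v, w, z)" "u \<in> carrier (Tb n)" "v \<in> carrier (Tc n)"
  "w \<in> carrier (Tc n)" "z \<in> carrier (Tc (Suc n))" using assms by (auto simp: Q_simps)
 assume "dQ n q = \<zero>[Q n]"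
 with q have "u = \<zero>[Tb n]" "sg n (Suc (Suc (Suc n))) v \<oplus>[Tc n] w = \<zero>[Tc n]"
  using v_comm[OF T_module q(4) sg_closed[OF q(3)]] by (simp_all add: dQ_def Q_simps)
 then have "w = sg (Suc n) (Suc (Suc (Suc n))) v" "u = \<zero>[Tb n]"
  using q by (simp_all add: v_add_eq_zero sg_Suc)
 then have "q = dQ (Suc n) (v, \<zero>[Tc (Suc n)], z, \<zero>[Tc (Suc (Suc n))])"
  using q by (simp add: dQ_def lin_zero[OF sg_lin T_module T_module])
 then show "q \<in> dQ (Suc n) ` carrier (Q (Suc (Suc n)))"
  by (rule image_eqI) (use q in \<open>simp add: Q_simps\<close>)
next
 assume "q \<in> dQ (Suc n) ` carrier (Q (Suc (Suc n)))"
 then show "dQ n q = \<zero>[Q n]"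
  by (auto simp: dQ_def Q_simps sg_Suc lin_zero[OF sg_lin T_module T_module])
qed

section \<open>The kernel of the product map and the augmentation\<close>

abbreviation "LCL \<equiv> tensor K C (regular L) (regular L)"
abbreviation "lcl \<equiv> tens K C (regular L) (regular L)"

lemma LCL_bimodule: "bimodule K L L LCL"
 by (rule tensor_bimodule[OF reg_CC(1,2)])

lemma LCL_tensorable: "tensorable K C (regular L) (regular L)"
 by (rule bm_tensorable[OF reg_CC(1,2)])

lemma LCL_module [simp]: "module K LCL"
 by (rule bm_module[OF LCL_bimodule])

lemma lcl_closed [simp]: "x \<in> carrier L ==> y \<in> carrier L ==> lcl x y \<in> carrier LCL"
 using tens_closed[OF LCL_tensorable] by simp

lemma lcl_lin1: "y \<in> carrier L ==> lin K L LCL (%x. lcl x y)"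
 and lcl_lin2: "x \<in> carrier L ==> lin K L LCL (lcl x)"
 using tens_lin1[OF LCL_tensorable, of y] tens_lin2[OF LCL_tensorable, of x] by simp_all

lemma lcl_balance: "x \<in> carrier L ==> c \<in> carrier C ==> y \<in> carrier L ==> lcl (x \<otimes>[L] c) y = lcl x (c \<otimes>[L] y)"
 using tens_balance[OF LCL_tensorable, of x c y] by simp

lemma lcl_l: "a \<in> carrier L ==> x \<in> carrier L ==> y \<in> carrier L ==> lmult LCL a (lcl x y) = lcl (a \<otimes>[L] x) y"
 and lcl_r: "a \<in> carrier L ==> x \<in> carrier L ==> y \<in> carrier L ==> rmult LCL (lcl x y) a = lcl x (y \<otimes>[L] a)"
 using tensor_lmult[OF reg_CC(1,2), of a x y] tensor_rmult[OF reg_CC(1,2), of a x y] by simp_all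

lemma LCL_lin_eq:
 assumes "lin K LCL V f" "lin K LCL V h" "!!x y. x \<in> carrier L ==> y \<in> carrier L ==> f (lcl x y) = h (lcl x y)"
  "u \<in> carrier LCL"
 shows "f u = h u"
 by (rule tensor_lin_eq[OF LCL_tensorable assms(1,2) _ assms(4)]) (simp add: assms(3))

definition mul :: "('l \<times> 'l => 'k) set => 'l" where
 "mul = plift K L (%(x, y). x \<otimes>[L] y)"

lemma mul_lin: "lin K LCL L mul" and mul_lcl: "x \<in> carrier L ==> y \<in> carrier L ==> mul (lcl x y) = x \<otimes>[L] y"
proof -
 have "balanced K C (regular L) (regular L) L (%x y. x \<otimes>[L] y)"
  by (rule balancedI) (simp_all add: alg_lin1[OF L] alg_lin2[OF L] alg_assoc[OF L] CL)
 note t = tensor_lift[OF LCL_tensorable Lm this]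
 show "lin K LCL L mul" unfolding mul_def by (rule t(1))
 show "x \<in> carrier L ==> y \<in> carrier L ==> mul (lcl x y) = x \<otimes>[L] y" unfolding mul_def using t(2) by simp
qed

abbreviation "K1 \<equiv> prod_kernel K C L"

lemma K1_eq: "K1 = LCL\<lparr>carrier := {u \<in> carrier LCL. mul u = \<zero>[L]}\<rparr>"
 by (simp add: prod_kernel_def Let_def mul_def)

lemma K1_bimodule: "bimodule K L L K1"
 unfolding K1_eq
proof (rule sub_bimodule[OF LCL_bimodule lin_ker[OF mul_lin LCL_module Lm]])
 fix a u assume a: "a \<in> carrier L" and u: "u \<in> {u \<in> carrier LCL. mul u = \<zero>[L]}"
 have "mul (lmult LCL a u) = a \<otimes>[L] mul u" "mul (rmult LCL u a) = mul u \<otimes>[L] a"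
  by (rule LCL_lin_eq[OF lin_comp[OF bm_l[OF LCL_bimodule a] mul_lin] lin_comp[OF mul_lin alg_lin2[OF L a]]]
     LCL_lin_eq[OF lin_comp[OF bm_r[OF LCL_bimodule a] mul_lin] lin_comp[OF mul_lin alg_lin1[OF L a]]];
    use a u L in \<open>auto simp: lcl_l lcl_r mul_lcl alg_assoc\<close>)+
 then show "lmult LCL a u \<in> {u \<in> carrier LCL. mul u = \<zero>[L]}" "rmult LCL u a \<in> {u \<in> carrier LCL. mul u = \<zero>[L]}"
  using a u lin_zero[OF alg_lin2[OF L a]] lin_zero[OF alg_lin1[OF L a]]
  by (simp_all add: bm_lcl[OF LCL_bimodule] bm_rcl[OF LCL_bimodule])
qed

text \<open>The \<open>C\<close>-bimodule isomorphism \<open>I \<oplus> I \<otimes>\<^sub>C I \<rightarrow> K1\<close> and its inverse.\<close>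

definition ka :: "('l list => 'k) set => ('l \<times> 'l => 'k) set" where
 "ka = plift K LCL (%ws. lcl \<one>[L] (hd ws) \<ominus>[LCL] lcl (hd ws) \<one>[L])"

definition mu :: "('l list => 'k) set => ('l \<times> 'l => 'k) set" where
 "mu = plift K LCL (%ws. lcl (hd ws) (hd (tl ws)))"

definition nu1 :: "('l \<times> 'l => 'k) set => ('l list => 'k) set" where
 "nu1 = plift K (T (Suc 0)) (%(x, y). tg (Suc 0) [pc x \<otimes>[L] pi y])"

definition nu2 :: "('l \<times> 'l => 'k) set => ('l list => 'k) set" where
 "nu2 = plift K (Tb 0) (%(x, y). tg (Suc (Suc 0)) [pi x, pi y])"

lemma lin_Im_L: "lin K L V f ==> lin K Im V f"
 by (auto simp: lin_def IL Pi_iff)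

lemma lin_C_L: "lin K L V f ==> lin K C V f"
 by (auto simp: lin_def CL C_simps Pi_iff)

lemma ka_lin: "lin K (T (Suc 0)) LCL ka"
 and ka_tg: "i \<in> I ==> ka (tg (Suc 0) [i]) = lcl \<one>[L] i \<ominus>[LCL] lcl i \<one>[L]"
proof -
 have m: "multilin K C Im (Suc 0) LCL (%ws. lcl \<one>[L] (hd ws) \<ominus>[LCL] lcl (hd ws) \<one>[L])"
 proof (rule multilinI)
  fix ws :: "'l list" assume "set ws <= carrier Im" "length ws = Suc 0"
  then show "lcl \<one>[L] (hd ws) \<ominus>[LCL] lcl (hd ws) \<one>[L] \<in> carrier LCL"
   using L by (cases ws) (auto simp: IL intro!: v_minus[OF LCL_module])
 next
  fix us vs :: "'l list" assume "length us + length vs + 1 = Suc 0"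
  then have "us = []" "vs = []" by auto
  then show "lin K Im LCL (%w. lcl \<one>[L] (hd (us @ w # vs)) \<ominus>[LCL] lcl (hd (us @ w # vs)) \<one>[L])"
   using lin_Im_L[OF lin_fun_minus[OF LCL_module lcl_lin2 lcl_lin1]] L by simp
 qed auto
 note t = tpow_lift[OF Im_powable LCL_module m]
 show "lin K (T (Suc 0)) LCL ka" unfolding ka_def by (rule t(1))
 show "i \<in> I ==> ka (tg (Suc 0) [i]) = lcl \<one>[L] i \<ominus>[LCL] lcl i \<one>[L]"
  unfolding ka_def using t(2)[of "[i]"] by simp
qed

lemma mu_lin: "lin K (Tb 0) LCL mu"
 and mu_tg: "i \<in> I ==> j \<in> I ==> mu (tg (Suc (Suc 0)) [i, j]) = lcl i j"
proof -
 have m: "multilin K C Im (Suc (Suc 0)) LCL (%ws. lcl (hd ws) (hd (tl ws)))"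
 proof (rule multilinI)
  fix ws :: "'l list" assume "set ws <= carrier Im" "length ws = Suc (Suc 0)"
  then show "lcl (hd ws) (hd (tl ws)) \<in> carrier LCL"
   by (cases ws; cases "tl ws") (auto simp: IL)
 next
  fix us vs :: "'l list" assume *: "length us + length vs + 1 = Suc (Suc 0)" "set us <= carrier Im" "set vs <= carrier Im"
  then consider u where "us = [u]" "vs = []" | v where "us = []" "vs = [v]"
   by (cases us; cases vs) auto
  then show "lin K Im LCL (%w. lcl (hd (us @ w # vs)) (hd (tl (us @ w # vs))))"
   by cases (use * in \<open>simp_all add: lin_Im_L[OF lcl_lin2] lin_Im_L[OF lcl_lin1] IL\<close>)
 next
  fix us vs :: "'l list" and v s w assume "length us + length vs + 2 = Suc (Suc 0)" "v \<in> carrier Im" "s \<in> carrier C" "w \<in> carrier Im"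
  then show "lcl (hd (us @ rmult Im v s # w # vs)) (hd (tl (us @ rmult Im v s # w # vs)))
    = lcl (hd (us @ v # lmult Im s w # vs)) (hd (tl (us @ v # lmult Im s w # vs)))"
   by (simp add: lcl_balance IL)
 qed
 note t = tpow_lift[OF Im_powable LCL_module m]
 show "lin K (Tb 0) LCL mu" unfolding mu_def by (rule t(1))
 show "i \<in> I ==> j \<in> I ==> mu (tg (Suc (Suc 0)) [i, j]) = lcl i j"
  unfolding mu_def using t(2)[of "[i, j]"] by simp
qed

lemma T1_lin: "lin K Im (T (Suc 0)) (%i. tg (Suc 0) [i])"
 using T_lin[of "[]" "[]" "Suc 0"] by simp

lemma nu1_lin: "lin K LCL (T (Suc 0)) nu1"
 and nu1_lcl: "x \<in> carrier L ==> y \<in> carrier L ==> nu1 (lcl x y) = tg (Suc 0) [pc x \<otimes>[L] pi y]"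
proof -
 have "balanced K C (regular L) (regular L) (T (Suc 0)) (%x y. tg (Suc 0) [pc x \<otimes>[L] pi y])"
 proof (rule balancedI)
  fix x assume "x \<in> carrier (regular L)"
  then have "pc x \<in> carrier C" by simp
  from lin_comp[OF lin_comp[OF pi_lin' bm_l[OF Im_bimodule this]] T1_lin]
  show "lin K (regular L) (T (Suc 0)) (%y. tg (Suc 0) [pc x \<otimes>[L] pi y])" by simp
 next
  fix y assume "y \<in> carrier (regular L)"
  then have "pi y \<in> carrier Im" by simp
  from lin_comp[OF lin_comp[OF pc_lin' bm_la[OF Im_bimodule this]] T1_lin]
  show "lin K (regular L) (T (Suc 0)) (%x. tg (Suc 0) [pc x \<otimes>[L] pi y])" by simp
 qed (use L in \<open>simp add: pc_mult pi_mult CL IL pc_C pi_C alg_assoc L_null\<close>)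
 note t = tensor_lift[OF LCL_tensorable T_module this]
 show "lin K LCL (T (Suc 0)) nu1" unfolding nu1_def by (rule t(1))
 show "x \<in> carrier L ==> y \<in> carrier L ==> nu1 (lcl x y) = tg (Suc 0) [pc x \<otimes>[L] pi y]"
  unfolding nu1_def using t(2) by simp
qed

lemma nu2_lin: "lin K LCL (Tb 0) nu2"
 and nu2_lcl: "x \<in> carrier L ==> y \<in> carrier L ==> nu2 (lcl x y) = tg (Suc (Suc 0)) [pi x, pi y]"
proof -
 have "balanced K C (regular L) (regular L) (Tb 0) (%x y. tg (Suc (Suc 0)) [pi x, pi y])"
 proof (rule balancedI)
  fix x assume "x \<in> carrier (regular L)"
  then show "lin K (regular L) (Tb 0) (%y. tg (Suc (Suc 0)) [pi x, pi y])"
   using lin_comp[OF pi_lin' T_lin[of "[pi x]" "[]" "Suc (Suc 0)"]] by simp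
 next
  fix y assume "y \<in> carrier (regular L)"
  then show "lin K (regular L) (Tb 0) (%x. tg (Suc (Suc 0)) [pi x, pi y])"
   using lin_comp[OF pi_lin' T_lin[of "[]" "[pi y]" "Suc (Suc 0)"]] by simp
 next
  fix x s y assume "x \<in> carrier (regular L)" "s \<in> carrier C" "y \<in> carrier (regular L)"
  moreover have "pc x \<otimes>[L] \<zero>[L] = \<zero>[L]" "\<zero>[L] \<otimes>[L] pc y = \<zero>[L]" if "x \<in> carrier L" "y \<in> carrier L"
   using lin_zero[OF alg_lin2[OF L, of "pc x"]] lin_zero[OF alg_lin1[OF L, of "pc y"]] that by (simp_all add: CL)
  ultimately show "tg (Suc (Suc 0)) [pi (rmult (regular L) x s), pi y] = tg (Suc (Suc 0)) [pi x, pi (lmult (regular L) s y)]"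
   using T_balance[of "[]" "[]" "Suc (Suc 0)" "pi x" s "pi y"] L by (simp add: pi_mult CL IL pi_C pc_C)
 qed
 note t = tensor_lift[OF LCL_tensorable T_module this]
 show "lin K LCL (Tb 0) nu2" unfolding nu2_def by (rule t(1))
 show "x \<in> carrier L ==> y \<in> carrier L ==> nu2 (lcl x y) = tg (Suc (Suc 0)) [pi x, pi y]"
  unfolding nu2_def using t(2) by simp
qed

end

context square_zero
begin

lemma T1_lin_eq:
 assumes "lin K (T (Suc 0)) V f" "lin K (T (Suc 0)) V h" "!!i. i \<in> I ==> f (tg (Suc 0) [i]) = h (tg (Suc 0) [i])"
  "u \<in> carrier (T (Suc 0))"
 shows "f u = h u"
 by (rule T_lin_eq[OF assms(1,2) _ assms(4)]) (simp add: assms(3))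

lemma T2_lin_eq:
 assumes "lin K (Tb 0) V f" "lin K (Tb 0) V h"
  "!!i j. i \<in> I ==> j \<in> I ==> f (tg (Suc (Suc 0)) [i, j]) = h (tg (Suc (Suc 0)) [i, j])"
  "u \<in> carrier (Tb 0)"
 shows "f u = h u"
proof (rule T_lin_eq[OF assms(1,2) _ assms(4)])
 fix w ws assume "w \<in> I" "set ws <= I" "length ws = Suc 0"
 then show "f (tg (Suc (Suc 0)) (w # ws)) = h (tg (Suc (Suc 0)) (w # ws))"
  using assms(3) by (cases ws) auto
qed

lemma ka_closed [simp]: "u \<in> carrier (T (Suc 0)) ==> ka u \<in> carrier LCL"
 and mu_closed [simp]: "v \<in> carrier (Tb 0) ==> mu v \<in> carrier LCL"
 using lin_closed[OF ka_lin] lin_closed[OF mu_lin] by auto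

lemmas LCL_rules = bm_lcl[OF LCL_bimodule] bm_rcl[OF LCL_bimodule] lin_minus[OF bm_l[OF LCL_bimodule] LCL_module LCL_module]
 lin_minus[OF bm_r[OF LCL_bimodule] LCL_module LCL_module]
 lin_minus[OF lcl_lin1 Lm LCL_module] lin_minus[OF lcl_lin2 Lm LCL_module] lcl_l lcl_r

lemma lcl_one_C: "c \<in> carrier C ==> y \<in> carrier L ==> lcl \<one>[L] (c \<otimes>[L] y) = lcl c y"
  "c \<in> carrier C ==> y \<in> carrier L ==> lcl y c = lcl (y \<otimes>[L] c) \<one>[L]"
 using lcl_balance[of "\<one>[L]" c y] lcl_balance[of y c "\<one>[L]"] L by (simp_all add: CL)

lemma lcl_zero: "y \<in> carrier L ==> lcl \<zero>[L] y = \<zero>[LCL]" "y \<in> carrier L ==> lcl y \<zero>[L] = \<zero>[LCL]"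
 using lin_zero[OF lcl_lin1 Lm LCL_module] lin_zero[OF lcl_lin2 Lm LCL_module] by auto

lemma ka_C:
 assumes c: "c \<in> carrier C" and u: "u \<in> carrier (T (Suc 0))"
 shows "lmult LCL c (ka u) = ka (lmult (T (Suc 0)) c u)" "rmult LCL (ka u) c = ka (rmult (T (Suc 0)) u c)"
proof -
 note cL = CL[OF c]
 show "lmult LCL c (ka u) = ka (lmult (T (Suc 0)) c u)"
 proof (rule T1_lin_eq[OF lin_comp[OF ka_lin bm_l[OF LCL_bimodule cL]] lin_comp[OF bm_l[OF T_bimodule c] ka_lin] _ u])
  fix i assume i: "i \<in> I"
  then show "lmult LCL c (ka (tg (Suc 0) [i])) = ka (lmult (T (Suc 0)) c (tg (Suc 0) [i]))"
   using c cL L by (simp add: ka_tg T_l CI LCL_rules IL lcl_one_C)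
 qed
 show "rmult LCL (ka u) c = ka (rmult (T (Suc 0)) u c)"
 proof (rule T1_lin_eq[OF lin_comp[OF ka_lin bm_r[OF LCL_bimodule cL]] lin_comp[OF bm_r[OF T_bimodule c] ka_lin] _ u])
  fix i assume i: "i \<in> I"
  then show "rmult LCL (ka (tg (Suc 0) [i])) c = ka (rmult (T (Suc 0)) (tg (Suc 0) [i]) c)"
   using c cL L T_r[of c i "[]" 0] by (simp add: ka_tg IC LCL_rules IL lcl_one_C)
 qed
qed

text \<open>Since \<open>j i\<close> and \<open>i j\<close> vanish,
  \<open>1 \<otimes> i - i \<otimes> 1\<close> becomes \<open>j \<otimes> i\<close> under
  \<open>j\<close> from the left and \<open>- i \<otimes> j\<close> under \<open>j\<close> from the
  right. Hence the opposite signs of \<open>v\<close> and \<open>w\<close> in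
  \<open>eps\<close>.\<close>

lemma ka_I:
 assumes j: "j \<in> I" and u: "u \<in> carrier (T (Suc 0))"
 shows "lmult LCL j (ka u) = mu (cl (Suc 0) j u)" "rmult LCL (ka u) j = \<ominus>[LCL] mu (cr (Suc 0) u j)"
proof -
 note jL = IL[OF j]
 show "lmult LCL j (ka u) = mu (cl (Suc 0) j u)"
 proof (rule T1_lin_eq[OF lin_comp[OF ka_lin bm_l[OF LCL_bimodule jL]] lin_comp[OF cl_lin[OF j] mu_lin] _ u])
  fix i assume i: "i \<in> I"
  then show "lmult LCL j (ka (tg (Suc 0) [i])) = mu (cl (Suc 0) j (tg (Suc 0) [i]))"
   using j jL L by (simp add: ka_tg cl_tg mu_tg LCL_rules IL II lcl_zero)
 qed
 have n: "lin K LCL LCL (%x. \<ominus>[LCL] x)"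
  by (rule lin_cong[OF lin_fun_smult[OF LCL_module lin_ident, of "\<ominus> \<one>"]])
   (simp_all add: v_inv_smult[OF LCL_module])
 show "rmult LCL (ka u) j = \<ominus>[LCL] mu (cr (Suc 0) u j)"
 proof (rule T1_lin_eq[OF lin_comp[OF ka_lin bm_r[OF LCL_bimodule jL]] lin_comp[OF lin_comp[OF cr_lin[OF j] mu_lin] n] _ u])
  fix i assume i: "i \<in> I"
  then show "rmult LCL (ka (tg (Suc 0) [i])) j = \<ominus>[LCL] mu (cr (Suc 0) (tg (Suc 0) [i]) j)"
   using j jL L by (simp add: ka_tg cr_tg mu_tg LCL_rules IL II lcl_zero) (simp add: a_minus_def IL)
 qed
qed

lemma mu_C:
 assumes c: "c \<in> carrier C" and u: "u \<in> carrier (Tb 0)"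
 shows "lmult LCL c (mu u) = mu (lmult (Tb 0) c u)" "rmult LCL (mu u) c = mu (rmult (Tb 0) u c)"
proof -
 note cL = CL[OF c]
 show "lmult LCL c (mu u) = mu (lmult (Tb 0) c u)"
  by (rule T2_lin_eq[OF lin_comp[OF mu_lin bm_l[OF LCL_bimodule cL]] lin_comp[OF bm_l[OF T_bimodule c] mu_lin] _ u])
   (use c cL L in \<open>simp add: mu_tg T_l CI LCL_rules IL\<close>)
 show "rmult LCL (mu u) c = mu (rmult (Tb 0) u c)"
 proof (rule T2_lin_eq[OF lin_comp[OF mu_lin bm_r[OF LCL_bimodule cL]] lin_comp[OF bm_r[OF T_bimodule c] mu_lin] _ u])
  fix i j assume "i \<in> I" "j \<in> I"
  then show "rmult LCL (mu (tg (Suc (Suc 0)) [i, j])) c = mu (rmult (Tb 0) (tg (Suc (Suc 0)) [i, j]) c)"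
   using c cL L T_r[of c j "[i]" "Suc 0"] by (simp add: mu_tg IC LCL_rules IL)
 qed
qed

lemma mu_I:
 assumes j: "j \<in> I" and u: "u \<in> carrier (Tb 0)"
 shows "lmult LCL j (mu u) = \<zero>[LCL]" "rmult LCL (mu u) j = \<zero>[LCL]"
 by (rule T2_lin_eq[OF lin_comp[OF mu_lin bm_l[OF LCL_bimodule IL[OF j]]] lin_const_zero[OF LCL_module] _ u]
   T2_lin_eq[OF lin_comp[OF mu_lin bm_r[OF LCL_bimodule IL[OF j]]] lin_const_zero[OF LCL_module] _ u];
   use j in \<open>simp add: mu_tg LCL_rules IL II lcl_zero\<close>)+

text \<open>On \<open>L \<otimes> I \<otimes> L\<close> over \<open>C\<close> this is \<open>x
  \<otimes> i \<otimes> y \<mapsto> x (1 \<otimes> i - i \<otimes> 1) y\<close>. On the fourth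
  summand both \<open>x\<close> and \<open>y\<close> lie in \<open>I\<close>, and the value is
  zero.\<close>

definition eps :: "('l list => 'k) set \<times> ('l list => 'k) set \<times> ('l list => 'k) set \<times> ('l list => 'k) set
  => ('l \<times> 'l => 'k) set" where
 "eps = (%(u, v, w, z). ka u \<oplus>[LCL] (mu v \<ominus>[LCL] mu w))"

lemma LCL_split:
 assumes x: "x \<in> carrier L" and y: "y \<in> carrier LCL"
 shows "lmult LCL x y = lmult LCL (pc x) y \<oplus>[LCL] lmult LCL (pi x) y"
  "rmult LCL y x = rmult LCL y (pc x) \<oplus>[LCL] rmult LCL y (pi x)"
 using lin_add[OF bm_la[OF LCL_bimodule y], of "pc x" "pi x"] lin_add[OF bm_ra[OF LCL_bimodule y], of "pc x" "pi x"]
  decomp[OF x] x by (simp_all add: CL IL)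

lemma eps_mul: "q \<in> carrier (Q 0) ==> mul (eps q) = \<zero>[L]"
proof -
 assume "q \<in> carrier (Q 0)"
 then obtain u v w z where q: "q = (u, v, w, z)" "u \<in> carrier (T (Suc 0))" "v \<in> carrier (Tb 0)"
  "w \<in> carrier (Tb 0)" "z \<in> carrier (Tc 0)" by (auto simp: Q_simps)
 have 1: "mul (ka u) = \<zero>[L]" if "u \<in> carrier (T (Suc 0))" for u
  by (rule T1_lin_eq[OF lin_comp[OF ka_lin mul_lin] lin_const_zero[OF Lm] _ that])
   (use L in \<open>simp add: ka_tg lin_minus[OF mul_lin LCL_module Lm] mul_lcl IL\<close>)
 have 2: "mul (mu u) = \<zero>[L]" if "u \<in> carrier (Tb 0)" for u
  by (rule T2_lin_eq[OF lin_comp[OF mu_lin mul_lin] lin_const_zero[OF Lm] _ that])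
   (simp add: mu_tg mul_lcl IL II)
 show ?thesis
  using q by (simp add: eps_def lin_add[OF mul_lin] lin_minus[OF mul_lin LCL_module Lm] 1 2)
qed

lemma K1_simps: "u \<in> carrier K1 \<longleftrightarrow> u \<in> carrier LCL \<and> mul u = \<zero>[L]" "\<zero>[K1] = \<zero>[LCL]" "x \<oplus>[K1] y = x \<oplus>[LCL] y"
  "a \<odot>[K1] x = a \<odot>[LCL] x" "lmult K1 = lmult LCL" "rmult K1 = rmult LCL"
 by (simp_all add: K1_eq)

lemma eps_hom: "bhom K L L (Q 0) K1 eps"
proof (rule bhomI)
 note S = Q_simps eps_def LCL_rules lin_add[OF ka_lin] lin_add[OF mu_lin] lin_smult[OF ka_lin] lin_smult[OF mu_lin] T_rules
 have lQ: "lin K (Q 0) LCL eps"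
  by (rule linI) (auto simp: S v_add_swap v_minus_add_swap v_smult_r_distr v_smult_minus)
 then show "lin K (Q 0) K1 eps"
  using eps_mul by (auto simp: lin_def K1_simps)
 fix x q assume x: "x \<in> carrier L" and "q \<in> carrier (Q 0)"
 then obtain u v w z where q: "q = (u, v, w, z)" "u \<in> carrier (T (Suc 0))" "v \<in> carrier (Tb 0)"
  "w \<in> carrier (Tb 0)" "z \<in> carrier (Tc 0)" by (auto simp: Q_simps)
 have e: "eps q \<in> carrier LCL" using q by (simp add: eps_def)
 have l: "lmult LCL y (eps q) = lmult LCL y (ka u) \<oplus>[LCL] (lmult LCL y (mu v) \<ominus>[LCL] lmult LCL y (mu w))"
  "rmult LCL (eps q) y = rmult LCL (ka u) y \<oplus>[LCL] (rmult LCL (mu v) y \<ominus>[LCL] rmult LCL (mu w) y)"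
  if "y \<in> carrier L" for y
  using q that by (simp_all add: eps_def bm_ladd[OF LCL_bimodule] bm_radd[OF LCL_bimodule] LCL_rules)
 show "eps (lmult (Q 0) x q) = lmult K1 x (eps q)"
  unfolding K1_simps LCL_split[OF x e] l[OF CL[OF pc_closed[OF x]]] l[OF IL[OF pi_closed[OF x]]]
  using x q by (simp add: CL IL ka_C ka_I mu_C mu_I) (simp add: S a_minus_def v_assoc v_comm v_lcomm)
 show "eps (rmult (Q 0) q x) = rmult K1 (eps q) x"
  unfolding K1_simps LCL_split[OF x e] l[OF CL[OF pc_closed[OF x]]] l[OF IL[OF pi_closed[OF x]]]
  using x q by (simp add: CL IL ka_C ka_I mu_C mu_I) (simp add: S a_minus_def v_inv_add v_assoc v_comm v_lcomm)
qed

text \<open>This separates the two parts of an element of the kernel and gives uniqueness of the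
  decomposition, where \<open>LCL_decomp\<close> gives existence.\<close>

lemma nu_ka: "u \<in> carrier (T (Suc 0)) ==> nu1 (ka u) = u" "u \<in> carrier (T (Suc 0)) ==> nu2 (ka u) = \<zero>[Tb 0]"
 and nu_mu: "v \<in> carrier (Tb 0) ==> nu1 (mu v) = \<zero>[T (Suc 0)]" "v \<in> carrier (Tb 0) ==> nu2 (mu v) = v"
proof -
 have one: "pc \<one>[L] = \<one>[L]" "pi \<one>[L] = \<zero>[L]" using C_one by (simp_all add: pc_C pi_C)
 have z: "\<zero>[L] \<in> I" by (rule v_submoduleD(2)[OF Lm Isub])
 have t1: "tg (Suc 0) [\<zero>[L]] = \<zero>[T (Suc 0)]" using lin_zero[OF T1_lin] bm_module[OF Im_bimodule] by simp
 have t2: "tg (Suc (Suc 0)) [\<zero>[L], i] = \<zero>[Tb 0]" "tg (Suc (Suc 0)) [i, \<zero>[L]] = \<zero>[Tb 0]" if "i \<in> I" for i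
  using lin_zero[OF T_lin[of "[]" "[i]" "Suc (Suc 0)"]] lin_zero[OF T_lin[of "[i]" "[]" "Suc (Suc 0)"]]
   bm_module[OF Im_bimodule] that by simp_all
 note S = lin_minus[OF nu1_lin LCL_module T_module] lin_minus[OF nu2_lin LCL_module T_module] nu1_lcl nu2_lcl one pc_I pi_I
  L_null IL t1 t2 z tpgen_closed[OF Im_powable]
 show "u \<in> carrier (T (Suc 0)) ==> nu1 (ka u) = u"
  by (rule T1_lin_eq[OF lin_comp[OF ka_lin nu1_lin] lin_ident]) (use L in \<open>simp_all add: S ka_tg\<close>)
 show "u \<in> carrier (T (Suc 0)) ==> nu2 (ka u) = \<zero>[Tb 0]"
  by (rule T1_lin_eq[OF lin_comp[OF ka_lin nu2_lin] lin_const_zero[OF T_module]]) (use L in \<open>simp_all add: S ka_tg\<close>)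
 show "v \<in> carrier (Tb 0) ==> nu1 (mu v) = \<zero>[T (Suc 0)]"
  by (rule T2_lin_eq[OF lin_comp[OF mu_lin nu1_lin] lin_const_zero[OF T_module]]) (use L in \<open>simp_all add: S mu_tg\<close>)
 show "v \<in> carrier (Tb 0) ==> nu2 (mu v) = v"
  by (rule T2_lin_eq[OF lin_comp[OF mu_lin nu2_lin] lin_ident]) (use L in \<open>simp_all add: S mu_tg\<close>)
qed

text \<open>Both factors are split along \<open>C \<oplus> I\<close> and elements of
  \<open>C\<close> are moved across the tensor sign; beyond \<open>mul y \<otimes> 1\<close> only
  values of \<open>ka\<close> and \<open>mu\<close> remain.\<close>

lemma LCL_decomp:
 assumes y: "y \<in> carrier LCL"
 shows "y = lcl (mul y) \<one>[L] \<oplus>[LCL] (ka (nu1 y) \<oplus>[LCL] mu (nu2 y))"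
proof (rule LCL_lin_eq[OF lin_ident _ _ y])
 show "lin K LCL LCL (%y. lcl (mul y) \<one>[L] \<oplus>[LCL] (ka (nu1 y) \<oplus>[LCL] mu (nu2 y)))"
  using L by (intro lin_fun_add[OF LCL_module] lin_comp[OF mul_lin lcl_lin1] lin_comp[OF nu1_lin ka_lin] lin_comp[OF nu2_lin mu_lin]) simp
 fix x y assume x: "x \<in> carrier L" and y: "y \<in> carrier L"
 have cl: "pc x \<in> carrier L" "pi x \<in> carrier L" "pc y \<in> carrier L" "pi y \<in> carrier L" "pc x \<otimes>[L] pi y \<in> carrier L" "x \<otimes>[L] pc y \<in> carrier L"
  using x y L CL IL by auto
 have xy: "x \<otimes>[L] y = x \<otimes>[L] pc y \<oplus>[L] pc x \<otimes>[L] pi y"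
 proof -
  have "x \<otimes>[L] y = x \<otimes>[L] pc y \<oplus>[L] x \<otimes>[L] pi y"
   using decomp[OF y] lin_add[OF alg_lin2[OF L x] cl(3,4)] by simp
  also have "x \<otimes>[L] pi y = (pc x \<oplus>[L] pi x) \<otimes>[L] pi y" using decomp[OF x] by simp
  also have "\<dots> = pc x \<otimes>[L] pi y"
   using cl x y L by (simp add: lin_add[OF alg_lin1[OF L]] II)
  finally show ?thesis .
 qed
 have "lcl x y = lcl x (pc y) \<oplus>[LCL] lcl x (pi y)"
  using decomp[OF y] lin_add[OF lcl_lin2[OF x] cl(3,4)] by simp
 also have "lcl x (pc y) = lcl (x \<otimes>[L] pc y) \<one>[L]" using x y by (simp add: lcl_one_C)
 also have "lcl x (pi y) = lcl (pc x) (pi y) \<oplus>[LCL] lcl (pi x) (pi y)"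
  using decomp[OF x] lin_add[OF lcl_lin1[OF cl(4)] cl(1,2)] by simp
 also have "lcl (pc x) (pi y) = lcl (pc x \<otimes>[L] pi y) \<one>[L] \<oplus>[LCL] (lcl \<one>[L] (pc x \<otimes>[L] pi y) \<ominus>[LCL] lcl (pc x \<otimes>[L] pi y) \<one>[L])"
  using x y cl L lcl_one_C(1)[of "pc x" "pi y"] by (simp add: a_minus_def v_assoc v_comm v_lcomm)
 also have "lcl (x \<otimes>[L] pc y) \<one>[L] \<oplus>[LCL] (lcl (pc x \<otimes>[L] pi y) \<one>[L]
   \<oplus>[LCL] (lcl \<one>[L] (pc x \<otimes>[L] pi y) \<ominus>[LCL] lcl (pc x \<otimes>[L] pi y) \<one>[L]) \<oplus>[LCL] lcl (pi x) (pi y))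
   = lcl (mul (lcl x y)) \<one>[L] \<oplus>[LCL] (ka (nu1 (lcl x y)) \<oplus>[LCL] mu (nu2 (lcl x y)))"
  using x y cl L
  by (simp add: mul_lcl nu1_lcl nu2_lcl ka_tg mu_tg CI xy lin_add[OF lcl_lin1] v_assoc)
 finally show "lcl x y = lcl (mul (lcl x y)) \<one>[L] \<oplus>[LCL] (ka (nu1 (lcl x y)) \<oplus>[LCL] mu (nu2 (lcl x y)))" .
qed

lemma eps_surj: "eps ` carrier (Q 0) = carrier K1"
proof
 show "eps ` carrier (Q 0) <= carrier K1" using lin_closed[OF bhomD(1)[OF eps_hom]] by auto
 show "carrier K1 <= eps ` carrier (Q 0)"
 proof
  fix y assume "y \<in> carrier K1"
  then have y: "y \<in> carrier LCL" "mul y = \<zero>[L]" by (simp_all add: K1_simps)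
  have n: "nu1 y \<in> carrier (T (Suc 0))" "nu2 y \<in> carrier (Tb 0)"
   using y lin_closed[OF nu1_lin] lin_closed[OF nu2_lin] by auto
  have "y = eps (nu1 y, nu2 y, \<zero>[Tb 0], \<zero>[Tc 0])"
   using LCL_decomp[OF y(1)] y n L by (simp add: eps_def lcl_zero lin_zero[OF mu_lin T_module LCL_module])
  then show "y \<in> eps ` carrier (Q 0)" by (rule image_eqI) (use n in \<open>simp add: Q_simps\<close>)
 qed
qed

lemma eps_exact:
 assumes "q \<in> carrier (Q 0)"
 shows "eps q = \<zero>[K1] \<longleftrightarrow> q \<in> dQ 0 ` carrier (Q (Suc 0))"
proof
 obtain u v w z where q: "q = (u, v, w, z)" "u \<in> carrier (T (Suc 0))" "v \<in> carrier (Tb 0)"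
  "w \<in> carrier (Tb 0)" "z \<in> carrier (Tc 0)" using assms by (auto simp: Q_simps)
 assume "eps q = \<zero>[K1]"
 then have e: "ka u \<oplus>[LCL] (mu v \<ominus>[LCL] mu w) = \<zero>[LCL]" using q by (simp add: K1_simps eps_def)
 have "nu1 (ka u \<oplus>[LCL] (mu v \<ominus>[LCL] mu w)) = u"
  using q by (simp add: lin_add[OF nu1_lin] lin_minus[OF nu1_lin LCL_module T_module] nu_ka nu_mu)
 then have u: "u = \<zero>[T (Suc 0)]" using e lin_zero[OF nu1_lin LCL_module T_module] by simp
 have "nu2 (ka u \<oplus>[LCL] (mu v \<ominus>[LCL] mu w)) = v \<ominus>[Tb 0] w"
  using q by (simp add: lin_add[OF nu2_lin] lin_minus[OF nu2_lin LCL_module T_module] nu_ka nu_mu)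
 then have "v \<ominus>[Tb 0] w = \<zero>[Tb 0]" using e lin_zero[OF nu2_lin LCL_module T_module] by simp
 then have "v = w" using q by (simp add: v_minus_eq_zero)
 then have "q = dQ 0 (v, \<zero>[Tc 0], z, \<zero>[Tc (Suc 0)])"
  using q u by (simp add: dQ_def sg_def)
 then show "q \<in> dQ 0 ` carrier (Q (Suc 0))"
  by (rule image_eqI) (use q in \<open>simp add: Q_simps\<close>)
next
 assume "q \<in> dQ 0 ` carrier (Q (Suc 0))"
 then show "eps q = \<zero>[K1]"
  by (auto simp: dQ_def Q_simps sg_def eps_def K1_simps lin_zero[OF ka_lin T_module LCL_module])
qed

theorem Q_resolution: "resolution K L K1 Q dQ eps"
 by (intro resolution.intro resolution_axioms.intro fld_axioms K1_bimodule Q_bimodule dQ_hom eps_hom eps_surj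
   eps_exact dQ_exact)

end

section \<open>Lifting out of the relative bar resolution\<close>

context square_zero
begin

abbreviation "Iv \<equiv> L\<lparr>carrier := I\<rparr>"
text \<open>\<open>CI\<close> and \<open>IC\<close> are tensor products over the field, in contrast
  to the powers \<open>T\<close>, which are over \<open>C\<close>. A \<open>C\<close>-linear map out
  of them is determined by any linear map on \<open>I\<close>.\<close>

abbreviation "CI \<equiv> tensor K K (kbimod C) (kbimod Iv)"
abbreviation "ci \<equiv> tens K K (kbimod C) (kbimod Iv)"
abbreviation "IC \<equiv> tensor K K (kbimod Iv) (kbimod C)"
abbreviation "ic \<equiv> tens K K (kbimod Iv) (kbimod C)"

lemma Iv_module [simp]: "module K Iv"
 by (rule v_submodule_module[OF Lm Isub])

lemma Iv_lin: "lin K Iv V f = lin K Im V f" "lin K W Iv g = lin K W Im g"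
 by (simp_all add: lin_def)

lemma CI_t: "tensorable K K (kbimod C) (kbimod Iv)" and IC_t: "tensorable K K (kbimod Iv) (kbimod C)"
 by simp_all

lemma CI_lift:
 assumes V: "module K V" and "!!c. c \<in> carrier C ==> lin K Im V (\<phi> c)" "!!i. i \<in> I ==> lin K C V (%c. \<phi> c i)"
 shows "lin K CI V (plift K V (%(c, i). \<phi> c i))"
  and "c \<in> carrier C ==> i \<in> I ==> plift K V (%(c, i). \<phi> c i) (ci c i) = \<phi> c i"
proof -
 have b: "balanced K K (kbimod C) (kbimod Iv) V \<phi>"
  by (rule balanced_kI) (use assms(2,3) in \<open>simp_all add: Iv_lin\<close>)
 show "lin K CI V (plift K V (%(c, i). \<phi> c i))" by (rule tensor_lift(1)[OF CI_t V b])
 show "c \<in> carrier C ==> i \<in> I ==> plift K V (%(c, i). \<phi> c i) (ci c i) = \<phi> c i"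
  using tensor_lift(2)[OF CI_t V b] by simp
qed

lemma IC_lift:
 assumes V: "module K V" and "!!c. c \<in> carrier C ==> lin K Im V (%i. \<phi> i c)" "!!i. i \<in> I ==> lin K C V (\<phi> i)"
 shows "lin K IC V (plift K V (%(i, c). \<phi> i c))"
  and "c \<in> carrier C ==> i \<in> I ==> plift K V (%(i, c). \<phi> i c) (ic i c) = \<phi> i c"
proof -
 have b: "balanced K K (kbimod Iv) (kbimod C) V \<phi>"
  by (rule balanced_kI) (use assms(2,3) in \<open>simp_all add: Iv_lin\<close>)
 show "lin K IC V (plift K V (%(i, c). \<phi> i c))" by (rule tensor_lift(1)[OF IC_t V b])
 show "c \<in> carrier C ==> i \<in> I ==> plift K V (%(i, c). \<phi> i c) (ic i c) = \<phi> i c"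
  using tensor_lift(2)[OF IC_t V b] by simp
qed

lemma CI_eq:
 assumes "lin K CI V f" "lin K CI V h" "!!c i. c \<in> carrier C ==> i \<in> I ==> f (ci c i) = h (ci c i)" "u \<in> carrier CI"
 shows "f u = h u"
 by (rule tensor_lin_eq[OF CI_t assms(1,2) _ assms(4)]) (use assms(3) in simp)

lemma IC_eq:
 assumes "lin K IC V f" "lin K IC V h" "!!c i. c \<in> carrier C ==> i \<in> I ==> f (ic i c) = h (ic i c)" "u \<in> carrier IC"
 shows "f u = h u"
 by (rule tensor_lin_eq[OF IC_t assms(1,2) _ assms(4)]) (use assms(3) in simp)

lemma ci_lin: "c \<in> carrier C ==> lin K Im CI (ci c)" "i \<in> I ==> lin K C CI (%c. ci c i)"
 using tens_lin2[OF CI_t, of c] tens_lin1[OF CI_t, of i] by (simp_all add: Iv_lin)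

lemma ic_lin: "i \<in> I ==> lin K C IC (ic i)" "c \<in> carrier C ==> lin K Im IC (%i. ic i c)"
 using tens_lin2[OF IC_t, of i] tens_lin1[OF IC_t, of c] by (simp_all add: Iv_lin)

lemma Im_lin: "c \<in> carrier C ==> lin K Im Im (%i. c \<otimes>[L] i)" "c \<in> carrier C ==> lin K Im Im (%i. i \<otimes>[L] c)"
 using bm_l[OF Im_bimodule, of c] bm_r[OF Im_bimodule, of c] by (simp_all add: lin_def Pi_iff)

lemma C_lin: "c \<in> carrier C ==> lin K C C (%x. c \<otimes>[L] x)" "c \<in> carrier C ==> lin K C C (%x. x \<otimes>[L] c)"
 using alg_lin2[OF C_alg, of c] alg_lin1[OF C_alg, of c] by (simp_all add: C_simps)

lemma CI_module [simp]: "module K CI" and IC_module [simp]: "module K IC"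
 using tensor_module[OF CI_t] tensor_module[OF IC_t] by auto

end

text \<open>Projectivity of \<open>I\<close> as a \<open>C\<close>-bimodule enters through bimodule sections \<open>sl\<close> and \<open>sr\<close> of the two actions
 \<open>C \<otimes> I \<rightarrow> I\<close> and \<open>I \<otimes> C \<rightarrow> I\<close>.\<close>

locale square_zero_proj = square_zero K L C I pc pi
 for K :: "('k, 'x) ring_scheme" (structure) and L C :: "('k, 'l) module" and I :: "'l set" and pc pi :: "'l => 'l" +
 fixes sl sr :: "'l => ('l \<times> 'l => 'k) set"
 assumes sl_lin: "lin K Im (tensor K K (kbimod C) (kbimod (L\<lparr>carrier := I\<rparr>))) sl"
  and sl_l: "c \<in> carrier C ==> i \<in> I ==> sl (c \<otimes>[L] i) = plift K (tensor K K (kbimod C) (kbimod (L\<lparr>carrier := I\<rparr>)))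
    (%(c', y). tens K K (kbimod C) (kbimod (L\<lparr>carrier := I\<rparr>)) (c \<otimes>[L] c') y) (sl i)"
  and sl_r: "c \<in> carrier C ==> i \<in> I ==> sl (i \<otimes>[L] c) = plift K (tensor K K (kbimod C) (kbimod (L\<lparr>carrier := I\<rparr>)))
    (%(c', y). tens K K (kbimod C) (kbimod (L\<lparr>carrier := I\<rparr>)) c' (y \<otimes>[L] c)) (sl i)"
  and sl_act: "i \<in> I ==> plift K L (%(c, y). c \<otimes>[L] y) (sl i) = i"
  and sr_lin: "lin K Im (tensor K K (kbimod (L\<lparr>carrier := I\<rparr>)) (kbimod C)) sr"
  and sr_l: "c \<in> carrier C ==> i \<in> I ==> sr (c \<otimes>[L] i) = plift K (tensor K K (kbimod (L\<lparr>carrier := I\<rparr>)) (kbimod C))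
    (%(y, c'). tens K K (kbimod (L\<lparr>carrier := I\<rparr>)) (kbimod C) (c \<otimes>[L] y) c') (sr i)"
  and sr_r: "c \<in> carrier C ==> i \<in> I ==> sr (i \<otimes>[L] c) = plift K (tensor K K (kbimod (L\<lparr>carrier := I\<rparr>)) (kbimod C))
    (%(y, c'). tens K K (kbimod (L\<lparr>carrier := I\<rparr>)) (kbimod C) y (c' \<otimes>[L] c)) (sr i)"
  and sr_act: "i \<in> I ==> plift K L (%(y, c). y \<otimes>[L] c) (sr i) = i"
begin

lemma sl_closed [simp]: "i \<in> I ==> sl i \<in> carrier CI" and sr_closed [simp]: "i \<in> I ==> sr i \<in> carrier IC"
 using lin_closed[OF sl_lin] lin_closed[OF sr_lin] by auto

text \<open>If \<open>sl i\<close> is a sum of tensors \<open>c \<otimes> y\<close>, then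
  \<open>bl Y h (sl i)\<close> is the sum of the \<open>c h(y)\<close>: the linear map
  \<open>h\<close> averaged into a left \<open>C\<close>-linear one. \<open>br\<close> does the same
  on the right.\<close>

definition bl :: "('k, 'l, 'l, 'y) bimodule => ('l => 'y) => ('l \<times> 'l => 'k) set => 'y" where
 "bl Y h = plift K Y (%(c, y). lmult Y c (h y))"

definition br :: "('k, 'l, 'l, 'y) bimodule => ('l => 'y) => ('l \<times> 'l => 'k) set => 'y" where
 "br Y h = plift K Y (%(y, c). rmult Y (h y) c)"

context
 fixes Y :: "('k, 'l, 'l, 'y) bimodule" and h :: "'l => 'y"
 assumes Y: "bimodule K L L Y" and h: "lin K Im Y h"
begin

lemma bl_lin: "lin K CI Y (bl Y h)"
 and bl_ci: "c \<in> carrier C ==> i \<in> I ==> bl Y h (ci c i) = lmult Y c (h i)"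
proof -
 have hc: "h i \<in> carrier Y" if "i \<in> I" for i using lin_closed[OF h] that by simp
 note t = CI_lift[OF bm_module[OF Y] lin_comp[OF h bm_l[OF Y CL]] lin_C_L[OF bm_la[OF Y hc]]]
 show "lin K CI Y (bl Y h)" unfolding bl_def by (rule t(1))
 show "c \<in> carrier C ==> i \<in> I ==> bl Y h (ci c i) = lmult Y c (h i)" unfolding bl_def by (rule t(2))
qed

lemma br_lin: "lin K IC Y (br Y h)"
 and br_ic: "c \<in> carrier C ==> i \<in> I ==> br Y h (ic i c) = rmult Y (h i) c"
proof -
 have hc: "h i \<in> carrier Y" if "i \<in> I" for i using lin_closed[OF h] that by simp
 note t = IC_lift[OF bm_module[OF Y] lin_comp[OF h bm_r[OF Y CL]] lin_C_L[OF bm_ra[OF Y hc]]]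
 show "lin K IC Y (br Y h)" unfolding br_def by (rule t(1))
 show "c \<in> carrier C ==> i \<in> I ==> br Y h (ic i c) = rmult Y (h i) c" unfolding br_def by (rule t(2))
qed

lemma bl_sl_l: "c \<in> carrier C ==> i \<in> I ==> bl Y h (sl (c \<otimes>[L] i)) = lmult Y c (bl Y h (sl i))"
proof -
 assume c: "c \<in> carrier C" and i: "i \<in> I"
 note t = CI_lift[OF CI_module ci_lin(1)[OF C_mult[OF c]] lin_comp[OF C_lin(1)[OF c] ci_lin(2)]]
 show ?thesis unfolding sl_l[OF c i]
  by (rule CI_eq[OF lin_comp[OF t(1) bl_lin] lin_comp[OF bl_lin bm_l[OF Y CL[OF c]]] _ sl_closed[OF i]])
   (use c lin_closed[OF h] in \<open>simp_all add: t(2) bl_ci C_mult CL bm_lassoc[OF Y]\<close>)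
qed

lemma br_sr_r: "c \<in> carrier C ==> i \<in> I ==> br Y h (sr (i \<otimes>[L] c)) = rmult Y (br Y h (sr i)) c"
proof -
 assume c: "c \<in> carrier C" and i: "i \<in> I"
 note t = IC_lift[OF IC_module ic_lin(2)[OF C_mult[OF _ c]] lin_comp[OF C_lin(2)[OF c] ic_lin(1)]]
 show ?thesis unfolding sr_r[OF c i]
  by (rule IC_eq[OF lin_comp[OF t(1) br_lin] lin_comp[OF br_lin bm_r[OF Y CL[OF c]]] _ sr_closed[OF i]])
   (use c lin_closed[OF h] in \<open>simp_all add: t(2) br_ic C_mult CL bm_rassoc[OF Y]\<close>)
qed

text \<open>\<open>sl\<close> respects the right action as well, so under averaging on the left a
  right multiplication passes to the argument of \<open>h\<close>.\<close>

lemma bl_sl_r: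
 assumes c: "c \<in> carrier C" and i: "i \<in> I"
 shows "bl Y h (sl (i \<otimes>[L] c)) = bl Y (%y. h (y \<otimes>[L] c)) (sl i)"
proof -
 note t = CI_lift[OF CI_module lin_comp[OF Im_lin(2)[OF c] ci_lin(1)] ci_lin(2)[OF IC[OF c]]]
 have h': "lin K Im Y (%y. h (y \<otimes>[L] c))" by (rule lin_comp[OF Im_lin(2)[OF c] h])
 have v: "bl Y (%y. h (y \<otimes>[L] c)) (ci c' i) = lmult Y c' (h (i \<otimes>[L] c))" if "c' \<in> carrier C" "i \<in> I" for c' i
  using CI_lift(2)[OF bm_module[OF Y] lin_comp[OF h' bm_l[OF Y CL]] lin_C_L[OF bm_la[OF Y lin_closed[OF h', simplified]]] that]
  by (simp add: bl_def)
 have l: "lin K CI Y (bl Y (%y. h (y \<otimes>[L] c)))"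
  unfolding bl_def by (rule CI_lift(1)[OF bm_module[OF Y] lin_comp[OF h' bm_l[OF Y CL]] lin_C_L[OF bm_la[OF Y lin_closed[OF h', simplified]]]])
 show ?thesis unfolding sl_r[OF c i]
  by (rule CI_eq[OF lin_comp[OF t(1) bl_lin] l _ sl_closed[OF i]])
   (use c in \<open>simp_all add: t(2) bl_ci v IC\<close>)
qed

lemma br_sr_l:
 assumes c: "c \<in> carrier C" and i: "i \<in> I"
 shows "br Y h (sr (c \<otimes>[L] i)) = br Y (%y. h (c \<otimes>[L] y)) (sr i)"
proof -
 note t = IC_lift[OF IC_module lin_comp[OF Im_lin(1)[OF c] ic_lin(2)] ic_lin(1)[OF CI[OF c]]]
 have h': "lin K Im Y (%y. h (c \<otimes>[L] y))" by (rule lin_comp[OF Im_lin(1)[OF c] h])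
 have v: "br Y (%y. h (c \<otimes>[L] y)) (ic i c') = rmult Y (h (c \<otimes>[L] i)) c'" if "c' \<in> carrier C" "i \<in> I" for c' i
  using IC_lift(2)[OF bm_module[OF Y] lin_comp[OF h' bm_r[OF Y CL]] lin_C_L[OF bm_ra[OF Y lin_closed[OF h', simplified]]] that]
  by (simp add: br_def)
 have l: "lin K IC Y (br Y (%y. h (c \<otimes>[L] y)))"
  unfolding br_def by (rule IC_lift(1)[OF bm_module[OF Y] lin_comp[OF h' bm_r[OF Y CL]] lin_C_L[OF bm_ra[OF Y lin_closed[OF h', simplified]]]])
 show ?thesis unfolding sr_l[OF c i]
  by (rule IC_eq[OF lin_comp[OF t(1) br_lin] l _ sr_closed[OF i]])
   (use c in \<open>simp_all add: t(2) br_ic v CI\<close>)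
qed

text \<open>\<open>sl\<close> is a section of the action map, so averaging returns a map that was
  left linear already.\<close>

lemma bl_sl_id:
 assumes hl: "!!c i. c \<in> carrier C ==> i \<in> I ==> h (c \<otimes>[L] i) = lmult Y c (h i)" and i: "i \<in> I"
 shows "bl Y h (sl i) = h i"
proof -
 note t = CI_lift[OF Iv_module, unfolded Iv_lin, OF Im_lin(1) bm_la[OF Im_bimodule, simplified]]
 have t1: "lin K CI L (plift K L (%(c, y). c \<otimes>[L] y))" "!!c i. c \<in> carrier C ==> i \<in> I ==> plift K L (%(c, y). c \<otimes>[L] y) (ci c i) = c \<otimes>[L] i"
  by (rule CI_lift[OF Lm]; use L in \<open>auto intro: lin_to_L lin_Im_L lin_C_L alg_lin1 alg_lin2 CL IL\<close>)+
 \<comment> \<open>Proved for every tensor \<open>u\<close>, with the action applied to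
   \<open>u\<close> in the role of \<open>i\<close>; at the end \<open>u\<close> is
   \<open>sl i\<close>.\<close>
 have mem: "plift K L (%(c, y). c \<otimes>[L] y) u \<in> I \<and> h (plift K L (%(c, y). c \<otimes>[L] y) u) = bl Y h u" if "u \<in> carrier CI" for u
  using that
 proof (induction rule: tensor_induct[OF CI_t, consumes 1, case_names gen add])
  case (gen c i)
  then show ?case by (simp add: t1 CI hl bl_ci)
 next
  case (add u v)
  then show ?case
   using v_submoduleD(3)[OF Lm Isub] lin_add[OF h]
   by (simp add: lin_add[OF t1(1)] lin_add[OF bl_lin])
 qed
 from mem[OF sl_closed[OF i]] show ?thesis by (simp add: sl_act[OF i])
qed

lemma br_sr_id:
 assumes hl: "!!c i. c \<in> carrier C ==> i \<in> I ==> h (i \<otimes>[L] c) = rmult Y (h i) c" and i: "i \<in> I"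
 shows "br Y h (sr i) = h i"
proof -
 have t1: "lin K IC L (plift K L (%(y, c). y \<otimes>[L] c))" "!!c i. c \<in> carrier C ==> i \<in> I ==> plift K L (%(y, c). y \<otimes>[L] c) (ic i c) = i \<otimes>[L] c"
  by (rule IC_lift[OF Lm]; use L in \<open>auto intro: lin_to_L lin_Im_L lin_C_L alg_lin1 alg_lin2 CL IL\<close>)+
 have mem: "plift K L (%(y, c). y \<otimes>[L] c) u \<in> I \<and> h (plift K L (%(y, c). y \<otimes>[L] c) u) = br Y h u" if "u \<in> carrier IC" for u
  using that
 proof (induction rule: tensor_induct[OF IC_t, consumes 1, case_names gen add])
  case (gen i c)
  then show ?case by (simp add: t1 IC hl br_ic)
 next
  case (add u v)
  then show ?case
   using v_submoduleD(3)[OF Lm Isub] lin_add[OF h]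
   by (simp add: lin_add[OF t1(1)] lin_add[OF br_lin])
 qed
 from mem[OF sr_closed[OF i]] show ?thesis by (simp add: sr_act[OF i])
qed

end

lemma bl_comp:
 assumes Y: "bimodule K L L Y" and Y': "bimodule K L L Y'" and h: "lin K Im Y h" and \<pi>: "lin K Y Y' \<pi>"
  and l: "!!c y. c \<in> carrier C ==> y \<in> carrier Y ==> \<pi> (lmult Y c y) = lmult Y' c (\<pi> y)" and u: "u \<in> carrier CI"
 shows "\<pi> (bl Y h u) = bl Y' (%y. \<pi> (h y)) u"
 by (rule CI_eq[OF lin_comp[OF bl_lin[OF Y h] \<pi>] bl_lin[OF Y' lin_comp[OF h \<pi>]] _ u])
  (use lin_closed[OF h] in \<open>simp add: bl_ci[OF Y h] bl_ci[OF Y' lin_comp[OF h \<pi>]] l\<close>)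

lemma br_comp:
 assumes Y: "bimodule K L L Y" and Y': "bimodule K L L Y'" and h: "lin K Im Y h" and \<pi>: "lin K Y Y' \<pi>"
  and l: "!!c y. c \<in> carrier C ==> y \<in> carrier Y ==> \<pi> (rmult Y y c) = rmult Y' (\<pi> y) c" and u: "u \<in> carrier IC"
 shows "\<pi> (br Y h u) = br Y' (%y. \<pi> (h y)) u"
 by (rule IC_eq[OF lin_comp[OF br_lin[OF Y h] \<pi>] br_lin[OF Y' lin_comp[OF h \<pi>]] _ u])
  (use lin_closed[OF h] in \<open>simp add: br_ic[OF Y h] br_ic[OF Y' lin_comp[OF h \<pi>]] l\<close>)

context
 fixes Y :: "('k, 'l, 'l, 'y) bimodule" and n :: nat and g :: "'l list => 'y"
 assumes Y: "bimodule K L L Y" and g: "multilin K C Im (Suc n) Y g"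
begin

lemma g_l: "set ws <= I ==> length ws = n ==> lin K Im Y (%y. g (y # ws))"
 and g_r: "set ws <= I ==> length ws = n ==> lin K Im Y (%y. g (ws @ [y]))"
 using multilinD(2)[OF g, of "[]" ws] multilinD(2)[OF g, of ws "[]"] by simp_all

lemma bl_multilin:
 assumes u: "u \<in> carrier CI"
 shows "multilin K C Im n Y (%ws. bl Y (%y. g (y # ws)) u)"
proof (rule multilinI)
 fix ws assume "set ws <= carrier Im" "length ws = n"
 then show "bl Y (%y. g (y # ws)) u \<in> carrier Y" using lin_closed[OF bl_lin[OF Y g_l]] u by simp
next
 fix us vs assume uv: "set us <= carrier Im" "set vs <= carrier Im" "length us + length vs + 1 = n"
 have l: "lin K Im Y (%y. g (y # us @ w # vs))" if "w \<in> I" for w using g_l[of "us @ w # vs"] uv that by simp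
 show "lin K Im Y (%w. bl Y (%y. g (y # us @ w # vs)) u)"
  using u
 proof (induction rule: tensor_induct[OF CI_t, consumes 1, case_names gen add])
  case (gen c i)
  then have c: "c \<in> carrier C" and i: "i \<in> I" by simp_all
  show ?case
   by (rule lin_cong[OF lin_comp[OF multilinD(2)[OF g, of "i # us" vs] bm_l[OF Y CL[OF c]]]])
    (use uv c i bm_module[OF Im_bimodule] v_add[of Im] v_smult[of Im] in \<open>simp_all add: bl_ci[OF Y l]\<close>)
 next
  case (add u v)
  show ?case
   by (rule lin_cong[OF lin_fun_add[OF bm_module[OF Y] add(3,4)]])
    (use add bm_module[OF Im_bimodule] v_add[of Im] v_smult[of Im] in \<open>simp_all add: lin_add[OF bl_lin[OF Y l]]\<close>)
 qed
next
 fix us vs v s w assume uv: "set us <= carrier Im" "set vs <= carrier Im" "length us + length vs + 2 = n"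
  "v \<in> carrier Im" "s \<in> carrier C" "w \<in> carrier Im"
 have r: "rmult Im v s \<in> I" "lmult Im s w \<in> I" using uv by (simp_all add: CI IC)
 show "bl Y (%y. g (y # us @ rmult Im v s # w # vs)) u = bl Y (%y. g (y # us @ v # lmult Im s w # vs)) u"
 proof (rule CI_eq[OF bl_lin[OF Y g_l] bl_lin[OF Y g_l] _ u])
  fix c i assume "c \<in> carrier C" "i \<in> I"
  then show "bl Y (%y. g (y # us @ rmult Im v s # w # vs)) (ci c i) = bl Y (%y. g (y # us @ v # lmult Im s w # vs)) (ci c i)"
   using uv r multilinD(3)[OF g, of "i # us" vs v s w] by (subst (1 2) bl_ci[OF Y g_l]) simp_all
 qed (use uv r in simp_all)
qed

lemma br_multilin:
 assumes u: "u \<in> carrier IC"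
 shows "multilin K C Im n Y (%ws. br Y (%y. g (ws @ [y])) u)"
proof (rule multilinI)
 fix ws assume "set ws <= carrier Im" "length ws = n"
 then show "br Y (%y. g (ws @ [y])) u \<in> carrier Y" using lin_closed[OF br_lin[OF Y g_r]] u by simp
next
 fix us vs assume uv: "set us <= carrier Im" "set vs <= carrier Im" "length us + length vs + 1 = n"
 have l: "lin K Im Y (%y. g ((us @ w # vs) @ [y]))" if "w \<in> I" for w by (rule g_r) (use uv that in auto)
 show "lin K Im Y (%w. br Y (%y. g ((us @ w # vs) @ [y])) u)"
  using u
 proof (induction rule: tensor_induct[OF IC_t, consumes 1, case_names gen add])
  case (gen i c)
  then have c: "c \<in> carrier C" and i: "i \<in> I" by simp_all
  show ?case
   by (rule lin_cong[OF lin_comp[OF multilinD(2)[OF g, of us "vs @ [i]"] bm_r[OF Y CL[OF c]]]])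
    (use uv c i bm_module[OF Im_bimodule] v_add[of Im] v_smult[of Im] in \<open>simp_all add: br_ic[OF Y l, simplified]\<close>)
 next
  case (add u v)
  show ?case
   by (rule lin_cong[OF lin_fun_add[OF bm_module[OF Y] add(3,4)]])
    (use add bm_module[OF Im_bimodule] v_add[of Im] v_smult[of Im] in \<open>simp_all add: lin_add[OF br_lin[OF Y l], simplified]\<close>)
 qed
next
 fix us vs v s w assume uv: "set us <= carrier Im" "set vs <= carrier Im" "length us + length vs + 2 = n"
  "v \<in> carrier Im" "s \<in> carrier C" "w \<in> carrier Im"
 have r: "rmult Im v s \<in> I" "lmult Im s w \<in> I" using uv by (simp_all add: CI IC)
 show "br Y (%y. g ((us @ rmult Im v s # w # vs) @ [y])) u = br Y (%y. g ((us @ v # lmult Im s w # vs) @ [y])) u"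
 proof (rule IC_eq[OF br_lin[OF Y g_r] br_lin[OF Y g_r] _ u])
  fix c i assume "c \<in> carrier C" "i \<in> I"
  then show "br Y (%y. g ((us @ rmult Im v s # w # vs) @ [y])) (ic i c) = br Y (%y. g ((us @ v # lmult Im s w # vs) @ [y])) (ic i c)"
   using uv r multilinD(3)[OF g, of us "vs @ [i]" v s w] by (subst (1 2) br_ic[OF Y g_r]) simp_all
 qed (use uv r in simp_all)
qed

text \<open>The balancing between the first two letters is the point: the scalar passes through
  \<open>sl\<close> to the argument of \<open>g\<close> and from there into the second
  letter.\<close>

lemma left_avg_multilin: "multilin K C Im (Suc n) Y (%ws. bl Y (%y. g (y # tl ws)) (sl (hd ws)))"
proof (rule multilinI)
 fix ws :: "'l list" assume "set ws <= carrier Im" "length ws = Suc n"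
 then show "bl Y (%y. g (y # tl ws)) (sl (hd ws)) \<in> carrier Y"
  using lin_closed[OF bl_lin[OF Y g_l]] by (cases ws) auto
next
 fix us vs :: "'l list" assume uv: "set us <= carrier Im" "set vs <= carrier Im" "length us + length vs + 1 = Suc n"
 show "lin K Im Y (%w. bl Y (%y. g (y # tl (us @ w # vs))) (sl (hd (us @ w # vs))))"
 proof (cases us)
  case Nil
  then show ?thesis using lin_comp[OF sl_lin bl_lin[OF Y g_l]] uv by simp
 next
  case (Cons u us')
  then show ?thesis using multilinD(2)[OF bl_multilin[OF sl_closed], of u us' vs] uv by simp
 qed
next
 fix us vs :: "'l list" and v s w assume uv: "set us <= carrier Im" "set vs <= carrier Im" "length us + length vs + 2 = Suc n"
  "v \<in> carrier Im" "s \<in> carrier C" "w \<in> carrier Im"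
 show "bl Y (%y. g (y # tl (us @ rmult Im v s # w # vs))) (sl (hd (us @ rmult Im v s # w # vs)))
   = bl Y (%y. g (y # tl (us @ v # lmult Im s w # vs))) (sl (hd (us @ v # lmult Im s w # vs)))"
 proof (cases us)
  case Nil
  have "bl Y (%y. g (y # w # vs)) (sl (v \<otimes>[L] s)) = bl Y (%y. g ((y \<otimes>[L] s) # w # vs)) (sl v)"
   by (rule bl_sl_r[OF Y g_l]) (use uv Nil in simp_all)
  also have "\<dots> = bl Y (%y. g (y # (s \<otimes>[L] w) # vs)) (sl v)"
  proof (rule CI_eq[OF bl_lin[OF Y] bl_lin[OF Y g_l]])
   have l: "lin K Im Y (%y. g ((y \<otimes>[L] s) # w # vs))"
    by (rule lin_comp[OF Im_lin(2) g_l]) (use uv Nil in simp_all)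
   then show "lin K Im Y (%y. g ((y \<otimes>[L] s) # w # vs))" .
   fix c i assume "c \<in> carrier C" "i \<in> I"
   then show "bl Y (%y. g ((y \<otimes>[L] s) # w # vs)) (ci c i) = bl Y (%y. g (y # (s \<otimes>[L] w) # vs)) (ci c i)"
    using uv Nil multilinD(3)[OF g, of "[]" vs i s w] by (simp add: bl_ci[OF Y l] bl_ci[OF Y g_l] CI)
  qed (use uv Nil in \<open>simp_all add: CI\<close>)
  finally show ?thesis using Nil by simp
 next
  case (Cons u us')
  then show ?thesis using multilinD(3)[OF bl_multilin[OF sl_closed], of u us' vs v s w] uv by simp
 qed
qed

lemma right_avg_multilin: "multilin K C Im (Suc n) Y (%ws. br Y (%y. g (butlast ws @ [y])) (sr (last ws)))"
proof (rule multilinI)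
 fix ws :: "'l list" assume "set ws <= carrier Im" "length ws = Suc n"
 then show "br Y (%y. g (butlast ws @ [y])) (sr (last ws)) \<in> carrier Y"
  using lin_closed[OF br_lin[OF Y g_r]] by (cases ws rule: rev_cases) auto
next
 fix us vs :: "'l list" assume uv: "set us <= carrier Im" "set vs <= carrier Im" "length us + length vs + 1 = Suc n"
 show "lin K Im Y (%w. br Y (%y. g (butlast (us @ w # vs) @ [y])) (sr (last (us @ w # vs))))"
 proof (cases vs rule: rev_cases)
  case Nil
  then show ?thesis using lin_comp[OF sr_lin br_lin[OF Y g_r]] uv by (simp add: butlast_append)
 next
  case (snoc vs' v)
  then show ?thesis using multilinD(2)[OF br_multilin[OF sr_closed], of v us vs'] uv by (simp add: butlast_append)
 qed
next
 fix us vs :: "'l list" and v s w assume uv: "set us <= carrier Im" "set vs <= carrier Im" "length us + length vs + 2 = Suc n"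
  "v \<in> carrier Im" "s \<in> carrier C" "w \<in> carrier Im"
 show "br Y (%y. g (butlast (us @ rmult Im v s # w # vs) @ [y])) (sr (last (us @ rmult Im v s # w # vs)))
   = br Y (%y. g (butlast (us @ v # lmult Im s w # vs) @ [y])) (sr (last (us @ v # lmult Im s w # vs)))"
 proof (cases vs rule: rev_cases)
  case Nil
  have m: "set (us @ [v \<otimes>[L] s]) <= I" "length (us @ [v \<otimes>[L] s]) = n" "set (us @ [v]) <= I" "length (us @ [v]) = n"
   using uv Nil by (simp_all add: IC)
  have l: "lin K Im Y (%y. g ((us @ [v]) @ [s \<otimes>[L] y]))"
   by (rule lin_comp[OF Im_lin(1) g_r]) (use uv m in simp_all)
  have "br Y (%y. g ((us @ [v]) @ [y])) (sr (s \<otimes>[L] w)) = br Y (%y. g ((us @ [v]) @ [s \<otimes>[L] y])) (sr w)"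
   by (rule br_sr_l[OF Y g_r[OF m(3,4)]]) (use uv in simp_all)
  also have "\<dots> = br Y (%y. g ((us @ [v \<otimes>[L] s]) @ [y])) (sr w)"
  proof (rule IC_eq[OF br_lin[OF Y l] br_lin[OF Y g_r[OF m(1,2)]]])
   fix c i assume c: "c \<in> carrier C" and i: "i \<in> I"
   show "br Y (%y. g ((us @ [v]) @ [s \<otimes>[L] y])) (ic i c) = br Y (%y. g ((us @ [v \<otimes>[L] s]) @ [y])) (ic i c)"
    unfolding br_ic[OF Y l c i] br_ic[OF Y g_r[OF m(1,2)] c i]
    using uv Nil i multilinD(3)[OF g, of us "[]" v s i] by simp
  qed (use uv in simp)
  finally show ?thesis using Nil by (simp add: butlast_append)
 next
  case (snoc vs' z)
  then show ?thesis using multilinD(3)[OF br_multilin[OF sr_closed], of z us vs' v s w] uv by (simp add: butlast_append)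
 qed
qed

end

end

context square_zero_proj
begin

lemma bl_cong:
 assumes Y: "bimodule K L L Y" and h: "lin K Im Y h" and eq: "!!i. i \<in> I ==> h i = h' i" and u: "u \<in> carrier CI"
 shows "bl Y h u = bl Y h' u"
proof -
 have h': "lin K Im Y h'" by (rule lin_cong[OF h]) (use eq bm_module[OF Im_bimodule] v_add[of Im] v_smult[of Im] in auto)
 show ?thesis
  by (rule CI_eq[OF bl_lin[OF Y h] bl_lin[OF Y h'] _ u]) (simp add: bl_ci[OF Y h] bl_ci[OF Y h'] eq)
qed


lemma T_rl: "c \<in> carrier C ==> w \<in> I ==> set ws <= I ==> length ws = n ==> n > 0
  ==> rmult (T (Suc n)) (tg (Suc n) (w # ws)) c = tg (Suc n) (w # butlast ws @ [last ws \<otimes>[L] c])"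
 using T_r[of c "last ws" "w # butlast ws" n] by (cases ws rule: rev_cases) auto


context
 fixes Y Y' \<pi> n h
 assumes Y: "bimodule K L L Y" and Y': "bimodule K L L Y'" and \<pi>: "bhom K L L Y Y' \<pi>"
  and h: "lin K (T (Suc n)) Y h"
begin

lemma g_multilin: "multilin K C Im (Suc n) Y (%ws. h (tg (Suc n) ws))"
 by (rule multilin_comp[OF tpgen_multilin[OF Im_powable] h])

text \<open>The first letter of each word is averaged. Right linearity of \<open>h\<close> survives,
  as right multiplication touches the last letter or, in a word of one letter, passes through
  \<open>sl\<close>. The composite of \<open>\<pi>\<close> and \<open>h\<close> is left linear and
  hence unchanged.\<close>

lemma left_average:
 assumes hl: "!!c u. c \<in> carrier C ==> u \<in> carrier (T (Suc n)) ==> \<pi> (h (lmult (T (Suc n)) c u)) = lmult Y' c (\<pi> (h u))"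
  and hr: "!!c u. c \<in> carrier C ==> u \<in> carrier (T (Suc n)) ==> h (rmult (T (Suc n)) u c) = rmult Y (h u) c"
 obtains h' where "lin K (T (Suc n)) Y h'"
  "!!c u. c \<in> carrier C ==> u \<in> carrier (T (Suc n)) ==> h' (lmult (T (Suc n)) c u) = lmult Y c (h' u)"
  "!!c u. c \<in> carrier C ==> u \<in> carrier (T (Suc n)) ==> h' (rmult (T (Suc n)) u c) = rmult Y (h' u) c"
  "!!u. u \<in> carrier (T (Suc n)) ==> \<pi> (h' u) = \<pi> (h u)"
proof -
 note g = g_multilin and gl = g_l[OF Y g_multilin]
 define h' where "h' = plift K Y (%ws. bl Y (%y. h (tg (Suc n) (y # tl ws))) (sl (hd ws)))"
 note t = tpow_lift[OF Im_powable bm_module[OF Y] left_avg_multilin[OF Y g], folded h'_def]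
 have v: "h' (tg (Suc n) (w # ws)) = bl Y (%y. h (tg (Suc n) (y # ws))) (sl w)"
  if "w \<in> I" "set ws <= I" "length ws = n" for w ws using t(2)[of "w # ws"] that by simp
 have tc: "tg (Suc n) ws \<in> carrier (T (Suc n))" if "set ws <= I" "length ws = Suc n" for ws
  using tg_closed[of ws] that by simp
 have 1: "h' (lmult (T (Suc n)) c u) = lmult Y c (h' u)" if c: "c \<in> carrier C" and u: "u \<in> carrier (T (Suc n))" for c u
  by (rule T_lin_eq[OF lin_comp[OF bm_l[OF T_bimodule c] t(1)] lin_comp[OF t(1) bm_l[OF Y CL[OF c]]] _ u])
   (use c in \<open>simp add: T_l v CI bl_sl_l[OF Y gl]\<close>)
 have 2: "h' (rmult (T (Suc n)) u c) = rmult Y (h' u) c" if c: "c \<in> carrier C" and u: "u \<in> carrier (T (Suc n))" for c u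
 proof (rule T_lin_eq[OF lin_comp[OF bm_r[OF T_bimodule c] t(1)] lin_comp[OF t(1) bm_r[OF Y CL[OF c]]] _ u])
  fix w ws assume w: "w \<in> I" "set ws <= I" "length ws = n"
  have e: "rmult Y (h' (tg (Suc n) (w # ws))) c = bl Y (%y. rmult Y (h (tg (Suc n) (y # ws))) c) (sl w)"
   unfolding v[OF w]
   by (rule bl_comp[OF Y Y gl bm_r[OF Y CL[OF c]]]) (use w c in \<open>simp_all add: bm_lr[OF Y] CL\<close>)
  have r: "lin K Im Y (%y. rmult Y (h (tg (Suc n) (y # ws))) c)"
   by (rule lin_comp[OF gl bm_r[OF Y CL[OF c]]]) (use w in simp_all)
  show "h' (rmult (T (Suc n)) (tg (Suc n) (w # ws)) c) = rmult Y (h' (tg (Suc n) (w # ws))) c"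
  proof (cases n)
   \<comment> \<open>The first letter is also the last one, and the right action has to cross
     \<open>sl\<close>.\<close>
   case 0
   with w have ws: "ws = []" by simp
   have "h' (rmult (T (Suc n)) (tg (Suc n) (w # ws)) c) = bl Y (%y. h (tg (Suc n) (y # ws))) (sl (w \<otimes>[L] c))"
    using v[of "w \<otimes>[L] c" "[]"] T_r[of c w "[]" n] w c 0 ws by (simp add: IC)
   also have "\<dots> = bl Y (%y. h (tg (Suc n) ((y \<otimes>[L] c) # ws))) (sl w)"
    by (rule bl_sl_r[OF Y gl]) (use w c in simp_all)
   also have "\<dots> = bl Y (%y. rmult Y (h (tg (Suc n) (y # ws))) c) (sl w)"
   proof (rule bl_cong[OF Y r, symmetric])
    fix i assume i: "i \<in> I"
    then show "rmult Y (h (tg (Suc n) (i # ws))) c = h (tg (Suc n) ((i \<otimes>[L] c) # ws))"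
     using hr[OF c tc[of "[i]"]] T_r[of c i "[]" n] c 0 ws by simp
   qed (use w in simp)
   finally show ?thesis using e by simp
  next
   case (Suc m)
   let ?ws = "butlast ws @ [last ws \<otimes>[L] c]"
   from Suc w have ws: "set ?ws <= I" "length ?ws = n"
    using c by (cases ws rule: rev_cases; simp add: IC)+
   have "h' (rmult (T (Suc n)) (tg (Suc n) (w # ws)) c) = bl Y (%y. h (tg (Suc n) (y # ?ws))) (sl w)"
    using v[OF w(1) ws] T_rl[OF c w] Suc by simp
   also have "\<dots> = bl Y (%y. rmult Y (h (tg (Suc n) (y # ws))) c) (sl w)"
   proof (rule bl_cong[OF Y r, symmetric])
    fix i assume i: "i \<in> I"
    then show "rmult Y (h (tg (Suc n) (i # ws))) c = h (tg (Suc n) (i # ?ws))"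
     using hr[OF c tc[of "i # ws"]] w c Suc by (simp add: T_rl)
   qed (use w in simp)
   finally show ?thesis using e by simp
  qed
 qed
 have 3: "\<pi> (h' u) = \<pi> (h u)" if u: "u \<in> carrier (T (Suc n))" for u
 proof (rule T_lin_eq[OF lin_comp[OF t(1) bhomD(1)[OF \<pi>]] lin_comp[OF h bhomD(1)[OF \<pi>]] _ u])
  fix w ws assume w: "w \<in> I" "set ws <= I" "length ws = n"
  have "\<pi> (h' (tg (Suc n) (w # ws))) = bl Y' (%y. \<pi> (h (tg (Suc n) (y # ws)))) (sl w)"
   unfolding v[OF w]
   by (rule bl_comp[OF Y Y' gl bhomD(1)[OF \<pi>]]) (use w in \<open>simp_all add: bhomD(2)[OF \<pi>] CL\<close>)
  also have "\<dots> = \<pi> (h (tg (Suc n) (w # ws)))"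
  proof (rule bl_sl_id[OF Y' lin_comp[OF gl bhomD(1)[OF \<pi>]]])
   fix c i assume c: "c \<in> carrier C" and i: "i \<in> I"
   then show "\<pi> (h (tg (Suc n) ((c \<otimes>[L] i) # ws))) = lmult Y' c (\<pi> (h (tg (Suc n) (i # ws))))"
    using hl[OF c tc[of "i # ws"]] w by (simp add: T_l)
  qed (use w in simp_all)
  finally show "\<pi> (h' (tg (Suc n) (w # ws))) = \<pi> (h (tg (Suc n) (w # ws)))" .
 qed
 from that[OF t(1) 1 2 3] show thesis .
qed

lemma right_average:
 assumes hr: "!!c u. c \<in> carrier C ==> u \<in> carrier (T (Suc n)) ==> \<pi> (h (rmult (T (Suc n)) u c)) = rmult Y' (\<pi> (h u)) c"
 obtains h' where "lin K (T (Suc n)) Y h'"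
  "!!c u. c \<in> carrier C ==> u \<in> carrier (T (Suc n)) ==> h' (rmult (T (Suc n)) u c) = rmult Y (h' u) c"
  "!!u. u \<in> carrier (T (Suc n)) ==> \<pi> (h' u) = \<pi> (h u)"
proof -
 note g = g_multilin and gr = g_r[OF Y g_multilin]
 define h' where "h' = plift K Y (%ws. br Y (%y. h (tg (Suc n) (butlast ws @ [y]))) (sr (last ws)))"
 note t = tpow_lift[OF Im_powable bm_module[OF Y] right_avg_multilin[OF Y g], folded h'_def]
 have v: "h' (tg (Suc n) (ws @ [w])) = br Y (%y. h (tg (Suc n) (ws @ [y]))) (sr w)"
  if "w \<in> I" "set ws <= I" "length ws = n" for w ws using t(2)[of "ws @ [w]"] that by simp
 have tc: "tg (Suc n) ws \<in> carrier (T (Suc n))" if "set ws <= I" "length ws = Suc n" for ws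
  using tg_closed[of ws] that by simp
 have 1: "h' (rmult (T (Suc n)) u c) = rmult Y (h' u) c" if c: "c \<in> carrier C" and u: "u \<in> carrier (T (Suc n))" for c u
  by (rule T_lin_eq'[OF lin_comp[OF bm_r[OF T_bimodule c] t(1)] lin_comp[OF t(1) bm_r[OF Y CL[OF c]]] _ u])
   (use c in \<open>simp add: T_r v IC br_sr_r[OF Y gr]\<close>)
 have 3: "\<pi> (h' u) = \<pi> (h u)" if u: "u \<in> carrier (T (Suc n))" for u
 proof (rule T_lin_eq'[OF lin_comp[OF t(1) bhomD(1)[OF \<pi>]] lin_comp[OF h bhomD(1)[OF \<pi>]] _ u])
  fix w ws assume w: "w \<in> I" "set ws <= I" "length ws = n"
  have "\<pi> (h' (tg (Suc n) (ws @ [w]))) = br Y' (%y. \<pi> (h (tg (Suc n) (ws @ [y])))) (sr w)"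
   unfolding v[OF w]
   by (rule br_comp[OF Y Y' gr bhomD(1)[OF \<pi>]]) (use w in \<open>simp_all add: bhomD(3)[OF \<pi>] CL\<close>)
  also have "\<dots> = \<pi> (h (tg (Suc n) (ws @ [w])))"
  proof (rule br_sr_id[OF Y' lin_comp[OF gr bhomD(1)[OF \<pi>]]])
   fix c i assume c: "c \<in> carrier C" and i: "i \<in> I"
   then show "\<pi> (h (tg (Suc n) (ws @ [i \<otimes>[L] c]))) = rmult Y' (\<pi> (h (tg (Suc n) (ws @ [i])))) c"
    using hr[OF c tc[of "ws @ [i]"]] w by (simp add: T_r)
  qed (use w in simp_all)
  finally show "\<pi> (h' (tg (Suc n) (ws @ [w]))) = \<pi> (h (tg (Suc n) (ws @ [w])))" .
 qed
 from that[OF t(1) 1 3] show thesis .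
qed

end

text \<open>A linear lift is averaged at the last letter and then at the first; the second averaging
  keeps what the first has achieved.\<close>

lemma T_lifting:
 assumes Y: "bimodule K L L Y" and Y': "bimodule K L L Y'" and \<pi>: "bhom K L L Y Y' \<pi>"
  and \<phi>: "bhom K C C (T (Suc n)) Y' \<phi>" and im: "\<phi> ` carrier (T (Suc n)) <= \<pi> ` carrier Y"
 obtains h where "bhom K C C (T (Suc n)) Y h" "!!u. u \<in> carrier (T (Suc n)) ==> \<pi> (h u) = \<phi> u"
proof -
 note Tb = bm_lcl[OF T_bimodule] bm_rcl[OF T_bimodule]
 obtain h0 where h0: "lin K (T (Suc n)) Y h0" "!!u. u \<in> carrier (T (Suc n)) ==> \<pi> (h0 u) = \<phi> u"
  by (rule linear_lift[OF bm_module[OF Y] bm_module[OF Y'] T_module bhomD(1)[OF \<pi>] bhomD(1)[OF \<phi>] im]) blast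
 obtain h1 where h1: "lin K (T (Suc n)) Y h1"
  "!!c u. c \<in> carrier C ==> u \<in> carrier (T (Suc n)) ==> h1 (rmult (T (Suc n)) u c) = rmult Y (h1 u) c"
  "!!u. u \<in> carrier (T (Suc n)) ==> \<pi> (h1 u) = \<pi> (h0 u)"
  by (rule right_average[OF Y Y' \<pi> h0(1)]) (auto simp: h0(2) Tb bhomD(3)[OF \<phi>])
 obtain h2 where h2: "lin K (T (Suc n)) Y h2"
  "!!c u. c \<in> carrier C ==> u \<in> carrier (T (Suc n)) ==> h2 (lmult (T (Suc n)) c u) = lmult Y c (h2 u)"
  "!!c u. c \<in> carrier C ==> u \<in> carrier (T (Suc n)) ==> h2 (rmult (T (Suc n)) u c) = rmult Y (h2 u) c"
  "!!u. u \<in> carrier (T (Suc n)) ==> \<pi> (h2 u) = \<pi> (h1 u)"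
  by (rule left_average[OF Y Y' \<pi> h1(1) _ h1(2)]) (auto simp: h0(2) h1(3) Tb bhomD(2)[OF \<phi>])
 show thesis
  by (rule that[of h2]) (auto intro: bhomI h2 simp: h2(4) h1(3) h0(2))
qed

end

context square_zero
begin

context
 fixes Y and n and h
 assumes Y: "bimodule K L L Y" and h: "bhom K C C (T (Suc n)) Y h"
begin

lemma hT: "set ws <= I ==> length ws = Suc n ==> h (tg (Suc n) ws) \<in> carrier Y"
 using lin_closed[OF bhomD(1)[OF h]] tg_closed[of ws] by simp

text \<open>The assignment \<open>j \<otimes> u \<mapsto> j h(u)\<close> is balanced because
  \<open>h\<close> is left \<open>C\<close>-linear. It extends \<open>h\<close> to one more summand
  of the bimodule that \<open>I^(n+1)\<close> induces over \<open>L\<close>.\<close>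

lemma ext_left:
 obtains h' where "bhom K C C (Tb n) Y h'"
  "!!j u. j \<in> I ==> u \<in> carrier (T (Suc n)) ==> h' (cl (Suc n) j u) = lmult Y j (h u)"
proof -
 note g = multilin_comp[OF tpgen_multilin[OF Im_powable] bhomD(1)[OF h]]
 let ?g = "%ws. lmult Y (hd ws) (h (tg (Suc n) (tl ws)))"
 have m: "multilin K C Im (Suc (Suc n)) Y ?g"
 proof (rule multilinI)
  fix ws :: "'l list" assume "set ws <= carrier Im" "length ws = Suc (Suc n)"
  then show "?g ws \<in> carrier Y" by (cases ws) (auto simp: bm_lcl[OF Y] hT IL)
 next
  fix us vs :: "'l list" assume uv: "set us <= carrier Im" "set vs <= carrier Im" "length us + length vs + 1 = Suc (Suc n)"
  show "lin K Im Y (%w. ?g (us @ w # vs))"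
  proof (cases us)
   case Nil
   then show ?thesis using uv lin_Im_L[OF bm_la[OF Y hT[of vs]]] by simp
  next
   case (Cons u us')
   then show ?thesis using uv lin_comp[OF multilinD(2)[OF g, of us' vs] bm_l[OF Y IL[of u]]] by simp
  qed
 next
  fix us vs :: "'l list" and v s w assume uv: "set us <= carrier Im" "set vs <= carrier Im" "length us + length vs + 2 = Suc (Suc n)"
   "v \<in> carrier Im" "s \<in> carrier C" "w \<in> carrier Im"
  show "?g (us @ rmult Im v s # w # vs) = ?g (us @ v # lmult Im s w # vs)"
  proof (cases us)
   case Nil
   then show ?thesis
    using uv bhomD(2)[OF h, of s "tg (Suc n) (w # vs)"] tg_closed[of "w # vs"]
    by (simp add: bm_lassoc[OF Y] CL IL hT T_l)
  next
   case (Cons u us')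
   then show ?thesis using uv multilinD(3)[OF g, of us' vs v s w] by simp
  qed
 qed
 define h' where "h' = plift K Y ?g"
 note t = tpow_lift[OF Im_powable bm_module[OF Y] m, folded h'_def]
 have v: "h' (tg (Suc (Suc n)) (w # ws)) = lmult Y w (h (tg (Suc n) ws))"
  if "w \<in> I" "set ws <= I" "length ws = Suc n" for w ws using t(2)[of "w # ws"] that by simp
 have b: "bhom K C C (Tb n) Y h'"
 proof (rule bhomI[OF t(1)])
  fix c u assume c: "c \<in> carrier C" and u: "u \<in> carrier (Tb n)"
  show "h' (lmult (Tb n) c u) = lmult Y c (h' u)"
   by (rule T_lin_eq[OF lin_comp[OF bm_l[OF T_bimodule c] t(1)] lin_comp[OF t(1) bm_l[OF Y CL[OF c]]] _ u])
    (use c in \<open>simp add: T_l v CI bm_lassoc[OF Y] CL IL hT\<close>)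
  show "h' (rmult (Tb n) u c) = rmult Y (h' u) c"
  proof (rule T_lin_eq'[OF lin_comp[OF bm_r[OF T_bimodule c] t(1)] lin_comp[OF t(1) bm_r[OF Y CL[OF c]]] _ u])
   fix w ws assume w: "w \<in> I" "set ws <= I" "length ws = Suc n"
   then obtain x ws' where x: "ws = x # ws'" by (cases ws) auto
   have "h (tg (Suc n) (ws' @ [w \<otimes>[L] c])) = rmult Y (h (tg (Suc n) (ws' @ [w]))) c"
    using bhomD(3)[OF h c, of "tg (Suc n) (ws' @ [w])"] tg_closed[of "ws' @ [w]"] T_r[of c w ws' n] w x c by simp
   then show "h' (rmult (Tb n) (tg (Suc (Suc n)) (ws @ [w])) c) = rmult Y (h' (tg (Suc (Suc n)) (ws @ [w]))) c"
    using w c x v[of x "ws' @ [w]"] v[of x "ws' @ [w \<otimes>[L] c]"] T_r[of c w ws "Suc n"]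
    by (simp add: IC bm_lr[OF Y] CL IL hT)
  qed
 qed
 show thesis
 proof (rule that[OF b])
  fix j u assume j: "j \<in> I" and u: "u \<in> carrier (T (Suc n))"
  show "h' (cl (Suc n) j u) = lmult Y j (h u)"
  proof (rule tpow_lin_eq[OF Im_powable lin_comp[OF cl_lin[OF j] t(1)] lin_comp[OF bhomD(1)[OF h] bm_l[OF Y IL[OF j]]] _ _ u])
   fix ws assume "set ws <= carrier Im" "length ws = Suc n"
   then show "h' (cl (Suc n) j (tg (Suc n) ws)) = lmult Y j (h (tg (Suc n) ws))"
    using j by (simp add: cl_tg v)
  qed simp
 qed
qed

lemma ext_right:
 obtains h' where "bhom K C C (Tb n) Y h'"
  "!!j u. j \<in> I ==> u \<in> carrier (T (Suc n)) ==> h' (cr (Suc n) u j) = rmult Y (h u) j"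
proof -
 note g = multilin_comp[OF tpgen_multilin[OF Im_powable] bhomD(1)[OF h]]
 let ?g = "%ws. rmult Y (h (tg (Suc n) (butlast ws))) (last ws)"
 have m: "multilin K C Im (Suc (Suc n)) Y ?g"
 proof (rule multilinI)
  fix ws :: "'l list" assume "set ws <= carrier Im" "length ws = Suc (Suc n)"
  then show "?g ws \<in> carrier Y" by (cases ws rule: rev_cases) (auto simp: bm_rcl[OF Y] hT IL)
 next
  fix us vs :: "'l list" assume uv: "set us <= carrier Im" "set vs <= carrier Im" "length us + length vs + 1 = Suc (Suc n)"
  show "lin K Im Y (%w. ?g (us @ w # vs))"
  proof (cases vs rule: rev_cases)
   case Nil
   then show ?thesis using uv lin_Im_L[OF bm_ra[OF Y hT[of us]]] by (simp add: butlast_append)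
  next
   case (snoc vs' u)
   then show ?thesis using uv lin_comp[OF multilinD(2)[OF g, of us vs'] bm_r[OF Y IL[of u]]] by (simp add: butlast_append)
  qed
 next
  fix us vs :: "'l list" and v s w assume uv: "set us <= carrier Im" "set vs <= carrier Im" "length us + length vs + 2 = Suc (Suc n)"
   "v \<in> carrier Im" "s \<in> carrier C" "w \<in> carrier Im"
  show "?g (us @ rmult Im v s # w # vs) = ?g (us @ v # lmult Im s w # vs)"
  proof (cases vs rule: rev_cases)
   case Nil
   then show ?thesis
    using uv bhomD(3)[OF h, of s "tg (Suc n) (us @ [v])"] tg_closed[of "us @ [v]"]
    by (simp add: bm_rassoc[OF Y] CL IL hT T_r butlast_append)
  next
   case (snoc vs' u)
   then show ?thesis using uv multilinD(3)[OF g, of us vs' v s w] by (simp add: butlast_append)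
  qed
 qed
 define h' where "h' = plift K Y ?g"
 note t = tpow_lift[OF Im_powable bm_module[OF Y] m, folded h'_def]
 have v: "h' (tg (Suc (Suc n)) (ws @ [w])) = rmult Y (h (tg (Suc n) ws)) w"
  if "w \<in> I" "set ws <= I" "length ws = Suc n" for w ws using t(2)[of "ws @ [w]"] that by simp
 have b: "bhom K C C (Tb n) Y h'"
 proof (rule bhomI[OF t(1)])
  fix c u assume c: "c \<in> carrier C" and u: "u \<in> carrier (Tb n)"
  show "h' (rmult (Tb n) u c) = rmult Y (h' u) c"
   by (rule T_lin_eq'[OF lin_comp[OF bm_r[OF T_bimodule c] t(1)] lin_comp[OF t(1) bm_r[OF Y CL[OF c]]] _ u])
    (use c in \<open>simp add: T_r v IC bm_rassoc[OF Y] CL IL hT\<close>)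
  show "h' (lmult (Tb n) c u) = lmult Y c (h' u)"
  proof (rule T_lin_eq[OF lin_comp[OF bm_l[OF T_bimodule c] t(1)] lin_comp[OF t(1) bm_l[OF Y CL[OF c]]] _ u])
   fix w ws assume w: "w \<in> I" "set ws <= I" "length ws = Suc n"
   then obtain x ws' where x: "ws = ws' @ [x]" by (cases ws rule: rev_cases) auto
   have "h (tg (Suc n) ((c \<otimes>[L] w) # ws')) = lmult Y c (h (tg (Suc n) (w # ws')))"
    using bhomD(2)[OF h c, of "tg (Suc n) (w # ws')"] tg_closed[of "w # ws'"] T_l[of c w ws' n] w x c by simp
   then show "h' (lmult (Tb n) c (tg (Suc (Suc n)) (w # ws))) = lmult Y c (h' (tg (Suc (Suc n)) (w # ws)))"
    using w c x v[of x "w # ws'"] v[of x "(c \<otimes>[L] w) # ws'"] T_l[of c w ws "Suc n"]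
    by (simp add: CI bm_lr[OF Y] CL IL hT)
  qed
 qed
 show thesis
 proof (rule that[OF b])
  fix j u assume j: "j \<in> I" and u: "u \<in> carrier (T (Suc n))"
  show "h' (cr (Suc n) u j) = rmult Y (h u) j"
  proof (rule tpow_lin_eq[OF Im_powable lin_comp[OF cr_lin[OF j] t(1)] lin_comp[OF bhomD(1)[OF h] bm_r[OF Y IL[OF j]]] _ _ u])
   fix ws assume "set ws <= carrier Im" "length ws = Suc n"
   then show "h' (cr (Suc n) (tg (Suc n) ws) j) = rmult Y (h (tg (Suc n) ws)) j"
    using j by (simp add: cr_tg v)
  qed simp
 qed
qed

end

lemma T_lin_eq_cl:
 assumes "lin K (Tb n) V f" "lin K (Tb n) V h"
  and "!!j u. j \<in> I ==> u \<in> carrier (T (Suc n)) ==> f (cl (Suc n) j u) = h (cl (Suc n) j u)"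
  and "u \<in> carrier (Tb n)"
 shows "f u = h u"
proof (rule T_lin_eq[OF assms(1,2) _ assms(4)])
 fix w ws assume "w \<in> I" "set ws <= I" "length ws = Suc n"
 then show "f (tg (Suc (Suc n)) (w # ws)) = h (tg (Suc (Suc n)) (w # ws))"
  using assms(3)[of w "tg (Suc n) ws"] tg_closed[of ws] by (simp add: cl_tg)
qed

lemma T_lin_eq_cr:
 assumes "lin K (Tb n) V f" "lin K (Tb n) V h"
  and "!!j u. j \<in> I ==> u \<in> carrier (T (Suc n)) ==> f (cr (Suc n) u j) = h (cr (Suc n) u j)"
  and "u \<in> carrier (Tb n)"
 shows "f u = h u"
proof (rule T_lin_eq'[OF assms(1,2) _ assms(4)])
 fix w ws assume "w \<in> I" "set ws <= I" "length ws = Suc n"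
 then show "f (tg (Suc (Suc n)) (ws @ [w])) = h (tg (Suc (Suc n)) (ws @ [w]))"
  using assms(3)[of w "tg (Suc n) ws"] tg_closed[of ws] by (simp add: cr_tg)
qed

lemma Q_in_lin:
 "lin K (T (Suc n)) (Q n) (%u. (u, \<zero>[Tb n], \<zero>[Tb n], \<zero>[Tc n]))"
 "lin K (Tb n) (Q n) (%v. (\<zero>[T (Suc n)], v, \<zero>[Tb n], \<zero>[Tc n]))"
 "lin K (Tb n) (Q n) (%w. (\<zero>[T (Suc n)], \<zero>[Tb n], w, \<zero>[Tc n]))"
 "lin K (Tc n) (Q n) (%z. (\<zero>[T (Suc n)], \<zero>[Tb n], \<zero>[Tb n], z))"
 by (auto intro!: linI simp: Q_simps)

lemma Q_sum:
 assumes "u \<in> carrier (T (Suc n))" "v \<in> carrier (Tb n)" "w \<in> carrier (Tb n)" "z \<in> carrier (Tc n)"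
 shows "(u, v, w, z) = (u, \<zero>[Tb n], \<zero>[Tb n], \<zero>[Tc n])
  \<oplus>[Q n] ((\<zero>[T (Suc n)], v, \<zero>[Tb n], \<zero>[Tc n])
  \<oplus>[Q n] ((\<zero>[T (Suc n)], \<zero>[Tb n], w, \<zero>[Tc n])
  \<oplus>[Q n] (\<zero>[T (Suc n)], \<zero>[Tb n], \<zero>[Tb n], z)))"
 using assms by (simp add: Q_simps)

lemma cl_zero: "u \<in> carrier (T (Suc n)) ==> cl (Suc n) \<zero>[L] u = \<zero>[Tb n]"
 and cr_zero: "u \<in> carrier (T (Suc n)) ==> cr (Suc n) u \<zero>[L] = \<zero>[Tb n]"
 and cl_zero2: "j \<in> I ==> cl n j \<zero>[T n] = \<zero>[T (Suc n)]" and cr_zero2: "j \<in> I ==> cr n \<zero>[T n] j = \<zero>[T (Suc n)]"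
 and T_zero: "u \<in> carrier (T (Suc n)) ==> lmult (T (Suc n)) \<zero>[L] u = \<zero>[T (Suc n)]"
  "u \<in> carrier (T (Suc n)) ==> rmult (T (Suc n)) u \<zero>[L] = \<zero>[T (Suc n)]"
  "c \<in> carrier C ==> lmult (T (Suc n)) c \<zero>[T (Suc n)] = \<zero>[T (Suc n)]"
  "c \<in> carrier C ==> rmult (T (Suc n)) \<zero>[T (Suc n)] c = \<zero>[T (Suc n)]"
 using lin_zero[OF cl_lin2 bm_module[OF Im_bimodule] T_module] lin_zero[OF cr_lin2 bm_module[OF Im_bimodule] T_module]
  lin_zero[OF cl_lin T_module T_module] lin_zero[OF cr_lin T_module T_module]
  bm_lzerol[OF T_bimodule] bm_rzeror[OF T_bimodule] bm_lzero[OF T_bimodule] bm_rzero[OF T_bimodule]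
 by (simp_all add: C_simps)

end

context square_zero_proj
begin

text \<open>\<open>Q n\<close> is induced from the \<open>C\<close>-bimodule \<open>I^(n+1)\<close>,
  so a bimodule map out of it amounts to a \<open>C\<close>-bimodule map on the first summand. The
  lift is found there by \<open>T_lifting\<close> and spread over the other summands by
  \<open>ext_left\<close> and \<open>ext_right\<close>.\<close>

theorem Q_lifting:
 assumes Y: "bimodule K L L Y" and Y': "bimodule K L L Y'"
 shows "lifting K L (Q n) Y Y'"
 unfolding lifting_def
proof (intro allI impI, elim conjE)
 fix \<pi> \<phi> assume \<pi>: "bhom K L L Y Y' \<pi>" and \<phi>: "bhom K L L (Q n) Y' \<phi>" and im: "\<phi> ` carrier (Q n) <= \<pi> ` carrier Y"
 note \<pi>l = bhomD(1)[OF \<pi>] and \<phi>l = bhomD(1)[OF \<phi>]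
 let ?z1 = "\<zero>[T (Suc n)]" and ?z2 = "\<zero>[Tb n]" and ?z3 = "\<zero>[Tc n]"
 let ?\<phi>1 = "%u. \<phi> (u, ?z2, ?z2, ?z3)"
 note zs = pc_C pi_C pc_I pi_I cl_zero cr_zero cl_zero2 cr_zero2 T_zero
 have \<phi>1: "bhom K C C (T (Suc n)) Y' ?\<phi>1"
 proof (rule bhomI[OF lin_comp[OF Q_in_lin(1) \<phi>l]])
  fix c u assume c: "c \<in> carrier C" and u: "u \<in> carrier (T (Suc n))"
  have q: "(u, ?z2, ?z2, ?z3) \<in> carrier (Q n)" using u by (simp add: Q_simps)
  show "?\<phi>1 (lmult (T (Suc n)) c u) = lmult Y' c (?\<phi>1 u)"
   using bhomD(2)[OF \<phi> CL[OF c] q] c u by (simp add: Q_simps zs)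
  show "?\<phi>1 (rmult (T (Suc n)) u c) = rmult Y' (?\<phi>1 u) c"
   using bhomD(3)[OF \<phi> CL[OF c] q] c u by (simp add: Q_simps zs)
 qed
 have im1: "?\<phi>1 ` carrier (T (Suc n)) <= \<pi> ` carrier Y" using im by (auto simp: Q_simps)
 obtain h where h: "bhom K C C (T (Suc n)) Y h" and h\<pi>: "!!u. u \<in> carrier (T (Suc n)) ==> \<pi> (h u) = ?\<phi>1 u"
  by (rule T_lifting[OF Y Y' \<pi> \<phi>1 im1]) blast
 obtain hl where hl: "bhom K C C (Tb n) Y hl"
  "!!j u. j \<in> I ==> u \<in> carrier (T (Suc n)) ==> hl (cl (Suc n) j u) = lmult Y j (h u)" by (rule ext_left[OF Y h]) blast
 obtain hr where hr: "bhom K C C (Tb n) Y hr"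
  "!!j u. j \<in> I ==> u \<in> carrier (T (Suc n)) ==> hr (cr (Suc n) u j) = rmult Y (h u) j" by (rule ext_right[OF Y h]) blast
 obtain hb where hb: "bhom K C C (Tc n) Y hb"
  "!!j u. j \<in> I ==> u \<in> carrier (Tb n) ==> hb (cr (Suc (Suc n)) u j) = rmult Y (hl u) j"
  by (rule ext_right[OF Y hl(1)]) blast
 note ll = bhomD(1)[OF h] bhomD(1)[OF hl(1)] bhomD(1)[OF hr(1)] bhomD(1)[OF hb(1)]
 note hc = ll[THEN lin_closed]
 note Yl = bm_l[OF Y IL] and Yr = bm_r[OF Y IL] and Ym = bm_module[OF Y]
 \<comment> \<open>\<open>hb\<close> comes from \<open>hl\<close> by right multiplication; left
   linearity of \<open>\<psi>\<close> requires that it also comes from \<open>hr\<close> by left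
   multiplication.\<close>
 have hb2: "hb (cl (Suc (Suc n)) j w) = lmult Y j (hr w)" if j: "j \<in> I" and w: "w \<in> carrier (Tb n)" for j w
 proof (rule T_lin_eq_cr[OF lin_comp[OF cl_lin[OF j] ll(4)] lin_comp[OF ll(3) Yl[OF j]] _ w])
  fix i u assume "i \<in> I" "u \<in> carrier (T (Suc n))"
  then show "hb (cl (Suc (Suc n)) j (cr (Suc n) u i)) = lmult Y j (hr (cr (Suc n) u i))"
   using j by (simp add: cl_cr hb(2) hl(2) hr(2) bm_lr[OF Y] IL hc)
 qed
 have Z: "lmult Y \<zero>[L] y = \<zero>[Y]" "rmult Y y \<zero>[L] = \<zero>[Y]" if "y \<in> carrier Y" for y
  using bm_lzerol[OF Y that] bm_rzeror[OF Y that] .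
 have Zl: "lmult Y i (lmult Y j y) = \<zero>[Y]" if "i \<in> I" "j \<in> I" "y \<in> carrier Y" for i j y
  using bm_lassoc[OF Y IL IL, symmetric] that by (simp add: II Z)
 have Zr: "rmult Y (rmult Y y j) i = \<zero>[Y]" if "i \<in> I" "j \<in> I" "y \<in> carrier Y" for i j y
  using bm_rassoc[OF Y IL IL, symmetric] that by (simp add: II Z)
 \<comment> \<open>Two successive factors from \<open>I\<close> on the same side multiply to zero;
   in \<open>Q n\<close> the corresponding components are zero by definition.\<close>
 have z1: "lmult Y i (hl v) = \<zero>[Y]" if i: "i \<in> I" and v: "v \<in> carrier (Tb n)" for i v
  by (rule T_lin_eq_cl[OF lin_comp[OF ll(2) Yl[OF i]] lin_const_zero[OF Ym] _ v]) (simp add: hl(2) Zl i hc)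
 have z2: "rmult Y (hr v) i = \<zero>[Y]" if i: "i \<in> I" and v: "v \<in> carrier (Tb n)" for i v
  by (rule T_lin_eq_cr[OF lin_comp[OF ll(3) Yr[OF i]] lin_const_zero[OF Ym] _ v]) (simp add: hr(2) Zr i hc)
 have z3: "lmult Y i (hb v) = \<zero>[Y]" if i: "i \<in> I" and v: "v \<in> carrier (Tc n)" for i v
  by (rule T_lin_eq_cl[OF lin_comp[OF ll(4) Yl[OF i]] lin_const_zero[OF Ym] _ v]) (simp add: hb2 Zl i hc)
 have z4: "rmult Y (hb v) i = \<zero>[Y]" if i: "i \<in> I" and v: "v \<in> carrier (Tc n)" for i v
  by (rule T_lin_eq_cr[OF lin_comp[OF ll(4) Yr[OF i]] lin_const_zero[OF Ym] _ v]) (simp add: hb(2) Zr i hc)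
 define \<psi> where "\<psi> = (%(u, v, w, z). h u \<oplus>[Y] (hl v \<oplus>[Y] (hr w \<oplus>[Y] hb z)))"
 have sp: "lmult Y x y = lmult Y (pc x) y \<oplus>[Y] lmult Y (pi x) y" "rmult Y y x = rmult Y y (pc x) \<oplus>[Y] rmult Y y (pi x)"
  if x: "x \<in> carrier L" and y: "y \<in> carrier Y" for x y
  using lin_add[OF bm_la[OF Y y], of "pc x" "pi x"] lin_add[OF bm_ra[OF Y y], of "pc x" "pi x"] decomp[OF x] x by (simp_all add: CL IL)
 note ladd = ll[THEN lin_add] and lsm = ll[THEN lin_smult]
 note bh = bhomD(2,3)[OF h] bhomD(2,3)[OF hl(1)] bhomD(2,3)[OF hr(1)] bhomD(2,3)[OF hb(1)]
 have \<psi>h: "bhom K L L (Q n) Y \<psi>"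
 proof (rule bhomI)
  show "lin K (Q n) Y \<psi>"
   using Ym by (intro linI) (auto simp: \<psi>_def Q_simps hc ladd lsm v_smult_r_distr v_add_swap)
  fix x q assume x: "x \<in> carrier L" and "q \<in> carrier (Q n)"
  then obtain u v w z where q: "q = (u, v, w, z)" "u \<in> carrier (T (Suc n))" "v \<in> carrier (Tb n)"
   "w \<in> carrier (Tb n)" "z \<in> carrier (Tc n)" by (auto simp: Q_simps)
  have e: "\<psi> q \<in> carrier Y" using q Ym by (simp add: \<psi>_def hc)
  have l: "lmult Y y (\<psi> q) = lmult Y y (h u) \<oplus>[Y] (lmult Y y (hl v) \<oplus>[Y] (lmult Y y (hr w) \<oplus>[Y] lmult Y y (hb z)))"
   "rmult Y (\<psi> q) y = rmult Y (h u) y \<oplus>[Y] (rmult Y (hl v) y \<oplus>[Y] (rmult Y (hr w) y \<oplus>[Y] rmult Y (hb z) y))"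
   if "y \<in> carrier L" for y
   using q that Ym by (simp_all add: \<psi>_def bm_ladd[OF Y] bm_radd[OF Y] hc)
  show "\<psi> (lmult (Q n) x q) = lmult Y x (\<psi> q)"
   unfolding sp[OF x e] l[OF CL[OF pc_closed[OF x]]] l[OF IL[OF pi_closed[OF x]]]
   using x q Ym by (simp add: z1 z3 bm_lcl[OF Y] CL IL hc)
    (simp add: \<psi>_def Q_simps T_rules ladd bh hl(2) hb2 hc bm_lcl[OF Y] CL IL v_assoc v_comm v_lcomm)
  show "\<psi> (rmult (Q n) q x) = rmult Y (\<psi> q) x"
   unfolding sp[OF x e] l[OF CL[OF pc_closed[OF x]]] l[OF IL[OF pi_closed[OF x]]]
   using x q Ym by (simp add: z2 z4 bm_rcl[OF Y] CL IL hc)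
    (simp add: \<psi>_def Q_simps T_rules ladd bh hr(2) hb(2) hc bm_rcl[OF Y] CL IL v_assoc v_comm v_lcomm)
 qed
 have p2: "\<pi> (hl v) = \<phi> (?z1, v, ?z2, ?z3)" if v: "v \<in> carrier (Tb n)" for v
 proof (rule T_lin_eq_cl[OF lin_comp[OF ll(2) \<pi>l] lin_comp[OF Q_in_lin(2) \<phi>l] _ v])
  fix j u assume j: "j \<in> I" and u: "u \<in> carrier (T (Suc n))"
  have "(u, ?z2, ?z2, ?z3) \<in> carrier (Q n)" using u by (simp add: Q_simps)
  from bhomD(2)[OF \<phi> IL[OF j] this] j u show "\<pi> (hl (cl (Suc n) j u)) = \<phi> (?z1, cl (Suc n) j u, ?z2, ?z3)"
   by (simp add: hl(2) bhomD(2)[OF \<pi>] IL hc h\<pi> Q_simps zs)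
 qed
 have p3: "\<pi> (hr v) = \<phi> (?z1, ?z2, v, ?z3)" if v: "v \<in> carrier (Tb n)" for v
 proof (rule T_lin_eq_cr[OF lin_comp[OF ll(3) \<pi>l] lin_comp[OF Q_in_lin(3) \<phi>l] _ v])
  fix j u assume j: "j \<in> I" and u: "u \<in> carrier (T (Suc n))"
  have "(u, ?z2, ?z2, ?z3) \<in> carrier (Q n)" using u by (simp add: Q_simps)
  from bhomD(3)[OF \<phi> IL[OF j] this] j u show "\<pi> (hr (cr (Suc n) u j)) = \<phi> (?z1, ?z2, cr (Suc n) u j, ?z3)"
   by (simp add: hr(2) bhomD(3)[OF \<pi>] IL hc h\<pi> Q_simps zs)
 qed
 have p4: "\<pi> (hb v) = \<phi> (?z1, ?z2, ?z2, v)" if v: "v \<in> carrier (Tc n)" for v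
 proof (rule T_lin_eq_cl[OF lin_comp[OF ll(4) \<pi>l] lin_comp[OF Q_in_lin(4) \<phi>l] _ v])
  fix j u assume j: "j \<in> I" and u: "u \<in> carrier (Tb n)"
  have "(?z1, ?z2, u, ?z3) \<in> carrier (Q n)" using u by (simp add: Q_simps)
  from bhomD(2)[OF \<phi> IL[OF j] this] j u show "\<pi> (hb (cl (Suc (Suc n)) j u)) = \<phi> (?z1, ?z2, ?z2, cl (Suc (Suc n)) j u)"
   by (simp add: hb2 bhomD(2)[OF \<pi>] IL hc p3 Q_simps zs)
 qed
 have "\<pi> (\<psi> q) = \<phi> q" if "q \<in> carrier (Q n)" for q
 proof -
  from that obtain u v w z where q: "q = (u, v, w, z)" "u \<in> carrier (T (Suc n))" "v \<in> carrier (Tb n)"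
   "w \<in> carrier (Tb n)" "z \<in> carrier (Tc n)" by (auto simp: Q_simps)
  have m: "(u, ?z2, ?z2, ?z3) \<in> carrier (Q n)" "(?z1, v, ?z2, ?z3) \<in> carrier (Q n)"
   "(?z1, ?z2, w, ?z3) \<in> carrier (Q n)" "(?z1, ?z2, ?z2, z) \<in> carrier (Q n)"
   using q by (simp_all add: Q_simps)
  have "\<phi> q = ?\<phi>1 u \<oplus>[Y'] (\<phi> (?z1, v, ?z2, ?z3) \<oplus>[Y'] (\<phi> (?z1, ?z2, w, ?z3) \<oplus>[Y'] \<phi> (?z1, ?z2, ?z2, z)))"
   unfolding q(1) by (subst Q_sum[OF q(2-5)]) (use m in \<open>simp only: lin_add[OF \<phi>l] v_add[OF Q_module]\<close>)
  then show ?thesis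
   using q Ym by (simp add: \<psi>_def lin_add[OF \<pi>l] hc h\<pi> p2 p3 p4)
 qed
 with \<psi>h show "\<exists>\<psi>. bhom K L L (Q n) Y \<psi> \<and> (\<forall>q\<in>carrier (Q n). \<pi> (\<psi> q) = \<phi> q)" by blast
qed

end

section \<open>Cyclic rotation\<close>

text \<open>One step is undone by \<open>rotate1\<close>, and \<open>rotate\<close> by the length is
  the identity.\<close>

lemma funpow_last_butlast:
 "ws \<noteq> [] ==> ((%ws. last ws # butlast ws) ^^ length ws) ws = ws"
proof -
 let ?f = "%ws :: 'a list. last ws # butlast ws"
 have len: "length ((?f ^^ k) ws) = length ws \<and> (?f ^^ k) ws \<noteq> []" if "ws \<noteq> []" for k and ws :: "'a list"
  using that by (induction k) auto
 have rot: "(rotate1 ^^ k) ((?f ^^ k) ws) = ws" if "ws \<noteq> []" for k and ws :: "'a list"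
  using that
 proof (induction k)
  case (Suc k)
  have "rotate1 (?f ((?f ^^ k) ws)) = (?f ^^ k) ws" using len[OF Suc.prems, of k] by simp
  with Suc show ?case by (simp add: funpow_swap1)
 qed simp
 assume ws: "ws \<noteq> []"
 have "rotate (length ws) ((?f ^^ length ws) ws) = (?f ^^ length ws) ws"
  by (rule rotate_id) (use len[OF ws, of "length ws"] in simp)
 with rot[OF ws, of "length ws"] show ?thesis by (simp add: rotate_def)
qed

context fld
begin

context
 fixes S :: "('k, 's, 'z) module_scheme" and W :: "('k, 's, 's, 'v) bimodule" and n :: nat
 assumes W: "bimodule K S S W" and n: "n > 0"
begin

abbreviation (input) "pw \<equiv> tpow K S W n"
abbreviation (input) "pg \<equiv> tpgen K S W n"
abbreviation (input) "pcl \<equiv> %z. commutator_span K S pw +>[pw] z"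
abbreviation (input) "PH \<equiv> H0 K S pw"

text \<open>Rotation cuts the word before its last letter. A scalar at the cut is carried around the
  word by the commutator relation; at every other place the balancing of the tensor power
  applies.\<close>

lemma rot_multilin: "multilin K S W n PH (%ws. pcl (pg (last ws # butlast ws)))"
proof -
 note P = bm_powable[OF W n] and B = tpow_bimodule[OF W n]
 have m: "multilin K S W n PH (%ws. pcl (pg ws))"
  by (rule multilin_comp[OF tpgen_multilin[OF P] hcl_lin[OF B]])
 show ?thesis
 proof (rule multilinI)
  fix ws assume "set ws <= carrier W" "length ws = n"
  then show "pcl (pg (last ws # butlast ws)) \<in> carrier PH"
   using n by (intro multilinD(1)[OF m]) (cases ws rule: rev_cases, auto)+
 next
  fix us vs assume uv: "set us <= carrier W" "set vs <= carrier W" "length us + length vs + 1 = n"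
  show "lin K W PH (%w. pcl (pg (last (us @ w # vs) # butlast (us @ w # vs))))"
  proof (cases vs rule: rev_cases)
   case Nil
   then show ?thesis using multilinD(2)[OF m, of "[]" us] uv by (simp add: butlast_append)
  next
   case (snoc vs' z)
   then show ?thesis using multilinD(2)[OF m, of "z # us" vs'] uv by (simp add: butlast_append)
  qed
 next
  fix us vs v s w assume uv: "set us <= carrier W" "set vs <= carrier W" "length us + length vs + 2 = n"
   "v \<in> carrier W" "s \<in> carrier S" "w \<in> carrier W"
  show "pcl (pg (last (us @ rmult W v s # w # vs) # butlast (us @ rmult W v s # w # vs)))
    = pcl (pg (last (us @ v # lmult W s w # vs) # butlast (us @ v # lmult W s w # vs)))"
  proof (cases vs rule: rev_cases)
   case Nil
   have "pcl (pg (w # us @ [rmult W v s])) = pcl (rmult pw (pg (w # us @ [v])) s)"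
    using tpow_rmult[OF W n uv(5), of "w # us" v] uv Nil by simp
   also have "\<dots> = pcl (lmult pw s (pg (w # us @ [v])))"
    by (rule hcl_comm[OF B uv(5), symmetric]) (use tpgen_closed[OF P] uv Nil in simp)
   also have "\<dots> = pcl (pg (lmult W s w # us @ [v]))"
    using tpow_lmult[OF W n uv(5), of w "us @ [v]"] uv Nil by simp
   finally show ?thesis using Nil by (simp add: butlast_append)
  next
   case (snoc vs' z)
   then show ?thesis using multilinD(3)[OF m, of "z # us" vs' v s w] uv by (simp add: butlast_append)
  qed
 qed
qed

lemma pw_lin_eq':
 assumes f: "lin K PH V f" and g: "lin K PH V g" and V: "module K V"
  and eq: "!!ws. set ws <= carrier W ==> length ws = n ==> f (pcl (pg ws)) = g (pcl (pg ws))" and U: "U \<in> carrier PH"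
 shows "f U = g U"
proof -
 note P = bm_powable[OF W n] and B = tpow_bimodule[OF W n]
 obtain z where z: "z \<in> carrier pw" "U = pcl z" by (rule H0_cases[OF B U])
 show ?thesis unfolding z(2)
  by (rule tpow_lin_eq[OF P lin_comp[OF hcl_lin[OF B] f] lin_comp[OF hcl_lin[OF B] g] n _ z(1)]) (rule eq)
qed

text \<open>Rotation makes the last and the first letter neighbours. A scalar on the outside of the
  word thereby comes to lie between two letters and can be balanced, so rotation respects
  commutators.\<close>

lemma cyc_lin: "lin K PH PH (cyc_gen K S W n)"
 and cyc_val: "set ws <= carrier W ==> length ws = n ==> cyc_gen K S W n (pcl (pg ws)) = pcl (pg (last ws # butlast ws))"
proof -
 note P = bm_powable[OF W n] and B = tpow_bimodule[OF W n]
 let ?r = "plift K PH (%ws. pcl (pg (last ws # butlast ws)))"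
 note t = tpow_lift[OF P H0_module[OF B] rot_multilin]
 have c: "?r (lmult pw b z) = ?r (rmult pw z b)" if b: "b \<in> carrier S" and z: "z \<in> carrier pw" for b z
 proof (rule tpow_lin_eq[OF P lin_comp[OF bm_l[OF B b] t(1)] lin_comp[OF bm_r[OF B b] t(1)] n _ z])
  fix ws assume ws: "set ws <= carrier W" "length ws = n"
  show "?r (lmult pw b (pg ws)) = ?r (rmult pw (pg ws) b)"
  proof (cases "n = 1")
   \<comment> \<open>A single letter has no inner junction; rotation does nothing, and the
     commutator relation itself applies.\<close>
   case True
   with ws obtain w where w: "ws = [w]" "w \<in> carrier W" by (cases ws) auto
   have "?r (lmult pw b (pg [w])) = pcl (lmult pw b (pg [w]))"
    using tpow_lmult[OF W n b, of w "[]"] t(2)[of "[lmult W b w]"] w True b by (simp add: bm_lcl[OF W])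
   also have "\<dots> = pcl (rmult pw (pg [w]) b)"
    by (rule hcl_comm[OF B b]) (use tpgen_closed[OF P, of "[w]"] w True in simp)
   also have "\<dots> = ?r (rmult pw (pg [w]) b)"
    using tpow_rmult[OF W n b, of "[]" w] t(2)[of "[rmult W w b]"] w True b by (simp add: bm_rcl[OF W])
   finally show ?thesis using w by simp
  next
   case False
   with ws n obtain w vs where "ws = w # vs" "vs \<noteq> []" by (cases ws; cases "tl ws") auto
   moreover from this obtain us z where "vs = us @ [z]" by (cases vs rule: rev_cases) auto
   ultimately have w: "ws = w # us @ [z]" by simp
   have wz: "w \<in> carrier W" "z \<in> carrier W" "set us <= carrier W" "length us + 2 = n" using ws w by auto
   have "?r (lmult pw b (pg ws)) = pcl (pg (z # lmult W b w # us))"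
    using tpow_lmult[OF W n b, of w "us @ [z]"] t(2)[of "lmult W b w # us @ [z]"] wz w b by (simp add: bm_lcl[OF W])
   also have "\<dots> = pcl (pg (rmult W z b # w # us))"
    using tpgen_balance[OF P, of "[]" us n z b w] wz b by simp
   also have "\<dots> = ?r (rmult pw (pg ws) b)"
    using tpow_rmult[OF W n b, of "w # us" z] t(2)[of "w # us @ [rmult W z b]"] wz w b by (simp add: bm_rcl[OF W])
   finally show ?thesis .
  qed
 qed
 have e: "cyc_gen K S W n = (%U. ?r (SOME z. z \<in> U))" by (rule ext) (simp add: cyc_gen_def)
 note h = H0_lift[where B=S and Z=pw, OF B t(1) H0_module[OF B]]
 show "lin K PH PH (cyc_gen K S W n)" unfolding e by (rule h(1)) (rule c)
 assume ws: "set ws <= carrier W" "length ws = n"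
 have "cyc_gen K S W n (pcl (pg ws)) = ?r (pg ws)"
  unfolding e by (rule h(2)) (use c tpgen_closed[OF P ws] in auto)
 then show "cyc_gen K S W n (pcl (pg ws)) = pcl (pg (last ws # butlast ws))" using t(2)[OF ws] by simp
qed

lemma cyc_pow_lin: "lin K PH PH (cyc_gen K S W n ^^ k)"
proof (induction k)
 case 0
 then show ?case using lin_ident[of K PH] by (simp add: id_def)
next
 case (Suc k)
 then show ?case using lin_comp[OF Suc cyc_lin] by (simp add: comp_def)
qed

lemma cyc_pow:
 assumes U: "U \<in> carrier PH"
 shows "(cyc_gen K S W n ^^ n) U = U"
proof -
 note B = tpow_bimodule[OF W n]
 let ?f = "%ws :: 'v list. last ws # butlast ws"
 have "(cyc_gen K S W n ^^ k) (pcl (pg ws)) = pcl (pg ((?f ^^ k) ws)) \<and> set ((?f ^^ k) ws) <= carrier W \<and> length ((?f ^^ k) ws) = n"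
  if "set ws <= carrier W" "length ws = n" for ws k
 proof (induction k)
  case (Suc k)
  then have "(?f ^^ k) ws \<noteq> []" using n by auto
  then show ?case using Suc cyc_val[of "(?f ^^ k) ws"] by (auto dest: in_set_butlastD)
 qed (use that in simp)
 note v = this[of _ n]
 show ?thesis
 proof (rule pw_lin_eq'[OF cyc_pow_lin lin_ident H0_module[OF B] _ U])
  fix ws assume "set ws <= carrier W" "length ws = n"
  moreover from this have "(?f ^^ n) ws = ws" using funpow_last_butlast[of ws] n by force
  ultimately show "(cyc_gen K S W n ^^ n) (pcl (pg ws)) = pcl (pg ws)" using v[of ws] by simp
 qed
qed

text \<open>By \<open>cyc_pow\<close> a power of the rotation is its inverse.\<close>

lemma cyc_inj: "U \<in> carrier PH ==> cyc_gen K S W n U = \<zero>[PH] ==> U = \<zero>[PH]"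
proof -
 note B = tpow_bimodule[OF W n]
 assume U: "U \<in> carrier PH" and z: "cyc_gen K S W n U = \<zero>[PH]"
 obtain k where k: "n = Suc k" using n by (cases n) auto
 have "U = (cyc_gen K S W n ^^ k) (cyc_gen K S W n U)"
  using cyc_pow[OF U] unfolding k by (simp only: funpow_Suc_right comp_apply)
 with z lin_zero[OF cyc_pow_lin H0_module[OF B] H0_module[OF B]] show ?thesis by simp
qed

lemma cyc_surj: "U \<in> carrier PH ==> \<exists>U'\<in>carrier PH. cyc_gen K S W n U' = U"
proof -
 assume U: "U \<in> carrier PH"
 obtain k where k: "n = Suc k" using n by (cases n) auto
 have "cyc_gen K S W n ((cyc_gen K S W n ^^ k) U) = U" using cyc_pow[OF U] unfolding k by simp
 then show ?thesis using lin_closed[OF cyc_pow_lin U] by blast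
qed

text \<open>Group elements act as powers of the generator. For \<open>n = 1\<close> the residue 1 is
  not in the carrier, but there the generator acts trivially by \<open>cyc_pow\<close>.\<close>

lemma cyc_act_invariants:
 "{x \<in> carrier PH. \<forall>s\<in>carrier (integer_mod_group n). cyc_act K S W n s x = x}
  = {x \<in> carrier PH. cyc_gen K S W n x = x}"
proof -
 have c: "carrier (integer_mod_group n) = {0..<int n}" using n by (auto simp: carrier_integer_mod_group)
 have "(cyc_gen K S W n ^^ k) x = x" if "cyc_gen K S W n x = x" for k x
  using that by (induction k) auto
 moreover have "cyc_gen K S W n x = x" if x: "x \<in> carrier PH" and "\<forall>s\<in>{0..<int n}. cyc_act K S W n s x = x" for x
 proof (cases "n = 1")
  case True
  then show ?thesis using cyc_pow[OF x] by simp
 next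
  case False
  with n have "(1::int) \<in> {0..<int n}" by auto
  with that(2) have "cyc_act K S W n 1 x = x" by blast
  then show ?thesis by (simp add: cyc_act_def)
 qed
 ultimately show ?thesis unfolding c by (auto simp: cyc_act_def)
qed

text \<open>\<open>t^k x - x\<close> telescopes into terms of the form \<open>t y - y\<close>, and
  the image of \<open>t - 1\<close> is already a subspace.\<close>

lemma cyc_act_span:
 "subspan K PH {cyc_act K S W n s x \<ominus>[PH] x |s x. s \<in> carrier (integer_mod_group n) \<and> x \<in> carrier PH}
  = (%x. cyc_gen K S W n x \<ominus>[PH] x) ` carrier PH" (is "subspan K PH ?Z = ?I")
proof
 note B = tpow_bimodule[OF W n]
 note Hm = H0_module[OF B]
 have c: "carrier (integer_mod_group n) = {0..<int n}" using n by (auto simp: carrier_integer_mod_group)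
 have L: "lin K PH PH (%x. cyc_gen K S W n x \<ominus>[PH] x)" by (rule lin_fun_minus[OF Hm cyc_lin lin_ident])
 have sub: "submodule ?I K PH" by (rule lin_image[OF L Hm Hm v_submodule_carrier[OF Hm]])
 note D = v_submoduleD[OF Hm sub]
 have "(cyc_gen K S W n ^^ k) x \<ominus>[PH] x \<in> ?I" if x: "x \<in> carrier PH" for k x
 proof (induction k)
  case 0
  then show ?case using D(2) x Hm by simp
 next
  case (Suc k)
  let ?y = "(cyc_gen K S W n ^^ k) x"
  have y: "?y \<in> carrier PH" by (rule lin_closed[OF cyc_pow_lin x])
  have "cyc_gen K S W n ?y \<ominus>[PH] x = (cyc_gen K S W n ?y \<ominus>[PH] ?y) \<oplus>[PH] (?y \<ominus>[PH] x)"
   using x y lin_closed[OF cyc_lin y] Hm by (simp add: a_minus_def v_assoc)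
  then show ?case using D(3)[OF imageI[OF y] Suc] by simp
 qed
 then have "?Z <= ?I" by (auto simp: cyc_act_def)
 then show "subspan K PH ?Z <= ?I" by (rule subspan_min[OF Hm sub])
 have Zc: "?Z <= carrier PH" using \<open>?Z <= ?I\<close> D(1) by blast
 show "?I <= subspan K PH ?Z"
 proof
  fix u assume "u \<in> ?I"
  then obtain x where x: "x \<in> carrier PH" "u = cyc_gen K S W n x \<ominus>[PH] x" by blast
  show "u \<in> subspan K PH ?Z"
  proof (cases "n = 1")
   case True
   then have "u = \<zero>[PH]" using cyc_pow[OF x(1)] x Hm by simp
   then show ?thesis using v_submoduleD(2)[OF Hm subspan_submodule[OF Hm Zc]] by simp
  next
   case False
   with n have 1: "(1::int) \<in> carrier (integer_mod_group n)" unfolding c by auto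
   have "u = cyc_act K S W n 1 x \<ominus>[PH] x" using x(2) by (simp add: cyc_act_def)
   with 1 x(1) have "u \<in> ?Z" by blast
   then show ?thesis by (rule subspan_inc[OF Hm])
  qed
 qed
qed

end
end

section \<open>The null-square algebra\<close>

lemma (in fld) v_inv_ex: "module K V ==> x \<in> carrier V ==> \<exists>y\<in>carrier V. y \<oplus>[V] x = \<zero>[V]"
 by (intro bexI[of _ "\<ominus>[V] x"]) auto

locale null_sq = fld K for K :: "('k, 'x) ring_scheme" (structure) +
 fixes A :: "('k, 'a) module" and B :: "('k, 'b) module"
  and M :: "('k, 'b, 'a, 'm) bimodule" and N :: "('k, 'a, 'b, 'n) bimodule"
 assumes alA: "k_algebra K A" and alB: "k_algebra K B"
  and bmM: "bimodule K B A M" and bmN: "bimodule K A B N"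
begin

abbreviation "Lam \<equiv> null_square A B M N"
abbreviation "Cd \<equiv> diag_subalg A B M N"

definition I0 :: "('a \<times> 'n \<times> 'm \<times> 'b) set" where
 "I0 = {(\<zero>[A], n, m, \<zero>[B]) |n m. n \<in> carrier N \<and> m \<in> carrier M}"

definition pd :: "'a \<times> 'n \<times> 'm \<times> 'b => 'a \<times> 'n \<times> 'm \<times> 'b" where
 "pd = (%(a, n, m, b). (a, \<zero>[N], \<zero>[M], b))"

definition po :: "'a \<times> 'n \<times> 'm \<times> 'b => 'a \<times> 'n \<times> 'm \<times> 'b" where
 "po = (%(a, n, m, b). (\<zero>[A], n, m, \<zero>[B]))"

lemma Lam_simps [simp]:
 "carrier Lam = carrier A \<times> carrier N \<times> carrier M \<times> carrier B"
 "(a, n, m, b) \<otimes>[Lam] (a', n', m', b') = (a \<otimes>[A] a', lmult N a n' \<oplus>[N] rmult N n b',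
    rmult M m a' \<oplus>[M] lmult M b m', b \<otimes>[B] b')"
 "\<one>[Lam] = (\<one>[A], \<zero>[N], \<zero>[M], \<one>[B])" "\<zero>[Lam] = (\<zero>[A], \<zero>[N], \<zero>[M], \<zero>[B])"
 "(a, n, m, b) \<oplus>[Lam] (a', n', m', b') = (a \<oplus>[A] a', n \<oplus>[N] n', m \<oplus>[M] m', b \<oplus>[B] b')"
 "c \<odot>[Lam] (a, n, m, b) = (c \<odot>[A] a, c \<odot>[N] n, c \<odot>[M] m, c \<odot>[B] b)"
 by (simp_all add: null_square_def)

lemma Cd_carrier [simp]: "carrier Cd = {(a, \<zero>[N], \<zero>[M], b) |a b. a \<in> carrier A \<and> b \<in> carrier B}"
 by (simp add: diag_subalg_def)

lemma modules [simp]: "module K A" "module K B" "module K M" "module K N"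
 using alg_module[OF alA] alg_module[OF alB] bm_module[OF bmM] bm_module[OF bmN] .

lemma Lam_module [simp]: "module K Lam"
proof (rule moduleI[OF is_cring_K])
 show "abelian_group Lam"
 proof (rule abelian_groupI)
  fix x assume "x \<in> carrier Lam"
  then show "\<exists>y\<in>carrier Lam. y \<oplus>[Lam] x = \<zero>[Lam]"
   by (auto simp: v_inv_ex)
 qed (auto simp: v_assoc v_comm v_lcomm)
qed (auto simp: v_smult_l_distr v_smult_r_distr v_smult_assoc)

lemmas comp_rules = bm_lcl[OF bmM] bm_rcl[OF bmM] bm_lcl[OF bmN] bm_rcl[OF bmN]
 bm_ladd[OF bmM] bm_radd[OF bmM] bm_ladd[OF bmN] bm_radd[OF bmN]
 bm_laddl[OF bmM] bm_raddr[OF bmM] bm_laddl[OF bmN] bm_raddr[OF bmN]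
 bm_lsm[OF bmM] bm_rsm[OF bmM] bm_lsm[OF bmN] bm_rsm[OF bmN]
 bm_lsml[OF bmM] bm_rsmr[OF bmM] bm_lsml[OF bmN] bm_rsmr[OF bmN]
 bm_lassoc[OF bmM] bm_rassoc[OF bmM] bm_lassoc[OF bmN] bm_rassoc[OF bmN]
 bm_lone[OF bmM] bm_rone[OF bmM] bm_lone[OF bmN] bm_rone[OF bmN]
 bm_lr[OF bmM] bm_lr[OF bmN]
 bm_lzero[OF bmM] bm_rzero[OF bmM] bm_lzero[OF bmN] bm_rzero[OF bmN]
 bm_lzerol[OF bmM] bm_rzeror[OF bmM] bm_lzerol[OF bmN] bm_rzeror[OF bmN]

lemmas alg_rules = lin_add[OF alg_lin1[OF alA]] lin_add[OF alg_lin2[OF alA]] lin_smult[OF alg_lin1[OF alA]]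
 lin_smult[OF alg_lin2[OF alA]] lin_add[OF alg_lin1[OF alB]] lin_add[OF alg_lin2[OF alB]]
 lin_smult[OF alg_lin1[OF alB]] lin_smult[OF alg_lin2[OF alB]] lin_zero[OF alg_lin1[OF alA]] lin_zero[OF alg_lin2[OF alA]]
 lin_zero[OF alg_lin1[OF alB]] lin_zero[OF alg_lin2[OF alB]]
 alg_assoc[OF alA] alg_assoc[OF alB]

lemma Lam_alg: "k_algebra K Lam"
proof (rule algI)
 show "lin K Lam Lam ((\<otimes>\<^bsub>Lam\<^esub>) x)" if "x \<in> carrier Lam" for x
  using that by (intro linI) (auto simp: comp_rules alg_rules alA alB v_smult_r_distr v_add_swap)
 show "lin K Lam Lam (%x. x \<otimes>[Lam] y)" if "y \<in> carrier Lam" for y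
  using that by (intro linI) (auto simp: comp_rules alg_rules alA alB v_smult_r_distr v_add_swap)
qed (auto simp: comp_rules alg_rules alA alB v_assoc)

lemma I0_iff: "(a, n, m, b) \<in> I0 \<longleftrightarrow> a = \<zero>[A] \<and> b = \<zero>[B] \<and> n \<in> carrier N \<and> m \<in> carrier M"
 by (auto simp: I0_def)

sublocale square_zero K Lam Cd I0 pd po
proof (intro square_zero.intro square_zero_axioms.intro)
 show "fld K" by (rule fld_axioms)
 show "k_algebra K Lam" by (rule Lam_alg)
 show "Cd = Lam\<lparr>carrier := carrier Cd\<rparr>" by (simp add: diag_subalg_def)
 show "submodule (carrier Cd) K Lam" by (rule v_submoduleI) auto
 show "submodule I0 K Lam" by (rule v_submoduleI) (auto simp: I0_def)
 show "lin K Lam Cd pd" by (rule linI) (auto simp: pd_def diag_subalg_def)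
 show "lin K Lam (Lam\<lparr>carrier := I0\<rparr>) po" by (rule linI) (auto simp: po_def I0_def)
qed (auto simp: I0_def pd_def po_def comp_rules alg_rules alA alB)

definition "jm x = (\<zero>[A], \<zero>[N], x, \<zero>[B])"
definition "jn y = (\<zero>[A], y, \<zero>[M], \<zero>[B])"
definition mp :: "'a \<times> 'n \<times> 'm \<times> 'b => 'm" where "mp i = fst (snd (snd i))"
definition np :: "'a \<times> 'n \<times> 'm \<times> 'b => 'n" where "np i = fst (snd i)"
definition ca :: "'a \<times> 'n \<times> 'm \<times> 'b => 'a" where "ca c = fst c"
definition cb :: "'a \<times> 'n \<times> 'm \<times> 'b => 'b" where "cb c = snd (snd (snd c))"
text \<open>The two orthogonal idempotents of \<open>Cd\<close>; multiplication by them tells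
  \<open>M\<close> from \<open>N\<close>.\<close>

definition "de = (\<one>[A], \<zero>[N], \<zero>[M], \<zero>[B])"
definition "df = (\<zero>[A], \<zero>[N], \<zero>[M], \<one>[B])"

lemmas j_defs = jm_def jn_def mp_def np_def ca_def cb_def de_def df_def

lemma j_closed [simp]: "x \<in> carrier M ==> jm x \<in> I0" "y \<in> carrier N ==> jn y \<in> I0"
  "i \<in> I0 ==> mp i \<in> carrier M" "i \<in> I0 ==> np i \<in> carrier N"
  "c \<in> carrier Cd ==> ca c \<in> carrier A" "c \<in> carrier Cd ==> cb c \<in> carrier B"
 by (auto simp: j_defs I0_def)

lemma d_closed [simp]: "de \<in> carrier Cd" "df \<in> carrier Cd"
 using alA alB by (auto simp: j_defs)

lemma j_lin: "lin K M Im jm" "lin K N Im jn" "lin K Im M mp" "lin K Im N np"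
 by (rule linI; simp add: j_defs I0_iff split_paired_all)+

lemma j_proj [simp]: "mp (jm x) = x" "np (jm x) = \<zero>[N]" "mp (jn y) = \<zero>[M]" "np (jn y) = y"
 by (simp_all add: j_defs)

lemma j_sum: "i \<in> I0 ==> i = jm (mp i) \<oplus>[Lam] jn (np i)"
 by (auto simp: j_defs I0_def)

lemma j_act: assumes "c \<in> carrier Cd" "i \<in> I0"
 shows "mp (c \<otimes>[Lam] i) = lmult M (cb c) (mp i)" "np (c \<otimes>[Lam] i) = lmult N (ca c) (np i)"
  "mp (i \<otimes>[Lam] c) = rmult M (mp i) (ca c)" "np (i \<otimes>[Lam] c) = rmult N (np i) (cb c)"
 using assms by (auto simp: j_defs I0_def comp_rules)

lemma cabs: assumes "a \<in> carrier A" "b \<in> carrier B"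
 shows "(a, \<zero>[N], \<zero>[M], b) \<in> carrier Cd" "ca (a, \<zero>[N], \<zero>[M], b) = a" "cb (a, \<zero>[N], \<zero>[M], b) = b"
 using assms by (auto simp: j_defs)

lemma j_mult:
 "c \<in> carrier Cd ==> x \<in> carrier M ==> c \<otimes>[Lam] jm x = jm (lmult M (cb c) x)"
 "c \<in> carrier Cd ==> x \<in> carrier M ==> jm x \<otimes>[Lam] c = jm (rmult M x (ca c))"
 "c \<in> carrier Cd ==> y \<in> carrier N ==> c \<otimes>[Lam] jn y = jn (lmult N (ca c) y)"
 "c \<in> carrier Cd ==> y \<in> carrier N ==> jn y \<otimes>[Lam] c = jn (rmult N y (cb c))"
 by (auto simp: j_defs comp_rules alg_rules alA alB)

lemma d_mult:
 "x \<in> carrier M ==> df \<otimes>[Lam] jm x = jm x" "x \<in> carrier M ==> jm x \<otimes>[Lam] de = jm x"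
 "x \<in> carrier M ==> de \<otimes>[Lam] jm x = \<zero>[Lam]" "x \<in> carrier M ==> jm x \<otimes>[Lam] df = \<zero>[Lam]"
 "y \<in> carrier N ==> de \<otimes>[Lam] jn y = jn y" "y \<in> carrier N ==> jn y \<otimes>[Lam] df = jn y"
 "y \<in> carrier N ==> df \<otimes>[Lam] jn y = \<zero>[Lam]" "y \<in> carrier N ==> jn y \<otimes>[Lam] de = \<zero>[Lam]"
 using alA alB by (auto simp: j_defs comp_rules alg_rules)

declare Lam_simps [simp del] Cd_carrier [simp del]

lemma tg_zero: "set us <= I0 ==> set vs <= I0 ==> length us + length vs + 1 = n ==> tg n (us @ \<zero>[Lam] # vs) = \<zero>[T n]"
 using lin_zero[OF T_lin bm_module[OF Im_bimodule] T_module] by simp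

text \<open>The idempotent that fixes \<open>M\<close> from the right kills it from the left, so
  moving it across the tensor sign annihilates two neighbouring letters from \<open>M\<close>;
  likewise for \<open>N\<close>.\<close>

lemma tg_jj:
 assumes "set vs <= I0" "length vs + 2 = n"
 shows "x \<in> carrier M ==> x' \<in> carrier M ==> tg n (jm x # jm x' # vs) = \<zero>[T n]"
  and "y \<in> carrier N ==> y' \<in> carrier N ==> tg n (jn y # jn y' # vs) = \<zero>[T n]"
proof -
 show "x \<in> carrier M ==> x' \<in> carrier M ==> tg n (jm x # jm x' # vs) = \<zero>[T n]"
  using T_balance[of "[]" vs n "jm x" de "jm x'"] tg_zero[of "[jm x]" vs n] assms by (simp add: d_mult)
 show "y \<in> carrier N ==> y' \<in> carrier N ==> tg n (jn y # jn y' # vs) = \<zero>[T n]"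
  using T_balance[of "[]" vs n "jn y" df "jn y'"] tg_zero[of "[jn y]" vs n] assms by (simp add: d_mult)
qed

text \<open>The alternating part of a word; the flag decides whether it starts in
  \<open>M\<close>.\<close>

primrec alt :: "('a \<times> 'n \<times> 'm \<times> 'b) list => bool => ('a \<times> 'n \<times> 'm \<times> 'b) list" where
 "alt [] s = []"
| "alt (i # is) s = (if s then jm (mp i) else jn (np i)) # alt is (\<not> s)"

lemma alt_closed: "set l <= I0 ==> set (alt l s) <= I0" and alt_length [simp]: "length (alt l s) = length l"
 by (induction l arbitrary: s) auto

lemma alt_append: "alt (l @ l') s = alt l s @ alt l' (if even (length l) then s else \<not> s)"
 by (induction l arbitrary: s) auto

text \<open>Since \<open>M \<otimes>\<^sub>C M\<close> and \<open>N \<otimes>\<^sub>C N\<close> vanish, only the alternating words survive in a tensor power of \<open>I\<close>.\<close>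

lemma alt_sum:
 "set l <= I0 ==> l \<noteq> [] ==> tg (length l) l = tg (length l) (alt l True) \<oplus>[T (length l)] tg (length l) (alt l False)"
proof (induction l)
 case (Cons i l)
 note lin1 = lin_add[OF T_lin[of "[]"], simplified]
 show ?case
 proof (cases l)
  case Nil
  have "tg (length [i]) [i] = tg (length [i]) [jm (mp i) \<oplus>[Lam] jn (np i)]" using Cons j_sum[of i] by simp
  also have "\<dots> = tg (length [i]) [jm (mp i)] \<oplus>[T (length [i])] tg (length [i]) [jn (np i)]"
   using Cons by (intro lin1) auto
  finally show ?thesis using Nil by simp
 next
  case l: (Cons k r)
  let ?n = "length l"
  have c: "k \<in> I0" "set r <= I0" "i \<in> I0" "set l <= I0" using Cons.prems l by auto
  note a = alt_closed[OF c(4)] and a' = alt_closed[OF c(2)]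
  have s: "tg (Suc ?n) (i # alt l b) = tg (Suc ?n) (jm (mp i) # alt l b) \<oplus>[T (Suc ?n)] tg (Suc ?n) (jn (np i) # alt l b)" for b
  proof -
   have "tg (Suc ?n) (i # alt l b) = tg (Suc ?n) ((jm (mp i) \<oplus>[Lam] jn (np i)) # alt l b)" using j_sum[OF c(3)] by simp
   also have "\<dots> = tg (Suc ?n) (jm (mp i) # alt l b) \<oplus>[T (Suc ?n)] tg (Suc ?n) (jn (np i) # alt l b)"
    using c a by (intro lin1) auto
   finally show ?thesis .
  qed
  have tc: "set ws <= I0 ==> length ws = length l ==> tg ?n ws \<in> carrier (T ?n)"
   "set ws <= I0 ==> length ws = Suc (length l) ==> tg (Suc ?n) ws \<in> carrier (T (Suc ?n))" for ws
   using tg_closed[of ws] by simp_all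
  have "tg (Suc ?n) (i # l) = cl ?n i (tg ?n l)" using c by (simp add: cl_tg)
  also have "\<dots> = cl ?n i (tg ?n (alt l True)) \<oplus>[T (Suc ?n)] cl ?n i (tg ?n (alt l False))"
   using Cons.IH[OF c(4)] l lin_add[OF cl_lin[OF c(3)] tc(1)[OF a, of True] tc(1)[OF a, of False]] by simp
  also have "\<dots> = tg (Suc ?n) (i # alt l True) \<oplus>[T (Suc ?n)] tg (Suc ?n) (i # alt l False)"
   using c a by (simp add: cl_tg)
  \<comment> \<open>Splitting the first letter gives four words; the two that begin with equal kinds
    vanish by \<open>tg_jj\<close>.\<close>
  also have "\<dots> = tg (Suc ?n) (jn (np i) # alt l True) \<oplus>[T (Suc ?n)] tg (Suc ?n) (jm (mp i) # alt l False)"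
   unfolding s using l c a' tc by (simp add: tg_jj)
  also have "\<dots> = tg (Suc ?n) (jm (mp i) # alt l False) \<oplus>[T (Suc ?n)] tg (Suc ?n) (jn (np i) # alt l True)"
   using c a by (intro v_comm[OF T_module] tc) auto
  finally show ?thesis by simp
 qed
qed simp

end

section \<open>Words in \<open>I\<close> and tensor powers of \<open>M \<otimes> N\<close> over
  \<open>A\<close>\<close>

context null_sq
begin

abbreviation "W \<equiv> tensor K A M N"
abbreviation "wn \<equiv> tens K A M N"
abbreviation "U \<equiv> tpow K B W"
abbreviation "ug \<equiv> tpgen K B W"

lemma W_t: "tensorable K A M N"
 by (rule bm_tensorable[OF bmM bmN])

lemma W_bimodule: "bimodule K B B W"
 by (rule tensor_bimodule[OF bmM bmN])

lemma wt_closed [simp]: "x \<in> carrier M ==> y \<in> carrier N ==> wn x y \<in> carrier W"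
 by (rule tens_closed[OF W_t])

lemma W_powable: "powable K B W"
 using bm_powable[OF W_bimodule, of 1] by simp

lemma U_module [simp]: "module K (U p)"
 by (rule tpow_module[OF W_powable])

lemma W_module [simp]: "module K W"
 by (rule bm_module[OF W_bimodule])

text \<open>Reads a word in pairs. A letter of the wrong kind contributes a zero component, so in
  the tensor power only words of the form \<open>M N M N ...\<close> survive.\<close>

fun prs :: "('a \<times> 'n \<times> 'm \<times> 'b) list => ('m \<times> 'n => 'k) set list" where
 "prs (i # j # l) = wn (mp i) (np j) # prs l"
| "prs [i] = []"
| "prs [] = []"

lemma prs_closed: "set l <= I0 ==> set (prs l) <= carrier W"
 by (induction l rule: prs.induct) auto

lemma prs_length [simp]: "length (prs l) = length l div 2"
 by (induction l rule: prs.induct) auto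

lemma prs_append: "even (length l) ==> prs (l @ l') = prs l @ prs l'"
 by (induction l rule: prs.induct) auto

lemma prs_alt: "even (length l) ==> prs (alt l True) = prs l"
 by (induction l rule: prs.induct) auto

text \<open>In a word of even length the distinguished letter is the first or the second of its
  pair, according to the parity of what precedes it; each case supplies its partner.\<close>

lemma even_split:
 assumes "length us + length vs + 1 = 2 * p" "set us <= S" "set vs <= S"
 obtains (even) v vs' where "vs = v # vs'" "even (length us)" "length us div 2 + length vs' div 2 + 1 = p" "v \<in> S" "set vs' <= S"
 | (odd) u us' where "us = us' @ [u]" "even (length us')" "length us' div 2 + length vs div 2 + 1 = p" "u \<in> S" "set us' <= S"
proof (cases "even (length us)")
 case True
 moreover have "2 * p = length us + length vs + 1" using assms by simp
 ultimately have "odd (length vs)" by (metis even_add even_mult_iff even_numeral odd_one)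
 then obtain v vs' where "vs = v # vs'" by (cases vs) auto
 moreover have "length us div 2 + length vs' div 2 + 1 = p" using assms(1) True calculation by (auto elim!: evenE)
 ultimately show thesis using even True assms by auto
next
 case False
 then obtain u us' where "us = us' @ [u]" by (cases us rule: rev_cases) auto
 moreover have "length us' div 2 + length vs div 2 + 1 = p" using assms(1) False calculation by (auto elim!: evenE)
 ultimately show thesis using odd False assms by auto
qed

text \<open>A scalar from \<open>Cd\<close> between two letters lies either inside a pair, where its
  \<open>A\<close>-part crosses the tensor sign over \<open>A\<close>, or between two pairs, where
  its \<open>B\<close>-part crosses the one over \<open>B\<close>.\<close>

lemma prs_multilin:
 assumes \<phi>: "multilin K B W p V \<phi>"
 shows "multilin K Cd Im (2 * p) V (%l. \<phi> (prs l))"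
proof (rule multilinI)
 fix l assume "set l <= carrier Im" "length l = 2 * p"
 then show "\<phi> (prs l) \<in> carrier V" by (intro multilinD(1)[OF \<phi>]) (simp_all add: prs_closed)
next
 fix us vs assume uv: "set us <= carrier Im" "set vs <= carrier Im" "length us + length vs + 1 = 2 * p"
 then have s: "set us <= I0" "set vs <= I0" by simp_all
 show "lin K Im V (%w. \<phi> (prs (us @ w # vs)))"
 proof (cases rule: even_split[OF uv(3) s, case_names even odd])
  case (even v vs')
  have "lin K Im V (%w. \<phi> (prs us @ wn (mp w) (np v) # prs vs'))"
   by (rule lin_comp[OF lin_comp[OF j_lin(3) tens_lin1[OF W_t]] multilinD(2)[OF \<phi>]])
     (use even s in \<open>simp_all add: prs_closed\<close>)
  then show ?thesis using even by (simp add: prs_append)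
 next
  case (odd u us')
  have "lin K Im V (%w. \<phi> (prs us' @ wn (mp u) (np w) # prs vs))"
   by (rule lin_comp[OF lin_comp[OF j_lin(4) tens_lin2[OF W_t]] multilinD(2)[OF \<phi>]])
     (use odd s in \<open>simp_all add: prs_closed\<close>)
  then show ?thesis using odd by (simp add: prs_append)
 qed
next
 fix us vs v c w assume uv: "set us <= carrier Im" "set vs <= carrier Im" "length us + length vs + 2 = 2 * p"
  and "v \<in> carrier Im" and c: "c \<in> carrier Cd" and "w \<in> carrier Im"
 then have s: "set us <= I0" "set (w # vs) <= I0" and v: "v \<in> I0" and w: "w \<in> I0" by simp_all
 have len: "length us + length (w # vs) + 1 = 2 * p" using uv by simp
 show "\<phi> (prs (us @ rmult Im v c # w # vs)) = \<phi> (prs (us @ v # lmult Im c w # vs))"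
 proof (cases rule: even_split[OF len s, case_names even odd])
  case (even w' vs')
  then show ?thesis using c v w tens_balance[OF W_t, of "mp v" "ca c" "np w"] by (simp add: prs_append j_act)
 next
  case (odd u us')
  then obtain z vs' where z: "vs = z # vs'" using uv(3) by (cases vs) auto
  show ?thesis
   using odd s v w c z multilinD(3)[OF \<phi>, of "prs us'" "prs vs'" "wn (mp u) (np v)" "cb c" "wn (mp w) (np z)"]
   by (simp add: prs_append j_act prs_closed tensor_rmult[OF bmM bmN] tensor_lmult[OF bmM bmN])
 qed
qed

lemma tens_pure_induct:
 assumes "lin K W V f" "lin K W V g" "!!i j. i \<in> I0 ==> j \<in> I0 ==> f (wn (mp i) (np j)) = g (wn (mp i) (np j))" "w \<in> carrier W"
 shows "f w = g w"
proof (rule tensor_lin_eq[OF W_t assms(1,2) _ assms(4)])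
 fix x y assume "x \<in> carrier M" "y \<in> carrier N"
 then show "f (wn x y) = g (wn x y)" using assms(3)[of "jm x" "jn y"] by simp
qed

text \<open>Words with pure tensors as letters, written \<open>prs l\<close>, suffice. Arbitrary
  letters are replaced by pure ones from the left, and the prefix \<open>prs l\<close> grows by two
  letters of \<open>l\<close> each time.\<close>

lemma U_lin_eq:
 assumes p: "p > 0" and f: "lin K (U p) V f" and g: "lin K (U p) V g"
  and eq: "!!l. set l <= I0 ==> length l = 2 * p ==> f (ug p (prs l)) = g (ug p (prs l))" and u: "u \<in> carrier (U p)"
 shows "f u = g u"
proof (rule tpow_lin_eq[OF W_powable f g p _ u])
 note m = tpgen_multilin[OF W_powable, of p]
 have "f (ug p (prs l @ ws)) = g (ug p (prs l @ ws))"
  if "set l <= I0" "even (length l)" "set ws <= carrier W" "length l + 2 * length ws = 2 * p" for l ws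
  using that
 proof (induction ws arbitrary: l)
  case Nil
  then show ?case using eq[of l] by simp
 next
  case (Cons w ws)
  have lin: "lin K W (U p) (%w. ug p (prs l @ w # ws))"
   by (rule multilinD(2)[OF m]) (use Cons.prems in \<open>auto simp: prs_closed elim!: evenE\<close>)
  show ?case
  proof (rule tens_pure_induct[OF lin_comp[OF lin f] lin_comp[OF lin g]])
   fix i j assume "i \<in> I0" "j \<in> I0"
   then show "f (ug p (prs l @ wn (mp i) (np j) # ws)) = g (ug p (prs l @ wn (mp i) (np j) # ws))"
    using Cons.IH[of "l @ [i, j]"] Cons.prems by (simp add: prs_append)
  qed (use Cons.prems in simp)
 qed
 from this[of "[]"] show "f (ug p ws) = g (ug p ws)" if "set ws <= carrier W" "length ws = p" for ws
  using that by simp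
qed

text \<open>The map \<open>bet\<close> from \<open>I\<^sup>2\<^sup>p\<close> to \<open>(M \<otimes>\<^sub>A N)\<^sup>p\<close>, killing the words that start in \<open>N\<close>, and its section \<open>alp\<close>.\<close>

definition bet :: "nat => _" where "bet p = plift K (U p) (%l. ug p (prs l))"

lemma bet_lin: "lin K (T (2 * p)) (U p) (bet p)"
 and bet_tg: "set l <= I0 ==> length l = 2 * p ==> bet p (tg (2 * p) l) = ug p (prs l)"
proof -
 note t = tpow_lift[OF Im_powable U_module prs_multilin[OF tpgen_multilin[OF W_powable]]]
 show "lin K (T (2 * p)) (U p) (bet p)" unfolding bet_def by (rule t(1))
 show "bet p (tg (2 * p) l) = ug p (prs l)" if "set l <= I0" "length l = 2 * p"
  unfolding bet_def using t(2)[of l] that by simp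
qed

text \<open>Puts an element of \<open>M \<otimes> N\<close> in front of an element of a power of
  \<open>I\<close>. Letters of \<open>W\<close> are not pure in general, so \<open>ap\<close>
  inserts them one at a time through the universal property of \<open>W\<close>.\<close>

definition lam :: "nat => _ => ('m \<times> 'n => 'k) set => _" where
 "lam n u = plift K (Tb n) (%(x, y). cl (Suc n) (jm x) (cl n (jn y) u))"

primrec ap :: "('m \<times> 'n => 'k) set list => _" where
 "ap [] = tg 0 []"
| "ap (w # ws) = lam (2 * length ws) (ap ws) w"

text \<open>The recursion of \<open>ap\<close> starts at the empty word in the zeroth power, which
  \<open>cl_lin2\<close> does not cover; the disjunction in the premise admits just this
  element.\<close>

lemma ap_lin: assumes "u \<in> carrier (T n)" "n > 0 \<or> u = tg 0 []"
 shows "lin K Im (T (Suc n)) (%j. cl n j u)"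
proof (cases n)
 case 0
 with assms have u: "u = tg 0 []" by simp
 show ?thesis unfolding 0 u
  by (rule lin_cong[OF T1_lin]) (simp_all add: cl_tg v_submoduleD(3,4)[OF Lm Isub])
qed (use assms in \<open>simp add: cl_lin2\<close>)

context
 fixes n u
 assumes u: "u \<in> carrier (T n)" "n > 0 \<or> u = tg 0 []"
begin

lemma lam_lin: "lin K W (Tb n) (lam n u)"
 and lam_wn: "x \<in> carrier M ==> y \<in> carrier N ==> lam n u (wn x y) = cl (Suc n) (jm x) (cl n (jn y) u)"
proof -
 have "balanced K A M N (Tb n) (%x y. cl (Suc n) (jm x) (cl n (jn y) u))"
 proof (rule balancedI)
  show "lin K N (Tb n) (%y. cl (Suc n) (jm x) (cl n (jn y) u))" if "x \<in> carrier M" for x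
   by (rule lin_comp[OF lin_comp[OF j_lin(2) ap_lin[OF u]] cl_lin]) (use that in simp)
  show "lin K M (Tb n) (%x. cl (Suc n) (jm x) (cl n (jn y) u))" if "y \<in> carrier N" for y
   by (rule lin_comp[OF j_lin(1) cl_lin2]) (use that u in simp)
  fix x a y assume x: "x \<in> carrier M" and a: "a \<in> carrier A" and y: "y \<in> carrier N"
  note c = cabs[OF a v_zero[OF modules(2)]]
  have "cl (Suc n) (jm (rmult M x a)) (cl n (jn y) u) = cl (Suc n) (jm x) (lmult (T (Suc n)) (a, \<zero>[N], \<zero>[M], \<zero>[B]) (cl n (jn y) u))"
   using cl_balance[OF c(1), of "jm x" "cl n (jn y) u" n] x y u(1) c by (simp add: j_mult)
  also have "lmult (T (Suc n)) (a, \<zero>[N], \<zero>[M], \<zero>[B]) (cl n (jn y) u) = cl n (jn (lmult N a y)) u"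
  proof (cases n)
   case 0
   with u show ?thesis using y c by (simp add: cl_tg T_l[of _ _ "[]" 0] j_mult comp_rules a)
  next
   case (Suc k)
   then show ?thesis using cl_cmult[OF c(1), of "jn y" u k] y u(1) c by (simp add: j_mult)
  qed
  finally show "cl (Suc n) (jm (rmult M x a)) (cl n (jn y) u) = cl (Suc n) (jm x) (cl n (jn (lmult N a y)) u)" .
 qed
 note t = tensor_lift[OF W_t T_module this]
 show "lin K W (Tb n) (lam n u)" unfolding lam_def by (rule t(1))
 show "x \<in> carrier M ==> y \<in> carrier N ==> lam n u (wn x y) = cl (Suc n) (jm x) (cl n (jn y) u)"
  unfolding lam_def by (rule t(2))
qed

end

lemma ap_closed: "set ws <= carrier W ==> ap ws \<in> carrier (T (2 * length ws)) \<and> (2 * length ws > 0 \<or> ap ws = tg 0 [])"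
proof (induction ws)
 case Nil
 then show ?case using tg_closed[of "[]"] by simp
next
 case (Cons w ws)
 then show ?case using lin_closed[OF lam_lin[of "ap ws" "2 * length ws"], of w] by simp
qed

lemma lam_lin2:
 assumes "w \<in> carrier W" and n: "n > 0"
 shows "lin K (T n) (Tb n) (%u. lam n u w)"
 using assms(1)
proof (induction rule: tensor_induct[OF W_t, consumes 1, case_names gen add])
 case (gen x y)
 show ?case
  by (rule lin_cong[OF lin_comp[OF cl_lin[of "jn y"] cl_lin[of "jm x"]]])
    (use gen n in \<open>simp_all add: lam_wn v_add v_smult\<close>)
next
 case (add w w')
 show ?case
  by (rule lin_cong[OF lin_fun_add[OF T_module add(3,4)]])
    (use add n in \<open>simp_all add: lin_add[OF lam_lin]\<close>)
qed

text \<open>For pure letters the scalar crosses the junction between a letter of \<open>N\<close>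
  and the next letter of \<open>M\<close>, by \<open>cl_balance\<close>. Both sides are linear in
  each of the two letters of \<open>W\<close>.\<close>

lemma ap_balance:
 assumes w: "w \<in> carrier W" "w' \<in> carrier W" and b: "b \<in> carrier B"
  and u: "u \<in> carrier (T n)" "n > 0 \<or> u = tg 0 []"
 shows "lam (Suc (Suc n)) (lam n u w') (rmult W w b) = lam (Suc (Suc n)) (lam n u (lmult W b w')) w"
proof -
 note c = cabs[OF v_zero[OF modules(1)] b]
 have cl: "lam n u v \<in> carrier (Tb n)" if "v \<in> carrier W" for v
  by (rule lin_closed[OF lam_lin[OF u] that])
 have pure: "lam (Suc (Suc n)) (lam n u (wn x' y')) (wn x (rmult N y b)) = lam (Suc (Suc n)) (lam n u (wn (lmult M b x') y')) (wn x y)"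
  if "x \<in> carrier M" "y \<in> carrier N" "x' \<in> carrier M" "y' \<in> carrier N" for x y x' y'
  using that u(1) c b cl_balance[OF c(1), of "jn y" "cl (Suc n) (jm x') (cl n (jn y') u)" "Suc n"]
   cl_cmult[OF c(1), of "jm x'" "cl n (jn y') u" n] cl[of "wn x' y'"] cl[of "wn (lmult M b x') y'"]
  by (simp add: lam_wn[OF u] lam_wn comp_rules j_mult)
 note R = bm_r[OF W_bimodule b] and L = bm_l[OF W_bimodule b]
 show ?thesis
 proof (rule tensor_lin_eq[OF W_t _ _ _ w(1)])
  show "lin K W (Tc (Suc n)) (%w. lam (Suc (Suc n)) (lam n u w') (rmult W w b))"
   by (rule lin_comp[OF R lam_lin]) (use cl w in simp_all)
  show "lin K W (Tc (Suc n)) (lam (Suc (Suc n)) (lam n u (lmult W b w')))"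
   by (rule lam_lin) (use cl w b in \<open>simp_all add: bm_lcl[OF W_bimodule]\<close>)
  fix x y assume xy: "x \<in> carrier M" "y \<in> carrier N"
  show "lam (Suc (Suc n)) (lam n u w') (rmult W (wn x y) b) = lam (Suc (Suc n)) (lam n u (lmult W b w')) (wn x y)"
  proof (rule tensor_lin_eq[OF W_t _ _ _ w(2)])
   show "lin K W (Tc (Suc n)) (%w'. lam (Suc (Suc n)) (lam n u w') (rmult W (wn x y) b))"
    by (rule lin_comp[OF lam_lin[OF u] lam_lin2]) (use xy b in \<open>simp_all add: bm_rcl[OF W_bimodule]\<close>)
   show "lin K W (Tc (Suc n)) (%w'. lam (Suc (Suc n)) (lam n u (lmult W b w')) (wn x y))"
    by (rule lin_comp[OF lin_comp[OF L lam_lin[OF u]] lam_lin2]) (use xy b in simp_all)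
   fix x' y' assume "x' \<in> carrier M" "y' \<in> carrier N"
   then show "lam (Suc (Suc n)) (lam n u (wn x' y')) (rmult W (wn x y) b) = lam (Suc (Suc n)) (lam n u (lmult W b (wn x' y'))) (wn x y)"
    using pure xy b by (simp add: tensor_rmult[OF bmM bmN] tensor_lmult[OF bmM bmN])
  qed
 qed
qed

lemma ap_multilin: "multilin K B W p (T (2 * p)) ap"
proof (rule multilinI)
 show "set ws <= carrier W ==> length ws = p ==> ap ws \<in> carrier (T (2 * p))" for ws using ap_closed[of ws] by auto
next
 fix us vs assume uv: "set us <= carrier W" "set vs <= carrier W" "length us + length vs + 1 = p"
 then show "lin K W (T (2 * p)) (%w. ap (us @ w # vs))"
 proof (induction us arbitrary: p)
  case Nil
  have "lin K W (Tb (2 * length vs)) (lam (2 * length vs) (ap vs))"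
   by (rule lam_lin) (use ap_closed[OF Nil(2)] in auto)
  then show ?case using Nil(3)[symmetric] by simp
 next
  case (Cons u us)
  let ?q = "length us + length vs + 1"
  have "lin K W (Tb (2 * ?q)) (%w. lam (2 * ?q) (ap (us @ w # vs)) u)"
   by (rule lin_comp[OF Cons.IH[of ?q] lam_lin2]) (use Cons.prems in simp_all)
  then show ?case using Cons.prems(3)[symmetric] by simp
 qed
next
 fix us vs v b w assume "set us <= carrier W" and vs: "set vs <= carrier W" and "v \<in> carrier W" "b \<in> carrier B" "w \<in> carrier W"
 then show "ap (us @ rmult W v b # w # vs) = ap (us @ v # lmult W b w # vs)"
  by (induction us) (simp_all add: ap_balance[OF _ _ _ conjunct1[OF ap_closed[OF vs]] conjunct2[OF ap_closed[OF vs]]])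
qed

definition alp :: "nat => _" where "alp p = plift K (T (2 * p)) ap"

lemma alp_lin: "lin K (U p) (T (2 * p)) (alp p)"
 and alp_ug: "set ws <= carrier W ==> length ws = p ==> alp p (ug p ws) = ap ws"
 unfolding alp_def using tpow_lift[OF W_powable T_module ap_multilin] by auto

lemma ap_prs: "set l <= I0 ==> even (length l) ==> ap (prs l) = tg (length l) (alt l True)"
proof (induction l rule: prs.induct)
 case (1 i j l)
 have l: "2 * (length l div 2) = length l" and set: "set l <= I0" "i \<in> I0" "j \<in> I0" using 1(2,3) by auto
 have c: "ap (prs l) \<in> carrier (T (length l))" "length l > 0 \<or> ap (prs l) = tg 0 []"
  using ap_closed[OF prs_closed[OF set(1)]] unfolding prs_length l by auto
 have "ap (prs (i # j # l)) = lam (length l) (ap (prs l)) (wn (mp i) (np j))" by (simp add: l)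
 also have "\<dots> = cl (Suc (length l)) (jm (mp i)) (cl (length l) (jn (np j)) (ap (prs l)))"
  by (rule lam_wn[OF c]) (use set in simp_all)
 also have "\<dots> = tg (Suc (Suc (length l))) (alt (i # j # l) True)"
  using 1 set alt_closed[of l True] by (simp add: cl_tg)
 finally show ?case by simp
qed auto

lemma alp_prs: "set l <= I0 ==> length l = 2 * p ==> alp p (ug p (prs l)) = tg (2 * p) (alt l True)"
 using alp_ug[of "prs l" p] ap_prs[of l] by (simp add: prs_closed)

text \<open>On \<open>prs l\<close> both maps are explicit: \<open>alp\<close> gives the alternating
  part of \<open>l\<close> that starts in \<open>M\<close>, and this has the same pairs as
  \<open>l\<close>.\<close>

lemma bet_alp: "p > 0 ==> z \<in> carrier (U p) ==> bet p (alp p z) = z"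
 by (rule U_lin_eq[OF _ lin_comp[OF alp_lin bet_lin] lin_ident]) (simp_all add: alp_prs bet_tg alt_closed prs_alt)

end

section \<open>The two cyclic readings of a word of even length\<close>

context null_sq
begin

context
 fixes p :: nat
 assumes p: "p > 0"
begin

abbreviation "T2 \<equiv> T (2 * p)"
abbreviation "Hp \<equiv> H0 K B (U p)"
abbreviation "Zp \<equiv> H0 K Cd T2"
abbreviation "uc \<equiv> %z. commutator_span K B (U p) +>[U p] z"
abbreviation "zc \<equiv> %u. commutator_span K Cd T2 +>[T2] u"
abbreviation "rr \<equiv> cyc_gen K Cd Im (2 * p)"
abbreviation "tt \<equiv> cyc_gen K B W p"

lemma p2: "2 * p > 0"
 using p by simp

lemma U_bimodule: "bimodule K B B (U p)"
 by (rule tpow_bimodule[OF W_bimodule p])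

lemma T2_bimodule: "bimodule K Cd Cd T2"
 by (rule tpow_bimodule[OF Im_bimodule p2])

lemma Hp_module [simp]: "module K Hp" and Zp_module [simp]: "module K Zp"
 by (rule H0_module[OF U_bimodule] H0_module[OF T2_bimodule])+

lemma uc_lin: "lin K (U p) Hp uc" and zc_lin: "lin K T2 Zp zc"
 by (rule hcl_lin[OF U_bimodule] hcl_lin[OF T2_bimodule])+

lemma rr_lin: "lin K Zp Zp rr" and tt_lin: "lin K Hp Hp tt"
 by (rule cyc_lin[OF Im_bimodule p2] cyc_lin[OF W_bimodule p])+

lemma rr_tg: "set l <= I0 ==> length l = 2 * p ==> rr (zc (tg (2 * p) l)) = zc (tg (2 * p) (last l # butlast l))"
 using cyc_val[OF Im_bimodule p2, of l] by simp

lemma T2_lin_eq: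
 assumes "lin K T2 V f" "lin K T2 V g" "!!l. set l <= I0 ==> length l = 2 * p ==> f (tg (2 * p) l) = g (tg (2 * p) l)" "u \<in> carrier T2"
 shows "f u = g u"
 by (rule tpow_lin_eq[OF Im_powable assms(1,2) p2 _ assms(4)]) (simp add: assms(3))

lemma T2_l: "c \<in> carrier Cd ==> set (w # ws) <= I0 ==> length (w # ws) = 2 * p
  ==> lmult T2 c (tg (2 * p) (w # ws)) = tg (2 * p) (c \<otimes>[Lam] w # ws)"
 and T2_r: "c \<in> carrier Cd ==> set (ws @ [w]) <= I0 ==> length (ws @ [w]) = 2 * p
  ==> rmult T2 (tg (2 * p) (ws @ [w])) c = tg (2 * p) (ws @ [w \<otimes>[Lam] c])"
 using tpow_lmult[OF Im_bimodule p2, of c w ws] tpow_rmult[OF Im_bimodule p2, of c ws w] by simp_all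

lemma U_l: "b \<in> carrier B ==> set (w # ws) <= carrier W ==> length (w # ws) = p
  ==> lmult (U p) b (ug p (w # ws)) = ug p (lmult W b w # ws)"
 and U_r: "b \<in> carrier B ==> set (ws @ [w]) <= carrier W ==> length (ws @ [w]) = p
  ==> rmult (U p) (ug p (ws @ [w])) b = ug p (ws @ [rmult W w b])"
 using tpow_lmult[OF W_bimodule p] tpow_rmult[OF W_bimodule p] by simp_all

lemma two_front: assumes "length l = 2 * p"
 obtains i j l' where "l = i # j # l'" "length l' + 2 = 2 * p"
 using assms p by (cases l; cases "tl l") auto

lemma two_back: assumes "length l = 2 * p"
 obtains i j l' where "l = l' @ [i, j]" "length l' + 2 = 2 * p"
proof -
 from assms p obtain l1 j where 1: "l = l1 @ [j]" by (cases l rule: rev_cases) auto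
 with assms obtain l' i where "l1 = l' @ [i]" by (cases l1 rule: rev_cases) auto
 with 1 that assms show thesis by simp
qed

lemma ug_prs_l: "c \<in> carrier Cd ==> set (i # j # l) <= I0 ==> length (i # j # l) = 2 * p
  ==> lmult (U p) (cb c) (ug p (prs (i # j # l))) = ug p (prs (c \<otimes>[Lam] i # j # l))"
 using U_l[of "cb c" "wn (mp i) (np j)" "prs l"] by (simp add: prs_closed j_act tensor_lmult[OF bmM bmN])

lemma ug_prs_r: "c \<in> carrier Cd ==> set (l @ [i, j]) <= I0 ==> length (l @ [i, j]) = 2 * p
  ==> rmult (U p) (ug p (prs (l @ [i, j]))) (cb c) = ug p (prs (l @ [i, j \<otimes>[Lam] c]))"
proof -
 assume a: "c \<in> carrier Cd" "set (l @ [i, j]) <= I0" "length (l @ [i, j]) = 2 * p"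
 then have "length l + 2 = 2 * p" by simp
 then have "even (length l)" "length l div 2 + 1 = p" by presburger+
 with a show ?thesis
  using U_r[of "cb c" "prs l" "wn (mp i) (np j)"]
  by (simp add: prs_append prs_closed j_act tensor_rmult[OF bmM bmN])
qed

definition beta :: "_ => _" where "beta u = uc (bet p u)"

lemma beta_lin: "lin K T2 Hp beta"
 unfolding beta_def by (rule lin_comp[OF bet_lin uc_lin])

lemma beta_tg: "set l <= I0 ==> length l = 2 * p ==> beta (tg (2 * p) l) = uc (ug p (prs l))"
 by (simp add: beta_def bet_tg)

text \<open>The first letter is read in \<open>M\<close>, where \<open>c\<close> acts from the left
  by its \<open>B\<close>-part. In \<open>bet_r\<close> the last letter is read in \<open>N\<close>,
  again with the \<open>B\<close>-part on the outside, so commutators over \<open>Cd\<close> become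
  commutators over \<open>B\<close>.\<close>

lemma bet_l: "c \<in> carrier Cd ==> u \<in> carrier T2 ==> bet p (lmult T2 c u) = lmult (U p) (cb c) (bet p u)"
proof (rule T2_lin_eq[OF lin_comp[OF bm_l[OF T2_bimodule] bet_lin] lin_comp[OF bet_lin bm_l[OF U_bimodule]]])
 fix l assume c: "c \<in> carrier Cd" and l: "set l <= I0" "length l = 2 * p"
 from l(2) obtain i j l' where "l = i # j # l'" "length l' + 2 = 2 * p" by (rule two_front)
 with c l show "bet p (lmult T2 c (tg (2 * p) l)) = lmult (U p) (cb c) (bet p (tg (2 * p) l))"
  using ug_prs_l[of c i j l'] T2_l[of c i "j # l'"] by (simp add: bet_tg CI)
qed auto

lemma bet_r: "c \<in> carrier Cd ==> u \<in> carrier T2 ==> bet p (rmult T2 u c) = rmult (U p) (bet p u) (cb c)"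
proof (rule T2_lin_eq[OF lin_comp[OF bm_r[OF T2_bimodule] bet_lin] lin_comp[OF bet_lin bm_r[OF U_bimodule]]])
 fix l assume c: "c \<in> carrier Cd" and l: "set l <= I0" "length l = 2 * p"
 from l(2) obtain i j l' where "l = l' @ [i, j]" "length l' + 2 = 2 * p" by (rule two_back)
 with c l show "bet p (rmult T2 (tg (2 * p) l) c) = rmult (U p) (bet p (tg (2 * p) l)) (cb c)"
  using ug_prs_r[of c l' i j] T2_r[of c "l' @ [i]" j] by (simp add: bet_tg IC)
qed auto

lemma beta_com: "c \<in> carrier Cd ==> u \<in> carrier T2 ==> beta (lmult T2 c u) = beta (rmult T2 u c)"
 using hcl_comm[OF U_bimodule, of "cb c" "bet p u"] lin_closed[OF bet_lin] by (simp add: beta_def bet_l bet_r)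

definition beb :: "_ => _" where "beb V = beta (SOME u. u \<in> V)"

lemma beb_lin: "lin K Zp Hp beb" and beb_zc: "u \<in> carrier T2 ==> beb (zc u) = beta u"
 using H0_lift[OF T2_bimodule beta_lin Hp_module beta_com] by (simp_all add: beb_def[abs_def])

text \<open>The coordinate for words that start in \<open>N\<close>: having even length, such an
  alternating word ends in \<open>M\<close>, and one rotation brings that letter to the
  front.\<close>

definition gam :: "_ => _" where "gam u = beb (rr (zc u))"

lemma gam_lin: "lin K T2 Hp gam"
 unfolding gam_def by (rule lin_comp[OF lin_comp[OF zc_lin rr_lin] beb_lin])

lemma rot_closed: "set l <= S ==> l \<noteq> [] ==> set (last l # butlast l) <= S"
 by (auto dest: in_set_butlastD)

lemma p2_closed: "set l <= I0 ==> length l = 2 * p ==> tg (2 * p) l \<in> carrier T2"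
  "set l <= I0 ==> length l = 2 * p ==> tg (2 * p) (last l # butlast l) \<in> carrier T2"
 using tg_closed[of l] tg_closed[of "last l # butlast l"] rot_closed[of l I0] p by fastforce+

lemma gam_tg:
 assumes l: "set l <= I0" "length l = 2 * p"
 shows "gam (tg (2 * p) l) = uc (ug p (prs (last l # butlast l)))"
proof -
 have "l \<noteq> []" using l p by auto
 then have "length (last l # butlast l) = 2 * p" using l by (cases l rule: rev_cases) auto
 with \<open>l \<noteq> []\<close> show ?thesis
  using l rot_closed[OF l(1)] beta_tg[of "last l # butlast l"] by (simp add: gam_def rr_tg beb_zc p2_closed)
qed

lemma gam_com: "c \<in> carrier Cd ==> u \<in> carrier T2 ==> gam (lmult T2 c u) = gam (rmult T2 u c)"
 using hcl_comm[OF T2_bimodule, of c u] by (simp add: gam_def)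

lemma tt_uc: "set ws <= carrier W ==> length ws = p ==> tt (uc (ug p ws)) = uc (ug p (last ws # butlast ws))"
 by (rule cyc_val[OF W_bimodule p])

text \<open>Together with \<open>gam_cl\<close> this says that rotation by one letter is
  \<open>(x, y) \<mapsto> (y, t x)\<close> in the coordinates \<open>beta\<close> and
  \<open>gam\<close>.\<close>

lemma gam_cr:
 assumes u: "u \<in> carrier (T (2 * p - 1))" and j: "j \<in> I0"
 shows "gam (cr (2 * p - 1) u j) = beta (cl (2 * p - 1) j u)"
proof -
 obtain q where q: "2 * p = Suc q" using p2 by (cases "2 * p") auto
 have s: "lin K (T q) T2 (%u. cr q u j)" "lin K (T q) T2 (cl q j)"
  unfolding q using cr_lin[OF j] cl_lin[OF j] by auto
 have q0: "q > 0" using q by (cases q) auto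
 have "gam (cr q u j) = beta (cl q j u)"
 proof (rule tpow_lin_eq[OF Im_powable lin_comp[OF s(1) gam_lin] lin_comp[OF s(2) beta_lin] q0])
  show "u \<in> carrier (T q)" using u q by simp
  fix ws assume "set ws <= carrier Im" "length ws = q"
  then show "gam (cr q (tg q ws) j) = beta (cl q j (tg q ws))"
   using gam_tg[of "ws @ [j]"] beta_tg[of "j # ws"] j q by (simp add: cl_tg cr_tg)
 qed
 then show ?thesis using q by simp
qed

lemma gam_cl:
 assumes u: "u \<in> carrier (T (2 * p - 1))" and j: "j \<in> I0"
 shows "gam (cl (2 * p - 1) j u) = tt (beta (cr (2 * p - 1) u j))"
proof -
 obtain q where q: "2 * p = Suc q" using p2 by (cases "2 * p") auto
 have s: "lin K (T q) T2 (%u. cr q u j)" "lin K (T q) T2 (cl q j)"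
  unfolding q using cr_lin[OF j] cl_lin[OF j] by auto
 have q0: "q > 0" using q by (cases q) auto
 have "gam (cl q j u) = tt (beta (cr q u j))"
 proof (rule tpow_lin_eq[OF Im_powable lin_comp[OF s(2) gam_lin] lin_comp[OF lin_comp[OF s(1) beta_lin] tt_lin] q0])
  show "u \<in> carrier (T q)" using u q by simp
  fix ws assume ws: "set ws <= carrier Im" "length ws = q"
  with q0 obtain us z where us: "ws = us @ [z]" by (cases ws rule: rev_cases) auto
  have "length us + 2 = 2 * p" using us ws(2) q by simp
  then have e: "even (length us)" "length us div 2 + 1 = p" by presburger+
  have c: "set us <= I0" "z \<in> I0" using ws us by auto
  have "tt (beta (cr q (tg q ws) j)) = tt (uc (ug p (prs us @ [wn (mp z) (np j)])))"
   using beta_tg[of "us @ [z, j]"] j q ws us e by (simp add: cr_tg prs_append)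
  also have "\<dots> = uc (ug p (wn (mp z) (np j) # prs us))"
   using tt_uc[of "prs us @ [wn (mp z) (np j)]"] c j e by (simp add: prs_closed)
  also have "\<dots> = gam (cl q j (tg q ws))"
   using gam_tg[of "j # us @ [z]"] j q ws us e by (simp add: cl_tg butlast_append)
  finally show "gam (cl q j (tg q ws)) = tt (beta (cr q (tg q ws) j))" by simp
 qed
 then show ?thesis using q by simp
qed

text \<open>Two letters of \<open>I\<close> form one factor of the tensor power of
  \<open>M \<otimes> N\<close>.\<close>

lemma beb_rr: "V \<in> carrier Zp ==> beb (rr (rr V)) = tt (beb V)"
proof (rule pw_lin_eq'[OF Im_bimodule p2 lin_comp[OF lin_comp[OF rr_lin rr_lin] beb_lin] lin_comp[OF beb_lin tt_lin] Hp_module])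
 fix l assume "set l <= carrier Im" and len: "length l = 2 * p"
 then have l: "set l <= I0" by simp
 from len obtain i j l' where l': "l = l' @ [i, j]" "length l' + 2 = 2 * p" by (rule two_back)
 have e: "even (length l')" "length l' div 2 + 1 = p" using l'(2) by presburger+
 have "rr (rr (zc (tg (2 * p) l))) = zc (tg (2 * p) (i # j # l'))"
  using l l' rr_tg[of "j # l' @ [i]"] by (simp add: rr_tg butlast_append)
 then have "beb (rr (rr (zc (tg (2 * p) l)))) = uc (ug p (wn (mp i) (np j) # prs l'))"
  using l l' p2_closed(1)[of "i # j # l'"] by (simp add: beb_zc beta_tg)
 also have "\<dots> = tt (uc (ug p (prs l)))"
  using tt_uc[of "prs l' @ [wn (mp i) (np j)]"] l l' e by (simp add: prs_append prs_closed)
 finally show "beb (rr (rr (zc (tg (2 * p) l)))) = tt (beb (zc (tg (2 * p) l)))"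
  using l len by (simp add: beb_zc p2_closed beta_tg)
qed

text \<open>With \<open>B\<close> embedded in \<open>Cd\<close> by a zero in the corner of
  \<open>A\<close>, the section \<open>alp\<close> is linear on both sides and therefore descends to
  \<open>alb\<close> on \<open>H0\<close>.\<close>

lemma alp_l: "b \<in> carrier B ==> z \<in> carrier (U p)
  ==> alp p (lmult (U p) b z) = lmult T2 (\<zero>[A], \<zero>[N], \<zero>[M], b) (alp p z)"
 and alp_r: "b \<in> carrier B ==> z \<in> carrier (U p)
  ==> alp p (rmult (U p) z b) = rmult T2 (alp p z) (\<zero>[A], \<zero>[N], \<zero>[M], b)"
proof -
 assume b: "b \<in> carrier B" and z: "z \<in> carrier (U p)"
 let ?c = "(\<zero>[A], \<zero>[N], \<zero>[M], b)"
 have c: "?c \<in> carrier Cd" "cb ?c = b" using cabs[OF v_zero[OF modules(1)] b] by auto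
 show "alp p (lmult (U p) b z) = lmult T2 ?c (alp p z)"
 proof (rule U_lin_eq[OF p lin_comp[OF bm_l[OF U_bimodule b] alp_lin] lin_comp[OF alp_lin bm_l[OF T2_bimodule c(1)]] _ z])
  fix l assume l: "set l <= I0" "length l = 2 * p"
  from l(2) obtain i j l' where l': "l = i # j # l'" "length l' + 2 = 2 * p" by (rule two_front)
  then show "alp p (lmult (U p) b (ug p (prs l))) = lmult T2 ?c (alp p (ug p (prs l)))"
   using l c ug_prs_l[of ?c i j l'] alp_prs[of "?c \<otimes>[Lam] i # j # l'" p] alp_prs[of "i # j # l'" p]
    T2_l[of ?c "jm (mp i)" "alt (j # l') False"]
   by (simp add: CI j_act j_mult alt_closed)
 qed
 show "alp p (rmult (U p) z b) = rmult T2 (alp p z) ?c"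
 proof (rule U_lin_eq[OF p lin_comp[OF bm_r[OF U_bimodule b] alp_lin] lin_comp[OF alp_lin bm_r[OF T2_bimodule c(1)]] _ z])
  fix l assume l: "set l <= I0" "length l = 2 * p"
  from l(2) obtain i j l' where l': "l = l' @ [i, j]" "length l' + 2 = 2 * p" by (rule two_back)
  have e: "even (length l')" using l'(2) by presburger
  then show "alp p (rmult (U p) (ug p (prs l)) b) = rmult T2 (alp p (ug p (prs l))) ?c"
   using l l' c ug_prs_r[of ?c l' i j] alp_prs[of "l' @ [i, j \<otimes>[Lam] ?c]" p] alp_prs[of "l' @ [i, j]" p]
    T2_r[of ?c "alt (l' @ [i]) True" "jn (np j)"]
   by (simp add: IC j_act j_mult alt_closed alt_append)
 qed
qed

definition alb :: "_ => _" where "alb V = zc (alp p (SOME z. z \<in> V))"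

lemma alb_lin: "lin K Hp Zp alb" and alb_uc: "z \<in> carrier (U p) ==> alb (uc z) = zc (alp p z)"
proof -
 have "zc (alp p (lmult (U p) b z)) = zc (alp p (rmult (U p) z b))" if "b \<in> carrier B" "z \<in> carrier (U p)" for b z
  unfolding alp_l[OF that] alp_r[OF that]
  by (rule hcl_comm[OF T2_bimodule]) (use that cabs[OF v_zero[OF modules(1)]] lin_closed[OF alp_lin] in simp_all)
 note h = H0_lift[OF U_bimodule lin_comp[OF alp_lin zc_lin] Zp_module this]
 show "lin K Hp Zp alb" using h(1) by (simp add: alb_def[abs_def])
 show "z \<in> carrier (U p) ==> alb (uc z) = zc (alp p z)" using h(2) by (simp add: alb_def)
qed

text \<open>The rotated word is the sum of its two alternating parts. The one starting in
  \<open>M\<close> is what \<open>gam\<close> reads; the other is the rotation of the part of the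
  original word starting in \<open>M\<close>, which \<open>beta\<close> reads. As rotation is
  injective, \<open>beta\<close> and \<open>gam\<close> together determine the class of
  \<open>u\<close>.\<close>

lemma rr_decomp:
 assumes u: "u \<in> carrier T2"
 shows "rr (zc u) = rr (alb (beta u)) \<oplus>[Zp] alb (gam u)"
proof (rule T2_lin_eq[OF lin_comp[OF zc_lin rr_lin] lin_fun_add[OF Zp_module lin_comp[OF lin_comp[OF beta_lin alb_lin] rr_lin] lin_comp[OF gam_lin alb_lin]] _ u])
 fix l assume l: "set l <= I0" "length l = 2 * p"
 have "l \<noteq> []" using l p by auto
 then obtain l' z where l': "l = l' @ [z]" by (cases l rule: rev_cases) auto
 let ?r = "z # l'"
 have r: "set ?r <= I0" "length ?r = 2 * p" "?r \<noteq> []" using l l' by auto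
 have o: "odd (length l')" using r(2) by (metis even_Suc even_mult_iff even_numeral length_Cons)
 have ug: "ug p (prs k) \<in> carrier (U p)" if "set k <= I0" "length k = 2 * p" for k
  using tpgen_closed[OF W_powable, of "prs k" p] that by (simp add: prs_closed)
 note a = alt_closed[OF l(1), of True] alt_closed[OF r(1)]
 have "rr (zc (tg (2 * p) l)) = zc (tg (2 * p) ?r)" using l l' by (simp add: rr_tg)
 also have "\<dots> = zc (tg (2 * p) (alt ?r True) \<oplus>[T2] tg (2 * p) (alt ?r False))"
  using alt_sum[OF r(1,3)] unfolding r(2) by simp
 also have "\<dots> = zc (tg (2 * p) (alt ?r True)) \<oplus>[Zp] zc (tg (2 * p) (alt ?r False))"
  using a r alt_closed[of l'] by (intro lin_add[OF zc_lin] p2_closed) simp_all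
 also have "zc (tg (2 * p) (alt ?r True)) = alb (gam (tg (2 * p) l))"
  using l r l' by (simp add: gam_tg alb_uc ug alp_prs del: alt.simps prs.simps)
 also have "zc (tg (2 * p) (alt ?r False)) = rr (zc (tg (2 * p) (alt l True)))"
  using rr_tg[OF a(1)] l o l' by (simp add: alt_append butlast_append)
 also have "zc (tg (2 * p) (alt l True)) = alb (beta (tg (2 * p) l))"
  using l by (simp add: beta_tg alb_uc ug alp_prs)
 also have "alb (gam (tg (2 * p) l)) \<oplus>[Zp] rr (alb (beta (tg (2 * p) l))) = rr (alb (beta (tg (2 * p) l))) \<oplus>[Zp] alb (gam (tg (2 * p) l))"
  by (rule v_comm[OF Zp_module]) (use p2_closed(1)[OF l] in \<open>auto intro!: lin_closed[OF alb_lin] lin_closed[OF rr_lin] lin_closed[OF beta_lin] lin_closed[OF gam_lin]\<close>)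
 finally show "rr (zc (tg (2 * p) l)) = rr (alb (beta (tg (2 * p) l))) \<oplus>[Zp] alb (gam (tg (2 * p) l))" .
qed

lemma bg_inj:
 assumes u: "u \<in> carrier T2" and "beta u = \<zero>[Hp]" "gam u = \<zero>[Hp]"
 shows "u \<in> commutator_span K Cd T2"
proof -
 have "rr (zc u) = \<zero>[Zp]"
  using rr_decomp[OF u] assms lin_zero[OF alb_lin] lin_zero[OF rr_lin] by simp
 then have "zc u = \<zero>[Zp]" using cyc_inj[OF Im_bimodule p2] lin_closed[OF zc_lin u] by blast
 then show ?thesis using hcl_zero_iff[OF T2_bimodule u] by simp
qed

text \<open>An alternating word that starts in \<open>M\<close> starts in \<open>N\<close> after one
  rotation, and the first of its pairs then has a zero component.\<close>

lemma bg_alp: assumes z: "z \<in> carrier (U p)" shows "beta (alp p z) = uc z" "gam (alp p z) = \<zero>[Hp]"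
proof -
 show "beta (alp p z) = uc z" using z p by (simp add: beta_def bet_alp)
 show "gam (alp p z) = \<zero>[Hp]"
 proof (rule U_lin_eq[OF p lin_comp[OF alp_lin gam_lin] lin_const_zero[OF Hp_module] _ z])
  fix l assume l: "set l <= I0" "length l = 2 * p"
  from l(2) obtain i j l' where l': "l = l' @ [i, j]" "length l' + 2 = 2 * p" by (rule two_back)
  have e: "even (length l')" using l'(2) by presburger
  obtain k r where k: "alt (l' @ [i]) True = k # r" by (cases "alt (l' @ [i]) True") (simp_all add: alt_append)
  have s: "set (k # r) <= I0" "length (k # r) + 1 = 2 * p"
   using alt_closed[of "l' @ [i]" True] l l' alt_length[of "l' @ [i]" True] unfolding k by auto
  have "alt l True = (k # r) @ [jn (np j)]" using k l' e by (simp add: alt_append)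
  then have "gam (alp p (ug p (prs l))) = uc (ug p (wn \<zero>[M] (np k) # prs r))"
   using gam_tg[OF alt_closed[OF l(1), of True]] l s(2) by (simp add: alp_prs)
  also have "wn \<zero>[M] (np k) = \<zero>[W]" using lin_zero[OF tens_lin1[OF W_t, of "np k"]] s by simp
  also have "ug p (\<zero>[W] # prs r) = \<zero>[U p]"
   using lin_zero[OF tpgen_lin[OF W_powable, of "[]" "prs r" p]] s by (simp add: prs_closed)
  finally show "gam (alp p (ug p (prs l))) = \<zero>[Hp]" using lin_zero[OF uc_lin] by simp
 qed
qed

text \<open>\<open>alp p z\<close> realises \<open>(h, 0)\<close>. For \<open>(0, g)\<close> one
  undoes a rotation of \<open>alp p y\<close>; the resulting \<open>beta\<close> vanishes because
  \<open>t\<close>, that is two rotations, sends it to \<open>gam p (alp p y) = 0\<close> and is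
  injective.\<close>

lemma bg_surj:
 assumes h: "h \<in> carrier Hp" and g: "g \<in> carrier Hp"
 obtains u where "u \<in> carrier T2" "beta u = h" "gam u = g"
proof -
 obtain z where z: "z \<in> carrier (U p)" "h = uc z" by (rule H0_cases[OF U_bimodule h])
 obtain y where y: "y \<in> carrier (U p)" "g = uc y" by (rule H0_cases[OF U_bimodule g])
 note ac = lin_closed[OF alp_lin]
 obtain V where V: "V \<in> carrier Zp" "rr V = zc (alp p y)"
  using cyc_surj[OF Im_bimodule p2 lin_closed[OF zc_lin ac[OF y(1)]]] by blast
 obtain v where v: "v \<in> carrier T2" "V = zc v" by (rule H0_cases[OF T2_bimodule V(1)])
 have gv: "gam v = g" using V v y ac by (simp add: gam_def beb_zc bg_alp)
 have "tt (beta v) = beb (rr (rr (zc v)))" using beb_rr[of "zc v"] V v by (simp add: beb_zc)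
 also have "\<dots> = gam (alp p y)" using V v by (simp add: gam_def)
 finally have "tt (beta v) = \<zero>[Hp]" using bg_alp(2)[OF y(1)] by simp
 then have bv: "beta v = \<zero>[Hp]" using cyc_inj[OF W_bimodule p] lin_closed[OF beta_lin v(1)] by blast
 show thesis
 proof (rule that[of "alp p z \<oplus>[T2] v"])
  show "beta (alp p z \<oplus>[T2] v) = h" "gam (alp p z \<oplus>[T2] v) = g"
   using z v ac h g by (simp_all add: lin_add[OF beta_lin] lin_add[OF gam_lin] bv gv bg_alp)
 qed (use z v ac in simp)
qed

end

text \<open>An alternating word of odd length begins and ends with the same kind of letter. The
  idempotent that fixes it from the left kills it from the right, so the word equals its commutator
  with that idempotent.\<close>

lemma odd_com:
 assumes n: "odd n" and u: "u \<in> carrier (T n)"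
 shows "u \<in> commutator_span K Cd (T n)"
proof -
 obtain k where k: "n = Suc k" using n by (cases n) auto
 have Tb: "bimodule K Cd Cd (T n)" unfolding k by (rule T_bimodule)
 note D = v_submoduleD[OF T_module com_sub[OF Tb]]
 have u': "u \<in> carrier (T (Suc k))" using u k by simp
 show ?thesis using u' unfolding k
 proof (induction rule: T_ind)
  case (gen l)
  obtain l' z where l': "l = l' @ [z]" using gen(2) by (cases l rule: rev_cases) auto
  obtain y l'' where l'': "l = y # l''" using gen(2) by (cases l) auto
  have e: "even (length l')" using gen(2) n k l' by simp
  have "tg (Suc k) (alt l s) \<in> commutator_span K Cd (T (Suc k))" for s
  proof -
   let ?c = "if s then df else de"
   have tc: "tg (Suc k) (alt l s) \<in> carrier (T (Suc k))"
    using tg_closed[OF alt_closed[OF gen(1), of s]] gen(2) by simp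
   have al: "set (alt l' s) <= I0" "set (alt l'' b) <= I0" for b
    using gen(1) alt_closed[of l'] alt_closed[of l''] by (simp add: l', simp add: l'')
   have "lmult (T (Suc k)) ?c (tg (Suc k) (alt l s)) = tg (Suc k) (alt l s)"
    using T_l[of ?c "if s then jm (mp y) else jn (np y)" "alt l'' (\<not> s)" k] gen l'' al by (auto simp: d_mult)
   moreover have "rmult (T (Suc k)) (tg (Suc k) (alt l s)) ?c = \<zero>[T (Suc k)]"
    using T_r[of ?c "if s then jm (mp z) else jn (np z)" "alt l' s" k] tg_zero[of "alt l' s" "[]" "Suc k"] gen l' al e
    by (auto simp: d_mult alt_append)
   ultimately show ?thesis using com_in[OF Tb, of ?c "tg (Suc k) (alt l s)"] tc k by (simp split: if_splits)
  qed
  then have "tg (Suc k) (alt l True) \<oplus>[T (Suc k)] tg (Suc k) (alt l False) \<in> commutator_span K Cd (T (Suc k))"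
   using D(3) k by simp
  then show ?case using alt_sum[of l] gen l' by simp
 next
  case (add u v)
  then show ?case using D(3) k by simp
 qed
qed

end

lemma (in fld) v_minus_cancel: "module K V ==> x \<in> carrier V ==> y \<in> carrier V ==> x \<oplus>[V] (y \<ominus>[V] x) = y"
 by (metis v_minus v_minus_iff)

lemma (in fld) v_zero_minus: "module K V ==> x \<in> carrier V ==> \<zero>[V] \<ominus>[V] x = \<ominus>[V] x"
 by (simp add: a_minus_def)

section \<open>Commutators in the relative bar resolution\<close>

context square_zero
begin

lemma Q_com_sub: "submodule (commutator_span K L (Q n)) K (Q n)"
 by (rule com_sub[OF Q_bimodule])

lemmas Q_com_D = v_submoduleD[OF Q_module Q_com_sub]

abbreviation (input) "zr n \<equiv> \<zero>[T n]"

lemmas slot_simps = Q_simps pc_C pi_C pc_I pi_I cl_zero cr_zero cl_zero2 cr_zero2 T_zero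
 bm_lcl[OF T_bimodule] bm_rcl[OF T_bimodule]

lemma Q_minus:
 assumes "u \<in> carrier (T (Suc n))" "v \<in> carrier (Tb n)" "w \<in> carrier (Tb n)" "z \<in> carrier (Tc n)"
  "u' \<in> carrier (T (Suc n))" "v' \<in> carrier (Tb n)" "w' \<in> carrier (Tb n)" "z' \<in> carrier (Tc n)"
 shows "(u, v, w, z) \<ominus>[Q n] (u', v', w', z') = (u \<ominus>[T (Suc n)] u', v \<ominus>[Tb n] v', w \<ominus>[Tb n] w',
   z \<ominus>[Tc n] z')"
 using assms by (subst v_minus_iff[OF Q_module]) (simp_all add: Q_simps v_minus_cancel)

text \<open>Elements of \<open>C\<close> act on each summand of \<open>Q n\<close>
  separately.\<close>

lemma Q_com_slot:
 "u \<in> commutator_span K C (T (Suc n)) ==> (u, zr (Suc (Suc n)), zr (Suc (Suc n)), zr (Suc (Suc (Suc n)))) \<in> commutator_span K L (Q n)"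
 "v \<in> commutator_span K C (Tb n) ==> (zr (Suc n), v, zr (Suc (Suc n)), zr (Suc (Suc (Suc n)))) \<in> commutator_span K L (Q n)"
proof -
 show "(u, zr (Suc (Suc n)), zr (Suc (Suc n)), zr (Suc (Suc (Suc n)))) \<in> commutator_span K L (Q n)"
  if "u \<in> commutator_span K C (T (Suc n))"
 proof (rule com_lin[OF T_bimodule Q_in_lin(1) Q_module Q_com_sub _ that])
  fix c z assume "c \<in> carrier C" "z \<in> carrier (T (Suc n))"
  then show "(lmult (T (Suc n)) c z, zr (Suc (Suc n)), zr (Suc (Suc n)), zr (Suc (Suc (Suc n)))) \<ominus>[Q n]
    (rmult (T (Suc n)) z c, zr (Suc (Suc n)), zr (Suc (Suc n)), zr (Suc (Suc (Suc n)))) \<in> commutator_span K L (Q n)"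
   using com_in[OF Q_bimodule, of c "(z, zr (Suc (Suc n)), zr (Suc (Suc n)), zr (Suc (Suc (Suc n))))" n] by (simp add: slot_simps CL)
 qed
 show "(zr (Suc n), v, zr (Suc (Suc n)), zr (Suc (Suc (Suc n)))) \<in> commutator_span K L (Q n)"
  if "v \<in> commutator_span K C (Tb n)"
 proof (rule com_lin[OF T_bimodule Q_in_lin(2) Q_module Q_com_sub _ that])
  fix c z assume "c \<in> carrier C" "z \<in> carrier (Tb n)"
  then show "(zr (Suc n), lmult (Tb n) c z, zr (Suc (Suc n)), zr (Suc (Suc (Suc n)))) \<ominus>[Q n]
    (zr (Suc n), rmult (Tb n) z c, zr (Suc (Suc n)), zr (Suc (Suc (Suc n)))) \<in> commutator_span K L (Q n)"
   using com_in[OF Q_bimodule, of c "(zr (Suc n), z, zr (Suc (Suc n)), zr (Suc (Suc (Suc n))))" n] by (simp add: slot_simps CL)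
 qed
qed

text \<open>From the left \<open>j\<close> takes an element of the third summand to the fourth, from
  the right to zero; the fourth summand thus consists of commutators.\<close>

lemma Q_com_last:
 "z \<in> carrier (Tc n) ==> (zr (Suc n), zr (Suc (Suc n)), zr (Suc (Suc n)), z) \<in> commutator_span K L (Q n)"
proof (induction rule: T_ind)
 case (gen l)
 then obtain j l' where l: "l = j # l'" by (cases l) auto
 let ?w = "tg (Suc (Suc n)) l'"
 have w: "?w \<in> carrier (Tb n)" using tg_closed[of l'] gen l by simp
 then show ?case
  using com_in[OF Q_bimodule, of j "(zr (Suc n), zr (Suc (Suc n)), ?w, zr (Suc (Suc (Suc n))))" n] gen l
  by (simp add: slot_simps IL Q_minus cl_tg[of j l'])
next
 case (add u v)
 then show ?case using Q_com_D(3)[OF add(3,4)] by (simp add: Q_simps)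
qed

text \<open>The commutator of \<open>j\<close> with \<open>u\<close> from the first summand is
  \<open>j u\<close> in the second minus \<open>u j\<close> in the third. This absorbs the third
  summand into the second.\<close>

lemma Q_com_move:
 "w \<in> carrier (Tb n) ==> \<exists>v\<in>carrier (Tb n).
  (zr (Suc n), v, \<ominus>[Tb n] w, zr (Suc (Suc (Suc n)))) \<in> commutator_span K L (Q n)"
proof (induction rule: T_ind)
 case (gen l)
 then obtain j l' where l: "l = l' @ [j]" by (cases l rule: rev_cases) auto
 let ?u = "tg (Suc n) l'"
 have u: "?u \<in> carrier (T (Suc n))" using tg_closed[of l'] gen l by simp
 then have "(zr (Suc n), cl (Suc n) j ?u, \<ominus>[Tb n] tg (Suc (Suc n)) l, zr (Suc (Suc (Suc n)))) \<in> commutator_span K L (Q n)"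
  using com_in[OF Q_bimodule, of j "(?u, zr (Suc (Suc n)), zr (Suc (Suc n)), zr (Suc (Suc (Suc n))))" n] gen l cr_closed[OF _ u, of j]
  by (simp add: slot_simps IL Q_minus cr_tg[of j l'] v_zero_minus)
 then show ?case using u gen l by (intro bexI) auto
next
 case (add w w')
 then obtain v v' where v: "v \<in> carrier (Tb n)" "v' \<in> carrier (Tb n)"
  "(zr (Suc n), v, \<ominus>[Tb n] w, zr (Suc (Suc (Suc n)))) \<in> commutator_span K L (Q n)"
  "(zr (Suc n), v', \<ominus>[Tb n] w', zr (Suc (Suc (Suc n)))) \<in> commutator_span K L (Q n)" by blast
 then show ?case using add(1,2) Q_com_D(3)[OF v(3,4)]
  by (intro bexI[of _ "v \<oplus>[Tb n] v'"]) (simp_all add: Q_simps v_inv_add)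
qed

end

context null_sq
begin

context
 fixes p n :: nat
 assumes p: "p > 0" and e: "2 * p = Suc n"
begin

lemma odd_n: "odd n"
 using e by presburger

text \<open>The first summand is an even power, in which \<open>beta\<close> and \<open>gam\<close>
  detect commutators. The second and third are odd powers, disposed of by \<open>odd_com\<close> and
  \<open>Q_com_move\<close>.\<close>

lemma Q_com_odd:
 assumes q: "(u, v, w, z) \<in> carrier (Q n)"
 shows "(u, v, w, z) \<in> commutator_span K Lam (Q n) \<longleftrightarrow> beta p u = \<zero>[Hp p] \<and> gam p u = \<zero>[Hp p]"
proof
 have c: "u \<in> carrier (T (Suc n))" "v \<in> carrier (Tb n)" "w \<in> carrier (Tb n)" "z \<in> carrier (Tc n)"
  using q by (auto simp: Q_simps)
 have fst: "lin K (Q n) (T (Suc n)) fst" by (rule linI) (auto simp: Q_simps)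
 assume m: "(u, v, w, z) \<in> commutator_span K Lam (Q n)"
 have z: "f u = \<zero>[Hp p]" if f: "lin K (T (Suc n)) (Hp p) f"
  and fc: "!!c u. c \<in> carrier Cd ==> u \<in> carrier (T (Suc n)) ==> f (lmult (T (Suc n)) c u) = f (rmult (T (Suc n)) u c)" for f
 proof -
  have "f (fst (u, v, w, z)) = \<zero>[Hp p]"
  proof (rule com_lin_zero[OF Q_bimodule lin_comp[OF fst f] Hp_module[OF p] _ m])
   fix x q assume x: "x \<in> carrier Lam" and "q \<in> carrier (Q n)"
   then show "f (fst (lmult (Q n) x q)) = f (fst (rmult (Q n) q x))"
    by (cases q) (simp add: Q_simps fc pc_closed)
  qed
  then show ?thesis by simp
 qed
 have "beta p u = \<zero>[Hp p]" by (rule z[OF beta_lin[OF p, unfolded e]]) (rule beta_com[OF p, unfolded e])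
 moreover have "gam p u = \<zero>[Hp p]" by (rule z[OF gam_lin[OF p, unfolded e]]) (rule gam_com[OF p, unfolded e])
 ultimately show "beta p u = \<zero>[Hp p] \<and> gam p u = \<zero>[Hp p]" by simp
next
 have c: "u \<in> carrier (T (Suc n))" "v \<in> carrier (Tb n)" "w \<in> carrier (Tb n)" "z \<in> carrier (Tc n)"
  using q by (auto simp: Q_simps)
 assume "beta p u = \<zero>[Hp p] \<and> gam p u = \<zero>[Hp p]"
 then have "u \<in> commutator_span K Cd (T (Suc n))" using bg_inj[OF p, unfolded e, of u] c(1) by simp
 note m1 = Q_com_slot(1)[OF this]
 have "odd (Suc (Suc n))" using odd_n by simp
 note o = odd_com[OF this]
 note m2 = Q_com_slot(2)[OF o[OF c(2)]] and m4 = Q_com_last[OF c(4)]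
 have w: "\<ominus>[Tb n] w \<in> carrier (Tb n)" using c(3) by simp
 \<comment> \<open>\<open>Q_com_move\<close> yields its argument with a minus sign, so it is applied
   to the negative of \<open>w\<close>.\<close>
 obtain v' where v': "v' \<in> carrier (Tb n)"
  "(zr (Suc n), v', \<ominus>[Tb n] (\<ominus>[Tb n] w), zr (Suc (Suc (Suc n)))) \<in> commutator_span K Lam (Q n)"
  using Q_com_move[OF w] by blast
 have "\<ominus>[Tb n] v' \<in> carrier (Tb n)" using v' by simp
 note m3 = Q_com_slot(2)[OF o[OF this]]
 have "(u, v, w, z) = (u, zr (Suc (Suc n)), zr (Suc (Suc n)), zr (Suc (Suc (Suc n)))) \<oplus>[Q n] ((zr (Suc n), v, zr (Suc (Suc n)), zr (Suc (Suc (Suc n)))) \<oplus>[Q n]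
  (((zr (Suc n), v', \<ominus>[Tb n] (\<ominus>[Tb n] w), zr (Suc (Suc (Suc n))))
   \<oplus>[Q n] (zr (Suc n), \<ominus>[Tb n] v', zr (Suc (Suc n)), zr (Suc (Suc (Suc n)))))
   \<oplus>[Q n] (zr (Suc n), zr (Suc (Suc n)), zr (Suc (Suc n)), z)))"
  using c v'(1) by (simp add: Q_simps)
 also have "\<dots> \<in> commutator_span K Lam (Q n)"
  by (intro Q_com_D(3) m1 m2 v'(2) m3 m4)
 finally show "(u, v, w, z) \<in> commutator_span K Lam (Q n)" .
qed

end

context
 fixes p n :: nat
 assumes p: "p > 0" and e: "2 * p = Suc (Suc n)"
begin

lemma e': "2 * p - 1 = Suc n"
 using e by simp

lemmas bl = beta_lin[OF p, unfolded e] and gl = gam_lin[OF p, unfolded e] and tl = tt_lin[OF p] and Hm = Hp_module[OF p]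

text \<open>\<open>r1\<close> and \<open>r2\<close> are the coordinates of \<open>v\<close> plus the
  rotation of \<open>w\<close>: modulo commutators the third summand moves into the second at the
  cost of one rotation, which is \<open>(x, y) \<mapsto> (y, t x)\<close>.\<close>

abbreviation (input) "r1 v w \<equiv> beta p v \<oplus>[Hp p] gam p w"
abbreviation (input) "r2 v w \<equiv> gam p v \<oplus>[Hp p] tt p (beta p w)"

lemma r_lin: "lin K (Q n) (Hp p) (%(u, v, w, z). r1 v w)" "lin K (Q n) (Hp p) (%(u, v, w, z). r2 v w)"
proof -
 note cl = lin_closed[OF bl] lin_closed[OF gl] lin_closed[OF tl] Hm
  lin_add[OF bl] lin_add[OF gl] lin_add[OF tl] lin_smult[OF bl] lin_smult[OF gl] lin_smult[OF tl]
 show "lin K (Q n) (Hp p) (%(u, v, w, z). r1 v w)" "lin K (Q n) (Hp p) (%(u, v, w, z). r2 v w)"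
  by (rule linI; auto simp: Q_simps cl v_add_swap[OF Hm] v_smult_r_distr)+
qed

lemma r_com:
 assumes m: "(u, v, w, z) \<in> commutator_span K Lam (Q n)"
 shows "r1 v w = \<zero>[Hp p] \<and> r2 v w = \<zero>[Hp p]"
proof -
 note cl = lin_closed[OF bl] lin_closed[OF gl] lin_closed[OF tl] Hm
  lin_add[OF bl] lin_add[OF gl] lin_add[OF tl] beta_com[OF p, unfolded e] gam_com[OF p, unfolded e]
  gam_cl[OF p, unfolded e'] gam_cr[OF p, unfolded e'] T_rules
 have "(%(u, v, w, z). r1 v w) (u, v, w, z) = \<zero>[Hp p]"
 proof (rule com_lin_zero[OF Q_bimodule r_lin(1) Hm _ m])
  fix x q assume "x \<in> carrier Lam" "q \<in> carrier (Q n)"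
  then show "(%(u, v, w, z). r1 v w) (lmult (Q n) x q) = (%(u, v, w, z). r1 v w) (rmult (Q n) q x)"
   by (cases q) (simp add: Q_simps cl pc_closed pi_closed v_assoc v_comm v_lcomm)
 qed
 moreover have "(%(u, v, w, z). r2 v w) (u, v, w, z) = \<zero>[Hp p]"
 proof (rule com_lin_zero[OF Q_bimodule r_lin(2) Hm _ m])
  fix x q assume "x \<in> carrier Lam" "q \<in> carrier (Q n)"
  then show "(%(u, v, w, z). r2 v w) (lmult (Q n) x q) = (%(u, v, w, z). r2 v w) (rmult (Q n) q x)"
   by (cases q) (simp add: Q_simps cl pc_closed pi_closed v_assoc v_comm v_lcomm)
 qed
 ultimately show ?thesis by simp
qed

text \<open>A commutator with third component \<open>w\<close> is subtracted. What remains in the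
  second summand is \<open>v\<close> minus \<open>v'\<close>, both coordinates of which vanish, so
  \<open>bg_inj\<close> applies; the first summand is an odd power.\<close>

lemma Q_com_even:
 assumes q: "(u, v, w, z) \<in> carrier (Q n)"
 shows "(u, v, w, z) \<in> commutator_span K Lam (Q n) \<longleftrightarrow> r1 v w = \<zero>[Hp p] \<and> r2 v w = \<zero>[Hp p]"
proof
 have c: "u \<in> carrier (T (Suc n))" "v \<in> carrier (Tb n)" "w \<in> carrier (Tb n)" "z \<in> carrier (Tc n)"
  using q by (auto simp: Q_simps)
 note bg = lin_closed[OF bl] lin_closed[OF gl] lin_closed[OF tl] Hm
 assume r: "r1 v w = \<zero>[Hp p] \<and> r2 v w = \<zero>[Hp p]"
 have "odd (Suc n)" using e by presburger
 note m1 = Q_com_slot(1)[OF odd_com[OF this c(1)]] and m4 = Q_com_last[OF c(4)]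
 have "\<ominus>[Tb n] w \<in> carrier (Tb n)" using c by simp
 from Q_com_move[OF this] c(3) obtain v' where v': "v' \<in> carrier (Tb n)"
  and m3: "(zr (Suc n), v', w, zr (Suc (Suc (Suc n)))) \<in> commutator_span K Lam (Q n)" by auto
 have r': "r1 v' w = \<zero>[Hp p]" "r2 v' w = \<zero>[Hp p]" using r_com[OF m3] by auto
 let ?v = "v \<ominus>[Tb n] v'"
 have "beta p v = beta p v'" "gam p v = gam p v'"
  using r r' c v' bg by (metis v_comm v_cancel)+
 then have "beta p ?v = \<zero>[Hp p]" "gam p ?v = \<zero>[Hp p]"
  using c v' bg lin_minus[OF bl T_module Hm] lin_minus[OF gl T_module Hm] by simp_all
 then have "?v \<in> commutator_span K Cd (Tb n)" using bg_inj[OF p, unfolded e, of ?v] c v' by simp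
 note m2 = Q_com_slot(2)[OF this]
 have "(u, v, w, z) = (u, zr (Suc (Suc n)), zr (Suc (Suc n)), zr (Suc (Suc (Suc n)))) \<oplus>[Q n] ((zr (Suc n), v', w, zr (Suc (Suc (Suc n))))
  \<oplus>[Q n] ((zr (Suc n), ?v, zr (Suc (Suc n)), zr (Suc (Suc (Suc n)))) \<oplus>[Q n] (zr (Suc n), zr (Suc (Suc n)), zr (Suc (Suc n)), z)))"
  using c v' by (simp add: Q_simps v_minus_cancel)
 also have "\<dots> \<in> commutator_span K Lam (Q n)"
  by (intro Q_com_D(3) m1 m2 m3 m4)
 finally show "(u, v, w, z) \<in> commutator_span K Lam (Q n)" .
qed (rule r_com)

end

lemma Q_rcyc: "resolution.rcyc K Lam Q dQ n = {q \<in> carrier (Q n). case n of 0 => True | Suc k => dQ k q \<in> commutator_span K Lam (Q k)}"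
 by (rule resolution.rcyc_def[OF Q_resolution])

lemma dQ_closed: "q \<in> carrier (Q (Suc n)) ==> dQ n q \<in> carrier (Q n)"
 by (rule lin_closed[OF bhomD(1)[OF dQ_hom]])

section \<open>Homology of the commutator quotient of \<open>Q\<close>\<close>

context
 fixes p n :: nat
 assumes p: "p > 0" and e: "2 * p = Suc (Suc n)"
begin

lemma dQ_even_simp: "even n" "sg n k u = u"
 using e by (presburger, simp add: sg_def) (use e in presburger)

text \<open>\<open>dQ n\<close> copies \<open>u\<close> into the second and the third summand, with
  sign plus as \<open>n\<close> is even; \<open>r1\<close> and \<open>r2\<close> are evaluated at
  \<open>v = w = u\<close>.\<close>

lemma dQ_com_iff:
 assumes q: "(u, v, w, z) \<in> carrier (Q (Suc n))"
 shows "dQ n (u, v, w, z) \<in> commutator_span K Lam (Q n)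
  \<longleftrightarrow> beta p u \<oplus>[Hp p] gam p u = \<zero>[Hp p] \<and> gam p u \<oplus>[Hp p] tt p (beta p u) = \<zero>[Hp p]"
 using Q_com_even[OF p e, of "\<zero>[T (Suc n)]" u u "w \<oplus>[Tc n] v"] q
 by (simp add: dQ_def dQ_even_simp Q_simps)

text \<open>The first equation makes the second coordinate the negative of the first; the second
  equation then says that \<open>t\<close> fixes the first coordinate.\<close>

lemma rcyc_odd: "(u, v, w, z) \<in> resolution.rcyc K Lam Q dQ (Suc n) \<longleftrightarrow> (u, v, w, z) \<in> carrier (Q (Suc n))
  \<and> gam p u = \<ominus>[Hp p] beta p u \<and> tt p (beta p u) = beta p u"
proof (cases "(u, v, w, z) \<in> carrier (Q (Suc n))")
 case True
 then have u: "u \<in> carrier (Tb n)" by (simp add: Q_simps)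
 note b = lin_closed[OF bl[OF p e] u] and g = lin_closed[OF gl[OF p e] u] and Hm = Hm[OF p e]
 note t = lin_closed[OF tl[OF p e] b]
 have "gam p u \<oplus>[Hp p] tt p (beta p u) = \<zero>[Hp p] \<longleftrightarrow> tt p (beta p u) = beta p u"
  if "gam p u = \<ominus>[Hp p] beta p u"
  unfolding that using v_add_eq_zero[OF Hm _ t, of "\<ominus>[Hp p] beta p u"] b Hm by simp
 then show ?thesis
  using True dQ_com_iff[OF True] v_add_eq_zero[OF Hm b g] by (auto simp: Q_rcyc)
qed (simp add: Q_rcyc)

text \<open>A cycle has coordinates \<open>(x, - x)\<close> with \<open>t x = x\<close>, so
  \<open>beta\<close> of its first component determines it modulo commutators. The incoming
  differential has zero first component and contributes only commutators.\<close>

theorem odd_homology: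
 shows "lin K (Q (Suc n)) (Hp p) (%q. beta p (fst q))"
  and "(%q. beta p (fst q)) ` resolution.rcyc K Lam Q dQ (Suc n) = {x \<in> carrier (Hp p). tt p x = x}"
  and "q \<in> resolution.rcyc K Lam Q dQ (Suc n) ==> beta p (fst q) = \<zero>[Hp p] \<longleftrightarrow>
   (\<exists>c\<in>commutator_span K Lam (Q (Suc n)). \<exists>q'\<in>carrier (Q (Suc (Suc n))). q = c \<oplus>[Q (Suc n)] dQ (Suc n) q')"
proof -
 note bl = bl[OF p e] and Hm = Hm[OF p e]
 have fst: "lin K (Q (Suc n)) (Tb n) fst" by (rule linI) (auto simp: Q_simps)
 show lin: "lin K (Q (Suc n)) (Hp p) (%q. beta p (fst q))" by (rule lin_comp[OF fst bl])
 show "(%q. beta p (fst q)) ` resolution.rcyc K Lam Q dQ (Suc n) = {x \<in> carrier (Hp p). tt p x = x}"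
 proof (intro equalityI subsetI)
  fix x assume "x \<in> (%q. beta p (fst q)) ` resolution.rcyc K Lam Q dQ (Suc n)"
  then obtain u v w z where "(u, v, w, z) \<in> resolution.rcyc K Lam Q dQ (Suc n)" "x = beta p u" by auto
  then show "x \<in> {x \<in> carrier (Hp p). tt p x = x}"
   by (simp add: rcyc_odd Q_simps lin_closed[OF bl])
 next
  fix x assume x: "x \<in> {x \<in> carrier (Hp p). tt p x = x}"
  then have "\<ominus>[Hp p] x \<in> carrier (Hp p)" using Hm by simp
  with x obtain u where u: "u \<in> carrier (T2 p)" "beta p u = x" "gam p u = \<ominus>[Hp p] x"
   using bg_surj[OF p, of x "\<ominus>[Hp p] x"] by blast
  with x have "(u, zr (Suc (Suc (Suc n))), zr (Suc (Suc (Suc n))), zr (Suc (Suc (Suc (Suc n))))) \<in> resolution.rcyc K Lam Q dQ (Suc n)"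
   by (simp add: rcyc_odd Q_simps e)
  then show "x \<in> (%q. beta p (fst q)) ` resolution.rcyc K Lam Q dQ (Suc n)" by (rule rev_image_eqI) (simp add: u)
 qed
 assume q: "q \<in> resolution.rcyc K Lam Q dQ (Suc n)"
 then obtain u v w z where uv: "q = (u, v, w, z)" by (cases q) auto
 have qc: "q \<in> carrier (Q (Suc n))" and g: "gam p u = \<ominus>[Hp p] beta p u" using q uv by (simp_all add: rcyc_odd)
 show "beta p (fst q) = \<zero>[Hp p] \<longleftrightarrow>
   (\<exists>c\<in>commutator_span K Lam (Q (Suc n)). \<exists>q'\<in>carrier (Q (Suc (Suc n))). q = c \<oplus>[Q (Suc n)] dQ (Suc n) q')"
 proof
  assume "beta p (fst q) = \<zero>[Hp p]"
  then have m: "q \<in> commutator_span K Lam (Q (Suc n))"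
   using Q_com_odd[OF p e, of u v w z] qc g uv Hm by simp
  have "q = q \<oplus>[Q (Suc n)] dQ (Suc n) \<zero>[Q (Suc (Suc n))]"
   using qc lin_zero[OF bhomD(1)[OF dQ_hom]] by simp
  with m show "\<exists>c\<in>commutator_span K Lam (Q (Suc n)). \<exists>q'\<in>carrier (Q (Suc (Suc n))). q = c \<oplus>[Q (Suc n)] dQ (Suc n) q'"
   using v_zero[OF Q_module] by blast
 next
  assume "\<exists>c\<in>commutator_span K Lam (Q (Suc n)). \<exists>q'\<in>carrier (Q (Suc (Suc n))). q = c \<oplus>[Q (Suc n)] dQ (Suc n) q'"
  then obtain c q' where c: "c \<in> commutator_span K Lam (Q (Suc n))" and q': "q' \<in> carrier (Q (Suc (Suc n)))"
   and eq: "q = c \<oplus>[Q (Suc n)] dQ (Suc n) q'" by blast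
  have cc: "c \<in> carrier (Q (Suc n))" using Q_com_D(1) c by blast
  have "beta p (fst c) = \<zero>[Hp p]" using Q_com_odd[OF p e] c cc by (cases c) simp
  moreover have "beta p (fst (dQ (Suc n) q')) = \<zero>[Hp p]"
   using lin_zero[OF bl T_module Hm] by (cases q') (simp add: dQ_def)
  ultimately show "beta p (fst q) = \<zero>[Hp p]"
   using lin_add[OF lin cc dQ_closed[OF q']] Hm by (simp add: eq)
 qed
qed

abbreviation (input) "Ip \<equiv> (%x. tt p x \<ominus>[Hp p] x) ` carrier (Hp p)"

lemma Ip_sub: "submodule Ip K (Hp p)"
 by (rule lin_image[OF lin_fun_minus[OF Hm[OF p e] tl[OF p e] lin_ident] Hm[OF p e] Hm[OF p e] v_submodule_carrier[OF Hm[OF p e]]])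

text \<open>The outgoing differential lands in an odd degree with zero first component, and in odd
  degrees that component alone decides about commutators.\<close>

lemma rcyc_even: "resolution.rcyc K Lam Q dQ n = carrier (Q n)"
proof (cases n)
 case 0
 then show ?thesis by (simp add: Q_rcyc)
next
 case (Suc k)
 \<comment> \<open>The value of \<open>p\<close> for which \<open>Q_com_odd\<close> applies one
   degree lower.\<close>
 define r where "r = p - 1"
 have r: "r > 0" "2 * r = Suc k" using e Suc by (auto simp: r_def)
 have "dQ k (u, v, w, z) \<in> commutator_span K Lam (Q k)" if "(u, v, w, z) \<in> carrier (Q n)" for u v w z
  using Q_com_odd[OF r, of "\<zero>[T (Suc k)]" u "sg k (Suc (Suc k)) u" "w \<oplus>[Tc k] sg k (Suc (Suc (Suc k))) v"] that
   lin_zero[OF beta_lin[OF r(1), unfolded r(2)] T_module Hp_module[OF r(1)]]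
   lin_zero[OF gam_lin[OF r(1), unfolded r(2)] T_module Hp_module[OF r(1)]]
  by (simp add: Q_simps dQ_def Suc)
 then show ?thesis unfolding Suc Q_rcyc by auto
qed

definition "rho1 = (%(u :: (('a \<times> 'n \<times> 'm \<times> 'b) list => 'k) set, v, w, z :: (('a \<times> 'n \<times> 'm \<times> 'b) list => 'k) set).
 beta p v \<oplus>[Hp p] gam p w)"
definition "rho2 = (%(u :: (('a \<times> 'n \<times> 'm \<times> 'b) list => 'k) set, v, w, z :: (('a \<times> 'n \<times> 'm \<times> 'b) list => 'k) set).
 gam p v \<oplus>[Hp p] tt p (beta p w))"

lemma rho_lin: "lin K (Q n) (Hp p) rho1" "lin K (Q n) (Hp p) rho2"
 using r_lin[OF p e] by (simp_all add: rho1_def rho2_def)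

lemma rho_com: "q \<in> carrier (Q n) ==> q \<in> commutator_span K Lam (Q n) \<longleftrightarrow> rho1 q = \<zero>[Hp p] \<and> rho2 q = \<zero>[Hp p]"
 by (cases q) (simp add: Q_com_even[OF p e] rho1_def rho2_def)

lemma rho_dQ: "rho1 (dQ n (u, v, w, z)) = beta p u \<oplus>[Hp p] gam p u" "rho2 (dQ n (u, v, w, z)) = gam p u \<oplus>[Hp p] tt p (beta p u)"
 by (simp_all add: dQ_def dQ_even_simp rho1_def rho2_def)

text \<open>The map \<open>(a, b) \<mapsto> b - a\<close> sends \<open>(x + y, y + t x)\<close> to
  \<open>t x - x\<close>; it identifies the cokernel on \<open>H \<oplus> H\<close> with the
  coinvariants.\<close>

theorem even_homology:
 defines "\<theta> \<equiv> %q. Ip +>[Hp p] (rho2 q \<ominus>[Hp p] rho1 q)"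
 shows "lin K (Q n) (quot_mod (Hp p) Ip) \<theta>"
  and "\<theta> ` resolution.rcyc K Lam Q dQ n = carrier (quot_mod (Hp p) Ip)"
  and "q \<in> resolution.rcyc K Lam Q dQ n ==> \<theta> q = \<zero>[quot_mod (Hp p) Ip] \<longleftrightarrow>
   (\<exists>c\<in>commutator_span K Lam (Q n). \<exists>q'\<in>carrier (Q (Suc n)). q = c \<oplus>[Q n] dQ n q')"
proof -
 note Hm = Hm[OF p e] and bl = bl[OF p e] and gl = gl[OF p e] and tl = tl[OF p e]
 note rc = lin_closed[OF rho_lin(1)] lin_closed[OF rho_lin(2)]
 show "lin K (Q n) (quot_mod (Hp p) Ip) \<theta>"
  unfolding \<theta>_def by (rule lin_comp[OF lin_fun_minus[OF Hm rho_lin(2,1)] coset_lin[OF Hm Ip_sub]])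
 show "\<theta> ` resolution.rcyc K Lam Q dQ n = carrier (quot_mod (Hp p) Ip)"
 proof (intro equalityI subsetI)
  fix U assume "U \<in> carrier (quot_mod (Hp p) Ip)"
  then obtain x where x: "x \<in> carrier (Hp p)" "U = Ip +>[Hp p] x" using quot_mod_cases[OF Hm Ip_sub] by blast
  obtain v where v: "v \<in> carrier (T2 p)" "beta p v = \<zero>[Hp p]" "gam p v = x"
   using bg_surj[OF p v_zero[OF Hm] x(1)] by blast
  let ?q = "(zr (Suc n), v, zr (Suc (Suc n)), zr (Suc (Suc (Suc n))))"
  have q: "?q \<in> carrier (Q n)" using v by (simp add: Q_simps e)
  have "\<theta> ?q = U" unfolding \<theta>_def x(2)
   using v x Hm lin_zero[OF bl T_module Hm] lin_zero[OF gl T_module Hm] lin_zero[OF tl Hm Hm] by (simp add: rho1_def rho2_def)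
  with q show "U \<in> \<theta> ` resolution.rcyc K Lam Q dQ n" unfolding rcyc_even by (metis image_eqI)
 next
  fix U assume "U \<in> \<theta> ` resolution.rcyc K Lam Q dQ n"
  then show "U \<in> carrier (quot_mod (Hp p) Ip)" unfolding rcyc_even
   using lin_closed[OF \<open>lin K (Q n) (quot_mod (Hp p) Ip) \<theta>\<close>] by blast
 qed
 assume "q \<in> resolution.rcyc K Lam Q dQ n"
 then have q: "q \<in> carrier (Q n)" unfolding rcyc_even .
 let ?a = "rho1 q" and ?b = "rho2 q"
 have ab: "?a \<in> carrier (Hp p)" "?b \<in> carrier (Hp p)" using rc q by auto
 have iff: "\<theta> q = \<zero>[quot_mod (Hp p) Ip] \<longleftrightarrow> ?b \<ominus>[Hp p] ?a \<in> Ip"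
  unfolding \<theta>_def by (rule coset_zero_iff[OF Hm Ip_sub]) (use ab Hm in simp)
 show "\<theta> q = \<zero>[quot_mod (Hp p) Ip] \<longleftrightarrow>
   (\<exists>c\<in>commutator_span K Lam (Q n). \<exists>q'\<in>carrier (Q (Suc n)). q = c \<oplus>[Q n] dQ n q')"
  unfolding iff
 proof
  assume "?b \<ominus>[Hp p] ?a \<in> Ip"
  then obtain x where x: "x \<in> carrier (Hp p)" "?b \<ominus>[Hp p] ?a = tt p x \<ominus>[Hp p] x" by blast
  note tx = lin_closed[OF tl x(1)]
  have b: "?b = ?a \<oplus>[Hp p] (tt p x \<ominus>[Hp p] x)"
   using x ab tx Hm by (simp add: v_minus_iff)
  \<comment> \<open>The equation \<open>x + y = a\<close> forces \<open>y = a - x\<close>, and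
    \<open>y + t x = b\<close> then holds because \<open>b - a = t x - x\<close>.\<close>
  have "?a \<ominus>[Hp p] x \<in> carrier (Hp p)" using ab x Hm by simp
  then obtain u where u: "u \<in> carrier (T2 p)" "beta p u = x" "gam p u = ?a \<ominus>[Hp p] x"
   using bg_surj[OF p x(1)] by blast
  let ?q' = "(u, zr (Suc (Suc (Suc n))), zr (Suc (Suc (Suc n))), zr (Suc (Suc (Suc (Suc n)))))"
  have q': "?q' \<in> carrier (Q (Suc n))" using u by (simp add: Q_simps e)
  note dc = dQ_closed[OF q']
  have "rho1 (dQ n ?q') = ?a" unfolding rho_dQ u(2,3) using ab x Hm by (simp add: v_minus_cancel)
  moreover have "rho2 (dQ n ?q') = ?b" unfolding rho_dQ u(2,3) b
   using ab x tx Hm by (simp add: a_minus_def v_assoc v_comm v_lcomm)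
  ultimately have "q \<ominus>[Q n] dQ n ?q' \<in> commutator_span K Lam (Q n)"
   using q dc ab Hm by (simp add: rho_com lin_minus[OF rho_lin(1) Q_module Hm] lin_minus[OF rho_lin(2) Q_module Hm])
  moreover have "q = (q \<ominus>[Q n] dQ n ?q') \<oplus>[Q n] dQ n ?q'"
   using q dc by (simp add: a_minus_def v_assoc)
  ultimately show "\<exists>c\<in>commutator_span K Lam (Q n). \<exists>q'\<in>carrier (Q (Suc n)). q = c \<oplus>[Q n] dQ n q'"
   using q' by blast
 next
  assume "\<exists>c\<in>commutator_span K Lam (Q n). \<exists>q'\<in>carrier (Q (Suc n)). q = c \<oplus>[Q n] dQ n q'"
  then obtain c q' where c: "c \<in> commutator_span K Lam (Q n)" and q': "q' \<in> carrier (Q (Suc n))" and eq: "q = c \<oplus>[Q n] dQ n q'" by blast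
  have cc: "c \<in> carrier (Q n)" using Q_com_D(1) c by blast
  obtain u v w z where uv: "q' = (u, v, w, z)" by (cases q') auto
  have u: "u \<in> carrier (Tb n)" using q' uv by (simp add: Q_simps)
  note bu = lin_closed[OF bl u] and gu = lin_closed[OF gl u]
  have "?a = beta p u \<oplus>[Hp p] gam p u" "?b = gam p u \<oplus>[Hp p] tt p (beta p u)"
   using lin_add[OF rho_lin(1) cc dQ_closed[OF q']] lin_add[OF rho_lin(2) cc dQ_closed[OF q']] c cc bu gu lin_closed[OF tl bu] Hm
   unfolding eq uv by (simp_all add: rho_com rho_dQ)
  then have "?b \<ominus>[Hp p] ?a = tt p (beta p u) \<ominus>[Hp p] beta p u"
   using v_minus_add_swap[OF Hm gu lin_closed[OF tl bu] gu bu] v_comm[OF Hm bu gu] bu gu lin_closed[OF tl bu] Hm by simp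
  then show "?b \<ominus>[Hp p] ?a \<in> Ip" using bu by blast
 qed
qed

end
end

section \<open>Projective bimodules\<close>

context fld
begin

lemma ground_alg: "k_algebra K (ground K)"
 by (rule algI) (auto intro!: linI simp: r_distr l_distr m_assoc m_comm m_lcomm)

text \<open>Paired with \<open>right_part P\<close> over the field it gives the bimodule
  \<open>R \<otimes> P\<close>, in which \<open>R\<close> acts on the first factor and
  \<open>S\<close> on the second. \<open>left_part\<close> and \<open>right_reg\<close> serve for
  \<open>P \<otimes> S\<close>.\<close>

definition left_reg :: "('k, 'r) module => ('k, 'r, 'k, 'r) bimodule" where
 "left_reg R = module.extend R \<lparr>lmult = monoid.mult R, rmult = %x c. c \<odot>[R] x\<rparr>"

definition right_reg :: "('k, 's) module => ('k, 'k, 's, 's) bimodule" where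
 "right_reg S = module.extend S \<lparr>lmult = smult S, rmult = monoid.mult S\<rparr>"

definition left_part :: "('k, 'r, 's, 'v) bimodule => ('k, 'r, 'k, 'v) bimodule" where
 "left_part P = module.extend (module.truncate P) \<lparr>lmult = lmult P, rmult = %x c. c \<odot>[P] x\<rparr>"

definition right_part :: "('k, 'r, 's, 'v) bimodule => ('k, 'k, 's, 'v) bimodule" where
 "right_part P = module.extend (module.truncate P) \<lparr>lmult = smult P, rmult = rmult P\<rparr>"

lemma smult_lin2: "module K V ==> v \<in> carrier V ==> lin K (ground K) V (%c. c \<odot>[V] v)"
 by (rule linI) (auto simp: v_smult_l_distr v_smult_assoc)

lemma smult_lin: "module K V ==> c \<in> carrier K ==> lin K V V (%v. c \<odot>[V] v)"
 by (rule linI) (auto simp: v_smult_r_distr v_smult_comm)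

context
 fixes R :: "('k, 'r) module" and S :: "('k, 's) module" and P :: "('k, 'r, 's, 'v) bimodule"
 assumes R: "k_algebra K R" and S: "k_algebra K S" and P: "bimodule K R S P"
begin

lemma left_reg_bimodule: "bimodule K R (ground K) (left_reg R)"
 unfolding left_reg_def
 by (rule bmI) (use R ground_alg in \<open>auto simp: smult_lin smult_lin2 alg_lin1 alg_lin2 alg_assoc v_smult_assoc
   v_smult_comm lin_smult[OF alg_lin2]\<close>)

lemma right_reg_bimodule: "bimodule K (ground K) S (right_reg S)"
 unfolding right_reg_def
 by (rule bmI) (use S ground_alg in \<open>auto simp: smult_lin smult_lin2 alg_lin1 alg_lin2 alg_assoc v_smult_assoc
   v_smult_comm lin_smult[OF alg_lin1]\<close>)

lemma left_part_bimodule: "bimodule K R (ground K) (left_part P)"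
 unfolding left_part_def
 by (rule bmI) (use R ground_alg bm_module[OF P] in \<open>auto simp: smult_lin smult_lin2 bm_l[OF P] bm_la[OF P] bm_lassoc[OF P]
   bm_lone[OF P] v_smult_assoc v_smult_comm bm_lsm[OF P]\<close>)

lemma right_part_bimodule: "bimodule K (ground K) S (right_part P)"
 unfolding right_part_def
 by (rule bmI) (use S ground_alg bm_module[OF P] in \<open>auto simp: smult_lin smult_lin2 bm_r[OF P] bm_ra[OF P] bm_rassoc[OF P]
   bm_rone[OF P] v_smult_assoc v_smult_comm bm_rsm[OF P]\<close>)

text \<open>Preimages under \<open>\<pi>\<close> are chosen for the images under \<open>p\<close> of
  the basis and extended to the free module; composing with \<open>i\<close> yields the
  section.\<close>

lemma projective_bimod_section:
 assumes pr: "projective_bimod K R S P" and Y: "bimodule K R S Y" and \<pi>: "bhom K R S Y P \<pi>"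
  and surj: "!!x. x \<in> carrier P ==> \<exists>y\<in>carrier Y. \<pi> y = x"
 obtains s where "bhom K R S P Y s" "!!x. x \<in> carrier P ==> \<pi> (s x) = x"
proof -
 let ?E = "env K R S" and ?et = "tens K K (kbimod R) (kbimod (opp_alg S))"
 let ?P = "env_left K P" and ?Y = "env_left K Y"
 note E = env_algebra[OF R S] and Em = env_module[OF R S] and etc = et_closed[OF R S] and ev = env_left_et[OF R S]
 note Pm = bm_module[OF P] and Ym = bm_module[OF Y]
 obtain G :: "'v set" and i p where i: "i \<in> lmod_hom ?E ?P (free_mod ?E G)" and p: "p \<in> lmod_hom ?E (free_mod ?E G) ?P"
  and pi: "!!x. x \<in> carrier P ==> p (i x) = x"
  using pr by (auto simp: projective_bimod_def projective_lmod_def)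
 let ?F = "free_mod ?E G"
 have Fm: "module K ?F" using Em by simp
 note one = alg_one[OF R] alg_one[OF S]
 \<comment> \<open>\<open>lmod_hom\<close> demands additivity and compatibility with the enveloping
   algebra; scalars are recovered as the action of \<open>c 1 \<otimes> 1\<close>.\<close>
 have sc: "lmult ?P (?et (c \<odot>[R] \<one>[R]) \<one>[S]) x = c \<odot>[P] x" if "c \<in> carrier K" "x \<in> carrier P" for c x
  using that one R by (simp add: ev[OF P] bm_lsml[OF P] bm_lone[OF P] bm_rsm[OF P] bm_rone[OF P])
 have scF: "lmult ?F (?et (c \<odot>[R] \<one>[R]) \<one>[S]) f = c \<odot>[?F] f" if c: "c \<in> carrier K" and "f \<in> carrier ?F" for c f
 proof -
  have "?et (c \<odot>[R] \<one>[R]) \<one>[S] = c \<odot>[?E] \<one>[?E]"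
   using lin_smult[OF et_lin1[OF R S one(2)] c one(1)] env_simps(5)[OF R S] by simp
  then show ?thesis
   using that E lin_smult[OF alg_lin1[OF E] c alg_one[OF E]] by (simp add: free_mod_carrier fun_eq_iff)
 qed
 have ec: "?et (c \<odot>[R] \<one>[R]) \<one>[S] \<in> carrier ?E" if "c \<in> carrier K" for c using that etc one R by simp
 have il: "lin K P ?F i"
 proof (rule linI)
  show "i x \<in> carrier ?F" if "x \<in> carrier P" for x using i that by (auto simp: lmod_hom_def)
  show "i (x \<oplus>[P] y) = i x \<oplus>[?F] i y" if "x \<in> carrier P" "y \<in> carrier P" for x y using i that by (simp add: lmod_hom_def)
  then show "i (c \<odot>[P] x) = c \<odot>[?F] i x" if "c \<in> carrier K" "x \<in> carrier P" for c x
  proof -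
   have "i (c \<odot>[P] x) = i (lmult ?P (?et (c \<odot>[R] \<one>[R]) \<one>[S]) x)" using sc[OF that] by simp
   also have "\<dots> = lmult ?F (?et (c \<odot>[R] \<one>[R]) \<one>[S]) (i x)" using i ec that by (simp add: lmod_hom_def)
   also have "\<dots> = c \<odot>[?F] i x" by (rule scF) (use i that in \<open>auto simp: lmod_hom_def\<close>)
   finally show ?thesis .
  qed
 qed
 have pl: "lin K ?F P p"
 proof (rule linI)
  show "p x \<in> carrier P" if "x \<in> carrier ?F" for x using p that by (auto simp: lmod_hom_def)
  show "p (x \<oplus>[?F] y) = p x \<oplus>[P] p y" if "x \<in> carrier ?F" "y \<in> carrier ?F" for x y using p that by (simp add: lmod_hom_def)
  then show "p (c \<odot>[?F] x) = c \<odot>[P] p x" if "c \<in> carrier K" "x \<in> carrier ?F" for c x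
  proof -
   have "p (c \<odot>[?F] x) = p (lmult ?F (?et (c \<odot>[R] \<one>[R]) \<one>[S]) x)" using scF[OF that] by simp
   also have "\<dots> = lmult ?P (?et (c \<odot>[R] \<one>[R]) \<one>[S]) (p x)" using p ec that by (simp add: lmod_hom_def)
   also have "\<dots> = c \<odot>[P] p x" by (rule sc) (use p that in \<open>auto simp: lmod_hom_def\<close>)
   finally show ?thesis .
  qed
 qed
 have F1: "single ?E g \<one>[?E] \<in> carrier ?F" if "g \<in> G" for g using that Em E by simp
 define y where "y g = (SOME y. y \<in> carrier Y \<and> \<pi> y = p (single ?E g \<one>[?E]))" for g
 have y: "y g \<in> carrier Y" "\<pi> (y g) = p (single ?E g \<one>[?E])" if "g \<in> G" for g
 proof -
  have "\<exists>z. z \<in> carrier Y \<and> \<pi> z = p (single ?E g \<one>[?E])" using surj[OF lin_closed[OF pl F1[OF that]]] by blast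
  from someI_ex[OF this] show "y g \<in> carrier Y" "\<pi> (y g) = p (single ?E g \<one>[?E])" by (simp_all add: y_def)
 qed
 note \<psi> = env_left_lin[OF R S Y y(1)]
 let ?h = "%f. finsum Y (%g. lmult ?Y (f g) (y g)) {g. f g \<noteq> \<zero>[?E]}"
 note hl = free_lin(1)[OF Em Ym \<psi>] and hs = free_lin(2)[OF Em Ym \<psi>]
 have Fl: "lin K ?F ?F (lmult ?F e)" if e: "e \<in> carrier ?E" for e
 proof (rule linI)
  note e' = alg_lin2[OF E e]
  show "lmult ?F e f \<in> carrier ?F" if f: "f \<in> carrier ?F" for f
  proof -
   have "finite {g. e \<otimes>[?E] f g \<noteq> \<zero>[?E]}"
    by (rule finite_subset[of _ "{g. f g \<noteq> \<zero>[?E]}"]) (use f lin_zero[OF e' Em Em] in \<open>auto simp: free_mod_carrier\<close>)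
   then show ?thesis using f e E lin_zero[OF e' Em Em] by (auto simp: free_mod_carrier)
  qed
 qed (use e E in \<open>auto simp: free_mod_carrier lin_add[OF alg_lin2[OF E]] lin_smult[OF alg_lin2[OF E]]\<close>)
 have Fs: "lmult ?F e (single ?E g e') = single ?E g (e \<otimes>[?E] e')" if "e \<in> carrier ?E" for e e' g
  using lin_zero[OF alg_lin2[OF E that] Em Em] by (simp add: single_def fun_eq_iff)
 have heq: "?h (lmult ?F (?et r s) f) = rmult Y (lmult Y r (?h f)) s"
  if r: "r \<in> carrier R" and s: "s \<in> carrier S" and f: "f \<in> carrier ?F" for r s f
 proof (rule free_lin_eq[OF lin_comp[OF Fl hl] lin_comp[OF lin_comp[OF hl bm_l[OF Y r]] bm_r[OF Y s]] Em Ym _ f])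
  show "?et r s \<in> carrier ?E" by (rule etc[OF r s])
  fix g e assume g: "g \<in> G" and e: "e \<in> carrier ?E"
  have "?h (lmult ?F (?et r s) (single ?E g e)) = lmult ?Y (?et r s \<otimes>[?E] e) (y g)"
   unfolding Fs[OF etc[OF r s]] using g e etc[OF r s] E by (simp only: hs alg_mult)
  also have "\<dots> = rmult Y (lmult Y r (lmult ?Y e (y g))) s"
  proof (rule env_ind_lin[OF R S lin_comp[OF alg_lin2[OF E etc[OF r s]] \<psi>[OF g]] lin_comp[OF lin_comp[OF \<psi>[OF g] bm_l[OF Y r]] bm_r[OF Y s]] _ e])
   fix r' s' assume "r' \<in> carrier R" "s' \<in> carrier S"
   then show "lmult ?Y (?et r s \<otimes>[?E] ?et r' s') (y g) = rmult Y (lmult Y r (lmult ?Y (?et r' s') (y g))) s"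
    using r s y(1)[OF g] R S
    by (simp add: env_mult[OF R S] ev[OF Y] bm_lassoc[OF Y] bm_rassoc[OF Y] bm_lr[OF Y] bm_lcl[OF Y] bm_rcl[OF Y])
  qed
  also have "lmult ?Y e (y g) = ?h (single ?E g e)" using g e by (simp only: hs)
  finally show "?h (lmult ?F (?et r s) (single ?E g e)) = rmult Y (lmult Y r (?h (single ?E g e))) s" .
 qed
 note ic = lin_closed[OF il]
 have hc: "?h (i x) \<in> carrier Y" if "x \<in> carrier P" for x by (rule lin_closed[OF hl ic[OF that]])
 have eq: "?h (i (rmult P (lmult P r x) s)) = rmult Y (lmult Y r (?h (i x))) s"
  if "r \<in> carrier R" "s \<in> carrier S" "x \<in> carrier P" for r s x
 proof -
  have "i (rmult P (lmult P r x) s) = i (lmult ?P (?et r s) x)" using that by (simp add: ev[OF P])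
  also have "\<dots> = lmult ?F (?et r s) (i x)" using i etc that by (simp add: lmod_hom_def)
  finally show ?thesis using heq[OF that(1,2) ic[OF that(3)]] by simp
 qed
 have h\<pi>: "\<pi> (?h f) = p f" if f: "f \<in> carrier ?F" for f
 proof (rule free_lin_eq[OF lin_comp[OF hl bhomD(1)[OF \<pi>]] pl Em Pm _ f])
  fix g e assume g: "g \<in> G" and e: "e \<in> carrier ?E"
  have "\<pi> (?h (single ?E g e)) = \<pi> (lmult ?Y e (y g))" using g e by (simp only: hs)
  also have "\<dots> = lmult ?P e (\<pi> (y g))"
  proof (rule env_ind_lin[OF R S lin_comp[OF \<psi>[OF g] bhomD(1)[OF \<pi>]] env_left_lin[OF R S P] _ e])
   show "\<pi> (y g) \<in> carrier P" by (rule lin_closed[OF bhomD(1)[OF \<pi>] y(1)[OF g]])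
   fix r s assume "r \<in> carrier R" "s \<in> carrier S"
   then show "\<pi> (lmult ?Y (?et r s) (y g)) = lmult ?P (?et r s) (\<pi> (y g))"
    using y(1)[OF g] lin_closed[OF bhomD(1)[OF \<pi>]] by (simp add: ev[OF Y] ev[OF P] bhomD(2,3)[OF \<pi>] bm_lcl[OF Y])
  qed
  also have "\<dots> = p (lmult ?F e (single ?E g \<one>[?E]))"
   unfolding y(2)[OF g] using p e F1[OF g] by (simp add: lmod_hom_def)
  also have "\<dots> = p (single ?E g e)" unfolding Fs[OF e] using e E by simp
  finally show "\<pi> (?h (single ?E g e)) = p (single ?E g e)" .
 qed
 show thesis
 proof (rule that)
  show "bhom K R S P Y (%x. ?h (i x))"
  proof (rule bhomI[OF lin_comp[OF il hl]])
   show "?h (i (lmult P r x)) = lmult Y r (?h (i x))" if "r \<in> carrier R" "x \<in> carrier P" for r x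
    using eq[OF that(1) one(2) that(2)] bm_rone[OF Y bm_lcl[OF Y that(1) hc[OF that(2)]]] bm_rone[OF P bm_lcl[OF P that]] by simp
   show "?h (i (rmult P x s)) = rmult Y (?h (i x)) s" if "s \<in> carrier S" "x \<in> carrier P" for s x
    using eq[OF one(1) that] bm_lone[OF Y hc[OF that(2)]] bm_lone[OF P that(2)] by simp
  qed
  show "\<pi> (?h (i x)) = x" if "x \<in> carrier P" for x using h\<pi>[OF ic[OF that]] pi[OF that] by simp
 qed
qed

end
end

section \<open>Sections of the two actions on \<open>I\<close> from projectivity\<close>

context square_zero
begin

lemma act_lin: "c \<in> carrier C ==> lin K Im L (%y. c \<otimes>[L] y)" "y \<in> I ==> lin K C L (%c. c \<otimes>[L] y)"
  "c \<in> carrier C ==> lin K Im L (%y. y \<otimes>[L] c)" "y \<in> I ==> lin K C L (%c. y \<otimes>[L] c)"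
proof -
 show "c \<in> carrier C ==> lin K Im L (%y. c \<otimes>[L] y)" "c \<in> carrier C ==> lin K Im L (%y. y \<otimes>[L] c)"
  by (rule lin_to_L(1); rule Im_lin; assumption)+
 show "lin K C L (%c. c \<otimes>[L] y)" if "y \<in> I"
  by (rule lin_to_L(1), rule lin_cong[OF bm_la[OF Im_bimodule, of y]]) (use that in auto)
 show "lin K C L (%c. y \<otimes>[L] c)" if "y \<in> I"
  by (rule lin_to_L(1), rule lin_cong[OF bm_ra[OF Im_bimodule, of y]]) (use that in auto)
qed

lemmas CI_l = CI_lift[OF CI_module, of "%c' y. ci (c \<otimes>[L] c') y" for c]
 and CI_r = CI_lift[OF CI_module, of "%c' y. ci c' (y \<otimes>[L] c)" for c]
 and IC_l = IC_lift[OF IC_module, of "%y c'. ic (c \<otimes>[L] y) c'" for c]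
 and IC_r = IC_lift[OF IC_module, of "%y c'. ic y (c' \<otimes>[L] c)" for c]

lemma CI_act: "lin K CI L (plift K L (%(c, y). c \<otimes>[L] y))"
  "c \<in> carrier C ==> y \<in> I ==> plift K L (%(c, y). c \<otimes>[L] y) (ci c y) = c \<otimes>[L] y"
 using CI_lift[OF Lm, of "%c y. c \<otimes>[L] y"] act_lin by auto

lemma IC_act: "lin K IC L (plift K L (%(y, c). y \<otimes>[L] c))"
  "c \<in> carrier C ==> y \<in> I ==> plift K L (%(y, c). y \<otimes>[L] c) (ic y c) = y \<otimes>[L] c"
 using IC_lift[OF Lm, of "%y c. y \<otimes>[L] c"] act_lin by auto

lemma CI_maps: assumes c: "c \<in> carrier C"
 shows "lin K CI CI (plift K CI (%(c', y). ci (c \<otimes>[L] c') y))"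
  and "c' \<in> carrier C ==> y \<in> I ==> plift K CI (%(c', y). ci (c \<otimes>[L] c') y) (ci c' y) = ci (c \<otimes>[L] c') y"
  and "lin K CI CI (plift K CI (%(c', y). ci c' (y \<otimes>[L] c)))"
  and "c' \<in> carrier C ==> y \<in> I ==> plift K CI (%(c', y). ci c' (y \<otimes>[L] c)) (ci c' y) = ci c' (y \<otimes>[L] c)"
proof -
 have l: "lin K Im CI (ci (c \<otimes>[L] c'))" if "c' \<in> carrier C" for c' by (rule ci_lin(1)) (rule C_mult[OF c that])
 have l': "lin K C CI (%c'. ci (c \<otimes>[L] c') y)" if "y \<in> I" for y by (rule lin_comp[OF C_lin(1)[OF c] ci_lin(2)[OF that]])
 have r: "lin K Im CI (%y. ci c' (y \<otimes>[L] c))" if "c' \<in> carrier C" for c' by (rule lin_comp[OF Im_lin(2)[OF c] ci_lin(1)[OF that]])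
 have r': "lin K C CI (%c'. ci c' (y \<otimes>[L] c))" if "y \<in> I" for y by (rule ci_lin(2)) (rule IC[OF c that])
 show "lin K CI CI (plift K CI (%(c', y). ci (c \<otimes>[L] c') y))"
  "c' \<in> carrier C ==> y \<in> I ==> plift K CI (%(c', y). ci (c \<otimes>[L] c') y) (ci c' y) = ci (c \<otimes>[L] c') y"
  using CI_l[OF l l'] by auto
 show "lin K CI CI (plift K CI (%(c', y). ci c' (y \<otimes>[L] c)))"
  "c' \<in> carrier C ==> y \<in> I ==> plift K CI (%(c', y). ci c' (y \<otimes>[L] c)) (ci c' y) = ci c' (y \<otimes>[L] c)"
  using CI_r[OF r r'] by auto
qed

lemma IC_maps: assumes c: "c \<in> carrier C"
 shows "lin K IC IC (plift K IC (%(y, c'). ic (c \<otimes>[L] y) c'))"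
  and "c' \<in> carrier C ==> y \<in> I ==> plift K IC (%(y, c'). ic (c \<otimes>[L] y) c') (ic y c') = ic (c \<otimes>[L] y) c'"
  and "lin K IC IC (plift K IC (%(y, c'). ic y (c' \<otimes>[L] c)))"
  and "c' \<in> carrier C ==> y \<in> I ==> plift K IC (%(y, c'). ic y (c' \<otimes>[L] c)) (ic y c') = ic y (c' \<otimes>[L] c)"
proof -
 have r: "lin K C IC (%c'. ic y (c' \<otimes>[L] c))" if "y \<in> I" for y by (rule lin_comp[OF C_lin(2)[OF c] ic_lin(1)[OF that]])
 have r': "lin K Im IC (%y. ic y (c' \<otimes>[L] c))" if "c' \<in> carrier C" for c' by (rule ic_lin(2)) (rule C_mult[OF that c])
 have l: "lin K C IC (ic (c \<otimes>[L] y))" if "y \<in> I" for y by (rule ic_lin(1)) (rule CI[OF c that])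
 have l': "lin K Im IC (%y. ic (c \<otimes>[L] y) c')" if "c' \<in> carrier C" for c' by (rule lin_comp[OF Im_lin(1)[OF c] ic_lin(2)[OF that]])
 show "lin K IC IC (plift K IC (%(y, c'). ic (c \<otimes>[L] y) c'))"
  "c' \<in> carrier C ==> y \<in> I ==> plift K IC (%(y, c'). ic (c \<otimes>[L] y) c') (ic y c') = ic (c \<otimes>[L] y) c'"
  using IC_l[OF l' l] by auto
 show "lin K IC IC (plift K IC (%(y, c'). ic y (c' \<otimes>[L] c)))"
  "c' \<in> carrier C ==> y \<in> I ==> plift K IC (%(y, c'). ic y (c' \<otimes>[L] c)) (ic y c') = ic y (c' \<otimes>[L] c)"
  using IC_r[OF r' r] by auto
qed

text \<open>Both corners are treated at once: \<open>P\<close> stands for \<open>M\<close> or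
  \<open>N\<close>, embedded by \<open>j\<close>, and \<open>C\<close> acts on it through
  \<open>fr\<close> from the left and through \<open>fs\<close> from the right.\<close>

context
 fixes R :: "('k, 'r) module" and S :: "('k, 's) module" and P :: "('k, 'r, 's, 'v) bimodule"
  and j :: "'v => 'l" and fr :: "'l => 'r" and fs :: "'l => 's"
 assumes R: "k_algebra K R" and S: "k_algebra K S" and P: "bimodule K R S P" and pr: "projective_bimod K R S P"
  and j: "lin K P Im j"
  and fr: "!!c. c \<in> carrier C ==> fr c \<in> carrier R" and fs: "!!c. c \<in> carrier C ==> fs c \<in> carrier S"
  and cj: "!!c x. c \<in> carrier C ==> x \<in> carrier P ==> c \<otimes>[L] j x = j (lmult P (fr c) x)"
  and jc: "!!c x. c \<in> carrier C ==> x \<in> carrier P ==> j x \<otimes>[L] c = j (rmult P x (fs c))"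
begin

lemma jI: "x \<in> carrier P ==> j x \<in> I"
 using lin_closed[OF j] by simp

text \<open>The action map from \<open>R \<otimes> P\<close> to \<open>P\<close> is a surjective
  bimodule map and splits by projectivity; \<open>\<iota> \<otimes> j\<close> carries the splitting
  into \<open>C \<otimes> I\<close>.\<close>

lemma left_section:
 assumes \<iota>: "lin K R C \<iota>" and c\<iota>: "!!c r. c \<in> carrier C ==> r \<in> carrier R ==> c \<otimes>[L] \<iota> r = \<iota> (fr c \<otimes>[R] r)"
  and \<iota>j: "!!r x. r \<in> carrier R ==> x \<in> carrier P ==> \<iota> r \<otimes>[L] j x = j (lmult P r x)"
 obtains \<phi> where "lin K P CI \<phi>"
  "!!c x. c \<in> carrier C ==> x \<in> carrier P ==> \<phi> (lmult P (fr c) x) = plift K CI (%(c', y). ci (c \<otimes>[L] c') y) (\<phi> x)"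
  "!!c x. c \<in> carrier C ==> x \<in> carrier P ==> \<phi> (rmult P x (fs c)) = plift K CI (%(c', y). ci c' (y \<otimes>[L] c)) (\<phi> x)"
  "!!x. x \<in> carrier P ==> plift K L (%(c, y). c \<otimes>[L] y) (\<phi> x) = j x"
proof -
 let ?Rl = "left_reg R" and ?Pr = "right_part P"
 note Rl = left_reg_bimodule[OF R S P] and Pr = right_part_bimodule[OF R S P]
 let ?Y = "tensor K (ground K) ?Rl ?Pr" and ?t = "tens K (ground K) ?Rl ?Pr"
 note Y = tensor_bimodule[OF Rl Pr] and tt = bm_tensorable[OF Rl Pr]
 have sm: "carrier ?Rl = carrier R" "carrier ?Pr = carrier P" "lmult ?Rl = monoid.mult R" "rmult ?Pr = rmult P"
  "lin K ?Rl V f = lin K R V f" "lin K ?Pr V g = lin K P V g" for V :: "('k, 'u, 'z) module_scheme" and f g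
  by (simp_all add: left_reg_def right_part_def lin_def)
 have sm': "rmult ?Rl r c = c \<odot>[R] r" "lmult ?Pr c x = c \<odot>[P] x" for r c x
  by (simp_all add: left_reg_def right_part_def)
 note tl = tensor_lmult[OF Rl Pr, unfolded sm] and tr = tensor_rmult[OF Rl Pr, unfolded sm]
 have "balanced K (ground K) ?Rl ?Pr P (lmult P)"
  by (rule balancedI) (simp_all add: sm sm' bm_l[OF P] bm_la[OF P] bm_lsm[OF P] bm_lsml[OF P])
 note \<pi> = tensor_lift[OF tt bm_module[OF P] this, unfolded sm]
 let ?\<pi> = "plift K P (%(x, y). lmult P x y)"
 have \<pi>b: "bhom K R S ?Y P ?\<pi>"
 proof (rule bhomI[OF \<pi>(1)])
  fix a u assume a: "a \<in> carrier R" and u: "u \<in> carrier ?Y"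
  show "?\<pi> (lmult ?Y a u) = lmult P a (?\<pi> u)"
   by (rule tensor_lin_eq[OF tt lin_comp[OF bm_l[OF Y a] \<pi>(1)] lin_comp[OF \<pi>(1) bm_l[OF P a]] _ u])
     (use a R in \<open>simp add: sm tl \<pi>(2) bm_lassoc[OF P]\<close>)
 next
  fix s u assume s: "s \<in> carrier S" and u: "u \<in> carrier ?Y"
  show "?\<pi> (rmult ?Y u s) = rmult P (?\<pi> u) s"
   by (rule tensor_lin_eq[OF tt lin_comp[OF bm_r[OF Y s] \<pi>(1)] lin_comp[OF \<pi>(1) bm_r[OF P s]] _ u])
     (use s in \<open>simp add: sm tr \<pi>(2) bm_lr[OF P] bm_rcl[OF P]\<close>)
 qed
 have surj: "\<exists>y\<in>carrier ?Y. ?\<pi> y = x" if "x \<in> carrier P" for x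
  using that alg_one[OF R] tens_closed[OF tt, of "\<one>[R]" x] \<pi>(2)[of "\<one>[R]" x] by (auto simp: sm bm_lone[OF P])
 obtain s where s: "bhom K R S P ?Y s" and s\<pi>: "!!x. x \<in> carrier P ==> ?\<pi> (s x) = x"
  by (rule projective_bimod_section[OF R S P pr Y \<pi>b surj]) blast+
 have \<iota>C: "\<iota> r \<in> carrier C" if "r \<in> carrier R" for r by (rule lin_closed[OF \<iota> that])
 have "balanced K (ground K) ?Rl ?Pr CI (%r x. ci (\<iota> r) (j x))"
 proof (rule balancedI)
  fix x c y assume "x \<in> carrier ?Rl" "c \<in> carrier (ground K)" "y \<in> carrier ?Pr"
  then show "ci (\<iota> (rmult ?Rl x c)) (j y) = ci (\<iota> x) (j (lmult ?Pr c y))"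
   using lin_smult[OF \<iota>, of c x] lin_smult[OF j, of c y] lin_smult[OF ci_lin(1)[OF \<iota>C], of x c "j y"]
    lin_smult[OF ci_lin(2)[OF jI], of y c "\<iota> x"] \<iota>C jI by (simp add: sm sm')
 qed (simp_all add: sm lin_comp[OF \<iota> ci_lin(2)] lin_comp[OF j ci_lin(1)] \<iota>C jI)
 note \<omega> = tensor_lift[OF tt CI_module this, unfolded sm]
 let ?\<omega> = "plift K CI (%(r, x). ci (\<iota> r) (j x))"
 have \<omega>l: "?\<omega> (lmult ?Y (fr c) u) = plift K CI (%(c', y). ci (c \<otimes>[L] c') y) (?\<omega> u)" if c: "c \<in> carrier C" and u: "u \<in> carrier ?Y" for c u
  by (rule tensor_lin_eq[OF tt lin_comp[OF bm_l[OF Y fr[OF c]] \<omega>(1)] lin_comp[OF \<omega>(1) CI_maps(1)[OF c]] _ u])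
    (use c R in \<open>simp add: sm fr tl \<omega>(2) CI_maps(2) \<iota>C jI c\<iota>\<close>)
 have \<omega>r: "?\<omega> (rmult ?Y u (fs c)) = plift K CI (%(c', y). ci c' (y \<otimes>[L] c)) (?\<omega> u)" if c: "c \<in> carrier C" and u: "u \<in> carrier ?Y" for c u
  by (rule tensor_lin_eq[OF tt lin_comp[OF bm_r[OF Y fs[OF c]] \<omega>(1)] lin_comp[OF \<omega>(1) CI_maps(3)[OF c]] _ u])
    (use c in \<open>simp add: sm fs tr \<omega>(2) CI_maps(4) \<iota>C jI jc bm_rcl[OF P]\<close>)
 have \<omega>a: "plift K L (%(c, y). c \<otimes>[L] y) (?\<omega> u) = j (?\<pi> u)" if u: "u \<in> carrier ?Y" for u
  by (rule tensor_lin_eq[OF tt lin_comp[OF \<omega>(1) CI_act(1)] lin_comp[OF \<pi>(1) lin_to_L(1)[OF j]] _ u])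
    (simp add: sm \<omega>(2) \<pi>(2) CI_act(2) \<iota>C jI \<iota>j)
 note sc = lin_closed[OF bhomD(1)[OF s]]
 show thesis
  by (rule that[of "%x. ?\<omega> (s x)"])
    (simp_all add: lin_comp[OF bhomD(1)[OF s] \<omega>(1)] bhomD(2,3)[OF s] fr fs \<omega>l \<omega>r \<omega>a sc s\<pi>)
qed

text \<open>The mirror image, with the right action map from \<open>P \<otimes> S\<close> to
  \<open>P\<close>.\<close>

lemma right_section:
 assumes \<iota>: "lin K S C \<iota>" and \<iota>c: "!!c r. c \<in> carrier C ==> r \<in> carrier S ==> \<iota> r \<otimes>[L] c = \<iota> (r \<otimes>[S] fs c)"
  and j\<iota>: "!!r x. r \<in> carrier S ==> x \<in> carrier P ==> j x \<otimes>[L] \<iota> r = j (rmult P x r)"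
 obtains \<phi> where "lin K P IC \<phi>"
  "!!c x. c \<in> carrier C ==> x \<in> carrier P ==> \<phi> (lmult P (fr c) x) = plift K IC (%(y, c'). ic (c \<otimes>[L] y) c') (\<phi> x)"
  "!!c x. c \<in> carrier C ==> x \<in> carrier P ==> \<phi> (rmult P x (fs c)) = plift K IC (%(y, c'). ic y (c' \<otimes>[L] c)) (\<phi> x)"
  "!!x. x \<in> carrier P ==> plift K L (%(y, c). y \<otimes>[L] c) (\<phi> x) = j x"
proof -
 let ?Rl = "left_part P" and ?Pr = "right_reg S"
 note Rl = left_part_bimodule[OF R S P] and Pr = right_reg_bimodule[OF R S P]
 let ?Y = "tensor K (ground K) ?Rl ?Pr" and ?t = "tens K (ground K) ?Rl ?Pr"
 note Y = tensor_bimodule[OF Rl Pr] and tt = bm_tensorable[OF Rl Pr]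
 have sm: "carrier ?Rl = carrier P" "carrier ?Pr = carrier S" "lmult ?Rl = lmult P" "rmult ?Pr = monoid.mult S"
  "lin K ?Rl V f = lin K P V f" "lin K ?Pr V g = lin K S V g" for V :: "('k, 'u, 'z) module_scheme" and f g
  by (simp_all add: left_part_def right_reg_def lin_def)
 have sm': "rmult ?Rl r c = c \<odot>[P] r" "lmult ?Pr c x = c \<odot>[S] x" for r c x
  by (simp_all add: left_part_def right_reg_def)
 note tl = tensor_lmult[OF Rl Pr, unfolded sm] and tr = tensor_rmult[OF Rl Pr, unfolded sm]
 have "balanced K (ground K) ?Rl ?Pr P (rmult P)"
  by (rule balancedI) (simp_all add: sm sm' bm_r[OF P] bm_ra[OF P] bm_rsm[OF P] bm_rsmr[OF P])
 note \<pi> = tensor_lift[OF tt bm_module[OF P] this, unfolded sm]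
 let ?\<pi> = "plift K P (%(x, y). rmult P x y)"
 have \<pi>b: "bhom K R S ?Y P ?\<pi>"
 proof (rule bhomI[OF \<pi>(1)])
  fix a u assume a: "a \<in> carrier R" and u: "u \<in> carrier ?Y"
  show "?\<pi> (lmult ?Y a u) = lmult P a (?\<pi> u)"
   by (rule tensor_lin_eq[OF tt lin_comp[OF bm_l[OF Y a] \<pi>(1)] lin_comp[OF \<pi>(1) bm_l[OF P a]] _ u])
     (use a in \<open>simp add: sm tl \<pi>(2) bm_lr[OF P] bm_lcl[OF P]\<close>)
 next
  fix s u assume s: "s \<in> carrier S" and u: "u \<in> carrier ?Y"
  show "?\<pi> (rmult ?Y u s) = rmult P (?\<pi> u) s"
   by (rule tensor_lin_eq[OF tt lin_comp[OF bm_r[OF Y s] \<pi>(1)] lin_comp[OF \<pi>(1) bm_r[OF P s]] _ u])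
     (use s S in \<open>simp add: sm tr \<pi>(2) bm_rassoc[OF P]\<close>)
 qed
 have surj: "\<exists>y\<in>carrier ?Y. ?\<pi> y = x" if "x \<in> carrier P" for x
  using that alg_one[OF S] tens_closed[OF tt, of x "\<one>[S]"] \<pi>(2)[of x "\<one>[S]"] by (auto simp: sm bm_rone[OF P])
 obtain s where s: "bhom K R S P ?Y s" and s\<pi>: "!!x. x \<in> carrier P ==> ?\<pi> (s x) = x"
  by (rule projective_bimod_section[OF R S P pr Y \<pi>b surj]) blast+
 have \<iota>C: "\<iota> r \<in> carrier C" if "r \<in> carrier S" for r by (rule lin_closed[OF \<iota> that])
 have "balanced K (ground K) ?Rl ?Pr IC (%x r. ic (j x) (\<iota> r))"
 proof (rule balancedI)
  fix y c x assume "y \<in> carrier ?Rl" "c \<in> carrier (ground K)" "x \<in> carrier ?Pr"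
  then show "ic (j (rmult ?Rl y c)) (\<iota> x) = ic (j y) (\<iota> (lmult ?Pr c x))"
   using lin_smult[OF \<iota>, of c x] lin_smult[OF j, of c y] lin_smult[OF ic_lin(2)[OF \<iota>C], of x c "j y"]
    lin_smult[OF ic_lin(1)[OF jI], of y c "\<iota> x"] \<iota>C jI by (simp add: sm sm')
 qed (simp_all add: sm lin_comp[OF \<iota> ic_lin(1)] lin_comp[OF j ic_lin(2)] \<iota>C jI)
 note \<omega> = tensor_lift[OF tt IC_module this, unfolded sm]
 let ?\<omega> = "plift K IC (%(x, r). ic (j x) (\<iota> r))"
 have \<omega>l: "?\<omega> (lmult ?Y (fr c) u) = plift K IC (%(y, c'). ic (c \<otimes>[L] y) c') (?\<omega> u)" if c: "c \<in> carrier C" and u: "u \<in> carrier ?Y" for c u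
  by (rule tensor_lin_eq[OF tt lin_comp[OF bm_l[OF Y fr[OF c]] \<omega>(1)] lin_comp[OF \<omega>(1) IC_maps(1)[OF c]] _ u])
    (use c in \<open>simp add: sm fr tl \<omega>(2) IC_maps(2) \<iota>C jI cj bm_lcl[OF P]\<close>)
 have \<omega>r: "?\<omega> (rmult ?Y u (fs c)) = plift K IC (%(y, c'). ic y (c' \<otimes>[L] c)) (?\<omega> u)" if c: "c \<in> carrier C" and u: "u \<in> carrier ?Y" for c u
  by (rule tensor_lin_eq[OF tt lin_comp[OF bm_r[OF Y fs[OF c]] \<omega>(1)] lin_comp[OF \<omega>(1) IC_maps(3)[OF c]] _ u])
    (use c S in \<open>simp add: sm fs tr \<omega>(2) IC_maps(4) \<iota>C jI \<iota>c\<close>)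
 have \<omega>a: "plift K L (%(y, c). y \<otimes>[L] c) (?\<omega> u) = j (?\<pi> u)" if u: "u \<in> carrier ?Y" for u
  by (rule tensor_lin_eq[OF tt lin_comp[OF \<omega>(1) IC_act(1)] lin_comp[OF \<pi>(1) lin_to_L(1)[OF j]] _ u])
    (simp add: sm \<omega>(2) \<pi>(2) IC_act(2) \<iota>C jI j\<iota>)
 note sc = lin_closed[OF bhomD(1)[OF s]]
 show thesis
  by (rule that[of "%x. ?\<omega> (s x)"])
    (simp_all add: lin_comp[OF bhomD(1)[OF s] \<omega>(1)] bhomD(2,3)[OF s] fr fs \<omega>l \<omega>r \<omega>a sc s\<pi>)
qed

end
end

context null_sq
begin

definition "ia a = (a, \<zero>[N], \<zero>[M], \<zero>[B])"
definition "ib b = (\<zero>[A], \<zero>[N], \<zero>[M], b)"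

lemma i_lin: "lin K A Cd ia" "lin K B Cd ib"
 by (rule linI; auto simp: ia_def ib_def C_simps Lam_simps Cd_carrier)+

lemma i_mult:
 "c \<in> carrier Cd ==> a \<in> carrier A ==> c \<otimes>[Lam] ia a = ia (ca c \<otimes>[A] a)"
 "c \<in> carrier Cd ==> b \<in> carrier B ==> c \<otimes>[Lam] ib b = ib (cb c \<otimes>[B] b)"
 "c \<in> carrier Cd ==> a \<in> carrier A ==> ia a \<otimes>[Lam] c = ia (a \<otimes>[A] ca c)"
 "c \<in> carrier Cd ==> b \<in> carrier B ==> ib b \<otimes>[Lam] c = ib (b \<otimes>[B] cb c)"
 "b \<in> carrier B ==> x \<in> carrier M ==> ib b \<otimes>[Lam] jm x = jm (lmult M b x)"
 "a \<in> carrier A ==> x \<in> carrier M ==> jm x \<otimes>[Lam] ia a = jm (rmult M x a)"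
 "a \<in> carrier A ==> y \<in> carrier N ==> ia a \<otimes>[Lam] jn y = jn (lmult N a y)"
 "b \<in> carrier B ==> y \<in> carrier N ==> jn y \<otimes>[Lam] ib b = jn (rmult N y b)"
 by (auto simp: ia_def ib_def j_defs comp_rules alg_rules alA alB Lam_simps Cd_carrier)

text \<open>\<open>I\<close> is the direct sum of its two corners as a \<open>C\<close>-bimodule, so
  the sections for \<open>M\<close> and \<open>N\<close> are added.\<close>

lemma proj_sections:
 assumes M: "projective_bimod K B A M" and N: "projective_bimod K A B N"
 obtains sl sr where "square_zero_proj K Lam Cd I0 pd po sl sr"
proof -
 note m = alB alA bmM M j_lin(1) j_closed(6,5) j_mult(1,2) and n = alA alB bmN N j_lin(2) j_closed(5,6) j_mult(3,4)
 obtain \<phi>M where M: "lin K M CI \<phi>M"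
  "!!c x. c \<in> carrier Cd ==> x \<in> carrier M ==> \<phi>M (lmult M (cb c) x) = plift K CI (%(c', y). ci (c \<otimes>[Lam] c') y) (\<phi>M x)"
  "!!c x. c \<in> carrier Cd ==> x \<in> carrier M ==> \<phi>M (rmult M x (ca c)) = plift K CI (%(c', y). ci c' (y \<otimes>[Lam] c)) (\<phi>M x)"
  "!!x. x \<in> carrier M ==> plift K Lam (%(c, y). c \<otimes>[Lam] y) (\<phi>M x) = jm x"
  by (rule left_section[where j=jm and fr=cb and fs=ca and \<iota>=ib and P=M, OF m i_lin(2) i_mult(2,5)]) blast+
 obtain \<phi>N where N: "lin K N CI \<phi>N"
  "!!c x. c \<in> carrier Cd ==> x \<in> carrier N ==> \<phi>N (lmult N (ca c) x) = plift K CI (%(c', y). ci (c \<otimes>[Lam] c') y) (\<phi>N x)"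
  "!!c x. c \<in> carrier Cd ==> x \<in> carrier N ==> \<phi>N (rmult N x (cb c)) = plift K CI (%(c', y). ci c' (y \<otimes>[Lam] c)) (\<phi>N x)"
  "!!x. x \<in> carrier N ==> plift K Lam (%(c, y). c \<otimes>[Lam] y) (\<phi>N x) = jn x"
  by (rule left_section[where j=jn and fr=ca and fs=cb and \<iota>=ia and P=N, OF n i_lin(1) i_mult(1,7)]) blast+
 obtain \<rho>M where M': "lin K M IC \<rho>M"
  "!!c x. c \<in> carrier Cd ==> x \<in> carrier M ==> \<rho>M (lmult M (cb c) x) = plift K IC (%(y, c'). ic (c \<otimes>[Lam] y) c') (\<rho>M x)"
  "!!c x. c \<in> carrier Cd ==> x \<in> carrier M ==> \<rho>M (rmult M x (ca c)) = plift K IC (%(y, c'). ic y (c' \<otimes>[Lam] c)) (\<rho>M x)"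
  "!!x. x \<in> carrier M ==> plift K Lam (%(y, c). y \<otimes>[Lam] c) (\<rho>M x) = jm x"
  by (rule right_section[where j=jm and fr=cb and fs=ca and \<iota>=ia and P=M, OF m i_lin(1) i_mult(3,6)]) blast+
 obtain \<rho>N where N': "lin K N IC \<rho>N"
  "!!c x. c \<in> carrier Cd ==> x \<in> carrier N ==> \<rho>N (lmult N (ca c) x) = plift K IC (%(y, c'). ic (c \<otimes>[Lam] y) c') (\<rho>N x)"
  "!!c x. c \<in> carrier Cd ==> x \<in> carrier N ==> \<rho>N (rmult N x (cb c)) = plift K IC (%(y, c'). ic y (c' \<otimes>[Lam] c)) (\<rho>N x)"
  "!!x. x \<in> carrier N ==> plift K Lam (%(y, c). y \<otimes>[Lam] c) (\<rho>N x) = jn x"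
  by (rule right_section[where j=jn and fr=ca and fs=cb and \<iota>=ib and P=N, OF n i_lin(2) i_mult(4,8)]) blast+
 let ?sl = "%i. \<phi>M (mp i) \<oplus>[CI] \<phi>N (np i)" and ?sr = "%i. \<rho>M (mp i) \<oplus>[IC] \<rho>N (np i)"
 note cl = lin_closed[OF M(1)] lin_closed[OF N(1)] lin_closed[OF M'(1)] lin_closed[OF N'(1)]
 have "square_zero_proj K Lam Cd I0 pd po ?sl ?sr"
 proof (intro square_zero_proj.intro square_zero_proj_axioms.intro)
  show "square_zero K Lam Cd I0 pd po" by (rule square_zero_axioms)
  show "lin K Im CI ?sl" by (rule lin_fun_add[OF CI_module lin_comp[OF j_lin(3) M(1)] lin_comp[OF j_lin(4) N(1)]])
  show "lin K Im IC ?sr" by (rule lin_fun_add[OF IC_module lin_comp[OF j_lin(3) M'(1)] lin_comp[OF j_lin(4) N'(1)]])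
 next
  fix c i assume c: "c \<in> carrier Cd" and i: "i \<in> I0"
  show "?sl (c \<otimes>[Lam] i) = plift K CI (%(c', y). ci (c \<otimes>[Lam] c') y) (?sl i)"
   using c i cl by (simp add: j_act M(2) N(2) lin_add[OF CI_maps(1)[OF c]])
  show "?sl (i \<otimes>[Lam] c) = plift K CI (%(c', y). ci c' (y \<otimes>[Lam] c)) (?sl i)"
   using c i cl by (simp add: j_act M(3) N(3) lin_add[OF CI_maps(3)[OF c]])
  show "?sr (c \<otimes>[Lam] i) = plift K IC (%(y, c'). ic (c \<otimes>[Lam] y) c') (?sr i)"
   using c i cl by (simp add: j_act M'(2) N'(2) lin_add[OF IC_maps(1)[OF c]])
  show "?sr (i \<otimes>[Lam] c) = plift K IC (%(y, c'). ic y (c' \<otimes>[Lam] c)) (?sr i)"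
   using c i cl by (simp add: j_act M'(3) N'(3) lin_add[OF IC_maps(3)[OF c]])
 next
  fix i assume i: "i \<in> I0"
  show "plift K Lam (%(c, y). c \<otimes>[Lam] y) (?sl i) = i"
   using i cl j_sum[OF i] by (simp add: lin_add[OF CI_act(1)] M(4) N(4))
  show "plift K Lam (%(y, c). y \<otimes>[Lam] c) (?sr i) = i"
   using i cl j_sum[OF i] by (simp add: lin_add[OF IC_act(1)] M'(4) N'(4))
 qed
 then show thesis by (rule that)
qed

section \<open>Identification of \<open>Tor\<close>\<close>

context
 assumes M: "projective_bimod K B A M" and N: "projective_bimod K A B N"
begin

text \<open>The canonical resolution has the lifting property because it is free, \<open>Q\<close>
  because of the sections. A description of the homology of \<open>Q\<close> modulo commutators can
  therefore be transported to the resolution that defines \<open>Tor\<close>.\<close>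

lemma Tor_from_Q:
 assumes \<theta>: "lin K (Q n) H \<theta>" and H: "module K H" and im: "\<theta> ` resolution.rcyc K Lam Q dQ n = Z"
  and ker: "!!q. q \<in> resolution.rcyc K Lam Q dQ n ==> \<theta> q = \<zero>[H] \<longleftrightarrow>
   (\<exists>c\<in>commutator_span K Lam (Q n). \<exists>q'\<in>carrier (Q (Suc n)). q = c \<oplus>[Q n] dQ n q')"
 shows "vs_iso K (Tor K (env K Lam Lam) n (env_right K K1) (env_left K (regular Lam))) (H\<lparr>carrier := Z\<rparr>)"
proof -
 obtain sl sr where "square_zero_proj K Lam Cd I0 pd po sl sr" by (rule proj_sections[OF M N])
 then interpret SP: square_zero_proj K Lam Cd I0 pd po sl sr .
 note rl = resb_lifting[OF Lam_alg K1_bimodule] and rb = resb_bimodule[OF Lam_alg K1_bimodule]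
 note rr = resb_resolution[OF Lam_alg K1_bimodule]
 note b = Q_bimodule rb K1_bimodule
 show ?thesis
 proof (rule homology_transport[OF rr Q_resolution _ _ _ _ _ _ \<theta> H im ker])
  show "lifting K Lam (resb Lam K1 0) (Q 0) K1" by (intro rl b)
  show "lifting K Lam (resb Lam K1 (Suc n)) (Q (Suc n)) (Q n)" for n by (intro rl b)
  show "lifting K Lam (Q 0) (resb Lam K1 0) K1" by (intro SP.Q_lifting b)
  show "lifting K Lam (Q (Suc n)) (resb Lam K1 (Suc n)) (resb Lam K1 n)" for n by (intro SP.Q_lifting b)
  show "lifting K Lam (resb Lam K1 n) (resb Lam K1 (Suc n)) (resb Lam K1 n)" for n by (intro rl b)
  show "lifting K Lam (Q n) (Q (Suc n)) (Q n)" for n by (intro SP.Q_lifting b)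
  fix \<Theta>
  assume "lin K (resb Lam K1 n) H \<Theta>"
   "\<Theta> ` resolution.rcyc K Lam (resb Lam K1) (%n. res_diff (env K Lam Lam)) n = Z"
   "!!p. p \<in> resolution.rcyc K Lam (resb Lam K1) (%n. res_diff (env K Lam Lam)) n ==> \<Theta> p = \<zero>[H] \<longleftrightarrow>
    (\<exists>c\<in>commutator_span K Lam (resb Lam K1 n). \<exists>p'\<in>carrier (resb Lam K1 (Suc n)).
     p = c \<oplus>[resb Lam K1 n] res_diff (env K Lam Lam) p')"
  then show ?thesis by (rule Tor_iso[OF Lam_alg K1_bimodule H])
 qed assumption
qed

lemma Tor_odd:
 "vs_iso K (Tor K (env K Lam Lam) (2 * m + 1) (env_right K K1) (env_left K (regular Lam)))
   (invariants (integer_mod_group (m + 1)) (cyc_act K B W (m + 1)) (H0 K B (U (m + 1))))"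
proof -
 \<comment> \<open>With \<open>p = m + 1\<close> the even degree is \<open>n = 2 m\<close>, and the
   invariants appear in degree \<open>Suc n\<close>.\<close>
 have e: "m + 1 > 0" "2 * (m + 1) = Suc (Suc (2 * m))" by simp_all
 note o = odd_homology[OF e]
 have "vs_iso K (Tor K (env K Lam Lam) (Suc (2 * m)) (env_right K K1) (env_left K (regular Lam)))
   ((Hp (m + 1))\<lparr>carrier := {x \<in> carrier (Hp (m + 1)). tt (m + 1) x = x}\<rparr>)"
  by (rule Tor_from_Q[OF o(1) Hp_module[OF e(1)] o(2,3)])
 then show ?thesis
  unfolding invariants_def cyc_act_invariants[OF W_bimodule e(1)] by simp
qed

lemma Tor_even:
 "vs_iso K (Tor K (env K Lam Lam) (2 * m) (env_right K K1) (env_left K (regular Lam)))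
   (coinvariants K (integer_mod_group (m + 1)) (cyc_act K B W (m + 1)) (H0 K B (U (m + 1))))"
proof -
 have e: "m + 1 > 0" "2 * (m + 1) = Suc (Suc (2 * m))" by simp_all
 note o = even_homology[OF e]
 let ?I = "(%x. tt (m + 1) x \<ominus>[Hp (m + 1)] x) ` carrier (Hp (m + 1))"
 \<comment> \<open>Updating the carrier by itself brings the quotient into the form that
   \<open>Tor_from_Q\<close> produces.\<close>
 have "vs_iso K (Tor K (env K Lam Lam) (2 * m) (env_right K K1) (env_left K (regular Lam)))
   ((quot_mod (Hp (m + 1)) ?I)\<lparr>carrier := carrier (quot_mod (Hp (m + 1)) ?I)\<rparr>)"
  by (rule Tor_from_Q[OF o(1) quot_mod_module[OF Hp_module[OF e(1)] Ip_sub[OF e]] o(2,3)])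
 then show ?thesis
  unfolding coinvariants_def cyc_act_span[OF W_bimodule e(1)] by simp
qed

end
end

theorem theorem3p11:
  fixes K :: "'k ring" and A :: "('k, 'a) module" and B :: "('k, 'b) module"
    and M :: "('k, 'b, 'a, 'm) bimodule" and N :: "('k, 'a, 'b, 'n) bimodule"
    and m :: nat
  assumes "field K" and "k_algebra K A" and "k_algebra K B"
    and "bimodule K B A M" and "bimodule K A B N"
    and "projective_bimod K B A M" and "projective_bimod K A B N"
  defines "\<Lambda> \<equiv> null_square A B M N" and "C \<equiv> diag_subalg A B M N"
  defines "\<Lambda>e \<equiv> env K \<Lambda> \<Lambda>"
    and "V \<equiv> env_right K (prod_kernel K C \<Lambda>)"
    and "Y \<equiv> env_left K (regular \<Lambda>)"
    and "W \<equiv> tensor K A M N"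
  shows "vs_iso K (Tor K \<Lambda>e (2 * m + 1) V Y)
           (invariants (integer_mod_group (m + 1)) (cyc_act K B W (m + 1))
             (H0 K B (tpow K B W (m + 1))))
       \<and> vs_iso K (Tor K \<Lambda>e (2 * m) V Y)
           (coinvariants K (integer_mod_group (m + 1)) (cyc_act K B W (m + 1))
             (H0 K B (tpow K B W (m + 1))))"
proof -
  interpret null_sq K A B M N
    using assms(1-5) by (intro null_sq.intro null_sq_axioms.intro fld.intro)
  show ?thesis
    unfolding \<Lambda>_def C_def \<Lambda>e_def V_def Y_def W_def
    by (intro conjI Tor_odd[OF assms(6,7)] Tor_even[OF assms(6,7)])
qed

end
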